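(* The following statements hold. (1) A positive pretzel knot has $\Delta$-unknotting number one if and only if it is the trefoil knot $3_1$ or its mirror image. (2) A torus knot has $\Delta$-unknotting number one if and only if it is the trefoil knot $3_1$ or its mirror image.
   Context: A $\Delta$-move is a local move on knot diagrams. Inside a disk, the diagram consists of three arcs, each pair crossing exactly once, bounding a small triangle, with cyclic over/under information (arc 1 passes over arc 2, arc 2 over arc 3, arc 3 over arc 1, up to relabelling). The move replaces this by the diagram with the same endpoints obtained by pushing one arc across the crossing of the other two (so the triangle is reversed, as in a Reidemeister III move), keeping the over/under information of each pair. Diagrams may also be changed by ambient isotopy (Reidemeister moves). Any two knots are related by finitely many $\Delta$-moves (Murakami–Nakanishi). The $\Delta$-Gordian distance $d_G^{\Delta}(K,K')$ is the minimum number of $\Delta$-moves needed to deform $K$ into $K'$, and the $\Delta$-unknotting number is $u^{\Delta}(K)=d_G^{\Delta}(K,O)$, with $O$ the trivial knot. The pretzel link $P(p_1,\dots,p_n)$ is obtained from $n$ vertical two-strand twisted columns (twisted bands) placed side by side, the $i$-th having $|p_i|$ half-twists (crossings) with handedness given by the sign of $p_i$, by joining adjacent columns cyclically at the top and at the bottom in the standard way. A positive pretzel knot is a pretzel knot whose standard diagram has all crossings positive or all crossings negative, namely $P(p_1,\dots,p_n)$ of one of the following types (up to mirror image): odd type ($n$ and all $p_i$ odd and positive); even type A ($n$ even and positive, $p_1$ even and positive, $p_i$ odd and positive for $2\le i\le n$); even type B ($n$ odd and positive, $p_1$ even and negative, $p_i$ odd and positive for $2\le i\le n$). *)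

theory Defs
  imports Complex_Main "HOL-Library.Extended_Nat"
begin

section \<open>Link diagrams\<close>

text \<open>
  A planar link diagram in general position with respect to the height function is cut by
  horizontal lines into layers, each containing one local minimum (Cup), one local maximum (Cap)
  or one crossing, and vertical strands otherwise.  The diagram is recorded as the list of these
  layers, from bottom to top; a layer (x, i) has its event x at horizontal position i, that is,
  with exactly i vertical strands (numbered 0, ..., i - 1) to its left.  In a crossing Over the
  strand running from bottom left to top right is the overcrossing strand, in a crossing Under it
  is the undercrossing one.  Diagrams are unoriented.
\<close>

datatype event = Cup | Cap | Over | Under

type_synonym diagram = "(event \<times> nat) list"

fun ins :: "event \<Rightarrow> nat" where
  "ins Cup = 0" | "ins Cap = 2" | "ins Over = 2" | "ins Under = 2"

fun outs :: "event \<Rightarrow> nat" where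
  "outs Cup = 2" | "outs Cap = 0" | "outs Over = 2" | "outs Under = 2"

definition crossing :: "event \<Rightarrow> bool" where
  "crossing x \<longleftrightarrow> x = Over \<or> x = Under"

fun flip :: "event \<Rightarrow> event" where
  "flip Cup = Cup" | "flip Cap = Cap" | "flip Over = Under" | "flip Under = Over"

text \<open>\<open>tangle m D n\<close>: the layers fit together, with m strands at the bottom and n at the top.\<close>

fun tangle :: "nat \<Rightarrow> diagram \<Rightarrow> nat \<Rightarrow> bool" where
  "tangle m [] n \<longleftrightarrow> m = n"
| "tangle m ((x, i) # D) n \<longleftrightarrow> i + ins x \<le> m \<and> tangle (m - ins x + outs x) D n"

definition link_diagram :: "diagram \<Rightarrow> bool" where
  "link_diagram D \<longleftrightarrow> tangle 0 D 0"

definition mirror :: "diagram \<Rightarrow> diagram" where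
  "mirror D = map (\<lambda>(x, i). (flip x, i)) D"


subsection \<open>Knot diagrams: link diagrams with one component\<close>

fun width :: "nat \<Rightarrow> diagram \<Rightarrow> nat" where
  "width m [] = m"
| "width m ((x, i) # D) = width (m - ins x + outs x) D"

text \<open>The point (k, j) is the intersection of the diagram with the horizontal line between the
  layers k - 1 and k that lies on the j-th strand from the left.\<close>

definition points :: "diagram \<Rightarrow> (nat \<times> nat) set" where
  "points D = {(k, j). k \<le> length D \<and> j < width 0 (take k D)}"

text \<open>Two points are joined if some arc inside a single layer connects them.\<close>

inductive joined :: "diagram \<Rightarrow> nat \<times> nat \<Rightarrow> nat \<times> nat \<Rightarrow> bool" for D where
  left: "k < length D \<Longrightarrow> D ! k = (x, i) \<Longrightarrow> j < i \<Longrightarrow> joined D (k, j) (Suc k, j)"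
| right: "k < length D \<Longrightarrow> D ! k = (x, i) \<Longrightarrow> i + ins x \<le> j \<Longrightarrow> j < width 0 (take k D) \<Longrightarrow>
    joined D (k, j) (Suc k, j - ins x + outs x)"
| cup: "k < length D \<Longrightarrow> D ! k = (Cup, i) \<Longrightarrow> joined D (Suc k, i) (Suc k, i + 1)"
| cap: "k < length D \<Longrightarrow> D ! k = (Cap, i) \<Longrightarrow> joined D (k, i) (k, i + 1)"
| cross1: "k < length D \<Longrightarrow> D ! k = (x, i) \<Longrightarrow> crossing x \<Longrightarrow> joined D (k, i) (Suc k, i + 1)"
| cross2: "k < length D \<Longrightarrow> D ! k = (x, i) \<Longrightarrow> crossing x \<Longrightarrow> joined D (k, i + 1) (Suc k, i)"

definition knot_diagram :: "diagram \<Rightarrow> bool" where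
  "knot_diagram D \<longleftrightarrow> link_diagram D \<and> points D \<noteq> {} \<and>
     (\<forall>p \<in> points D. \<forall>q \<in> points D. equivclp (joined D) p q)"


section \<open>Isotopy\<close>

text \<open>
  Two diagrams of the above kind represent ambient isotopic links if and only if they are related
  by a finite sequence of these local moves (Turaev; Freyd and Yetter).  The first five rules
  generate planar isotopy: exchanging the heights of two horizontally separated events,
  straightening a zigzag, and sliding a strand across a local minimum or maximum.  The remaining
  ones are the Reidemeister moves.  In \<open>R3\<close> the strands numbered 0, 1, 2 from the left at the
  bottom meet on the left-hand side in the order 01, 02, 12 (in the crossings a, b, c) and on the
  right-hand side in the order 12, 02, 01.  The over/under information of these three crossings
  is cyclic if and only if a = c and b is the opposite crossing.
\<close>

inductive isotopy_move :: "diagram \<Rightarrow> diagram \<Rightarrow> bool" where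
  exchange: "i \<le> k \<Longrightarrow> isotopy_move [(x, i), (y, k + outs x)] [(y, k + ins x), (x, i)]"
| zigzag_left: "isotopy_move [(Cup, i), (Cap, i + 1)] []"
| zigzag_right: "isotopy_move [(Cup, i + 1), (Cap, i)] []"
| slide_cup: "crossing x \<Longrightarrow> isotopy_move [(Cup, i), (x, i + 1)] [(Cup, i + 1), (flip x, i)]"
| slide_cap: "crossing x \<Longrightarrow> isotopy_move [(x, i + 1), (Cap, i)] [(flip x, i), (Cap, i + 1)]"
| R1_cup: "crossing x \<Longrightarrow> isotopy_move [(Cup, i), (x, i)] [(Cup, i)]"
| R1_cap: "crossing x \<Longrightarrow> isotopy_move [(x, i), (Cap, i)] [(Cap, i)]"
| R2: "crossing x \<Longrightarrow> isotopy_move [(x, i), (flip x, i)] []"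
| R3: "crossing a \<Longrightarrow> crossing b \<Longrightarrow> crossing c \<Longrightarrow> \<not> (a = c \<and> b = flip a) \<Longrightarrow>
    isotopy_move [(a, i), (b, i + 1), (c, i)] [(c, i + 1), (b, i), (a, i + 1)]"

text \<open>Applying a local move inside a link diagram.\<close>

inductive apply_move :: "(diagram \<Rightarrow> diagram \<Rightarrow> bool) \<Rightarrow> diagram \<Rightarrow> diagram \<Rightarrow> bool" for M where
  "M S T \<Longrightarrow> link_diagram (U @ S @ V) \<Longrightarrow> link_diagram (U @ T @ V) \<Longrightarrow>
    apply_move M (U @ S @ V) (U @ T @ V)"

definition isotopic :: "diagram \<Rightarrow> diagram \<Rightarrow> bool" where
  "isotopic = equivclp (apply_move isotopy_move)"


section \<open>Delta-moves\<close>

text \<open>The same replacement as in \<open>R3\<close>, for cyclic over/under information.\<close>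

inductive delta_local :: "diagram \<Rightarrow> diagram \<Rightarrow> bool" where
  "crossing a \<Longrightarrow>
    delta_local [(a, i), (flip a, i + 1), (a, i)] [(a, i + 1), (flip a, i), (a, i + 1)]"

definition delta_move :: "diagram \<Rightarrow> diagram \<Rightarrow> bool" where
  "delta_move = symclp (apply_move delta_local)"

text \<open>\<open>delta_path n D E\<close>: D can be deformed into E by isotopies and exactly n Delta-moves.\<close>

inductive delta_path :: "nat \<Rightarrow> diagram \<Rightarrow> diagram \<Rightarrow> bool" where
  isotopy: "isotopic D E \<Longrightarrow> delta_path 0 D E"
| delta: "delta_path n D E \<Longrightarrow> delta_move E E' \<Longrightarrow> isotopic E' F \<Longrightarrow> delta_path (Suc n) D F"

text \<open>The value is \<open>\<infinity>\<close> if there is no such deformation (which cannot happen for knots).\<close>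

definition delta_gordian_distance :: "diagram \<Rightarrow> diagram \<Rightarrow> enat" where
  "delta_gordian_distance D E = (INF n \<in> {n. delta_path n D E}. enat n)"

definition unknot :: diagram where
  "unknot = [(Cup, 0), (Cap, 0)]"

definition delta_unknotting_number :: "diagram \<Rightarrow> enat" where
  "delta_unknotting_number D = delta_gordian_distance D unknot"


section \<open>The trefoil, torus knots and pretzel knots\<close>

definition twist :: "int \<Rightarrow> event" where
  "twist p = (if 0 \<le> p then Over else Under)"

text \<open>The closure of the braid of three equal crossings on two strands; the vertical strands 0
  and 3 close up the twisted strands 1 and 2 on the left and on the right.\<close>

definition trefoil :: diagram where
  "trefoil = [(Cup, 0), (Cup, 2), (Over, 1), (Over, 1), (Over, 1), (Cap, 0), (Cap, 0)]"

text \<open>The standard closure of the p-strand braid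
  \<open>(\<sigma>\<^sub>1 \<dots> \<sigma>\<^sub>p\<^sub>-\<^sub>1)\<^sup>q\<close>, mirrored if q is negative.  The
  nested cups and caps join the strand number j to the strand number 2 p - 1 - j; the braid is on
  the strands 0, ..., p - 1.\<close>

definition torus_diagram :: "nat \<Rightarrow> int \<Rightarrow> diagram" where
  "torus_diagram p q =
     map (\<lambda>j. (Cup, j)) [0..<p] @
     concat (replicate (nat \<bar>q\<bar>) (map (\<lambda>j. (twist q, j)) [0..<p - 1])) @
     map (\<lambda>j. (Cap, j)) (rev [0..<p])"

definition torus_knot :: "diagram \<Rightarrow> bool" where
  "torus_knot K \<longleftrightarrow> knot_diagram K \<and>
     (\<exists>p q. 1 \<le> p \<and> coprime (int p) q \<and> isotopic K (torus_diagram p q))"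

text \<open>The j-th column (counted from 0) consists of the strands 2 j and 2 j + 1.  The first cup and
  the last cap join the outermost strands 0 and 2 n - 1, the others join the strands 2 j + 1 and
  2 j + 2 of adjacent columns.\<close>

definition pretzel_diagram :: "int list \<Rightarrow> diagram" where
  "pretzel_diagram ps =
     (let n = length ps in
       (Cup, 0) # map (\<lambda>j. (Cup, 2 * j + 1)) [0..<n - 1] @
       concat (map (\<lambda>j. replicate (nat \<bar>ps ! j\<bar>) (twist (ps ! j), 2 * j)) [0..<n]) @
       map (\<lambda>j. (Cap, 2 * j + 1)) (rev [0..<n - 1]) @ [(Cap, 0)])"

definition pretzel_odd_type :: "int list \<Rightarrow> bool" where
  "pretzel_odd_type ps \<longleftrightarrow> odd (length ps) \<and> (\<forall>p \<in> set ps. odd p \<and> 0 < p)"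

definition pretzel_even_type_A :: "int list \<Rightarrow> bool" where
  "pretzel_even_type_A ps \<longleftrightarrow> even (length ps) \<and> 0 < length ps \<and>
     even (hd ps) \<and> 0 < hd ps \<and> (\<forall>p \<in> set (tl ps). odd p \<and> 0 < p)"

definition pretzel_even_type_B :: "int list \<Rightarrow> bool" where
  "pretzel_even_type_B ps \<longleftrightarrow> odd (length ps) \<and>
     even (hd ps) \<and> hd ps < 0 \<and> (\<forall>p \<in> set (tl ps). odd p \<and> 0 < p)"

definition positive_pretzel_knot :: "diagram \<Rightarrow> bool" where
  "positive_pretzel_knot K \<longleftrightarrow> knot_diagram K \<and>
     (\<exists>ps. (pretzel_odd_type ps \<or> pretzel_even_type_A ps \<or> pretzel_even_type_B ps) \<and>
       (isotopic K (pretzel_diagram ps) \<or> isotopic K (mirror (pretzel_diagram ps))))"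

end

(* The second Conway coefficient, computed from the Gauss word of a diagram by the Polyak-Viro
   formula, is an isotopy invariant that vanishes on the unknot and changes by 1 or -1 under a
   Delta-move; so it is 1 or -1 on a knot of Delta-unknotting number one.  In the standard diagrams
   of positive pretzel knots and torus knots all crossings have the same sign, so every term of the
   formula is +1 and the coefficient counts the pairs of crossings that are interleaved in the
   prescribed way.  Exhibiting two such pairs leaves only P(1,1,1), P(2,1), P(-2,1,1), T(2,3) and
   T(3,2), for which there are explicit isotopies to a trefoil. *)

theory Submission
  imports Defs "HOL-Library.Multiset"
begin

text \<open>A move above the first layer leaves the Gauss word alone or replaces some of its letters
  by short words. Such a replacement commutes with everything below it, so invariance becomes a
  comparison of a few short words. The obstacle is the base point. For an arbitrary Gauss word the
  formula depends on it; independence needs planarity, used here in the form that two closed curves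
  in the plane have algebraic intersection number zero. The base point sits on the lowest cup, so
  exchanging the two lowest cups forces this argument. To count terms in infinite families no word
  is ever computed: integer times are written down for all strands, verified layer by layer, and the
  pattern of a term turns into inequalities between times. For the converse, one Delta-move on an
  explicit trefoil diagram gives the unknot, and a single counted pair shows that the trefoil is not
  the unknot.\<close>

section \<open>Gauss words of tangles\<close>

text \<open>The letter (c, v, e) is a passage through the crossing c, on the upper strand if v holds.  The
  sign e is the one of a strand running upwards, up to a choice per crossing, and is reversed with
  the direction; only the product of the signs of the two passages through a crossing matters, and
  this product is the sign of the crossing.  A triple (a, w, b) is an arc from the end a to the end
  b of a tangle without top ends, and each arc is listed in both directions.\<close>

type_synonym 'c letter = "'c \<times> bool \<times> int"
type_synonym 'c word = "'c letter list"
type_synonym 'c arcs = "(nat \<times> 'c word \<times> nat) set"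
type_synonym 'c layer = "event \<times> nat \<times> 'c"

definition pass :: "'c letter \<Rightarrow> 'c \<times> bool" where
  "pass l = (fst l, fst (snd l))"

definition rev_letter :: "'c letter \<Rightarrow> 'c letter" where
  "rev_letter l = (fst l, fst (snd l), - snd (snd l))"

definition rev_word :: "'c word \<Rightarrow> 'c word" where
  "rev_word w = map rev_letter (rev w)"

lemma pass_simps [simp]: "pass (c, v, e) = (c, v)" "pass (rev_letter l) = pass l"
  "fst (rev_letter l) = fst l"
  by (auto simp: pass_def rev_letter_def)

lemma rev_letter_simps [simp]: "rev_letter (c, v, e) = (c, v, - e)" "rev_letter (rev_letter l) = l"
  by (auto simp: rev_letter_def)

lemma rev_word_simps [simp]: "rev_word [] = []" "rev_word (u @ w) = rev_word w @ rev_word u"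
  "rev_word (l # w) = rev_word w @ [rev_letter l]" "rev_word (rev_word w) = w"
  by (auto simp: rev_word_def rev_map comp_def)

lemma pass_rev_word [simp]: "pass ` set (rev_word w) = pass ` set w"
  by (force simp: rev_word_def)

lemma map_pass_rev_word: "map pass (rev_word w) = rev (map pass w)"
  by (simp add: rev_word_def rev_map)

lemma distinct_pass_rev_word [simp]: "distinct (map pass (rev_word w)) = distinct (map pass w)"
  by (metis distinct_rev map_pass_rev_word)

text \<open>The position of strand \<open>a\<close> on that side of a cup or cap which has the two
  additional strands \<open>i\<close> and \<open>i + 1\<close>.\<close>

definition gap :: "nat \<Rightarrow> nat \<Rightarrow> nat" where
  "gap i a = (if a < i then a else a + 2)"

definition swap :: "nat \<Rightarrow> nat \<Rightarrow> nat" where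
  "swap i a = (if a = i then i + 1 else if a = i + 1 then i else a)"

lemma gap_inj [simp]: "gap i a = gap i b \<longleftrightarrow> a = b"
  by (auto simp: gap_def split: if_splits)

lemma gap_neq [simp]: "gap i a \<noteq> i" "gap i a \<noteq> Suc i" "i \<noteq> gap i a" "Suc i \<noteq> gap i a"
  by (auto simp: gap_def)

lemma gap_cases: obtains "a = i" | "a = Suc i" | b where "a = gap i b"
proof -
  consider "a < i" | "a = i" | "a = Suc i" | "a \<ge> i + 2" by linarith
  then show thesis
  proof cases
    case 1 then show ?thesis using that(3)[of a] by (simp add: gap_def)
  next
    case 4
    then have "a = gap i (a - 2)" by (auto simp: gap_def)
    then show ?thesis by (rule that(3))
  qed (use that in auto)
qed

lemma gap_less [simp]: "i \<le> n \<Longrightarrow> gap i a < n + 2 \<longleftrightarrow> a < n" "i \<le> n \<Longrightarrow> gap i a < Suc (Suc n) \<longleftrightarrow> a < n"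
  by (auto simp: gap_def)

lemma swap_swap [simp]: "swap i (swap i a) = a"
  by (auto simp: swap_def)

lemma swap_inj [simp]: "swap i a = swap i b \<longleftrightarrow> a = b"
  by (metis swap_swap)

lemma swap_simps [simp]: "swap i i = Suc i" "swap i (Suc i) = i"
  by (auto simp: swap_def)

lemma swap_less: "i + 2 \<le> n \<Longrightarrow> swap i a < n \<longleftrightarrow> a < n"
  by (auto simp: swap_def)

lemma swap_gap [simp]: "swap i (gap i a) = gap i a"
  by (auto simp: swap_def gap_def)

text \<open>Left and right refer to the bottom end of the strand. Both signs are those of upward
  travel; their product is 1 for \<open>Over\<close> and - 1 for \<open>Under\<close>.\<close>

definition left_letter :: "event \<Rightarrow> 'c \<Rightarrow> 'c letter" where
  "left_letter x c = (c, x = Over, 1)"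

definition right_letter :: "event \<Rightarrow> 'c \<Rightarrow> 'c letter" where
  "right_letter x c = (c, x = Under, if x = Over then 1 else - 1)"

text \<open>Extends every strand downwards: the new letters come first when an arc leaves its end,
  and reversed and last when it arrives there.\<close>

definition decorate :: "(nat \<Rightarrow> 'c word) \<Rightarrow> 'c arcs \<Rightarrow> 'c arcs" where
  "decorate d M = {(a, d a @ w @ rev_word (d b), b) | a w b. (a, w, b) \<in> M}"

definition permute :: "(nat \<Rightarrow> nat) \<Rightarrow> 'c arcs \<Rightarrow> 'c arcs" where
  "permute f M = {(f a, w, f b) | a w b. (a, w, b) \<in> M}"

definition cap_arcs :: "nat \<Rightarrow> 'c arcs \<Rightarrow> 'c arcs" where
  "cap_arcs i M = permute (gap i) M \<union> {(i, [], Suc i), (Suc i, [], i)}"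

text \<open>A component closed by the cup disappears from the arcs; \<open>layer_loops\<close> keeps
  count of it.\<close>

definition cup_arcs :: "nat \<Rightarrow> 'c arcs \<Rightarrow> 'c arcs" where
  "cup_arcs i M = {(a, w, b). (gap i a, w, gap i b) \<in> M \<or>
     (\<exists>w1 w2. w = w1 @ w2 \<and> (gap i a, w1, i) \<in> M \<and> (Suc i, w2, gap i b) \<in> M) \<or>
     (\<exists>w1 w2. w = w1 @ w2 \<and> (gap i a, w1, Suc i) \<in> M \<and> (i, w2, gap i b) \<in> M)}"

definition at2 :: "nat \<Rightarrow> 'c word \<Rightarrow> 'c word \<Rightarrow> nat \<Rightarrow> 'c word" where
  "at2 i u v a = (if a = i then u else if a = Suc i then v else [])"

definition cross_arcs :: "event \<Rightarrow> nat \<Rightarrow> 'c \<Rightarrow> 'c arcs \<Rightarrow> 'c arcs" where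
  "cross_arcs x i c M = decorate (at2 i [left_letter x c] [right_letter x c]) (permute (swap i) M)"

fun layer_arcs :: "'c layer \<Rightarrow> 'c arcs \<Rightarrow> 'c arcs" where
  "layer_arcs (Cup, i, c) M = cup_arcs i M"
| "layer_arcs (Cap, i, c) M = cap_arcs i M"
| "layer_arcs (x, i, c) M = cross_arcs x i c M"

fun layer_loops :: "'c layer \<Rightarrow> 'c arcs \<Rightarrow> nat" where
  "layer_loops (x, i, c) M = (if x = Cup \<and> (\<exists>w. (i, w, Suc i) \<in> M) then 1 else 0)"

text \<open>Layers are listed from bottom to top, so the head acts last; \<open>M\<close> holds the
  arcs of everything above the listed layers.\<close>

fun act :: "'c layer list \<Rightarrow> 'c arcs \<Rightarrow> 'c arcs" where
  "act [] M = M"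
| "act (y # A) M = layer_arcs y (act A M)"

fun loops :: "'c layer list \<Rightarrow> 'c arcs \<Rightarrow> nat" where
  "loops [] M = 0"
| "loops (y # A) M = layer_loops y (act A M) + loops A M"

fun ids :: "'c layer list \<Rightarrow> 'c list" where
  "ids [] = []"
| "ids ((x, i, c) # A) = (if crossing x then c # ids A else ids A)"

definition erase :: "'c layer list \<Rightarrow> diagram" where
  "erase A = map (\<lambda>(x, i, c). (x, i)) A"

lemma act_append: "act (A @ B) M = act A (act B M)"
  by (induction A) auto

lemma loops_append: "loops (A @ B) M = loops A (act B M) + loops B M"
  by (induction A) (auto simp: act_append)

lemma ids_append [simp]: "ids (A @ B) = ids A @ ids B"
  by (induction A rule: ids.induct) auto

lemma erase_simps [simp]: "erase [] = []" "erase ((x, i, c) # A) = (x, i) # erase A"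
  "erase (A @ B) = erase A @ erase B" "length (erase A) = length A"
  by (auto simp: erase_def)

section \<open>Arc systems: matchings of the ends in which each passage occurs once\<close>

definition passes :: "'c arcs \<Rightarrow> ('c \<times> bool) set" where
  "passes M = (\<Union>(a, w, b) \<in> M. pass ` set w)"

lemma passesI: "(a, w, b) \<in> M \<Longrightarrow> l \<in> set w \<Longrightarrow> pass l \<in> passes M"
  unfolding passes_def by force

lemma in_passes: "p \<in> passes M \<longleftrightarrow> (\<exists>a w b. (a, w, b) \<in> M \<and> p \<in> pass ` set w)"
  unfolding passes_def by auto

text \<open>In the last clause \<open>a'\<close> differs from both ends of the first arc, which says
  that the two arcs are different and not reverses of each other.\<close>

definition arc_system :: "nat \<Rightarrow> 'c arcs \<Rightarrow> bool" where
  "arc_system n M \<longleftrightarrow>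
     (\<forall>a w b. (a, w, b) \<in> M \<longrightarrow> a < n \<and> b < n \<and> a \<noteq> b \<and> (b, rev_word w, a) \<in> M \<and> distinct (map pass w)) \<and>
     (\<forall>a<n. \<exists>w b. (a, w, b) \<in> M) \<and>
     (\<forall>a w b w' b'. (a, w, b) \<in> M \<longrightarrow> (a, w', b') \<in> M \<longrightarrow> w = w' \<and> b = b') \<and>
     (\<forall>a w b a' w' b'. (a, w, b) \<in> M \<longrightarrow> (a', w', b') \<in> M \<longrightarrow> a' \<noteq> a \<longrightarrow> a' \<noteq> b \<longrightarrow>
        pass ` set w \<inter> pass ` set w' = {})"

lemma arc_systemD:
  assumes "arc_system n M" "(a, w, b) \<in> M"
  shows "a < n" "b < n" "a \<noteq> b" "(b, rev_word w, a) \<in> M" "distinct (map pass w)"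
  using assms(1)[unfolded arc_system_def, THEN conjunct1, rule_format, OF assms(2)] by simp_all

lemma arc_system_total: "arc_system n M \<Longrightarrow> a < n \<Longrightarrow> \<exists>w b. (a, w, b) \<in> M"
  unfolding arc_system_def by simp

lemma arc_system_unique:
  "arc_system n M \<Longrightarrow> (a, w, b) \<in> M \<Longrightarrow> (a, w', b') \<in> M \<Longrightarrow> w = w' \<and> b = b'"
  unfolding arc_system_def by metis

lemma arc_system_unique_end:
  assumes "arc_system n M" "(a, w, b) \<in> M" "(a', w', b) \<in> M"
  shows "w = w' \<and> a = a'"
proof -
  have "(b, rev_word w, a) \<in> M" "(b, rev_word w', a') \<in> M"
    using assms arc_systemD(4) by blast+
  then show ?thesis using arc_system_unique[OF assms(1)] by (metis rev_word_simps(4))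
qed

lemma arc_system_disjoint:
  "arc_system n M \<Longrightarrow> (a, w, b) \<in> M \<Longrightarrow> (a', w', b') \<in> M \<Longrightarrow> a' \<noteq> a \<Longrightarrow> a' \<noteq> b \<Longrightarrow>
     pass ` set w \<inter> pass ` set w' = {}"
  unfolding arc_system_def by metis

lemma arc_systemI:
  assumes "\<And>a w b. (a, w, b) \<in> M \<Longrightarrow> a < n \<and> b < n \<and> a \<noteq> b \<and> (b, rev_word w, a) \<in> M \<and> distinct (map pass w)"
    and "\<And>a. a < n \<Longrightarrow> \<exists>w b. (a, w, b) \<in> M"
    and "\<And>a w b w' b'. (a, w, b) \<in> M \<Longrightarrow> (a, w', b') \<in> M \<Longrightarrow> w = w' \<and> b = b'"
    and "\<And>a w b a' w' b'. (a, w, b) \<in> M \<Longrightarrow> (a', w', b') \<in> M \<Longrightarrow> a' \<noteq> a \<Longrightarrow> a' \<noteq> b \<Longrightarrow>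
        pass ` set w \<inter> pass ` set w' = {}"
  shows "arc_system n M"
  unfolding arc_system_def
  apply (intro conjI)
  subgoal using assms(1) by simp
  subgoal using assms(2) by simp
  subgoal using assms(3) by simp
  subgoal using assms(4) by simp
  done

lemma arc_system_empty: "arc_system 0 {}"
  by (rule arc_systemI) auto

lemma in_permute: "(a, w, b) \<in> permute f M \<longleftrightarrow> (\<exists>a' b'. a = f a' \<and> b = f b' \<and> (a', w, b') \<in> M)"
  unfolding permute_def by auto

lemma in_permute_swap: "(a, w, b) \<in> permute (swap i) M \<longleftrightarrow> (swap i a, w, swap i b) \<in> M"
  unfolding in_permute by (metis swap_swap)

lemma in_decorate: "(a, u, b) \<in> decorate d M \<longleftrightarrow> (\<exists>w. u = d a @ w @ rev_word (d b) \<and> (a, w, b) \<in> M)"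
  unfolding decorate_def by auto

lemma in_cap_arcs:
  "(a, w, b) \<in> cap_arcs i M \<longleftrightarrow> (\<exists>a' b'. a = gap i a' \<and> b = gap i b' \<and> (a', w, b') \<in> M) \<or>
     w = [] \<and> (a = i \<and> b = Suc i \<or> a = Suc i \<and> b = i)"
  unfolding cap_arcs_def in_permute[symmetric] by auto

lemma in_cap_arcs_simps [simp]:
  "(gap i a, w, gap i b) \<in> cap_arcs i M \<longleftrightarrow> (a, w, b) \<in> M"
  "(i, w, b) \<in> cap_arcs i M \<longleftrightarrow> w = [] \<and> b = Suc i"
  "(Suc i, w, b) \<in> cap_arcs i M \<longleftrightarrow> w = [] \<and> b = i"
  "(a, w, i) \<in> cap_arcs i M \<longleftrightarrow> w = [] \<and> a = Suc i"
  "(a, w, Suc i) \<in> cap_arcs i M \<longleftrightarrow> w = [] \<and> a = i"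
  unfolding in_cap_arcs by auto

lemma in_cup_arcs:
  "(a, w, b) \<in> cup_arcs i M \<longleftrightarrow> (gap i a, w, gap i b) \<in> M \<or>
     (\<exists>w1 w2. w = w1 @ w2 \<and> (gap i a, w1, i) \<in> M \<and> (Suc i, w2, gap i b) \<in> M) \<or>
     (\<exists>w1 w2. w = w1 @ w2 \<and> (gap i a, w1, Suc i) \<in> M \<and> (i, w2, gap i b) \<in> M)"
  unfolding cup_arcs_def by simp

lemma arc_system_cap:
  assumes M: "arc_system n M" and i: "i \<le> n"
  shows "arc_system (n + 2) (cap_arcs i M)"
proof (rule arc_systemI)
  fix a w b assume "(a, w, b) \<in> cap_arcs i M"
  then show "a < n + 2 \<and> b < n + 2 \<and> a \<noteq> b \<and> (b, rev_word w, a) \<in> cap_arcs i M \<and> distinct (map pass w)"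
    unfolding in_cap_arcs[of a] using arc_systemD[OF M] i by (auto simp: gap_less[OF i, simplified])
next
  fix a assume "a < n + 2"
  then show "\<exists>w b. (a, w, b) \<in> cap_arcs i M"
    using arc_system_total[OF M] i by (cases a rule: gap_cases[of _ i]) (auto, metis in_cap_arcs_simps(1))
next
  fix a w b w' b' assume "(a, w, b) \<in> cap_arcs i M" "(a, w', b') \<in> cap_arcs i M"
  then show "w = w' \<and> b = b'"
    unfolding in_cap_arcs using arc_system_unique[OF M] by auto
next
  fix a w b a' w' b' assume "(a, w, b) \<in> cap_arcs i M" "(a', w', b') \<in> cap_arcs i M" "a' \<noteq> a" "a' \<noteq> b"
  then show "pass ` set w \<inter> pass ` set w' = {}"
    unfolding in_cap_arcs by (elim disjE exE conjE) (use arc_system_disjoint[OF M] in simp_all)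
qed

lemma passes_permute: "passes (permute f M) = passes M"
  unfolding set_eq_iff in_passes in_permute by blast

lemma passes_cap: "passes (cap_arcs i M) = passes M"
proof -
  have "passes (cap_arcs i M) = passes (permute (gap i) M)" unfolding cap_arcs_def passes_def by auto
  then show ?thesis unfolding passes_permute .
qed

lemma arc_system_permute_swap:
  assumes M: "arc_system n M" and i: "i + 2 \<le> n"
  shows "arc_system n (permute (swap i) M)"
  by (rule arc_systemI; unfold in_permute_swap)
    (use arc_systemD[OF M] swap_less[OF i] in blast,
     metis arc_system_total[OF M] swap_less[OF i] swap_swap,
     metis arc_system_unique[OF M] swap_inj,
     use arc_system_disjoint[OF M] swap_inj in blast)

lemma disjoint_union3:
  assumes "x2 \<subseteq> m" "y2 \<subseteq> m" "x2 \<inter> y2 = {}" "x1 \<inter> y1 = {}" "x1 \<inter> y3 = {}" "x3 \<inter> y1 = {}" "x3 \<inter> y3 = {}"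
    "x1 \<inter> m = {}" "x3 \<inter> m = {}" "y1 \<inter> m = {}" "y3 \<inter> m = {}"
  shows "(x1 \<union> x2 \<union> x3) \<inter> (y1 \<union> y2 \<union> y3) = {}"
  using assms by blast

lemma arc_system_decorate:
  assumes M: "arc_system n M"
    and d: "\<And>a. a < n \<Longrightarrow> distinct (map pass (d a))"
    and d2: "\<And>a b. a < n \<Longrightarrow> b < n \<Longrightarrow> a \<noteq> b \<Longrightarrow> pass ` set (d a) \<inter> pass ` set (d b) = {}"
    and d3: "\<And>a. a < n \<Longrightarrow> pass ` set (d a) \<inter> passes M = {}"
  shows "arc_system n (decorate d M)"
proof (rule arc_systemI)
  fix a w b assume "(a, w, b) \<in> decorate d M"
  then obtain u where u: "w = d a @ u @ rev_word (d b)" "(a, u, b) \<in> M" by (auto simp: in_decorate)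
  note D = arc_systemD[OF M u(2)]
  have "pass ` set u \<subseteq> passes M" using passesI[OF u(2)] by auto
  then have "pass ` set (d a) \<inter> pass ` set u = {}" "pass ` set (d b) \<inter> pass ` set u = {}"
    using d3[OF D(1)] d3[OF D(2)] by blast+
  then have "distinct (map pass w)"
    using d[OF D(1)] d[OF D(2)] d2[OF D(1,2,3)] D(5) distinct_pass_rev_word[of "d b"] pass_rev_word[of "d b"]
    unfolding u(1) by (auto simp del: pass_rev_word)
  moreover have "(b, rev_word w, a) \<in> decorate d M"
    unfolding in_decorate using D(4) u(1) by (intro exI[of _ "rev_word u"]) auto
  ultimately show "a < n \<and> b < n \<and> a \<noteq> b \<and> (b, rev_word w, a) \<in> decorate d M \<and> distinct (map pass w)"
    using D by blast
next
  fix a assume "a < n" then show "\<exists>w b. (a, w, b) \<in> decorate d M"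
    using arc_system_total[OF M] unfolding in_decorate by blast
next
  fix a w b w' b' assume "(a, w, b) \<in> decorate d M" "(a, w', b') \<in> decorate d M"
  then show "w = w' \<and> b = b'" unfolding in_decorate using arc_system_unique[OF M] by blast
next
  fix a w b a' w' b'
  assume *: "(a, w, b) \<in> decorate d M" "(a', w', b') \<in> decorate d M" "a' \<noteq> a" "a' \<noteq> b"
  obtain u where u: "w = d a @ u @ rev_word (d b)" "(a, u, b) \<in> M" using *(1) by (auto simp: in_decorate)
  obtain u' where u': "w' = d a' @ u' @ rev_word (d b')" "(a', u', b') \<in> M" using *(2) by (auto simp: in_decorate)
  note D = arc_systemD[OF M u(2)] and D' = arc_systemD[OF M u'(2)]
  \<comment> \<open>Ends determine arcs, so an arc that starts at neither \<open>a\<close> nor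
    \<open>b\<close> cannot end there.\<close>
  have b': "b' \<noteq> a" "b' \<noteq> b"
    using *(3,4) arc_system_unique_end[OF M D(4), of a' u'] arc_system_unique_end[OF M u(2), of a' u'] u'(2) by auto
  have "pass ` set u \<inter> pass ` set u' = {}" using arc_system_disjoint[OF M u(2) u'(2) *(3,4)] .
  moreover have "pass ` set u \<subseteq> passes M" "pass ` set u' \<subseteq> passes M"
    using passesI[OF u(2)] passesI[OF u'(2)] by auto
  moreover have "pass ` set w = pass ` set (d a) \<union> pass ` set u \<union> pass ` set (d b)"
    "pass ` set w' = pass ` set (d a') \<union> pass ` set u' \<union> pass ` set (d b')"
    unfolding u u' by (simp_all add: image_Un Un_assoc)
  moreover note d2[OF D(1) D'(1)] d2[OF D(1) D'(2)] d2[OF D(2) D'(1)] d2[OF D(2) D'(2)]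
    d3[OF D(1)] d3[OF D(2)] d3[OF D'(1)] d3[OF D'(2)]
  ultimately show "pass ` set w \<inter> pass ` set w' = {}" using *(3,4) b'
    disjoint_union3[of "pass ` set u" "passes M" "pass ` set u'" "pass ` set (d a)" "pass ` set (d a')"
      "pass ` set (d b')" "pass ` set (d b)"] by simp
qed

lemma passes_decorate:
  assumes M: "arc_system n M"
  shows "passes (decorate d M) = passes M \<union> (\<Union>a<n. pass ` set (d a))"
proof (intro set_eqI iffI)
  fix p assume "p \<in> passes (decorate d M)"
  then obtain a w b where w: "(a, w, b) \<in> M" "p \<in> pass ` set (d a @ w @ rev_word (d b))"
    unfolding in_passes in_decorate by blast
  moreover have "a < n" "b < n" using arc_systemD[OF M w(1)] by auto
  moreover have "p \<in> pass ` set (d a) \<or> p \<in> pass ` set w \<or> p \<in> pass ` set (d b)"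
    using w(2) by (metis Un_iff image_Un pass_rev_word set_append)
  ultimately show "p \<in> passes M \<union> (\<Union>a<n. pass ` set (d a))"
    unfolding in_passes Un_iff by (meson UN_I lessThan_iff)
next
  fix p assume "p \<in> passes M \<union> (\<Union>a<n. pass ` set (d a))"
  then consider a w b where "(a, w, b) \<in> M" "p \<in> pass ` set w" | a where "a < n" "p \<in> pass ` set (d a)"
    unfolding Un_iff in_passes by blast
  then obtain a w b where "(a, w, b) \<in> M" "p \<in> pass ` set (d a @ w @ rev_word (d b))"
  proof cases
    case 1 then show ?thesis using that[of a w b] by auto
  next
    case 2 then show ?thesis using that arc_system_total[OF M 2(1)] by auto
  qed
  then show "p \<in> passes (decorate d M)" unfolding in_passes in_decorate by blast
qed

lemma arc_system_cup:
  assumes M: "arc_system (n + 2) M" and i: "i \<le> n"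
  shows "arc_system n (cup_arcs i M)"
proof (rule arc_systemI)
  note D = arc_systemD[OF M] and U = arc_system_unique[OF M] and E = arc_system_unique_end[OF M]
    and DJ = arc_system_disjoint[OF M]
  note g = gap_less[OF i, simplified]
  {
    fix a w b assume *: "(a, w, b) \<in> cup_arcs i M"
    have ab: "a < n" "b < n"
      using * unfolding in_cup_arcs by (auto dest: D(1) D(2) simp: g)
    moreover have "a \<noteq> b"
    proof
      assume "a = b"
      then show False using * unfolding in_cup_arcs
        proof (elim disjE exE conjE)
          assume "(gap i a, w, gap i b) \<in> M" then show False using D(3) \<open>a = b\<close> by blast
        next
          \<comment> \<open>The reverse of the second half would be a second arc from
            \<open>gap i a\<close>; uniqueness would then identify \<open>i\<close> with
            \<open>Suc i\<close>.\<close>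
          fix w1 w2 assume "(gap i a, w1, i) \<in> M" "(Suc i, w2, gap i b) \<in> M"
          then show False using D(4)[of "Suc i"] U[of "gap i a"] \<open>a = b\<close> by (metis n_not_Suc_n)
        next
          fix w1 w2 assume "(gap i a, w1, Suc i) \<in> M" "(i, w2, gap i b) \<in> M"
          then show False using D(4)[of i] U[of "gap i a"] \<open>a = b\<close> by (metis n_not_Suc_n)
        qed
    qed
    moreover have "(b, rev_word w, a) \<in> cup_arcs i M"
      using * unfolding in_cup_arcs
    proof (elim disjE exE conjE)
      assume "(gap i a, w, gap i b) \<in> M" from D(4)[OF this] show "(gap i b, rev_word w, gap i a) \<in> M \<or>
        (\<exists>w1 w2. rev_word w = w1 @ w2 \<and> (gap i b, w1, i) \<in> M \<and> (Suc i, w2, gap i a) \<in> M) \<or>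
        (\<exists>w1 w2. rev_word w = w1 @ w2 \<and> (gap i b, w1, Suc i) \<in> M \<and> (i, w2, gap i a) \<in> M)" by simp
    next
      fix w1 w2 assume **: "w = w1 @ w2" "(gap i a, w1, i) \<in> M" "(Suc i, w2, gap i b) \<in> M"
      from D(4)[OF **(2)] D(4)[OF **(3)] show "(gap i b, rev_word w, gap i a) \<in> M \<or>
        (\<exists>w1 w2. rev_word w = w1 @ w2 \<and> (gap i b, w1, i) \<in> M \<and> (Suc i, w2, gap i a) \<in> M) \<or>
        (\<exists>w1 w2. rev_word w = w1 @ w2 \<and> (gap i b, w1, Suc i) \<in> M \<and> (i, w2, gap i a) \<in> M)"
        unfolding **(1) rev_word_simps by blast
    next
      fix w1 w2 assume **: "w = w1 @ w2" "(gap i a, w1, Suc i) \<in> M" "(i, w2, gap i b) \<in> M"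
      from D(4)[OF **(2)] D(4)[OF **(3)] show "(gap i b, rev_word w, gap i a) \<in> M \<or>
        (\<exists>w1 w2. rev_word w = w1 @ w2 \<and> (gap i b, w1, i) \<in> M \<and> (Suc i, w2, gap i a) \<in> M) \<or>
        (\<exists>w1 w2. rev_word w = w1 @ w2 \<and> (gap i b, w1, Suc i) \<in> M \<and> (i, w2, gap i a) \<in> M)"
        unfolding **(1) rev_word_simps by blast
    qed    moreover have "distinct (map pass w)"
      using * unfolding in_cup_arcs
    proof (elim disjE exE conjE)
      assume "(gap i a, w, gap i b) \<in> M" then show ?thesis by (rule D(5))
    next
      fix w1 w2 assume **: "w = w1 @ w2" "(gap i a, w1, i) \<in> M" "(Suc i, w2, gap i b) \<in> M"
      then show ?thesis using D(5)[OF **(2)] D(5)[OF **(3)] DJ[OF **(2,3)] by simp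
    next
      fix w1 w2 assume **: "w = w1 @ w2" "(gap i a, w1, Suc i) \<in> M" "(i, w2, gap i b) \<in> M"
      then show ?thesis using D(5)[OF **(2)] D(5)[OF **(3)] DJ[OF **(2,3)] by simp
    qed
    ultimately show "a < n \<and> b < n \<and> a \<noteq> b \<and> (b, rev_word w, a) \<in> cup_arcs i M \<and> distinct (map pass w)"
      by blast
  next
    fix a assume "a < n"
    then obtain w b where w: "(gap i a, w, b) \<in> M" using arc_system_total[OF M] g by (metis add_2_eq_Suc')
    obtain w1 b1 where w1: "(i, w1, b1) \<in> M" using arc_system_total[OF M, of i] i by auto
    obtain w2 b2 where w2: "(Suc i, w2, b2) \<in> M" using arc_system_total[OF M, of "Suc i"] i by auto
    show "\<exists>w b. (a, w, b) \<in> cup_arcs i M"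
    proof (cases b rule: gap_cases[of _ i])
      case 1
      then have "b2 \<noteq> i" "b2 \<noteq> Suc i" using 1 w w2 E[of _ _ i] D(3) by (metis gap_neq(2), metis)
      then obtain b' where "b2 = gap i b'" by (metis gap_cases)
      then show ?thesis unfolding in_cup_arcs using 1 w w2 by blast
    next
      case 2
      then have "b1 \<noteq> i" "b1 \<noteq> Suc i" using 2 w w1 E[of _ _ "Suc i"] D(3) by (metis, metis gap_neq(1))
      then obtain b' where "b1 = gap i b'" by (metis gap_cases)
      then show ?thesis unfolding in_cup_arcs using 2 w w1 by blast
    next
      case (3 b')
      then show ?thesis using w unfolding in_cup_arcs by blast
    qed
  next
    fix a w b w' b' assume "(a, w, b) \<in> cup_arcs i M" "(a, w', b') \<in> cup_arcs i M"
    then show "w = w' \<and> b = b'"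
      unfolding in_cup_arcs by (elim disjE exE conjE; metis U gap_inj gap_neq(1,2) n_not_Suc_n)
  next
    fix a w b a' w' b'
    assume *: "(a, w, b) \<in> cup_arcs i M" "(a', w', b') \<in> cup_arcs i M" "a' \<noteq> a" "a' \<noteq> b"
    have ne: "gap i a' \<noteq> gap i a" "gap i a' \<noteq> gap i b" using *(3,4) by auto
    show "pass ` set w \<inter> pass ` set w' = {}"
      using *(1,2) unfolding in_cup_arcs
    proof (elim disjE exE conjE, goal_cases)
      case 1 show ?case using DJ[OF 1 ne] .
    next
      case (2 w1 w2) show ?case using DJ[OF 2(1) 2(3) ne] DJ[OF 2(1) 2(4)] 2(2)
        by (auto simp: Int_Un_distrib image_Un)
    next
      case (3 w1 w2) show ?case using DJ[OF 3(1) 3(3) ne] DJ[OF 3(1) 3(4)] 3(2)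
        by (auto simp: Int_Un_distrib image_Un)
    next
      case (4 w1 w2) show ?case using DJ[OF 4(3) 4(1)] DJ[OF 4(4) 4(1)] ne 4
        by (auto simp: Int_Un_distrib2 image_Un)
    next
      case (5 w1 w2) show ?case using DJ[OF 5(3) 5(1)] DJ[OF 5(4) 5(1)] ne 5(2)
        by (auto simp: Int_Un_distrib2 image_Un)
    next
      \<comment> \<open>Only one arc runs through the cup, so in the remaining cases both arcs are
        this one, in the same or in opposite directions, against \<open>ne\<close>.\<close>
      case 6
      have "gap i a = gap i a'" using E[OF 6(3) 6(5)] by simp
      then show ?case using ne by simp
    next
      case 7
      have "gap i b = gap i a'" using E[OF D(4)[OF 7(4)] 7(5)] by simp
      then show ?case using ne by simp
    next
      case 8
      have "gap i b = gap i a'" using E[OF D(4)[OF 8(4)] 8(5)] by simp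
      then show ?case using ne by simp
    next
      case 9
      have "gap i a = gap i a'" using E[OF 9(3) 9(5)] by simp
      then show ?case using ne by simp
    qed
  }
qed

lemma passes_cup_subset: "passes (cup_arcs i M) \<subseteq> passes M"
proof
  fix p assume "p \<in> passes (cup_arcs i M)"
  then obtain a w b where w: "(a, w, b) \<in> cup_arcs i M" "p \<in> pass ` set w" unfolding in_passes by blast
  show "p \<in> passes M"
    using w(1) unfolding in_cup_arcs
  proof (elim disjE exE conjE)
    assume "(gap i a, w, gap i b) \<in> M" then show ?thesis using w(2) unfolding in_passes by blast
  next
    fix w1 w2 assume *: "w = w1 @ w2" "(gap i a, w1, i) \<in> M" "(Suc i, w2, gap i b) \<in> M"
    have "p \<in> pass ` set w1 \<or> p \<in> pass ` set w2" using w(2) *(1) by auto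
    then show ?thesis using *(2,3) unfolding in_passes by blast
  next
    fix w1 w2 assume *: "w = w1 @ w2" "(gap i a, w1, Suc i) \<in> M" "(i, w2, gap i b) \<in> M"
    have "p \<in> pass ` set w1 \<or> p \<in> pass ` set w2" using w(2) *(1) by auto
    then show ?thesis using *(2,3) unfolding in_passes by blast
  qed
qed

text \<open>If no loop is closed, the two joined strands survive as the arc
  \<open>rev_word u @ v\<close>, so no letter is lost.\<close>

lemma passes_cup:
  assumes M: "arc_system (n + 2) M" and i: "i \<le> n" and nl: "\<not> (\<exists>w. (i, w, Suc i) \<in> M)"
  shows "passes (cup_arcs i M) = passes M"
proof (intro equalityI passes_cup_subset subsetI)
  fix p assume "p \<in> passes M"
  then obtain a w b where w: "(a, w, b) \<in> M" "p \<in> pass ` set w" unfolding in_passes by blast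
  have nl': "\<not> (\<exists>w. (Suc i, w, i) \<in> M)" using nl arc_systemD(4)[OF M] by blast
  obtain u a1 where u: "(i, u, a1) \<in> M" using arc_system_total[OF M, of i] i by auto
  obtain v b1 where v: "(Suc i, v, b1) \<in> M" using arc_system_total[OF M, of "Suc i"] i by auto
  have "a1 \<noteq> i" "a1 \<noteq> Suc i" using u nl arc_systemD(3)[OF M u] by auto
  then obtain a2 where a2: "a1 = gap i a2" by (metis gap_cases)
  have "b1 \<noteq> i" "b1 \<noteq> Suc i" using v nl' arc_systemD(3)[OF M v] by auto
  then obtain b2 where b2: "b1 = gap i b2" by (metis gap_cases)
  have c: "(a2, rev_word u @ v, b2) \<in> cup_arcs i M"
    unfolding in_cup_arcs using arc_systemD(4)[OF M u] v a2 b2 by blast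
  consider "a = i" | "a = Suc i" | "b = i" | "b = Suc i" | a' b' where "a = gap i a'" "b = gap i b'"
    by (metis gap_cases)
  then show "p \<in> passes (cup_arcs i M)"
  proof cases
    case 1
    then have "w = u" using arc_system_unique[OF M u] w(1) by auto
    then have "p \<in> pass ` set (rev_word u @ v)" using w(2) by (metis UnCI image_Un pass_rev_word set_append)
    then show ?thesis unfolding in_passes using c by blast
  next
    case 2
    then have "w = v" using arc_system_unique[OF M v] w(1) by auto
    then have "p \<in> pass ` set (rev_word u @ v)" using w(2) by auto
    then show ?thesis unfolding in_passes using c by blast
  next
    case 3
    then have "rev_word w = u" using arc_system_unique[OF M u] arc_systemD(4)[OF M w(1)] by auto
    then have "p \<in> pass ` set (rev_word u @ v)" using w(2) by auto
    then show ?thesis unfolding in_passes using c by blast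
  next
    case 4
    then have "rev_word w = v" using arc_system_unique[OF M v] arc_systemD(4)[OF M w(1)] by auto
    then have "p \<in> pass ` set (rev_word u @ v)" using w(2) by (metis UnCI image_Un pass_rev_word set_append)
    then show ?thesis unfolding in_passes using c by blast
  next
    case 5
    then have "(a', w, b') \<in> cup_arcs i M" unfolding in_cup_arcs using w(1) by blast
    then show ?thesis unfolding in_passes using w(2) by blast
  qed
qed

lemma at2_simps [simp]: "at2 i u v i = u" "at2 i u v (Suc i) = v"
  by (auto simp: at2_def)

lemma at2_other: "a \<noteq> i \<Longrightarrow> a \<noteq> Suc i \<Longrightarrow> at2 i u v a = []"
  by (auto simp: at2_def)

lemma at2_gap [simp]: "at2 i u v (gap i a) = []"
  by (auto simp: at2_def)

lemma letters_simps [simp]: "fst (left_letter x c) = c" "fst (right_letter x c) = c"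
  by (auto simp: left_letter_def right_letter_def)

lemma pass_letters: "crossing x \<Longrightarrow> {pass (left_letter x c), pass (right_letter x c)} = {c} \<times> UNIV"
  "crossing x \<Longrightarrow> pass (left_letter x c) \<noteq> pass (right_letter x c)"
  by (cases x; auto simp: left_letter_def right_letter_def crossing_def)+

lemma arc_system_cross:
  assumes M: "arc_system n M" and i: "i + 2 \<le> n" and c: "c \<notin> fst ` passes M" and x: "crossing x"
  shows "arc_system n (cross_arcs x i c M)" "passes (cross_arcs x i c M) = passes M \<union> {c} \<times> UNIV"
proof -
  note P = arc_system_permute_swap[OF M i]
  have c': "(c, v) \<notin> passes M" for v using c by force
  have pl: "pass (left_letter x c) \<notin> passes M" "pass (right_letter x c) \<notin> passes M"
    using c' by (auto simp: left_letter_def right_letter_def)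
  show "arc_system n (cross_arcs x i c M)"
    unfolding cross_arcs_def
    by (rule arc_system_decorate[OF P])
      (use pl pass_letters(2)[OF x, of c] in \<open>auto simp: at2_def passes_permute\<close>)
  have "(\<Union>a<n. pass ` set (at2 i [left_letter x c] [right_letter x c] a)) = {pass (left_letter x c), pass (right_letter x c)}"
  proof -
    have "{..<n} = {i, Suc i} \<union> {a. a < n \<and> a \<noteq> i \<and> a \<noteq> Suc i}" using i by auto
    then show ?thesis by (auto simp: UN_Un at2_other)
  qed
  then show "passes (cross_arcs x i c M) = passes M \<union> {c} \<times> UNIV"
    unfolding cross_arcs_def passes_decorate[OF P] passes_permute using pass_letters(1)[OF x, of c] by simp
qed

lemma layer_arcs_crossing: "crossing x \<Longrightarrow> layer_arcs (x, i, c) M = cross_arcs x i c M"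
  by (cases x) (auto simp: crossing_def)

lemma layer_arcs_not_crossing: "\<not> crossing x \<Longrightarrow> x = Cup \<or> x = Cap"
  by (cases x) (auto simp: crossing_def)

text \<open>Equality of the passages is tied to \<open>loops A M = 0\<close>, because the letters of
  a closed component vanish together with it.\<close>

lemma act_arc_system:
  assumes "arc_system n M" "tangle m (erase A) n" "distinct (ids A)" "set (ids A) \<inter> fst ` passes M = {}"
  shows "arc_system m (act A M) \<and> passes (act A M) \<subseteq> passes M \<union> set (ids A) \<times> UNIV \<and>
    (loops A M = 0 \<longrightarrow> passes (act A M) = passes M \<union> set (ids A) \<times> UNIV)"
  using assms(2-4)
proof (induction A arbitrary: m)
  case Nil
  then show ?case using assms(1) by simp
next
  case (Cons y A)
  obtain x i c where y: "y = (x, i, c)" by (cases y) auto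
  have t: "i + ins x \<le> m" "tangle (m - ins x + outs x) (erase A) n" using Cons.prems(1) by (auto simp: y)
  have d: "distinct (ids A)" "set (ids A) \<inter> fst ` passes M = {}" using Cons.prems(2,3) by (auto simp: y split: if_splits)
  note IH = Cons.IH[OF t(2) d]
  show ?case
  proof (cases "crossing x")
    case True
    then have [simp]: "ins x = 2" "outs x = 2" by (auto simp: crossing_def)
    have m: "m - ins x + outs x = m" and i: "i + 2 \<le> m" using t by simp_all
    have c: "c \<notin> set (ids A)" "c \<notin> fst ` passes M" using Cons.prems(2,3) True by (auto simp: y)
    then have c': "c \<notin> fst ` passes (act A M)" using IH by auto
    have "loops (y # A) M = loops A M" using True by (auto simp: y crossing_def)
    moreover have "act (y # A) M = cross_arcs x i c (act A M)" using True by (simp add: y layer_arcs_crossing)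
    moreover have "set (ids (y # A)) = insert c (set (ids A))" using True by (simp add: y)
    ultimately show ?thesis
      using arc_system_cross[OF IH[unfolded m, THEN conjunct1] i c' True] IH by auto
  next
    case False
    then consider "x = Cup" | "x = Cap" using layer_arcs_not_crossing by blast
    then show ?thesis
    proof cases
      case 1
      have "arc_system m (act (y # A) M)" using IH t 1 arc_system_cup[of m "act A M" i] by (simp add: y)
      then show ?thesis
        using IH t 1 passes_cup[of m "act A M" i] passes_cup_subset[of i "act A M"]
        by (auto simp: y crossing_def split: if_splits)
    next
      case 2
      have "arc_system (m - 2) (act A M)" using IH 2 by simp
      have m: "m - 2 + 2 = m" "i \<le> m - 2" using t 2 by simp_all
      have "arc_system m (act (y # A) M)" using arc_system_cap[OF \<open>arc_system (m - 2) (act A M)\<close> m(2), unfolded m(1)] 2 y by simp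
      then show ?thesis
        using IH t 2 by (auto simp: y crossing_def passes_cap)
    qed
  qed
qed

section \<open>Substitution of words for letters\<close>

definition subst :: "('c letter \<Rightarrow> 'c word) \<Rightarrow> 'c arcs \<Rightarrow> 'c arcs" where
  "subst h M = {(a, concat (map h w), b) | a w b. (a, w, b) \<in> M}"

lemma in_subst: "(a, u, b) \<in> subst h M \<longleftrightarrow> (\<exists>w. u = concat (map h w) \<and> (a, w, b) \<in> M)"
  unfolding subst_def by auto

lemma subst_cup: "subst h (cup_arcs i M) = cup_arcs i (subst h M)"
proof (rule set_eqI, clarify)
  fix a u b
  show "(a, u, b) \<in> subst h (cup_arcs i M) \<longleftrightarrow> (a, u, b) \<in> cup_arcs i (subst h M)"
    unfolding in_subst in_cup_arcs
    apply (rule iffI)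
    subgoal by (elim exE conjE disjE) (simp, blast, metis concat_append map_append, metis concat_append map_append)
    subgoal by (elim exE conjE disjE) (blast, metis concat_append map_append, metis concat_append map_append)
    done
qed

lemma subst_permute: "subst h (permute f M) = permute f (subst h M)"
  by (rule set_eqI, clarify, unfold in_subst in_permute) blast

lemma subst_cap: "subst h (cap_arcs i M) = cap_arcs i (subst h M)"
proof -
  have u: "subst h (A \<union> B) = subst h A \<union> subst h B" for A B by (auto simp: subst_def)
  have s: "subst h {(i, [], Suc i), (Suc i, [], i)} = {(i, [], Suc i), (Suc i, [], i)}" by (auto simp: subst_def)
  show ?thesis unfolding cap_arcs_def u s subst_permute ..
qed

lemma subst_decorate:
  assumes "\<And>a. concat (map h (d a)) = e a" "\<And>a. concat (map h (rev_word (d a))) = rev_word (e a)"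
  shows "subst h (decorate d M) = decorate e (subst h M)"
proof (rule set_eqI, clarify)
  fix a u b
  have "concat (map h (d a @ w @ rev_word (d b))) = e a @ concat (map h w) @ rev_word (e b)" for w
    using assms by simp
  then show "(a, u, b) \<in> subst h (decorate d M) \<longleftrightarrow> (a, u, b) \<in> decorate e (subst h M)"
    unfolding in_subst in_decorate by metis
qed

lemma subst_cross:
  assumes "\<And>v e. h (c, v, e) = [(c, v, e)]"
  shows "subst h (cross_arcs x i c M) = cross_arcs x i c (subst h M)"
  unfolding cross_arcs_def subst_permute[symmetric]
  by (rule subst_decorate) (auto simp: at2_def left_letter_def right_letter_def assms)

text \<open>This makes moves local: a change of letters above passes unchanged through all lower
  layers as long as \<open>h\<close> fixes their own crossings.\<close>

lemma act_subst:
  assumes "\<And>c v e. c \<in> set (ids A) \<Longrightarrow> h (c, v, e) = [(c, v, e)]"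
  shows "act A (subst h M) = subst h (act A M) \<and> loops A (subst h M) = loops A M"
  using assms
proof (induction A)
  case (Cons y A)
  obtain x i c where y: "y = (x, i, c)" by (cases y) auto
  have IH: "act A (subst h M) = subst h (act A M) \<and> loops A (subst h M) = loops A M"
    using Cons by (auto simp: y)
  have "act (y # A) (subst h M) = subst h (act (y # A) M)"
    using IH Cons.prems by (cases x) (auto simp: y subst_cup subst_cap subst_cross crossing_def)
  then show ?case using IH by (auto simp: y in_subst)
qed simp

definition ends :: "'c arcs \<Rightarrow> (nat \<times> nat) set" where
  "ends M = {(a, b). \<exists>w. (a, w, b) \<in> M}"

text \<open>Letters never influence which ends get joined, so connectivity and loops do not depend
  on the labels of the crossings.\<close>

lemma act_ends:
  assumes "erase A = erase B" "ends M = ends N"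
  shows "ends (act A M) = ends (act B N) \<and> loops A M = loops B N"
  using assms(1)
proof (induction A arbitrary: B)
  case Nil
  then show ?case using assms(2) by (auto simp: erase_def)
next
  case (Cons y A)
  obtain x i c where y: "y = (x, i, c)" by (cases y) auto
  then obtain d B' where B: "B = (x, i, d) # B'" "erase A = erase B'" using Cons.prems
    by (cases B) (auto simp: erase_def)
  have IH: "ends (act A M) = ends (act B' N)" "loops A M = loops B' N" using Cons.IH[OF B(2)] by auto
  have e: "(\<exists>w. (a, w, b) \<in> act A M) \<longleftrightarrow> (\<exists>w. (a, w, b) \<in> act B' N)" for a b
    using IH(1) unfolding ends_def set_eq_iff by auto
  have cup: "(\<exists>w. (a, w, b) \<in> cup_arcs i K) \<longleftrightarrow> (\<exists>w. (gap i a, w, gap i b) \<in> K) \<or>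
     ((\<exists>w. (gap i a, w, i) \<in> K) \<and> (\<exists>w. (Suc i, w, gap i b) \<in> K)) \<or>
     ((\<exists>w. (gap i a, w, Suc i) \<in> K) \<and> (\<exists>w. (i, w, gap i b) \<in> K))" for a b i and K :: "'x arcs"
    unfolding in_cup_arcs by blast
  have cross: "(\<exists>w. (a, w, b) \<in> cross_arcs x i c K) \<longleftrightarrow> (\<exists>w. (swap i a, w, swap i b) \<in> K)" for a b i x c and K :: "'x arcs"
    unfolding cross_arcs_def in_decorate in_permute_swap by blast
  have cap: "(\<exists>w. (a, w, b) \<in> cap_arcs i K) \<longleftrightarrow> (\<exists>a' b'. a = gap i a' \<and> b = gap i b' \<and> (\<exists>w. (a', w, b') \<in> K)) \<or>
     (a = i \<and> b = Suc i \<or> a = Suc i \<and> b = i)" for a b i and K :: "'x arcs"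
    unfolding in_cap_arcs by blast
  have "(\<exists>w. (a, w, b) \<in> layer_arcs (x, i, c) (act A M)) \<longleftrightarrow> (\<exists>w. (a, w, b) \<in> layer_arcs (x, i, d) (act B' N))" for a b
    by (cases x) (simp_all only: layer_arcs.simps cup cross cap e)
  then show ?case using IH(2) e by (simp add: y B ends_def)
qed

lemma tangle_append: "tangle m (D @ E) n \<longleftrightarrow> (\<exists>k. tangle m D k \<and> tangle k E n)"
proof (induction D arbitrary: m)
  case (Cons y D)
  obtain x i where y: "y = (x, i)" by (cases y)
  show ?case unfolding y append_Cons tangle.simps Cons.IH by blast
qed simp

lemma tangle_unique: "tangle m D n \<Longrightarrow> tangle m D n' \<Longrightarrow> n = n'"
  by (induction D arbitrary: m) auto

definition letters :: "'c arcs \<Rightarrow> 'c letter set" where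
  "letters M = {l. \<exists>a w b. (a, w, b) \<in> M \<and> l \<in> set w}"

lemma act_letters:
  assumes "letters M \<subseteq> P" "\<And>c v e. c \<in> set (ids A) \<Longrightarrow> (c, v, e) \<in> P"
  shows "letters (act A M) \<subseteq> P"
  using assms
proof (induction A)
  case (Cons y A)
  obtain x i c where y: "y = (x, i, c)" by (cases y) auto
  have IH: "letters (act A M) \<subseteq> P" using Cons by (auto simp: y)
  have cup: "letters (cup_arcs i K) \<subseteq> letters K" for i and K :: "'a arcs"
    unfolding letters_def in_cup_arcs by fastforce
  have cap: "letters (cap_arcs i K) \<subseteq> letters K" for i and K :: "'a arcs"
    unfolding letters_def in_cap_arcs by fastforce
  have at2: "l \<in> set (at2 i [left_letter x c] [right_letter x c] a) \<or>
      l \<in> set (rev_word (at2 i [left_letter x c] [right_letter x c] a)) \<Longrightarrow> fst l = c" for l i x a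
    by (auto simp: at2_def left_letter_def right_letter_def split: if_splits)
  have cross: "l \<in> letters K \<or> fst l = c" if "l \<in> letters (cross_arcs x i c K)" for l i x and K :: "'a arcs"
    using that at2 unfolding letters_def cross_arcs_def in_decorate in_permute mem_Collect_eq
    by (elim exE conjE) (metis (no_types, lifting) Un_iff set_append)
  show ?case
  proof (cases "crossing x")
    case True
    then have "c \<in> set (ids (y # A))" by (simp add: y)
    then have "fst l = c \<Longrightarrow> l \<in> P" for l using Cons.prems(2)[of c "fst (snd l)" "snd (snd l)"] by (cases l) simp
    then show ?thesis using IH cross[of _ x i "act A M"] True by (simp add: y layer_arcs_crossing) blast
  next
    case False
    then show ?thesis using IH cup[of i "act A M"] cap[of i "act A M"] layer_arcs_not_crossing[OF False] by (auto simp: y)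
  qed
qed simp

section \<open>Planar isotopy at the level of arcs\<close>

lemma gap_gap: "i \<le> k \<Longrightarrow> gap i (gap k a) = gap (k + 2) (gap i a)"
  by (auto simp: gap_def)

lemma permute_image: "permute f M = (\<lambda>(a, w, b). (f a, w, f b)) ` M"
  unfolding permute_def by force

lemma decorate_image: "decorate d M = (\<lambda>(a, w, b). (a, d a @ w @ rev_word (d b), b)) ` M"
  unfolding decorate_def by force

lemma permute_union: "permute f (M \<union> N) = permute f M \<union> permute f N"
  unfolding permute_def by blast

lemma permute_permute: "permute f (permute g M) = permute (f \<circ> g) M"
  unfolding permute_image image_image by (rule image_cong) auto

lemma decorate_union: "decorate d (M \<union> N) = decorate d M \<union> decorate d N"
  unfolding decorate_def by blast

lemma decorate_decorate: "decorate d (decorate e M) = decorate (\<lambda>a. d a @ e a) M"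
  unfolding decorate_image image_image by (rule image_cong) auto

lemma permute_decorate: "(\<And>a. d (f a) = e a) \<Longrightarrow> permute f (decorate e M) = decorate d (permute f M)"
  unfolding decorate_image permute_image image_image by (rule image_cong) auto

lemma permute_swap_decorate: "permute (swap i) (decorate e M) = decorate (\<lambda>a. e (swap i a)) (permute (swap i) M)"
  by (rule permute_decorate) simp

text \<open>A normal form for successive crossings: all letters in one decoration, all renumbering
  in one permutation. Identities between crossing layers then reduce to pointwise ones.\<close>

lemma cross_cross:
  "decorate d (permute (swap i) (decorate e (permute f M))) = decorate (\<lambda>a. d a @ e (swap i a)) (permute (swap i \<circ> f) M)"
  by (simp add: permute_swap_decorate decorate_decorate permute_permute)

lemma permute_insert [simp]: "permute f (insert (a, w, b) M) = insert (f a, w, f b) (permute f M)" "permute f {} = {}"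
  unfolding permute_def by auto

lemma decorate_insert [simp]: "decorate d (insert (a, w, b) M) = insert (a, d a @ w @ rev_word (d b), b) (decorate d M)"
  "decorate d {} = {}"
  unfolding decorate_def by auto

lemma cap_cap_exchange:
  assumes "i \<le> k"
  shows "cap_arcs i (cap_arcs k M) = cap_arcs (k + 2) (cap_arcs i M)"
proof -
  have 1: "gap i \<circ> gap k = gap (k + 2) \<circ> gap i" using gap_gap[OF assms] by auto
  have 2: "permute (gap i) {(k, [], Suc k), (Suc k, [], k)} = {(k + 2, [], Suc (k + 2)), (Suc (k + 2), [], k + 2)}"
    "permute (gap (k + 2)) {(i, [], Suc i), (Suc i, [], i)} = {(i, [], Suc i), (Suc i, [], i)}"
    using assms by (simp_all add: gap_def)
  show ?thesis unfolding cap_arcs_def permute_union permute_permute 1 2 by blast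
qed

lemma at2_gap_gap: "j \<noteq> Suc l \<Longrightarrow> at2 (gap j l) u v (gap j a) = at2 l u v a"
  by (auto simp: at2_def gap_def)

lemma at2_gap_fixed: "j \<noteq> Suc l \<Longrightarrow> at2 (gap j l) u v j = []" "j \<noteq> Suc l \<Longrightarrow> at2 (gap j l) u v (Suc j) = []"
  by (auto simp: at2_def gap_def)

lemma swap_gap_fixed: "j \<noteq> Suc l \<Longrightarrow> swap (gap j l) j = j" "j \<noteq> Suc l \<Longrightarrow> swap (gap j l) (Suc j) = Suc j"
  by (auto simp: swap_def gap_def)

lemma gap_swap: "j \<noteq> Suc l \<Longrightarrow> gap j (swap l a) = swap (gap j l) (gap j a)"
  by (auto simp: swap_def gap_def)

text \<open>The condition says that the new pair is not inserted between the two crossing strands.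
  With \<open>gap j l\<close> a crossing on either side of the cap is treated at once.\<close>

lemma cap_cross_exchange:
  assumes j: "j \<noteq> Suc l"
  shows "cap_arcs j (cross_arcs x l c M) = cross_arcs x (gap j l) c (cap_arcs j M)"
proof -
  have 1: "gap j \<circ> swap l = swap (gap j l) \<circ> gap j" using gap_swap[OF j] by auto
  have 2: "decorate (at2 (gap j l) u v) (permute (swap (gap j l)) {(j, [], Suc j), (Suc j, [], j)}) = {(j, [], Suc j), (Suc j, [], j)}" for u v
    by (simp add: at2_gap_fixed[OF j] swap_gap_fixed[OF j])
  have 3: "permute (gap j) (decorate (at2 l u v) M) = decorate (at2 (gap j l) u v) (permute (gap j) M)" for u v M
    by (rule permute_decorate) (simp add: at2_gap_gap[OF j])
  show ?thesis unfolding cap_arcs_def cross_arcs_def permute_union decorate_union 2 3 permute_permute 1 ..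
qed

lemma cross_cross_exchange:
  assumes "i + 2 \<le> k"
  shows "cross_arcs x i c (cross_arcs y k d M) = cross_arcs y k d (cross_arcs x i c M)"
proof -
  have 1: "swap i \<circ> swap k = swap k \<circ> swap i" using assms by (auto simp: swap_def)
  have 2: "at2 i u v a @ at2 k u' v' (swap i a) = at2 k u' v' a @ at2 i u v (swap k a)" for u v u' v' a
    using assms by (auto simp: swap_def at2_def)
  show ?thesis unfolding cross_arcs_def cross_cross 1 2 ..
qed

lemma cup_permute:
  assumes "\<And>a. f' (gap i a) = gap i (f a)" "f' i = i" "f' (Suc i) = Suc i" "\<And>a. f' (f' a) = a" "\<And>a. f (f a) = a"
  shows "cup_arcs i (permute f' M) = permute f (cup_arcs i M)"
proof -
  have p: "(a, w, b) \<in> permute f' K \<longleftrightarrow> (f' a, w, f' b) \<in> K" for a w b and K :: "'a arcs"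
    unfolding in_permute by (metis assms(4))
  have q: "(a, w, b) \<in> permute f K \<longleftrightarrow> (f a, w, f b) \<in> K" for a w b and K :: "'a arcs"
    unfolding in_permute by (metis assms(5))
  show ?thesis by (rule set_eqI, clarify, unfold q in_cup_arcs p assms(1-3), rule refl)
qed

lemma cup_decorate:
  assumes "\<And>a. d' (gap i a) = d a" "d' i = []" "d' (Suc i) = []"
  shows "cup_arcs i (decorate d' M) = decorate d (cup_arcs i M)"
proof (rule set_eqI, clarify)
  fix a u b
  show "(a, u, b) \<in> cup_arcs i (decorate d' M) \<longleftrightarrow> (a, u, b) \<in> decorate d (cup_arcs i M)"
    unfolding in_cup_arcs in_decorate assms rev_word_simps append_Nil append_Nil2
  proof ((rule iffI; elim exE conjE disjE), goal_cases)
    case (1 w) then show ?case by blast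
  next
    case (2 w1 w2 v1 v2)
    then have "u = d a @ (v1 @ v2) @ rev_word (d b)" by simp
    then show ?case using 2 by blast
  next
    case (3 w1 w2 v1 v2)
    then have "u = d a @ (v1 @ v2) @ rev_word (d b)" by simp
    then show ?case using 3 by blast
  next
    case (4 w) then show ?case by blast
  next
    case (5 w w1 w2)
    then have "u = (d a @ w1) @ (w2 @ rev_word (d b))" by simp
    then show ?case using 5 by blast
  next
    case (6 w w1 w2)
    then have "u = (d a @ w1) @ (w2 @ rev_word (d b))" by simp
    then show ?case using 6 by blast
  qed
qed

lemma cup_cross_exchange:
  assumes j: "j \<noteq> Suc l"
  shows "cup_arcs j (cross_arcs x (gap j l) c M) = cross_arcs x l c (cup_arcs j M)"
proof -
  have 1: "cup_arcs j (permute (swap (gap j l)) M) = permute (swap l) (cup_arcs j M)"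
    by (rule cup_permute) (use gap_swap[OF j] swap_gap_fixed[OF j] in auto)
  have 2: "cup_arcs j (decorate (at2 (gap j l) u v) M) = decorate (at2 l u v) (cup_arcs j M)" for u v M
    by (rule cup_decorate) (use at2_gap_gap[OF j] at2_gap_fixed[OF j] in auto)
  show ?thesis unfolding cross_arcs_def 2 1 ..
qed

lemma cup_cap_exchange:
  assumes "i \<le> k"
  shows "cup_arcs i (cap_arcs (k + 2) M) = cap_arcs k (cup_arcs i M)"
proof (rule set_eqI, clarify)
  fix a w b
  have i: "i = gap (k + 2) i" "Suc i = gap (k + 2) (Suc i)" "gap i k = k + 2" "gap i (Suc k) = Suc (k + 2)"
    using assms by (auto simp: gap_def)
  have gg: "gap i (gap k x) = gap (k + 2) (gap i x)" for x using gap_gap[OF assms] .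
  have A: "(gap i (gap k x), w, i) \<in> cap_arcs (k + 2) M \<longleftrightarrow> (gap i x, w, i) \<in> M"
    "(gap i (gap k x), w, Suc i) \<in> cap_arcs (k + 2) M \<longleftrightarrow> (gap i x, w, Suc i) \<in> M"
    "(i, w, gap i (gap k x)) \<in> cap_arcs (k + 2) M \<longleftrightarrow> (i, w, gap i x) \<in> M"
    "(Suc i, w, gap i (gap k x)) \<in> cap_arcs (k + 2) M \<longleftrightarrow> (Suc i, w, gap i x) \<in> M"
    "(gap i (gap k x), w, gap i (gap k y)) \<in> cap_arcs (k + 2) M \<longleftrightarrow> (gap i x, w, gap i y) \<in> M" for x y w
    unfolding gg using in_cap_arcs_simps(1)[of "k + 2" _ _ _ M] i by metis+
  have B: "(k + 2, w, j) \<in> cap_arcs (k + 2) M \<longleftrightarrow> w = [] \<and> j = Suc (k + 2)"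
    "(Suc (k + 2), w, j) \<in> cap_arcs (k + 2) M \<longleftrightarrow> w = [] \<and> j = k + 2"
    "(j, w, k + 2) \<in> cap_arcs (k + 2) M \<longleftrightarrow> w = [] \<and> j = Suc (k + 2)"
    "(j, w, Suc (k + 2)) \<in> cap_arcs (k + 2) M \<longleftrightarrow> w = [] \<and> j = k + 2" for j w by auto
  have ne: "i \<noteq> k + 2" "i \<noteq> Suc (k + 2)" "Suc i \<noteq> k + 2" "Suc i \<noteq> Suc (k + 2)" using assms by auto
  have C: "Suc (k + 2) = gap i b' \<longleftrightarrow> b' = Suc k" "k + 2 = gap i b' \<longleftrightarrow> b' = k" "gap i b' = Suc (k + 2) \<longleftrightarrow> b' = Suc k" "gap i b' = k + 2 \<longleftrightarrow> b' = k" for b' using assms by (auto simp: gap_def)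
  show "(a, w, b) \<in> cup_arcs i (cap_arcs (k + 2) M) \<longleftrightarrow> (a, w, b) \<in> cap_arcs k (cup_arcs i M)"
    by (cases a rule: gap_cases[of _ k]; cases b rule: gap_cases[of _ k])
      (simp_all only: in_cup_arcs A B ne C i(3,4) in_cap_arcs_simps simp_thms, auto?)
qed

lemma cap_cup_exchange:
  assumes "i \<le> k"
  shows "cap_arcs i (cup_arcs k M) = cup_arcs (k + 2) (cap_arcs i M)"
proof -
  define K where "K = k + 2"
  have i: "gap i k = K" "gap i (Suc k) = Suc K" "gap K i = i" "gap K (Suc i) = Suc i"
    using assms by (auto simp: gap_def K_def)
  have gg: "gap K (gap i x) = gap i (gap k x)" for x using gap_gap[OF assms] by (simp add: K_def)
  have A: "(gap i x, w, K) \<in> cap_arcs i M \<longleftrightarrow> (x, w, k) \<in> M"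
    "(gap i x, w, Suc K) \<in> cap_arcs i M \<longleftrightarrow> (x, w, Suc k) \<in> M"
    "(K, w, gap i x) \<in> cap_arcs i M \<longleftrightarrow> (k, w, x) \<in> M"
    "(Suc K, w, gap i x) \<in> cap_arcs i M \<longleftrightarrow> (Suc k, w, x) \<in> M" for x w
    using in_cap_arcs_simps(1)[of i _ _ _ M] i by metis+
  have ne: "i \<noteq> K" "i \<noteq> Suc K" "Suc i \<noteq> K" "Suc i \<noteq> Suc K" "K \<noteq> i" "K \<noteq> Suc i" "Suc K \<noteq> Suc i" "Suc K \<noteq> i" using assms by (auto simp: K_def)
  have "(a, w, b) \<in> cap_arcs i (cup_arcs k M) \<longleftrightarrow> (a, w, b) \<in> cup_arcs K (cap_arcs i M)" for a w b
    by (cases a rule: gap_cases[of _ i]; cases b rule: gap_cases[of _ i])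
      (simp_all only: in_cup_arcs gg i A in_cap_arcs_simps simp_thms gap_neq ne, auto?)
  then show ?thesis unfolding K_def by auto
qed

text \<open>Below the cup, strand \<open>i\<close> is the one at position \<open>i + 2\<close> above
  it; the cap leads it to \<open>i + 1\<close> and the cup on to \<open>i\<close>, where the old
  strand begins.\<close>

lemma zigzag_left_arcs:
  assumes "arc_system n M"
  shows "cup_arcs i (cap_arcs (Suc i) M) = M"
proof (rule set_eqI, clarify)
  fix a w b
  have 1: "i = gap (Suc i) i" by (simp add: gap_def)
  have 2: "gap i x = (if x = i then Suc (Suc i) else gap (Suc i) x)" for x by (auto simp: gap_def)
  have 3: "(x, w, i) \<in> cap_arcs (Suc i) M \<longleftrightarrow> (x, w, gap (Suc i) i) \<in> cap_arcs (Suc i) M"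
    "(i, w, x) \<in> cap_arcs (Suc i) M \<longleftrightarrow> (gap (Suc i) i, w, x) \<in> cap_arcs (Suc i) M" for x w using 1 by metis+
  have 4: "Suc (Suc i) \<noteq> gap (Suc i) x" "gap (Suc i) x \<noteq> Suc (Suc i)" for x by auto
  show "(a, w, b) \<in> cup_arcs i (cap_arcs (Suc i) M) \<longleftrightarrow> (a, w, b) \<in> M"
    unfolding in_cup_arcs 3
    by (cases "a = i"; cases "b = i") (auto simp: 2 dest: arc_systemD(3)[OF assms])
qed

lemma zigzag_right_arcs:
  assumes "arc_system n M"
  shows "cup_arcs (Suc i) (cap_arcs i M) = M"
proof (rule set_eqI, clarify)
  fix a w b
  have 1: "Suc (Suc i) = gap i i" by (simp add: gap_def)
  have 2: "gap (Suc i) x = (if x = i then i else gap i x)" for x by (auto simp: gap_def)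
  have 3: "(x, w, Suc (Suc i)) \<in> cap_arcs i M \<longleftrightarrow> (x, w, gap i i) \<in> cap_arcs i M"
    "(Suc (Suc i), w, x) \<in> cap_arcs i M \<longleftrightarrow> (gap i i, w, x) \<in> cap_arcs i M" for x w using 1 by metis+
  show "(a, w, b) \<in> cup_arcs (Suc i) (cap_arcs i M) \<longleftrightarrow> (a, w, b) \<in> M"
    unfolding in_cup_arcs 3
    by (cases "a = i"; cases "b = i") (auto simp: 2 dest: arc_systemD(3)[OF assms])
qed

text \<open>Joining the ends p and q without removing them; unlike \<open>cup_arcs\<close> this needs no
  renumbering, so that two joins visibly commute.\<close>

definition via :: "nat \<Rightarrow> nat \<Rightarrow> 'c arcs \<Rightarrow> 'c arcs" where
  "via p q M = {(a, w, b). (a, w, b) \<in> M \<or>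
     (\<exists>w1 w2. w = w1 @ w2 \<and> (a, w1, p) \<in> M \<and> (q, w2, b) \<in> M) \<or>
     (\<exists>w1 w2. w = w1 @ w2 \<and> (a, w1, q) \<in> M \<and> (p, w2, b) \<in> M)}"

lemma in_via: "(a, w, b) \<in> via p q M \<longleftrightarrow> (a, w, b) \<in> M \<or>
     (\<exists>w1 w2. w = w1 @ w2 \<and> (a, w1, p) \<in> M \<and> (q, w2, b) \<in> M) \<or>
     (\<exists>w1 w2. w = w1 @ w2 \<and> (a, w1, q) \<in> M \<and> (p, w2, b) \<in> M)"
  unfolding via_def by simp

lemma viaI:
  "(a, w, b) \<in> M \<Longrightarrow> (a, w, b) \<in> via p q M"
  "(a, w1, p) \<in> M \<Longrightarrow> (q, w2, b) \<in> M \<Longrightarrow> (a, w1 @ w2, b) \<in> via p q M"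
  "(a, w1, q) \<in> M \<Longrightarrow> (p, w2, b) \<in> M \<Longrightarrow> (a, w1 @ w2, b) \<in> via p q M"
  unfolding in_via by blast+

lemma viaE:
  assumes "(a, w, b) \<in> via p q M"
  obtains "(a, w, b) \<in> M" | w1 w2 where "w = w1 @ w2" "(a, w1, p) \<in> M" "(q, w2, b) \<in> M"
  | w1 w2 where "w = w1 @ w2" "(a, w1, q) \<in> M" "(p, w2, b) \<in> M"
  using assms unfolding in_via by blast

text \<open>If the join of \<open>q\<close> and \<open>q'\<close> were used both before and after
  the join of \<open>p\<close> and \<open>p'\<close>, two arcs of \<open>M\<close> would share an
  end. So each join is used at most once and the path can be cut up in the other order.\<close>

lemma via_via_aux:
  assumes M: "arc_system n M" and ne: "a \<notin> {p, p', q, q'}" "b \<notin> {p, p', q, q'}" "distinct [p, p', q, q']"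
    and 1: "(a, u, p) \<in> via q q' M" and 2: "(p', v, b) \<in> via q q' M"
  shows "(a, u @ v, b) \<in> via q q' (via p p' M)"
  using 1
proof (cases rule: viaE)
  case a: 1
  from 2 show ?thesis
  proof (cases rule: viaE)
    case 1
    then show ?thesis using a by (intro viaI(1) viaI(2))
  next
    case (2 w1 w2)
    have "(a, (u @ w1) @ w2, b) \<in> via q q' (via p p' M)"
      by (rule viaI(2), rule viaI(2)[OF a 2(2)], rule viaI(1)[OF 2(3)])
    then show ?thesis by (simp add: 2)
  next
    case (3 w1 w2)
    have "(a, (u @ w1) @ w2, b) \<in> via q q' (via p p' M)"
      by (rule viaI(3), rule viaI(2)[OF a 3(2)], rule viaI(1)[OF 3(3)])
    then show ?thesis by (simp add: 3)
  qed
next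
  case a: (2 u1 u2)
  from 2 show ?thesis
  proof (cases rule: viaE)
    case 1
    have "(a, u1 @ (u2 @ v), b) \<in> via q q' (via p p' M)"
      by (rule viaI(2), rule viaI(1)[OF a(2)], rule viaI(2)[OF a(3) 1])
    then show ?thesis by (simp add: a)
  next
    case (2 w1 w2)
    then show ?thesis using arc_system_unique_end[OF M a(2) 2(2)] ne by auto
  next
    case (3 w1 w2)
    then show ?thesis using arc_system_unique_end[OF M arc_systemD(4)[OF M a(3)] 3(2)] ne by auto
  qed
next
  case a: (3 u1 u2)
  from 2 show ?thesis
  proof (cases rule: viaE)
    case 1
    have "(a, u1 @ (u2 @ v), b) \<in> via q q' (via p p' M)"
      by (rule viaI(3), rule viaI(1)[OF a(2)], rule viaI(2)[OF a(3) 1])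
    then show ?thesis by (simp add: a)
  next
    case (2 w1 w2)
    then show ?thesis using arc_system_unique_end[OF M arc_systemD(4)[OF M a(3)] 2(2)] ne by auto
  next
    case (3 w1 w2)
    then show ?thesis using arc_system_unique_end[OF M a(2) 3(2)] ne by auto
  qed
qed

lemma via_commute: "via p q M = via q p M"
  unfolding via_def by blast

lemma via_via:
  assumes M: "arc_system n M" and ne: "a \<notin> {p, p', q, q'}" "b \<notin> {p, p', q, q'}" "distinct [p, p', q, q']"
    and *: "(a, w, b) \<in> via p p' (via q q' M)"
  shows "(a, w, b) \<in> via q q' (via p p' M)"
  using *
proof (cases rule: viaE)
  case 1
  then show ?thesis by (cases rule: viaE) (auto intro: viaI)
next
  case (2 w1 w2)
  show ?thesis unfolding 2(1) by (rule via_via_aux[OF M ne 2(2,3)])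
next
  case (3 w1 w2)
  have "(a, w1 @ w2, b) \<in> via q q' (via p' p M)"
    by (rule via_via_aux[OF M _ _ _ 3(2,3)]) (use ne in auto)
  then show ?thesis unfolding 3(1) via_commute[of p p'] .
qed

lemma in_cup_via: "(a, w, b) \<in> cup_arcs i M \<longleftrightarrow> (gap i a, w, gap i b) \<in> via i (Suc i) M"
  unfolding in_cup_arcs in_via ..

lemma cup_cup_exchange:
  assumes M: "arc_system n M" and i: "i \<le> k"
  shows "cup_arcs i (cup_arcs (k + 2) M) = cup_arcs k (cup_arcs i M)"
proof (rule set_eqI, clarify)
  fix a w b
  define K where "K = k + 2"
  have g: "gap K (gap i x) = gap i (gap k x)" for x using gap_gap[OF i] by (simp add: K_def)
  have g': "gap K i = i" "gap K (Suc i) = Suc i" "gap i k = K" "gap i (Suc k) = Suc K"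
    using i by (auto simp: gap_def K_def)
  have 1: "(a, w, b) \<in> cup_arcs i (cup_arcs K M) \<longleftrightarrow> (gap i (gap k a), w, gap i (gap k b)) \<in> via i (Suc i) (via K (Suc K) M)"
    by (simp only: in_cup_via in_via[of _ _ _ i] g g')
  have 2: "(a, w, b) \<in> cup_arcs k (cup_arcs i M) \<longleftrightarrow> (gap i (gap k a), w, gap i (gap k b)) \<in> via K (Suc K) (via i (Suc i) M)"
    by (simp only: in_cup_via in_via[of _ _ _ K] in_via[of _ _ _ k] g g')
  have ne: "gap i (gap k x) \<notin> {i, Suc i, K, Suc K}" for x by (metis g g' gap_neq insert_iff singletonD)
  have ne': "gap i (gap k x) \<notin> {K, Suc K, i, Suc i}" for x using ne by auto
  have d: "distinct [i, Suc i, K, Suc K]" "distinct [K, Suc K, i, Suc i]" using i by (auto simp: K_def)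
  show "(a, w, b) \<in> cup_arcs i (cup_arcs (k + 2) M) \<longleftrightarrow> (a, w, b) \<in> cup_arcs k (cup_arcs i M)"
    unfolding K_def[symmetric] 1 2
    using via_via[OF M ne ne d(1)] via_via[OF M ne' ne' d(2)] by blast
qed

section \<open>Moves with crossings at the level of arcs\<close>

lemma ex_append_conv:
  "(\<exists>w1 w2. u = w1 @ w2 \<and> (\<exists>w. w1 = f w \<and> P w) \<and> (\<exists>w. w2 = g w \<and> Q w)) \<longleftrightarrow> (\<exists>w w'. u = f w @ g w' \<and> P w \<and> Q w')"
  by blast

text \<open>The letter \<open>l\<close> lies on the cup. After the slide the other leg of the cup is
  crossed, where upward travel has the opposite direction along the arc; hence
  \<open>rev_letter l\<close>.\<close>

lemma slide_cup_arcs: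
  "cup_arcs i (decorate (at2 (Suc i) [l] [r]) (permute (swap (Suc i)) M)) =
   cup_arcs (Suc i) (decorate (at2 i [r] [rev_letter l]) (permute (swap i) M))"
proof (rule set_eqI, clarify)
  fix a u b
  define s where "s x = (if x = i then Suc i else gap i x)" for x
  define d where "d x = (if x = i then [r] else [])" for x
  have s: "swap (Suc i) (gap i x) = s x" "swap i (gap (Suc i) x) = s x" for x
    by (auto simp: s_def swap_def gap_def)
  have d: "at2 (Suc i) [l] [r] (gap i x) = d x" "at2 i [r] [rev_letter l] (gap (Suc i) x) = d x" for x
    by (auto simp: d_def at2_def gap_def)
  have e: "at2 (Suc i) [l] [r] i = []" "swap (Suc i) i = i" "at2 i [r] [rev_letter l] (Suc (Suc i)) = []" "swap i (Suc (Suc i)) = Suc (Suc i)"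
    by (auto simp: at2_def swap_def)
  have dp: "(x, y, z) \<in> decorate f (permute (swap j) M) \<longleftrightarrow> (\<exists>w. y = f x @ w @ rev_word (f z) \<and> (swap j x, w, swap j z) \<in> M)" for x y z j f
    unfolding in_decorate in_permute_swap ..
  show "(a, u, b) \<in> cup_arcs i (decorate (at2 (Suc i) [l] [r]) (permute (swap (Suc i)) M)) \<longleftrightarrow>
    (a, u, b) \<in> cup_arcs (Suc i) (decorate (at2 i [r] [rev_letter l]) (permute (swap i) M))"
    unfolding in_cup_arcs dp s d e at2_simps swap_simps ex_append_conv by simp
qed

lemma slide_cap_arcs:
  "decorate (at2 (Suc i) [l] [r]) (permute (swap (Suc i)) (cap_arcs i M)) =
   decorate (at2 i [rev_letter r] [l]) (permute (swap i) (cap_arcs (Suc i) M))"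
proof -
  have 1: "swap (Suc i) \<circ> gap i = swap i \<circ> gap (Suc i)" by (auto simp: swap_def gap_def)
  have 2: "decorate (at2 (Suc i) [l] [r]) (permute (swap i \<circ> gap (Suc i)) M) =
    decorate (at2 i [rev_letter r] [l]) (permute (swap i \<circ> gap (Suc i)) M)"
    unfolding permute_image decorate_image image_image
    by (rule image_cong) (auto simp: at2_def swap_def gap_def)
  show ?thesis unfolding cap_arcs_def permute_union permute_permute decorate_union 1 2
    by (auto simp: at2_def swap_def)
qed

text \<open>A kink amounts to the two letters of its crossing standing next to each other on one leg
  of the cup.\<close>

lemma R1_cup_arcs:
  "cup_arcs i (decorate (at2 i [l] [r]) (permute (swap i) M)) = cup_arcs i (decorate (at2 i [rev_letter l, r] []) M)"
  by (rule set_eqI, clarify,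
    unfold in_cup_arcs in_decorate in_permute_swap at2_simps at2_gap swap_simps swap_gap ex_append_conv) auto

lemma R1_cap_arcs:
  "decorate (at2 i [l] [r]) (permute (swap i) (cap_arcs i M)) = decorate (at2 i [l, rev_letter r] []) (cap_arcs i M)"
proof -
  have 1: "swap i \<circ> gap i = gap i" by auto
  have 2: "decorate (at2 i u v) (permute (gap i) M) = permute (gap i) M" for u v
    unfolding permute_image decorate_image image_image by (rule image_cong) auto
  show ?thesis unfolding cap_arcs_def permute_union permute_permute decorate_union 1 2 by auto
qed

lemma R2_arcs:
  "decorate (at2 i [l] [r]) (permute (swap i) (decorate (at2 i [l'] [r']) (permute (swap i) M))) =
   decorate (at2 i [l, r'] [r, l']) M"
proof -
  have 1: "permute (swap i \<circ> swap i) M = M" unfolding permute_image by (auto simp: image_iff)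
  have 2: "at2 i [l] [r] a @ at2 i [l'] [r'] (swap i a) = at2 i [l, r'] [r, l'] a" for a
    by (auto simp: at2_def swap_def)
  show ?thesis unfolding cross_cross 1 2 ..
qed

definition at3 :: "nat \<Rightarrow> 'c word \<Rightarrow> 'c word \<Rightarrow> 'c word \<Rightarrow> nat \<Rightarrow> 'c word" where
  "at3 i u v w a = (if a = i then u else if a = Suc i then v else if a = Suc (Suc i) then w else [])"

text \<open>The half turn of three strands: it exchanges \<open>i\<close> and \<open>i + 2\<close>
  and fixes \<open>i + 1\<close>.\<close>

definition turn3 :: "nat \<Rightarrow> nat \<Rightarrow> nat" where
  "turn3 i = swap i \<circ> swap (Suc i) \<circ> swap i"

text \<open>Both sides of a triangle induce the same permutation, and each strand meets the same two
  crossings in opposite orders.\<close>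

lemma R3_arcs:
  "decorate (at2 i [la] [ra]) (permute (swap i) (decorate (at2 (Suc i) [lb] [rb]) (permute (swap (Suc i))
     (decorate (at2 i [lc] [rc]) (permute (swap i) M))))) =
   decorate (at3 i [la, lb] [ra, lc] [rb, rc]) (permute (turn3 i) M)"
  "decorate (at2 (Suc i) [lc] [rc]) (permute (swap (Suc i)) (decorate (at2 i [lb] [rb]) (permute (swap i)
     (decorate (at2 (Suc i) [la] [ra]) (permute (swap (Suc i)) M))))) =
   decorate (at3 i [lb, la] [lc, ra] [rc, rb]) (permute (turn3 i) M)"
proof -
  have 1: "swap (Suc i) \<circ> (swap i \<circ> swap (Suc i)) = turn3 i" "swap i \<circ> (swap (Suc i) \<circ> swap i) = turn3 i"
    unfolding turn3_def by (auto simp: swap_def)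
  have 2: "at2 i [la] [ra] a @ at2 (Suc i) [lb] [rb] (swap i a) @ at2 i [lc] [rc] (swap (Suc i) (swap i a)) =
      at3 i [la, lb] [ra, lc] [rb, rc] a"
    "at2 (Suc i) [lc] [rc] a @ at2 i [lb] [rb] (swap (Suc i) a) @ at2 (Suc i) [la] [ra] (swap i (swap (Suc i) a)) =
      at3 i [lb, la] [lc, ra] [rc, rb] a" for a
    by (auto simp: at2_def at3_def swap_def)
  show "decorate (at2 i [la] [ra]) (permute (swap i) (decorate (at2 (Suc i) [lb] [rb]) (permute (swap (Suc i))
     (decorate (at2 i [lc] [rc]) (permute (swap i) M))))) =
   decorate (at3 i [la, lb] [ra, lc] [rb, rc]) (permute (turn3 i) M)"
   "decorate (at2 (Suc i) [lc] [rc]) (permute (swap (Suc i)) (decorate (at2 i [lb] [rb]) (permute (swap i)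
     (decorate (at2 (Suc i) [la] [ra]) (permute (swap (Suc i)) M))))) =
   decorate (at3 i [lb, la] [lc, ra] [rc, rb]) (permute (turn3 i) M)"
    unfolding cross_cross 1 2 by (simp_all add: cross_cross 1 2)
qed

text \<open>A marker with sign 1 is traversed in its own direction; the other sign means that the
  strand is traversed backwards, so its word is reversed.\<close>

definition expand :: "('c \<Rightarrow> 'c word option) \<Rightarrow> 'c letter \<Rightarrow> 'c word" where
  "expand W l = (case W (fst l) of None \<Rightarrow> [l] | Some w \<Rightarrow> if snd (snd l) = 1 then w else rev_word w)"

lemma in_letters: "l \<in> letters M \<Longrightarrow> fst l \<in> fst ` passes M"
  unfolding letters_def passes_def by (force simp: pass_def)

lemma subst_id: "(\<And>l. l \<in> letters M \<Longrightarrow> h l = [l]) \<Longrightarrow> subst h M = M"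
proof -
  assume *: "\<And>l. l \<in> letters M \<Longrightarrow> h l = [l]"
  have "concat (map h w) = w" if "(a, w, b) \<in> M" for a w b
  proof -
    have "h l = [l]" if "l \<in> set w" for l using * that \<open>(a, w, b) \<in> M\<close> unfolding letters_def by blast
    then have "map h w = map (\<lambda>l. [l]) w" by (simp only: map_eq_conv) simp
    then have "concat (map h w) = concat (map (\<lambda>l. [l]) w)" by (simp only:)
    then show ?thesis by simp
  qed
  then show ?thesis unfolding set_eq_iff in_subst split_paired_All by (metis in_subst)
qed

lemma expand_id: "W (fst l) = None \<Longrightarrow> expand W l = [l]"
  by (simp add: expand_def)

lemma subst_expand_id: "dom W \<inter> fst ` passes M = {} \<Longrightarrow> subst (expand W) M = M"
  by (rule subst_id, rule expand_id) (meson disjoint_iff domIff in_letters)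

text \<open>Writes decorated arcs as an expansion of single marker letters, so that both sides of a
  move become two expansions of the same marked arcs.\<close>

lemma subst_expand_decorate:
  assumes M: "dom W \<inter> fst ` passes M = {}"
    and d: "\<And>a. d a = [] \<and> e a = [] \<or> (\<exists>k v. d a = [(k, v, 1)] \<and> W k = Some (e a))"
  shows "subst (expand W) (decorate d M) = decorate e M"
proof -
  have "subst (expand W) (decorate d M) = decorate e (subst (expand W) M)"
  proof (rule subst_decorate)
    fix a
    show "concat (map (expand W) (d a)) = e a" using d[of a] by (auto simp: expand_def)
    show "concat (map (expand W) (rev_word (d a))) = rev_word (e a)" using d[of a] by (auto simp: expand_def)
  qed
  then show ?thesis using subst_expand_id[OF M] by simp
qed

lemma decorate_Nil: "(\<And>a. d a = []) \<Longrightarrow> decorate d M = M"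
  unfolding decorate_def by auto

lemma letters_decorate: "letters (decorate d M) \<subseteq> letters M \<union> (\<Union>a. set (d a) \<union> set (rev_word (d a)))"
  unfolding letters_def in_decorate by (auto; blast)

section \<open>The second Conway coefficient of a Gauss word\<close>

definition restrict :: "'c \<Rightarrow> 'c \<Rightarrow> 'c word \<Rightarrow> 'c word" where
  "restrict c d w = filter (\<lambda>l. fst l = c \<or> fst l = d) w"

text \<open>The one arrow diagram of the formula: two crossed chords, with the base point before the
  first letter. Each crossing contributes the product of its two letter signs, that is, its
  sign.\<close>

definition interleaving :: "'c \<Rightarrow> 'c \<Rightarrow> 'c word \<Rightarrow> int" where
  "interleaving c d v = (if map pass v = [(c, False), (d, True), (c, True), (d, False)]
     then prod_list (map (\<lambda>l. snd (snd l)) v) else 0)"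

text \<open>The Polyak-Viro formula for the second Conway coefficient (the Casson knot invariant), with the
  base point at the beginning of the word.\<close>

definition casson :: "'c word \<Rightarrow> int" where
  "casson w = (\<Sum>c \<in> fst ` set w. \<Sum>d \<in> fst ` set w. interleaving c d (restrict c d w))"

lemma restrict_append [simp]: "restrict c d (u @ w) = restrict c d u @ restrict c d w"
  by (simp add: restrict_def)

lemma restrict_concat: "restrict c d (concat (map h w)) = concat (map (\<lambda>l. restrict c d (h l)) w)"
  by (induction w) (auto simp: restrict_def)

lemma concat_map_id: "(\<And>l. l \<in> set w \<Longrightarrow> h l = [l]) \<Longrightarrow> concat (map h w) = w"
  by (induction w) auto

lemma interleaving_in:
  assumes "interleaving c d (restrict c d w) \<noteq> 0"
  shows "c \<in> fst ` set w" "d \<in> fst ` set w"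
proof -
  have m: "map pass (restrict c d w) = [(c, False), (d, True), (c, True), (d, False)]"
    using assms by (auto simp: interleaving_def split: if_splits)
  have "(c, False) \<in> set (map pass (restrict c d w))" "(d, True) \<in> set (map pass (restrict c d w))"
    unfolding m by auto
  then show "c \<in> fst ` set w" "d \<in> fst ` set w" by (force simp: restrict_def pass_def)+
qed

lemma restrict_commute: "restrict c d w = restrict d c w"
  by (simp add: restrict_def disj_commute)

lemma interleaving_notin:
  assumes "k \<notin> fst ` set w"
  shows "interleaving e k (restrict e k w) = 0" "interleaving k e (restrict e k w) = 0"
  using interleaving_in(2)[of e k w] interleaving_in(1)[of k e w] assms restrict_commute by metis+

lemma casson_superset:
  assumes "finite I" "fst ` set w \<subseteq> I"
  shows "casson w = (\<Sum>c \<in> I. \<Sum>d \<in> I. interleaving c d (restrict c d w))"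
proof -
  have "(\<Sum>c \<in> I. \<Sum>d \<in> I. interleaving c d (restrict c d w)) =
    (\<Sum>c \<in> fst ` set w. \<Sum>d \<in> I. interleaving c d (restrict c d w))"
    by (rule sum.mono_neutral_right[OF assms]) (auto intro!: sum.neutral dest: interleaving_in(1))
  also have "\<dots> = casson w"
    unfolding casson_def
    by (rule sum.cong[OF refl], rule sum.mono_neutral_right[OF assms]) (auto dest: interleaving_in(2))
  finally show ?thesis ..
qed

lemma interleaving_same:
  assumes "distinct (map pass w)"
  shows "interleaving c c (restrict c c w) = 0"
proof -
  have "distinct (map pass (restrict c c w))" unfolding restrict_def using assms by (rule distinct_map_filter)
  then show ?thesis by (auto simp: interleaving_def)
qed

lemma sum_sum_Un:
  fixes f :: "'a \<Rightarrow> 'a \<Rightarrow> int"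
  assumes "finite E" "finite J" "E \<inter> J = {}"
  shows "(\<Sum>c \<in> E \<union> J. \<Sum>d \<in> E \<union> J. f c d) =
    (\<Sum>c \<in> E. \<Sum>d \<in> E. f c d) + (\<Sum>c \<in> E. \<Sum>d \<in> J. f c d + f d c) + (\<Sum>c \<in> J. \<Sum>d \<in> J. f c d)"
  unfolding sum.union_disjoint[OF assms] sum.distrib sum.swap[of "\<lambda>c d. f d c" J E] by simp

text \<open>Pairs of crossings are sorted into those off \<open>J\<close>, mixed ones and those
  inside \<open>J\<close>. The first kind does not see the substitution, and the last kind sees
  nothing of the word but the letters with crossings in \<open>J\<close>.\<close>

lemma casson_split:
  assumes J: "finite J" and h: "\<And>l. fst l \<notin> J \<Longrightarrow> h l = [l]" "\<And>l. fst l \<in> J \<Longrightarrow> fst ` set (h l) \<subseteq> J"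
  shows "casson (concat (map h w)) =
    (\<Sum>c \<in> fst ` set w - J. \<Sum>d \<in> fst ` set w - J. interleaving c d (restrict c d w)) +
    (\<Sum>e \<in> fst ` set w - J. \<Sum>k \<in> J. interleaving e k (restrict e k (concat (map h w))) + interleaving k e (restrict e k (concat (map h w)))) +
    (\<Sum>x \<in> J. \<Sum>y \<in> J. interleaving x y (restrict x y (concat (map h (filter (\<lambda>l. fst l \<in> J) w)))))"
proof -
  define E where "E = fst ` set w - J"
  have E: "finite E" "E \<inter> J = {}" by (auto simp: E_def)
  have "fst ` set (concat (map h w)) \<subseteq> E \<union> J"
  proof
    fix c assume "c \<in> fst ` set (concat (map h w))"
    then obtain l k where l: "l \<in> set w" "k \<in> set (h l)" "c = fst k" by auto
    show "c \<in> E \<union> J"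
    proof (cases "fst l \<in> J")
      case True then show ?thesis using h(2)[OF True] l by auto
    next
      case False then show ?thesis using h(1)[OF False] l by (auto simp: E_def)
    qed
  qed
  note 1 = casson_superset[OF _ this, unfolded sum_sum_Un[OF E(1) J E(2)]]
  have 2: "restrict c d (concat (map h w)) = restrict c d w" if "c \<in> E" "d \<in> E" for c d
  proof -
    have cd: "c \<notin> J" "d \<notin> J" using that by (auto simp: E_def)
    have "restrict c d (h l) = restrict c d [l]" for l
    proof (cases "fst l \<in> J")
      case True
      then have "\<forall>k \<in> set (h l). fst k \<noteq> c \<and> fst k \<noteq> d" using h(2) cd by fastforce
      then have "restrict c d (h l) = []" unfolding restrict_def by (simp add: filter_empty_conv)
      then show ?thesis using True cd by (auto simp: restrict_def)
    next
      case False then show ?thesis using h(1) by simp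
    qed
    then have "restrict c d (concat (map h w)) = restrict c d (concat (map (\<lambda>l. [l]) w))"
      unfolding restrict_concat by simp
    then show ?thesis by simp
  qed
  have 3: "restrict x y (concat (map h w)) = restrict x y (concat (map h (filter (\<lambda>l. fst l \<in> J) w)))" if "x \<in> J" "y \<in> J" for x y
  proof (induction w)
    case (Cons l w)
    have "fst l \<notin> J \<Longrightarrow> restrict x y (h l) = []" using h(1) that by (auto simp: restrict_def)
    then show ?case using Cons by auto
  qed (simp add: restrict_def)
  note com = restrict_commute
  show ?thesis
    unfolding 1[OF finite_UnI[OF E(1) J]] E_def[symmetric]
    apply (intro arg_cong2[where f = "(+)"] sum.cong refl)
    subgoal by (simp only: 2)
    subgoal by (rule arg_cong[OF com])
    subgoal by (rule arg_cong[OF 3])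
    done
qed

text \<open>Once the mixed pairs balance for every outer crossing, the change of the coefficient is
  confined to pairs of crossings of the move, which leaves a finite computation.\<close>

lemma casson_replace:
  assumes J: "finite J" and h: "\<And>l. fst l \<notin> J \<Longrightarrow> h l = [l]" "\<And>l. fst l \<in> J \<Longrightarrow> fst ` set (h l) \<subseteq> J"
    and h': "\<And>l. fst l \<notin> J \<Longrightarrow> h' l = [l]" "\<And>l. fst l \<in> J \<Longrightarrow> fst ` set (h' l) \<subseteq> J"
    and eJ: "\<And>e. e \<in> fst ` set w - J \<Longrightarrow>
      (\<Sum>k \<in> J. interleaving e k (restrict e k (concat (map h w))) + interleaving k e (restrict e k (concat (map h w)))) =
      (\<Sum>k \<in> J. interleaving e k (restrict e k (concat (map h' w))) + interleaving k e (restrict e k (concat (map h' w))))"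
  shows "casson (concat (map h w)) - casson (concat (map h' w)) =
    (\<Sum>x \<in> J. \<Sum>y \<in> J. interleaving x y (restrict x y (concat (map h (filter (\<lambda>l. fst l \<in> J) w))))) -
    (\<Sum>x \<in> J. \<Sum>y \<in> J. interleaving x y (restrict x y (concat (map h' (filter (\<lambda>l. fst l \<in> J) w)))))"
proof -
  note 1 = casson_split[of J h w, OF J h] and 2 = casson_split[of J h' w, OF J h']
  have 3: "(\<Sum>e \<in> fst ` set w - J. \<Sum>k \<in> J. interleaving e k (restrict e k (concat (map h w))) + interleaving k e (restrict e k (concat (map h w)))) =
    (\<Sum>e \<in> fst ` set w - J. \<Sum>k \<in> J. interleaving e k (restrict e k (concat (map h' w))) + interleaving k e (restrict e k (concat (map h' w))))"
    by (rule sum.cong[OF refl], rule eJ)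
  show ?thesis using 1 2 3 by linarith
qed

section \<open>The effect of the local moves on the coefficient\<close>

text \<open>The crossings in K are mere markers for the strands that run through the place of a local move:
  each occurs in only one passage, and the move replaces it by the passages of that strand.\<close>

definition marked :: "'c set \<Rightarrow> 'c word \<Rightarrow> bool" where
  "marked K w \<longleftrightarrow> distinct (map pass w) \<and> (\<forall>l \<in> set w. fst l \<in> K \<longrightarrow> fst (snd l) \<and> snd (snd l) \<in> {1, - 1})"

lemma marked_filter: "marked K w \<Longrightarrow> marked K (filter P w)"
  unfolding marked_def by (auto simp: distinct_map_filter)

lemma marked_length:
  assumes "marked K w" "set (map fst w) \<subseteq> K" "finite K"
  shows "length w \<le> card K" "distinct (map fst w)"
proof -
  have "map pass w = map (\<lambda>l. (fst l, True)) w" using assms(1,2) unfolding marked_def pass_def by auto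
  then have "distinct (map (\<lambda>l. (fst l, True)) w)" using assms(1) unfolding marked_def by metis
  then show d: "distinct (map fst w)" unfolding distinct_map by (auto simp: inj_on_def)
  show "length w \<le> card K" using card_mono[OF assms(3,2)] distinct_card[OF d] by simp
qed

lemma marked_cases:
  assumes "marked K w" "l \<in> set w" "fst l \<in> K"
  shows "l = (fst l, True, 1) \<or> l = (fst l, True, - 1)"
  using assms unfolding marked_def by (cases l) auto

text \<open>The pattern alternates between two crossings, so a crossing whose two letters are
  neighbours takes part in no term.\<close>

lemma casson_expand_R1:
  assumes m: "marked {c} w" and W: "fst l = c" "fst l' = c"
    and d: "distinct (map pass (concat (map (expand [c \<mapsto> [l, l']]) w)))"
  shows "casson (concat (map (expand [c \<mapsto> [l, l']]) w)) = casson (concat (map (expand [c \<mapsto> []]) w))"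
proof -
  define h where "h = expand [c \<mapsto> [l, l']]"
  define h' where "h' = expand [c \<mapsto> []]"
  have hh: "\<And>k. fst k \<notin> {c} \<Longrightarrow> h k = [k]" "\<And>k. fst k \<notin> {c} \<Longrightarrow> h' k = [k]"
    "\<And>k. fst k \<in> {c} \<Longrightarrow> fst ` set (h k) \<subseteq> {c}" "\<And>k. fst k \<in> {c} \<Longrightarrow> fst ` set (h' k) \<subseteq> {c}"
    using W by (auto simp: h_def h'_def expand_def)
  let ?v = "filter (\<lambda>l. fst l \<in> {c}) w"
  have v: "length ?v \<le> 1" using marked_length(1)[OF marked_filter[OF m, of "\<lambda>l. fst l \<in> {c}"]] by auto
  have adj: "interleaving e k (A @ x # y # B) = 0" if "fst x = fst y" "e \<noteq> k" for e k A x y B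
    using that by (cases A; cases "tl A"; cases "tl (tl A)") (auto simp: interleaving_def pass_def)
  have 0: "interleaving e c (restrict e c (concat (map h w))) = 0 \<and> interleaving c e (restrict e c (concat (map h w))) = 0"
    if "e \<noteq> c" for e
  proof (cases "\<exists>k \<in> set w. fst k = c")
    case True
    then obtain A k B where w: "w = A @ k # B" "fst k = c" by (meson split_list)
    have "\<exists>x y. h k = [x, y] \<and> fst x = c \<and> fst y = c"
      using w(2) W by (cases "snd (snd k) = 1") (simp_all add: h_def expand_def)
    then obtain x y where "h k = [x, y]" "fst x = c" "fst y = c" by blast
    then have "restrict e c (concat (map h w)) = restrict e c (concat (map h A)) @ x # y # restrict e c (concat (map h B))"
      unfolding w by (simp add: restrict_def)
    then show ?thesis using adj[of x y] that \<open>fst x = c\<close> \<open>fst y = c\<close> by metis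
  next
    case False
    then have "concat (map h w) = w" using hh(1) concat_map_id[of w h] by auto
    moreover have "c \<notin> fst ` set w" using False by auto
    ultimately show ?thesis using interleaving_notin[of c w e] by simp
  qed
  have 1: "interleaving e c (restrict e c (concat (map h' w))) = 0 \<and> interleaving c e (restrict e c (concat (map h' w))) = 0" for e
  proof -
    have "c \<notin> fst ` set (concat (map h' w))" by (auto simp: h'_def expand_def split: if_splits)
    then show ?thesis using interleaving_notin[of c "concat (map h' w)" e] by simp
  qed
  have 2: "interleaving c c (restrict c c (concat (map h ?v))) = 0"
  proof -
    have "restrict c c (concat (map h ?v)) = restrict c c (concat (map h w))"
      unfolding restrict_concat by (induction w) (auto simp: hh restrict_def)
    then show ?thesis using interleaving_same[OF d, of c] unfolding h_def by simp
  qed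
  have 3: "interleaving c c (restrict c c (concat (map h' ?v))) = 0"
  proof -
    have "concat (map h' ?v) = []" by (auto simp: h'_def expand_def)
    then show ?thesis by (simp only:) (simp add: restrict_def interleaving_def)
  qed
  have "casson (concat (map h w)) - casson (concat (map h' w)) = 0"
    by (subst casson_replace[of "{c}" h h' w]) (use hh 0 1 2 3 in auto)
  then show ?thesis unfolding h_def h'_def by simp
qed

definition rescale :: "'c \<Rightarrow> int \<Rightarrow> 'c letter \<Rightarrow> 'c letter" where
  "rescale c s l = (if fst l = c then (fst l, fst (snd l), s * snd (snd l)) else l)"

text \<open>A nonzero term contains both letters of each of its crossings, so the factor
  \<open>s\<close> enters squared.\<close>

lemma casson_rescale:
  assumes s: "s * s = 1"
  shows "casson (map (rescale c s) w) = casson w"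
proof -
  have f: "fst (rescale c s l) = fst l" "pass (rescale c s l) = pass l" for l by (auto simp: rescale_def pass_def)
  have r: "restrict x y (map (rescale c s) w) = map (rescale c s) (restrict x y w)" for x y
    unfolding restrict_def filter_map comp_def f ..
  have i: "interleaving x y (map (rescale c s) v) = interleaving x y v" for x y v
  proof (cases "map pass v = [(x, False), (y, True), (x, True), (y, False)]")
    case True
    then obtain e1 e2 e3 e4 where "v = [(x, False, e1), (y, True, e2), (x, True, e3), (y, False, e4)]"
      by (auto simp: map_eq_Cons_conv pass_def)
    then show ?thesis using s by (auto simp: interleaving_def rescale_def algebra_simps)
  next
    case False then show ?thesis by (auto simp: interleaving_def f comp_def)
  qed
  have "fst ` set (map (rescale c s) w) = fst ` set w" by (force simp: f)
  then show ?thesis unfolding casson_def r i by simp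
qed

lemma marked_pair_cases:
  assumes "marked {c, d} w" "set (map fst w) \<subseteq> {c, d}" "c \<noteq> d"
  obtains "w = []" | x s where "x \<in> {c, d}" "s \<in> {1, - 1}" "w = [(x, True, s)]"
  | x s t where "x \<in> {c, d}" "s \<in> {1, - 1}" "t \<in> {1, - 1}" "w = [(x, True, s), (if x = c then d else c, True, t)]"
proof -
  have len: "length w \<le> 2" and dis: "distinct (map fst w)" using marked_length[OF assms(1,2)] assms(3) by auto
  have l: "l = (fst l, True, snd (snd l)) \<and> fst l \<in> {c, d} \<and> snd (snd l) \<in> {1, - 1}" if "l \<in> set w" for l
  proof -
    have "fst l \<in> {c, d}" using assms(2) that by auto
    then show ?thesis using marked_cases[OF assms(1) that] by (cases l) auto
  qed
  consider "w = []" | x where "w = [x]" | x y where "w = [x, y]"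
    using len by (cases w; cases "tl w"; cases "tl (tl w)") auto
  then show thesis
  proof cases
    case 2
    then show ?thesis using l[of x] that(2)[of "fst x" "snd (snd x)"] by auto
  next
    case (3 x y)
    then have "fst y = (if fst x = c then d else c)" using l[of x] l[of y] dis by auto
    then show ?thesis using l[of x] l[of y] 3 that(3)[of "fst x" "snd (snd x)" "snd (snd y)"] by auto
  qed (use that in auto)
qed

text \<open>The condition on the product says that \<open>c\<close> and \<open>d\<close> have
  opposite signs. Their letters are neighbours on both strands, so for each third crossing the terms
  with \<open>c\<close> and with \<open>d\<close> cancel. A term with both would need an under
  letter followed by an over letter on a single strand, but one strand lies over at both crossings
  and the other under.\<close>

lemma casson_expand_R2:
  assumes m: "marked {c, d} w" and cd: "c \<noteq> d"
    and s: "s1 \<in> {1, - 1}" "s2 \<in> {1, - 1}" "s3 \<in> {1, - 1}" "s4 \<in> {1, - 1 :: int}" "s1 * s2 * s3 * s4 = - 1"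
    and W: "W = [c \<mapsto> [(c, v, s1), (d, v, s2)], d \<mapsto> [(c, \<not> v, s3), (d, \<not> v, s4)]]"
  shows "casson (concat (map (expand W) w)) = casson (concat (map (expand [c \<mapsto> [], d \<mapsto> []]) w))"
proof -
  define h where "h = expand W"
  define h' where "h' = expand [c \<mapsto> [], d \<mapsto> []]"
  have hh: "\<And>k. fst k \<notin> {c, d} \<Longrightarrow> h k = [k]" "\<And>k. fst k \<in> {c, d} \<Longrightarrow> fst ` set (h k) \<subseteq> {c, d}"
    "\<And>k. fst k \<notin> {c, d} \<Longrightarrow> h' k = [k]" "\<And>k. fst k \<in> {c, d} \<Longrightarrow> fst ` set (h' k) \<subseteq> {c, d}"
    using cd by (auto simp: h_def h'_def expand_def W)
  let ?v = "filter (\<lambda>l. fst l \<in> {c, d}) w"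
  \<comment> \<open>Renames \<open>c\<close> to \<open>d\<close> and corrects the sign:
    \<open>s1 * s2 * s1 = s2\<close> is the sign of the neighbouring letter of \<open>d\<close>, and
    likewise for \<open>s3\<close> and \<open>s4\<close>.\<close>
  define r where "r l = (if fst l = c then (d, fst (snd l), (if fst (snd l) = v then s1 * s2 else s3 * s4) * snd (snd l)) else l)" for l :: "'a letter"
  have rr: "restrict e d (concat (map h w)) = map r (restrict e c (concat (map h w)))" if "e \<noteq> c" "e \<noteq> d" for e
  proof -
    have "restrict e d (h l) = map r (restrict e c (h l))" if "l \<in> set w" for l
    proof (cases "fst l \<in> {c, d}")
      case True
      then have "l \<in> {(c, True, 1), (c, True, - 1), (d, True, 1), (d, True, - 1)}"
        using marked_cases[OF m that True] by auto
      then show ?thesis using \<open>e \<noteq> c\<close> \<open>e \<noteq> d\<close> cd s(1-4)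
        by (elim insertE emptyE) (auto simp: h_def W expand_def restrict_def r_def)
    next
      case False
      then show ?thesis using hh(1)[OF False] by (auto simp: restrict_def r_def)
    qed
    then show ?thesis unfolding restrict_concat map_concat map_map comp_def by (metis (no_types, lifting) map_cong)
  qed
  have neg: "interleaving e d (map r u) = - interleaving e c u" "interleaving d e (map r u) = - interleaving c e u"
    if "e \<noteq> c" "e \<noteq> d" "\<And>l. l \<in> set u \<Longrightarrow> fst l = e \<or> fst l = c" for e u
  proof -
    define k where "k p = (if fst p = c then (d, snd p) else p)" for p :: "'a \<times> bool"
    have p: "map pass (map r u) = map k (map pass u)" by (auto simp: r_def pass_def k_def)
    have k: "inj_on k (set (map pass u) \<union> {(e, False), (e, True), (c, False), (c, True)})"
      using that cd by (fastforce simp: inj_on_def k_def pass_def)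
    have ke: "map k [(e, False), (c, True), (e, True), (c, False)] = [(e, False), (d, True), (e, True), (d, False)]"
      "map k [(c, False), (e, True), (c, True), (e, False)] = [(d, False), (e, True), (d, True), (e, False)]"
      using that by (auto simp: k_def)
    have q: "(if v then s1 * s2 else s3 * s4) * (if \<not> v then s1 * s2 else s3 * s4) = - 1" using s by auto
    have eq: "map pass (map r u) = [(e, False), (d, True), (e, True), (d, False)] \<longleftrightarrow> map pass u = [(e, False), (c, True), (e, True), (c, False)]"
      "map pass (map r u) = [(d, False), (e, True), (d, True), (e, False)] \<longleftrightarrow> map pass u = [(c, False), (e, True), (c, True), (e, False)]"
      unfolding p ke[symmetric] by (rule inj_on_map_eq_map, rule inj_on_subset[OF k], force)+
    show "interleaving e d (map r u) = - interleaving e c u"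
    proof (cases "map pass u = [(e, False), (c, True), (e, True), (c, False)]")
      case True
      then obtain e1 e2 e3 e4 where "u = [(e, False, e1), (c, True, e2), (e, True, e3), (c, False, e4)]"
        by (auto simp: map_eq_Cons_conv pass_def)
      then show ?thesis using q that by (auto simp: interleaving_def r_def algebra_simps)
    next
      case False then show ?thesis unfolding interleaving_def eq by simp
    qed
    show "interleaving d e (map r u) = - interleaving c e u"
    proof (cases "map pass u = [(c, False), (e, True), (c, True), (e, False)]")
      case True
      then obtain e1 e2 e3 e4 where "u = [(c, False, e1), (e, True, e2), (c, True, e3), (e, False, e4)]"
        by (auto simp: map_eq_Cons_conv pass_def)
      then show ?thesis using q that by (auto simp: interleaving_def r_def algebra_simps)
    next
      case False then show ?thesis unfolding interleaving_def eq by simp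
    qed
  qed
  have nin: "c \<notin> fst ` set (concat (map h' w))" "d \<notin> fst ` set (concat (map h' w))"
    by (auto simp: h'_def expand_def split: if_splits)
  have 1: "(\<Sum>k \<in> {c, d}. interleaving e k (restrict e k (concat (map h w))) + interleaving k e (restrict e k (concat (map h w)))) = 0"
    if "e \<notin> {c, d}" for e
  proof -
    have "l \<in> set (restrict e c (concat (map h w))) \<Longrightarrow> fst l = e \<or> fst l = c" for l by (auto simp: restrict_def)
    then show ?thesis using that cd rr[of e] neg[of e "restrict e c (concat (map h w))"] by simp
  qed
  have 2: "(\<Sum>k \<in> {c, d}. interleaving e k (restrict e k (concat (map h' w))) + interleaving k e (restrict e k (concat (map h' w)))) = 0" for e
    using interleaving_notin[OF nin(1)] interleaving_notin[OF nin(2)] cd by simp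
  have 3: "(\<Sum>x \<in> {c, d}. \<Sum>y \<in> {c, d}. interleaving x y (restrict x y (concat (map h ?v)))) = 0"
  proof -
    have *: "(\<Sum>x \<in> {c, d}. \<Sum>y \<in> {c, d}. interleaving x y (restrict x y (concat (map h u)))) = 0"
      if "marked {c, d} u" "set (map fst u) \<subseteq> {c, d}" for u
      using that cd
    proof (cases rule: marked_pair_cases)
      case 1
      then show ?thesis by (simp add: restrict_def interleaving_def)
    next
      case (2 x s)
      then show ?thesis using cd by (elim insertE emptyE) (simp_all add: h_def W expand_def restrict_def interleaving_def)
    next
      case (3 x s t)
      then show ?thesis using cd by (elim insertE emptyE) (simp_all add: h_def W expand_def restrict_def interleaving_def)
    qed
    show ?thesis by (rule *) (use marked_filter[OF m] in auto)
  qed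
  have 4: "(\<Sum>x \<in> {c, d}. \<Sum>y \<in> {c, d}. interleaving x y (restrict x y (concat (map h' ?v)))) = 0"
  proof -
    have "concat (map h' ?v) = []" by (auto simp: h'_def expand_def)
    then show ?thesis by (simp only:) (simp add: restrict_def interleaving_def)
  qed
  have "casson (concat (map h w)) - casson (concat (map h' w)) = 0"
    by (subst casson_replace[of "{c, d}" h h' w]) (use hh 1 2 3 4 in auto)
  then show ?thesis unfolding h_def h'_def by simp
qed

lemma marked_triple_cases:
  assumes "marked {a, b, c} w" "set (map fst w) \<subseteq> {a, b, c}"
  obtains "w = []" | x s where "x \<in> {a, b, c}" "s \<in> {1, - 1}" "w = [(x, True, s)]"
  | x y s t where "x \<in> {a, b, c}" "y \<in> {a, b, c}" "x \<noteq> y" "s \<in> {1, - 1}" "t \<in> {1, - 1}" "w = [(x, True, s), (y, True, t)]"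
  | x y z s t u where "x \<in> {a, b, c}" "y \<in> {a, b, c}" "z \<in> {a, b, c}" "x \<noteq> y" "x \<noteq> z" "y \<noteq> z"
    "s \<in> {1, - 1}" "t \<in> {1, - 1}" "u \<in> {1, - 1}" "w = [(x, True, s), (y, True, t), (z, True, u)]"
proof -
  have "card {a, b, c} \<le> 3" by (simp add: card_insert_if)
  then have len: "length w \<le> 3" and dis: "distinct (map fst w)" using marked_length[OF assms] by auto
  have l: "l = (fst l, True, snd (snd l)) \<and> fst l \<in> {a, b, c} \<and> snd (snd l) \<in> {1, - 1}" if "l \<in> set w" for l
  proof -
    have "fst l \<in> {a, b, c}" using assms(2) that by auto
    then show ?thesis using marked_cases[OF assms(1) that] by (cases l) auto
  qed
  consider "w = []" | x where "w = [x]" | x y where "w = [x, y]" | x y z where "w = [x, y, z]"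
    using len by (cases w; cases "tl w"; cases "tl (tl w)"; cases "tl (tl (tl w))") auto
  then show thesis
  proof cases
    case (2 x)
    then show ?thesis using l[of x] that(2)[of "fst x" "snd (snd x)"] by auto
  next
    case (3 x y)
    then show ?thesis using l[of x] l[of y] dis that(3)[of "fst x" "fst y" "snd (snd x)" "snd (snd y)"] by auto
  next
    case (4 x y z)
    then show ?thesis using l[of x] l[of y] l[of z] dis
      that(4)[of "fst x" "fst y" "fst z" "snd (snd x)" "snd (snd y)" "snd (snd z)"] by auto
  qed (use that in auto)
qed

definition sgn_of :: "bool \<Rightarrow> int" where "sgn_of p = (if p then 1 else - 1)"

text \<open>The passages of the strands 0, 1, 2, with the markers a, b, c, on the two sides of \<open>R3\<close>; the
  crossings 01, 02, 12 are again called a, b, c.\<close>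

definition triangle :: "'c \<Rightarrow> 'c \<Rightarrow> 'c \<Rightarrow> bool \<Rightarrow> bool \<Rightarrow> bool \<Rightarrow> 'c \<Rightarrow> 'c word option" where
  "triangle a b c p q r = [a \<mapsto> [(a, p, 1), (b, q, 1)], b \<mapsto> [(a, \<not> p, sgn_of p), (c, r, 1)],
     c \<mapsto> [(b, \<not> q, sgn_of q), (c, \<not> r, sgn_of r)]]"

definition triangle' :: "'c \<Rightarrow> 'c \<Rightarrow> 'c \<Rightarrow> bool \<Rightarrow> bool \<Rightarrow> bool \<Rightarrow> 'c \<Rightarrow> 'c word option" where
  "triangle' a b c p q r = [a \<mapsto> [(b, q, 1), (a, p, 1)], b \<mapsto> [(c, r, 1), (a, \<not> p, sgn_of p)],
     c \<mapsto> [(c, \<not> r, sgn_of r), (b, \<not> q, sgn_of q)]]"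

definition inner_sum :: "'c \<Rightarrow> 'c \<Rightarrow> 'c \<Rightarrow> 'c word \<Rightarrow> int" where
  "inner_sum a b c w = (\<Sum>x \<in> {a, b, c}. \<Sum>y \<in> {a, b, c}. interleaving x y (restrict x y w))"

definition cross_sum :: "'c \<Rightarrow> 'c \<Rightarrow> 'c \<Rightarrow> 'c word \<Rightarrow> int" where
  "cross_sum a b c w = interleaving a b (restrict a b w) + interleaving b a (restrict a b w) +
    interleaving a c (restrict a c w) + interleaving c a (restrict a c w) +
    interleaving b c (restrict b c w) + interleaving c b (restrict b c w)"

lemma inner_sum_alt:
  assumes "a \<noteq> b" "a \<noteq> c" "b \<noteq> c" "distinct (map pass w)"
  shows "inner_sum a b c w = cross_sum a b c w"
  using assms by (simp add: inner_sum_def cross_sum_def interleaving_same restrict_commute[of b a] restrict_commute[of c a] restrict_commute[of c b])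

lemma interleaving4:
  "interleaving c d [(x1, v1, e1), (x2, v2, e2), (x3, v3, e3), (x4, v4, e4)] =
    (if \<not> v1 \<and> v2 \<and> v3 \<and> \<not> v4 \<and> x1 = c \<and> x2 = d \<and> x3 = c \<and> x4 = d then e1 * e2 * e3 * e4 else 0)"
  by (auto simp: interleaving_def)

lemma interleaving_short: "length v \<noteq> 4 \<Longrightarrow> interleaving c d v = 0"
  unfolding interleaving_def using length_map[of pass v] by (auto simp del: length_map)

lemma restrict_Cons: "restrict c d ((x, l) # w) = (if x = c \<or> x = d then (x, l) # restrict c d w else restrict c d w)"
  "restrict c d [] = []"
  by (auto simp: restrict_def)

text \<open>Two of the three strands contain both letters of only one crossing, so no term arises on
  either side. With three strands all orders, directions and heights are checked, and a change
  remains exactly for cyclic heights.\<close>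

lemma cross_sum_triangle:
  assumes ne: "a \<noteq> b" "a \<noteq> c" "b \<noteq> c" and xyz: "x \<in> {a, b, c}" "y \<in> {a, b, c}" "z \<in> {a, b, c}"
    "x \<noteq> y" "x \<noteq> z" "y \<noteq> z" "s \<in> {1, - 1}" "t \<in> {1, - 1}" "u \<in> {1, - 1}"
  shows "cross_sum a b c (concat (map (expand (triangle a b c p q r)) [(x, True, s), (y, True, t)])) =
     cross_sum a b c (concat (map (expand (triangle' a b c p q r)) [(x, True, s), (y, True, t)]))"
    "cross_sum a b c (concat (map (expand (triangle a b c p q r)) [(x, True, s), (y, True, t), (z, True, u)])) -
     cross_sum a b c (concat (map (expand (triangle' a b c p q r)) [(x, True, s), (y, True, t), (z, True, u)]))
     \<in> (if p = r \<and> q \<noteq> p then {1, - 1} else {0})"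
proof -
  define f where "f = expand (triangle a b c p q r)"
  define g where "g = expand (triangle' a b c p q r)"
  have f: "f (a, True, 1) = [(a, p, 1), (b, q, 1)]" "f (a, True, - 1) = [(b, q, - 1), (a, p, - 1)]"
    "f (b, True, 1) = [(a, \<not> p, sgn_of p), (c, r, 1)]" "f (b, True, - 1) = [(c, r, - 1), (a, \<not> p, - sgn_of p)]"
    "f (c, True, 1) = [(b, \<not> q, sgn_of q), (c, \<not> r, sgn_of r)]" "f (c, True, - 1) = [(c, \<not> r, - sgn_of r), (b, \<not> q, - sgn_of q)]"
    and g: "g (a, True, 1) = [(b, q, 1), (a, p, 1)]" "g (a, True, - 1) = [(a, p, - 1), (b, q, - 1)]"
    "g (b, True, 1) = [(c, r, 1), (a, \<not> p, sgn_of p)]" "g (b, True, - 1) = [(a, \<not> p, - sgn_of p), (c, r, - 1)]"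
    "g (c, True, 1) = [(c, \<not> r, sgn_of r), (b, \<not> q, sgn_of q)]" "g (c, True, - 1) = [(b, \<not> q, - sgn_of q), (c, \<not> r, - sgn_of r)]"
    using ne by (auto simp: f_def g_def expand_def triangle_def triangle'_def)
  have sg: "sgn_of True = 1" "sgn_of False = - 1" by (auto simp: sgn_of_def)
  show "cross_sum a b c (concat (map (expand (triangle a b c p q r)) [(x, True, s), (y, True, t)])) =
     cross_sum a b c (concat (map (expand (triangle' a b c p q r)) [(x, True, s), (y, True, t)]))"
    unfolding f_def[symmetric] g_def[symmetric] using xyz(1,2,4,7,8)
    by (elim insertE emptyE; hypsubst; (simp only: simp_thms)?;
      simp only: f g cross_sum_def list.map concat.simps append.simps restrict_Cons ne ne[symmetric] simp_thms if_True if_False;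
      cases p; cases q; cases r; simp add: interleaving4 interleaving_short ne sg)
  show "cross_sum a b c (concat (map (expand (triangle a b c p q r)) [(x, True, s), (y, True, t), (z, True, u)])) -
     cross_sum a b c (concat (map (expand (triangle' a b c p q r)) [(x, True, s), (y, True, t), (z, True, u)]))
     \<in> (if p = r \<and> q \<noteq> p then {1, - 1} else {0})"
    unfolding f_def[symmetric] g_def[symmetric] using xyz
    by (elim insertE emptyE; hypsubst; (simp only: simp_thms)?;
      simp only: f g cross_sum_def list.map concat.simps append.simps restrict_Cons ne ne[symmetric] simp_thms if_True if_False;
      cases p; cases q; cases r; simp add: interleaving4 interleaving_short ne sg)
qed

lemma cross_sum_triangle_2:
  assumes ne: "a \<noteq> b" "a \<noteq> c" "b \<noteq> c" and xy: "x \<in> {a, b, c}" "y \<in> {a, b, c}" "x \<noteq> y" "s \<in> {1, - 1}" "t \<in> {1, - 1}"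
  shows "cross_sum a b c (concat (map (expand (triangle a b c p q r)) [(x, True, s), (y, True, t)])) =
     cross_sum a b c (concat (map (expand (triangle' a b c p q r)) [(x, True, s), (y, True, t)]))"
proof -
  obtain z where "z \<in> {a, b, c}" "x \<noteq> z" "y \<noteq> z" using ne xy by auto
  then show ?thesis using cross_sum_triangle(1)[OF ne xy(1,2) _ xy(3) _ _ xy(4,5), of z 1] by simp
qed

lemma filter_concat_map:
  "(\<And>l. filter P (h l) = (if Q l then h l else [])) \<Longrightarrow> filter P (concat (map h w)) = concat (map h (filter Q w))"
  by (induction w) auto

text \<open>A strand meets a given crossing of the triangle at most once, so after restriction to
  that crossing and an outer one the reversed order of its two letters is invisible. Only pairs
  inside the triangle can change. The inclusion in the second claim says that all three strands lie
  on the word.\<close>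

lemma casson_triangle:
  assumes m: "marked {a, b, c} w" and ne: "a \<noteq> b" "a \<noteq> c" "b \<noteq> c"
    and d: "distinct (map pass (concat (map (expand (triangle a b c p q r)) w)))"
      "distinct (map pass (concat (map (expand (triangle' a b c p q r)) w)))"
    and D: "D = casson (concat (map (expand (triangle a b c p q r)) w)) - casson (concat (map (expand (triangle' a b c p q r)) w))"
  shows "\<not> (p = r \<and> q \<noteq> p) \<Longrightarrow> D = 0"
    and "{(a, True), (b, True), (c, True)} \<subseteq> pass ` set w \<Longrightarrow> p = r \<Longrightarrow> q \<noteq> p \<Longrightarrow> \<bar>D\<bar> = 1"
proof -
  define h where "h = expand (triangle a b c p q r)"
  define h' where "h' = expand (triangle' a b c p q r)"
  define v where "v = filter (\<lambda>l. fst l \<in> {a, b, c}) w"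
  have hh: "\<And>k. fst k \<notin> {a, b, c} \<Longrightarrow> h k = [k]" "\<And>k. fst k \<in> {a, b, c} \<Longrightarrow> fst ` set (h k) \<subseteq> {a, b, c}"
    "\<And>k. fst k \<notin> {a, b, c} \<Longrightarrow> h' k = [k]" "\<And>k. fst k \<in> {a, b, c} \<Longrightarrow> fst ` set (h' k) \<subseteq> {a, b, c}"
    using ne by (auto simp: h_def h'_def triangle_def triangle'_def expand_def)
  have e: "restrict e k (concat (map h w)) = restrict e k (concat (map h' w))" if "e \<notin> {a, b, c}" for e k
  proof -
    have "restrict e k (h l) = restrict e k (h' l)" if "l \<in> set w" for l
    proof (cases "fst l \<in> {a, b, c}")
      case True
      then have "l \<in> {(a, True, 1), (a, True, - 1), (b, True, 1), (b, True, - 1), (c, True, 1), (c, True, - 1)}"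
        using marked_cases[OF m that True] by auto
      moreover have "a \<noteq> e" "b \<noteq> e" "c \<noteq> e" using \<open>e \<notin> {a, b, c}\<close> by auto
      ultimately show ?thesis using \<open>e \<notin> {a, b, c}\<close> ne
        by (elim insertE emptyE; cases "k = a"; cases "k = b"; cases "k = c")
          (simp_all add: h_def h'_def triangle_def triangle'_def expand_def restrict_def)
    next
      case False
      then show ?thesis using hh(1,3) by simp
    qed
    then show ?thesis unfolding restrict_concat by (metis (no_types, lifting) map_cong)
  qed
  have D': "D = inner_sum a b c (concat (map h v)) - inner_sum a b c (concat (map h' v))"
    unfolding D inner_sum_def v_def h_def[symmetric] h'_def[symmetric]
    by (rule casson_replace[of "{a, b, c}" h h' w]) (use hh e in auto)
  have v: "marked {a, b, c} v" "set (map fst v) \<subseteq> {a, b, c}" using marked_filter[OF m] by (auto simp: v_def)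
  have "concat (map h v) = filter (\<lambda>l. fst l \<in> {a, b, c}) (concat (map h w))"
    "concat (map h' v) = filter (\<lambda>l. fst l \<in> {a, b, c}) (concat (map h' w))"
  proof -
    have J: "filter (\<lambda>l. fst l \<in> {a, b, c}) (g l) = (if fst l \<in> {a, b, c} then g l else [])"
      if "fst l \<notin> {a, b, c} \<Longrightarrow> g l = [l]" "fst l \<in> {a, b, c} \<Longrightarrow> fst ` set (g l) \<subseteq> {a, b, c}" for g l
    proof (cases "fst l \<in> {a, b, c}")
      case True
      have "\<forall>k \<in> set (g l). fst k \<in> {a, b, c}" using that(2)[OF True] by blast
      then have "filter (\<lambda>l. fst l \<in> {a, b, c}) (g l) = g l" by (rule filter_True)
      then show ?thesis using True by (simp only: if_True)
    next
      case False
      then show ?thesis using that(1)[OF False] by simp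
    qed
    note * = J[of _ h, OF hh(1) hh(2)] J[of _ h', OF hh(3) hh(4)]
    show "concat (map h v) = filter (\<lambda>l. fst l \<in> {a, b, c}) (concat (map h w))"
      unfolding v_def by (rule sym, rule filter_concat_map, rule *(1))
    show "concat (map h' v) = filter (\<lambda>l. fst l \<in> {a, b, c}) (concat (map h' w))"
      unfolding v_def by (rule sym, rule filter_concat_map, rule *(2))
  qed
  then have "distinct (map pass (concat (map h v)))" "distinct (map pass (concat (map h' v)))"
    using d unfolding h_def[symmetric] h'_def[symmetric] by (simp_all only: distinct_map_filter)
  note D' = D'[unfolded inner_sum_alt[OF ne this(1)] inner_sum_alt[OF ne this(2)]]
  show "D = 0" if "\<not> (p = r \<and> q \<noteq> p)"
    using v
  proof (cases rule: marked_triple_cases)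
    case 1
    then show ?thesis unfolding D' by simp
  next
    case (2 x s)
    then show ?thesis using ne
      unfolding D' h_def h'_def
      by (elim insertE emptyE; simp add: cross_sum_def expand_def triangle_def triangle'_def restrict_Cons interleaving_short)
  next
    case (3 x y s t)
    then show ?thesis unfolding D' h_def h'_def using 3(6) cross_sum_triangle_2[OF ne 3(1-5)] by simp
  next
    case (4 x y z s t u)
    then show ?thesis unfolding D' h_def h'_def using 4(10) cross_sum_triangle(2)[OF ne 4(1-9), of p q r] that by auto
  qed
  show "\<bar>D\<bar> = 1" if "{(a, True), (b, True), (c, True)} \<subseteq> pass ` set w" "p = r" "q \<noteq> p"
  proof -
    have "{a, b, c} \<subseteq> set (map fst v)"
      using that(1) by (force simp: v_def pass_def)
    then have "card {a, b, c} \<le> card (set (map fst v))" by (intro card_mono) auto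
    then have len: "length v \<ge> 3" using ne card_length[of "map fst v"] by simp
    from v show ?thesis
    proof (cases rule: marked_triple_cases)
      case (4 x y z s t u)
      then show ?thesis unfolding D' h_def h'_def using 4(10) cross_sum_triangle(2)[OF ne 4(1-9), of p q r] that by auto
    qed (use len in auto)
  qed
qed

text \<open>Backwards, the pattern of \<open>c\<close> and \<open>d\<close> is that of
  \<open>d\<close> and \<open>c\<close>; the four reversed signs cancel.\<close>

lemma interleaving_rev: "interleaving c d (rev_word v) = interleaving d c v"
proof -
  have "map pass (rev_word v) = [(c, False), (d, True), (c, True), (d, False)] \<longleftrightarrow>
    map pass v = [(d, False), (c, True), (d, True), (c, False)]"
    unfolding map_pass_rev_word by (metis append.simps rev.simps(1,2) rev_rev_ident)
  moreover have "prod_list (map (\<lambda>l. snd (snd l)) (rev_word v)) = prod_list (map (\<lambda>l. snd (snd l)) v)"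
    if "map pass v = [(d, False), (c, True), (d, True), (c, False)]"
    using that by (auto simp: map_eq_Cons_conv rev_letter_def)
  ultimately show ?thesis unfolding interleaving_def by simp
qed

lemma casson_rev [simp]: "casson (rev_word w) = casson w"
proof -
  have r: "restrict c d (rev_word w) = rev_word (restrict d c w)" for c d
    unfolding restrict_def rev_word_def by (simp add: filter_map comp_def rev_filter disj_commute)
  have s: "fst ` set (rev_word w) = fst ` set w" by (force simp: rev_word_def)
  show ?thesis unfolding casson_def r s interleaving_rev by (rule sum.swap)
qed

text \<open>In the pattern the first and the last letter belong to different crossings. This serves
  kinks that contain the base point.\<close>

lemma casson_ends:
  assumes "fst l = c" "fst l' = c" "c \<notin> fst ` set w"
  shows "casson (l # w @ [l']) = casson w"
proof -
  let ?I = "insert c (fst ` set w)"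
  have i: "interleaving c e (restrict c e (l # w @ [l'])) = 0 \<and> interleaving e c (restrict e c (l # w @ [l'])) = 0" if "e \<in> fst ` set w" for e
  proof -
    have "e \<noteq> c" using that assms(3) by auto
    have "restrict c e (l # w @ [l']) = l # restrict c e w @ [l']" using assms by (auto simp: restrict_def)
    then show ?thesis using \<open>e \<noteq> c\<close> assms(1,2) unfolding interleaving_def restrict_commute[of e c]
      by (auto simp: pass_def append_eq_Cons_conv map_eq_append_conv)
  qed
  have "restrict c c w = []" using assms(3) by (force simp: restrict_def filter_empty_conv)
  then have j: "interleaving c c (restrict c c (l # w @ [l'])) = 0"
    using assms by (auto simp: restrict_def interleaving_def)
  have k: "restrict x y (l # w @ [l']) = restrict x y w" if "x \<in> fst ` set w" "y \<in> fst ` set w" for x y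
    using that assms by (auto simp: restrict_def)
  have "casson (l # w @ [l']) = (\<Sum>x \<in> ?I. \<Sum>y \<in> ?I. interleaving x y (restrict x y (l # w @ [l'])))"
    by (rule casson_superset) (use assms in auto)
  also have "\<dots> = casson w"
    using assms(3) i j unfolding casson_def by (simp add: k cong: sum.cong)
  finally show ?thesis .
qed

section \<open>Local moves\<close>

text \<open>M and M' arise from the same arcs N by two substitutions for the markers K, and these
  substitutions lead to R-related values of \<open>casson\<close> for every Gauss word containing N.\<close>

definition exchange_data :: "'c set \<Rightarrow> nat \<Rightarrow> (int \<Rightarrow> int \<Rightarrow> bool) \<Rightarrow> 'c arcs \<Rightarrow> 'c arcs \<Rightarrow>
    'c arcs \<Rightarrow> ('c letter \<Rightarrow> 'c word) \<Rightarrow> ('c letter \<Rightarrow> 'c word) \<Rightarrow> 'c set \<Rightarrow> 'c letter set \<Rightarrow> bool" where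
  "exchange_data X n R M M' N h h' K \<Lambda> \<longleftrightarrow> arc_system n N \<and> (K \<union> fst ` passes N) \<inter> X = {} \<and>
     M = subst h N \<and> M' = subst h' N \<and> (\<forall>l. fst l \<notin> K \<longrightarrow> h l = [l]) \<and> (\<forall>l. fst l \<notin> K \<longrightarrow> h' l = [l]) \<and>
     (\<forall>l \<in> letters N. fst l \<in> K \<longrightarrow> l \<in> \<Lambda>) \<and>
     (\<forall>w. distinct (map pass w) \<longrightarrow> (\<forall>l \<in> set w. fst l \<in> K \<longrightarrow> l \<in> \<Lambda>) \<longrightarrow> passes N \<subseteq> pass ` set w \<longrightarrow>
        distinct (map pass (concat (map h w))) \<longrightarrow> distinct (map pass (concat (map h' w))) \<longrightarrow>
        R (casson (concat (map h w))) (casson (concat (map h' w))))"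

definition exchangeable :: "'c set \<Rightarrow> nat \<Rightarrow> (int \<Rightarrow> int \<Rightarrow> bool) \<Rightarrow> 'c arcs \<Rightarrow> 'c arcs \<Rightarrow> bool" where
  "exchangeable X n R M M' \<longleftrightarrow> (\<exists>N h h' K \<Lambda>. exchange_data X n R M M' N h h' K \<Lambda>)"

lemma exchange_data_sym: "exchange_data X n R M M' N h h' K \<Lambda> \<Longrightarrow> exchange_data X n (\<lambda>x y. R y x) M' M N h' h K \<Lambda>"
  unfolding exchange_data_def by simp

lemma exchangeable_sym: "exchangeable X n R M M' \<Longrightarrow> exchangeable X n (\<lambda>x y. R y x) M' M"
  unfolding exchangeable_def by (elim exE, drule exchange_data_sym) (intro exI)

lemma exchangeable_refl: "arc_system n M \<Longrightarrow> fst ` passes M \<inter> X = {} \<Longrightarrow> (\<And>x. R x x) \<Longrightarrow> exchangeable X n R M M"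
  unfolding exchangeable_def
  by (rule exI[of _ M], rule exI[of _ "\<lambda>l. [l]"], rule exI[of _ "\<lambda>l. [l]"], rule exI[of _ "{}"], rule exI[of _ "{}"])
    (auto simp: subst_def exchange_data_def)

text \<open>By \<open>act_subst\<close> the layers \<open>U\<close> can act on the common arcs
  \<open>N\<close> before any substitution. Both closed words are then substitution instances of one
  marked word, which is what \<open>exchange_data\<close> compares.\<close>

lemma exchangeable_act:
  assumes ex: "exchangeable (set (ids U)) n R M M'" and t: "tangle 2 (erase U) n" and d: "distinct (ids U)"
  shows "loops U M = loops U M'"
    and "loops U M = 0 \<Longrightarrow> arc_system 2 (act U M) \<Longrightarrow> arc_system 2 (act U M') \<Longrightarrow> (0, w, 1) \<in> act U M \<Longrightarrow>
      \<exists>w'. (0, w', 1) \<in> act U M' \<and> R (casson w) (casson w')"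
proof -
  obtain N h h' K \<Lambda> where data: "exchange_data (set (ids U)) n R M M' N h h' K \<Lambda>"
    using ex unfolding exchangeable_def by (elim exE)
  have N: "arc_system n N" "(K \<union> fst ` passes N) \<inter> set (ids U) = {}" "M = subst h N" "M' = subst h' N"
    and h: "\<And>l. fst l \<notin> K \<Longrightarrow> h l = [l]" "\<And>l. fst l \<notin> K \<Longrightarrow> h' l = [l]"
    and \<Lambda>: "\<And>l. l \<in> letters N \<Longrightarrow> fst l \<in> K \<Longrightarrow> l \<in> \<Lambda>"
    and R: "\<And>w. distinct (map pass w) \<Longrightarrow> (\<And>l. l \<in> set w \<Longrightarrow> fst l \<in> K \<Longrightarrow> l \<in> \<Lambda>) \<Longrightarrow> passes N \<subseteq> pass ` set w \<Longrightarrow>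
        distinct (map pass (concat (map h w))) \<Longrightarrow> distinct (map pass (concat (map h' w))) \<Longrightarrow>
        R (casson (concat (map h w))) (casson (concat (map h' w)))"
    using data unfolding exchange_data_def by (simp_all del: split_paired_All)
  have fixed: "h (c, v, e) = [(c, v, e)]" "h' (c, v, e) = [(c, v, e)]" if "c \<in> set (ids U)" for c v e
  proof -
    have "c \<notin> K" using that N(2) by blast
    then show "h (c, v, e) = [(c, v, e)]" "h' (c, v, e) = [(c, v, e)]" using h[of "(c, v, e)"] by auto
  qed
  note S = act_subst[of U h N, OF fixed(1)] and S' = act_subst[of U h' N, OF fixed(2)]
  show loops: "loops U M = loops U M'" using S S' N by auto
  assume l0: "loops U M = 0" and A: "arc_system 2 (act U M)" "arc_system 2 (act U M')" and w: "(0, w, 1) \<in> act U M"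
  have "(0, w, 1) \<in> subst h (act U N)" using w S N(3) by simp
  then obtain u where u: "w = concat (map h u)" "(0, u, 1) \<in> act U N" unfolding in_subst by blast
  have "act U M' = subst h' (act U N)" using S' N(4) by simp
  then have w': "(0, concat (map h' u), 1) \<in> act U M'" unfolding u(1) using u(2) in_subst by blast
  have dU: "set (ids U) \<inter> fst ` passes N = {}" using N(2) by blast
  have "loops U N = 0" using l0 S N(3) by auto
  then have sys: "arc_system 2 (act U N)" "passes (act U N) = passes N \<union> set (ids U) \<times> UNIV"
    using act_arc_system[OF N(1) t d dU] by auto
  have "letters (act U N) \<subseteq> {l. fst l \<in> K \<longrightarrow> l \<in> \<Lambda>}"
    by (rule act_letters) (use \<Lambda> N(2) in auto)
  then have lu: "l \<in> \<Lambda>" if "l \<in> set u" "fst l \<in> K" for l using that u(2) unfolding letters_def by blast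
  \<comment> \<open>Without loops the single arc, read in one direction or the other, carries every
    passage of the tangle.\<close>
  have "p \<in> pass ` set u" if p: "p \<in> passes N" for p
  proof -
    have "p \<in> passes (act U N)" using p sys(2) by blast
    then obtain a v b where v: "(a, v, b) \<in> act U N" "p \<in> pass ` set v" unfolding in_passes by blast
    then have "a = 0 \<or> a = 1" using arc_systemD(1)[OF sys(1) v(1)] by auto
    then show ?thesis
    proof
      assume "a = 0" then show ?thesis using v u(2) arc_system_unique[OF sys(1) u(2)] by auto
    next
      assume "a = 1"
      then have "v = rev_word u" using v(1) arc_system_unique[OF sys(1) arc_systemD(4)[OF sys(1) u(2)]] by auto
      then show ?thesis using v(2) by auto
    qed
  qed
  then have "R (casson w) (casson (concat (map h' u)))"
    unfolding u(1) using arc_systemD(5)[OF sys(1) u(2)] arc_systemD(5)[OF A(1) w] arc_systemD(5)[OF A(2) w'] lu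
    by (intro R) (auto simp: u(1))
  then show "\<exists>w'. (0, w', 1) \<in> act U M' \<and> R (casson w) (casson w')" using w' by blast
qed

text \<open>The base point lies on the first layer, which is a Cup at position 0 in every nonempty link
  diagram.  The condition on \<open>loops\<close> says that the link has only one component, so value_of relates
  links with more components to no value.\<close>

definition value_of :: "diagram \<Rightarrow> int \<Rightarrow> bool" where
  "value_of D v \<longleftrightarrow> (\<exists>(A :: (nat \<times> nat) layer list) w. D = (Cup, 0) # erase A \<and> tangle 2 (erase A) 0 \<and>
     distinct (ids A) \<and> loops A {} = 0 \<and> (0, w, 1) \<in> act A {} \<and> casson w = v)"

text \<open>Here \<open>V\<close> is the part above the move and \<open>X\<close> contains the
  labels of the part below. The new side may bring in labels, provided that they are fresh. Loops
  inside the move are compared separately because they leave no arcs.\<close>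

definition replaceable :: "(int \<Rightarrow> int \<Rightarrow> bool) \<Rightarrow> diagram \<Rightarrow> diagram \<Rightarrow> bool" where
  "replaceable R S T \<longleftrightarrow> (\<forall>(A :: (nat \<times> nat) layer list) V X n k. erase A = S \<longrightarrow> tangle n S k \<longrightarrow> tangle n T k \<longrightarrow>
     tangle k (erase V) 0 \<longrightarrow> distinct (ids (A @ V)) \<longrightarrow> finite X \<longrightarrow> set (ids (A @ V)) \<inter> X = {} \<longrightarrow>
     (\<exists>B. erase B = T \<and> distinct (ids (B @ V)) \<and> set (ids (B @ V)) \<inter> X = {} \<and>
       loops B (act V {}) = loops A (act V {}) \<and> exchangeable X n R (act (A @ V) {}) (act (B @ V) {})))"

lemma tangle_unique_left: "tangle m D n \<Longrightarrow> tangle m' D n \<Longrightarrow> m = m'"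
proof (induction D arbitrary: m m')
  case (Cons y D)
  obtain x i where y: "y = (x, i)" by (cases y)
  have "m - ins x + outs x = m' - ins x + outs x" using Cons.IH Cons.prems unfolding y by auto
  then show ?case using Cons.prems unfolding y by auto
qed simp

lemma arc_system_act:
  assumes "tangle n (erase A) 0" "distinct (ids A)"
  shows "arc_system n (act A {})" "passes (act A {}) \<subseteq> set (ids A) \<times> UNIV"
    "loops A {} = 0 \<Longrightarrow> passes (act A {}) = set (ids A) \<times> UNIV"
  using act_arc_system[OF arc_system_empty assms] by (auto simp: passes_def)

lemma erase_append_split: "erase C = D @ E \<Longrightarrow> \<exists>A B. C = A @ B \<and> erase A = D \<and> erase B = E"
  unfolding erase_def by (auto simp: map_eq_append_conv)

text \<open>With \<open>U \<noteq> []\<close> the first cup, and with it the base point, stays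
  outside the move.\<close>

lemma value_replace:
  assumes R: "replaceable R S T" and U: "U \<noteq> []" and l: "link_diagram (U @ S @ V)" "link_diagram (U @ T @ V)"
    and v: "value_of (U @ S @ V) v"
  shows "\<exists>v'. value_of (U @ T @ V) v' \<and> R v v'"
proof -
  obtain C :: "(nat \<times> nat) layer list" and w where C: "U @ S @ V = (Cup, 0) # erase C" "tangle 2 (erase C) 0" "distinct (ids C)"
    "loops C {} = 0" "(0, w, 1) \<in> act C {}" "casson w = v" using v unfolding value_of_def by (elim exE conjE)
  obtain U' where U': "U = (Cup, 0) # U'" using U C(1) by (cases U) auto
  have "erase C = U' @ S @ V" using C(1) U' by simp
  then obtain A1 A2 A3 where A: "C = A1 @ A2 @ A3" "erase A1 = U'" "erase A2 = S" "erase A3 = V"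
    by (metis erase_append_split)
  have tT: "tangle 2 (U' @ T @ V) 0" using l(2) by (simp add: link_diagram_def U' numeral_2_eq_2)
  obtain n k where t: "tangle 2 U' n" "tangle n S k" "tangle k V 0"
    using C(2) A by (auto simp: tangle_append)
  obtain n' k' where t': "tangle 2 U' n'" "tangle n' T k'" "tangle k' V 0"
    using tT by (auto simp: tangle_append)
  have "n' = n" "k' = k" using tangle_unique[OF t(1) t'(1)] tangle_unique_left[OF t(3) t'(3)] by auto
  note t' = t'[unfolded this]
  have d: "distinct (ids (A2 @ A3))" "distinct (ids A1)" "set (ids (A2 @ A3)) \<inter> set (ids A1) = {}" using C(3) unfolding A by auto
  obtain B where B: "erase B = T" "distinct (ids (B @ A3))" "set (ids (B @ A3)) \<inter> set (ids A1) = {}"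
    "loops B (act A3 {}) = loops A2 (act A3 {})" "exchangeable (set (ids A1)) n R (act (A2 @ A3) {}) (act (B @ A3) {})"
    using R[unfolded replaceable_def, rule_format, OF A(3) t(2) t'(2) _ d(1) _ d(3)] t(3) A(4) by auto
  define C' where "C' = A1 @ B @ A3"
  have C': "U @ T @ V = (Cup, 0) # erase C'" "tangle 2 (erase C') 0" "distinct (ids C')"
    using U' A B tT d by (auto simp: C'_def)
  note e = exchangeable_act[OF B(5) _ d(2), unfolded A, OF t(1)]
  have "loops A1 (act (A2 @ A3) {}) = 0" "loops A2 (act A3 {}) = 0" "loops A3 {} = 0"
    using C(4) unfolding A loops_append by auto
  moreover from this have "loops C' {} = 0" using e(1) B(4) unfolding C'_def loops_append by simp
  moreover have "arc_system 2 (act C {})" "arc_system 2 (act C' {})"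
    using arc_system_act[OF C(2,3)] arc_system_act[OF C'(2,3)] by auto
  ultimately obtain w' where w': "(0, w', 1) \<in> act C' {}" "R (casson w) (casson w')" "loops C' {} = 0"
    using e(2)[of w] C(5) unfolding C'_def A(1) act_append by auto
  have "value_of (U @ T @ V) (casson w')"
    unfolding value_of_def using C' w'(1,3) by (intro exI[of _ C'] exI[of _ w'] conjI) simp_all
  then show ?thesis using w'(2) C(6) by auto
qed

section \<open>Moves that leave the arcs unchanged\<close>

lemma replaceable_eqI:
  assumes "\<And>A n k M. erase A = S \<Longrightarrow> tangle n S k \<Longrightarrow> tangle n T k \<Longrightarrow> arc_system k M \<Longrightarrow>
    \<exists>B. erase B = T \<and> set (ids B) = set (ids A) \<and> (distinct (ids A) \<longrightarrow> distinct (ids B)) \<and>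
      act B M = act A M \<and> loops B M = loops (A :: (nat \<times> nat) layer list) M"
  shows "replaceable (=) S T"
  unfolding replaceable_def
proof (intro allI impI)
  fix A V :: "(nat \<times> nat) layer list" and X n k
  assume *: "erase A = S" "tangle n S k" "tangle n T k" "tangle k (erase V) 0" "distinct (ids (A @ V))"
    "finite X" "set (ids (A @ V)) \<inter> X = {}"
  have sys: "arc_system k (act V {})" using arc_system_act(1)[OF *(4)] *(5) by simp
  obtain B where B: "erase B = T" "set (ids B) = set (ids A)" "distinct (ids A) \<longrightarrow> distinct (ids B)"
    "act B (act V {}) = act A (act V {})" "loops B (act V {}) = loops A (act V {})"
    using assms[OF *(1-3) sys] by (elim exE conjE)
  have t: "tangle n (erase (A @ V)) 0" using *(1,2,4) by (auto simp: tangle_append)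
  have "exchangeable X n (=) (act (A @ V) {}) (act (A @ V) {})"
    by (rule exchangeable_refl) (use arc_system_act[OF t *(5)] *(7) in auto)
  then show "\<exists>B. erase B = T \<and> distinct (ids (B @ V)) \<and> set (ids (B @ V)) \<inter> X = {} \<and>
      loops B (act V {}) = loops A (act V {}) \<and> exchangeable X n (=) (act (A @ V) {}) (act (B @ V) {})"
    using B *(5,7) by (intro exI[of _ B]) (auto simp: act_append)
qed

lemma erase_2: "erase A = [(x, i), (y, j)] \<longleftrightarrow> (\<exists>c d. A = [(x, i, c), (y, j, d)])"
  unfolding erase_def by (auto simp: map_eq_Cons_conv)

lemma erase_1: "erase A = [(x, i)] \<longleftrightarrow> (\<exists>c. A = [(x, i, c)])"
  unfolding erase_def by (auto simp: map_eq_Cons_conv)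

lemma erase_0: "erase A = [] \<longleftrightarrow> A = []"
  unfolding erase_def by auto

lemma erase_3: "erase A = [(x, i), (y, j), (z, k)] \<longleftrightarrow> (\<exists>c d e. A = [(x, i, c), (y, j, d), (z, k, e)])"
  unfolding erase_def by (auto simp: map_eq_Cons_conv)

lemma ex_cross: "(\<exists>w. (a, w, b) \<in> cross_arcs x i c M) \<longleftrightarrow> (\<exists>w. (swap i a, w, swap i b) \<in> M)"
  unfolding cross_arcs_def in_decorate in_permute_swap by blast

text \<open>A component through both cups (\<open>r\<close> or \<open>s\<close>) is counted at the
  lower one, a component through a single cup (\<open>p\<close> or \<open>q\<close>) at that cup. As
  \<open>r\<close> or \<open>s\<close> excludes both \<open>p\<close> and \<open>q\<close>, the
  totals agree in either order.\<close>

lemma cup_cup_loops: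
  assumes M: "arc_system n M" and i: "i \<le> k"
  shows "loops [(Cup, i, c), (Cup, k + 2, d)] M = loops [(Cup, k, d), (Cup, i, c)] M"
proof -
  have g: "gap (k + 2) i = i" "gap (k + 2) (Suc i) = Suc i" "gap i k = k + 2" "gap i (Suc k) = Suc (k + 2)"
    using i by (auto simp: gap_def)
  define p where "p \<longleftrightarrow> (\<exists>w. (i, w, Suc i) \<in> M)"
  define q where "q \<longleftrightarrow> (\<exists>w. (k + 2, w, Suc (k + 2)) \<in> M)"
  define r where "r \<longleftrightarrow> (\<exists>w. (i, w, k + 2) \<in> M) \<and> (\<exists>w. (Suc (k + 2), w, Suc i) \<in> M)"
  define s where "s \<longleftrightarrow> (\<exists>w. (i, w, Suc (k + 2)) \<in> M) \<and> (\<exists>w. (k + 2, w, Suc i) \<in> M)"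
  have sym: "(\<exists>w. (a, w, b) \<in> M) \<longleftrightarrow> (\<exists>w. (b, w, a) \<in> M)" for a b using arc_systemD(4)[OF M] by metis
  have 1: "(\<exists>w. (i, w, Suc i) \<in> cup_arcs (k + 2) M) \<longleftrightarrow> p \<or> r \<or> s"
    unfolding in_cup_arcs g p_def r_def s_def by blast
  have 2: "(\<exists>w. (k, w, Suc k) \<in> cup_arcs i M) \<longleftrightarrow> q \<or> r \<or> s"
  proof -
    have "(\<exists>w. (k, w, Suc k) \<in> cup_arcs i M) \<longleftrightarrow> q \<or> ((\<exists>w. (k + 2, w, i) \<in> M) \<and> (\<exists>w. (Suc i, w, Suc (k + 2)) \<in> M)) \<or>
      ((\<exists>w. (k + 2, w, Suc i) \<in> M) \<and> (\<exists>w. (i, w, Suc (k + 2)) \<in> M))"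
      unfolding in_cup_arcs g q_def by blast
    then show ?thesis unfolding r_def s_def using sym[of "k + 2" i] sym[of "Suc i" "Suc (k + 2)"] by blast
  qed
  have ne: "Suc i \<noteq> k + 2" "Suc i \<noteq> Suc (k + 2)" "i \<noteq> Suc (k + 2)" using i by auto
  have 3: "\<not> (p \<and> (r \<or> s))" unfolding p_def r_def s_def using arc_system_unique[OF M] ne by metis
  have 4: "\<not> (q \<and> (r \<or> s))"
  proof
    assume "q \<and> (r \<or> s)"
    then obtain w where w: "(k + 2, w, Suc (k + 2)) \<in> M" and rs: "r \<or> s" unfolding q_def by blast
    show False using rs
    proof
      assume r
      then obtain v where "(i, v, k + 2) \<in> M" unfolding r_def by blast
      from arc_systemD(4)[OF M this] arc_system_unique[OF M w] ne show False by blast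
    next
      assume s
      then obtain v where "(k + 2, v, Suc i) \<in> M" unfolding s_def by blast
      from this arc_system_unique[OF M w] ne show False by blast
    qed
  qed
  have "loops [(Cup, i, c), (Cup, k + 2, d)] M = (if p \<or> r \<or> s then 1 else 0) + (if q then 1 else 0)"
    using 1 q_def by simp
  moreover have "loops [(Cup, k, d), (Cup, i, c)] M = (if q \<or> r \<or> s then 1 else 0) + (if p then 1 else 0)"
    using 2 p_def by simp
  ultimately show ?thesis using 3 4 by auto
qed

lemma event_cases: obtains "x = Cup" | "x = Cap" | "crossing x"
  by (cases x) (auto simp: crossing_def)

lemma exchange_arcs:
  assumes M: "arc_system n M" and i: "i \<le> k"
  shows "act [(x, i, c), (y, k + outs x, d)] M = act [(y, k + ins x, d), (x, i, c)] M"
    and "loops [(x, i, c), (y, k + outs x, d)] M = loops [(y, k + ins x, d), (x, i, c)] M"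
proof -
  have g: "gap i k = k + 2" "gap (k + 2) i = i" "gap (k + 2) (Suc i) = Suc i" "gap i (Suc k) = Suc (k + 2)"
    using i by (auto simp: gap_def)
  have s: "swap i (k + 2) = k + 2" "swap i (Suc (k + 2)) = Suc (k + 2)" "swap (k + 2) i = i" "swap (k + 2) (Suc i) = Suc i"
    using i by (auto simp: swap_def)
  have cr [simp]: "crossing z \<Longrightarrow> ins z = 2" "crossing z \<Longrightarrow> outs z = 2" "crossing z \<Longrightarrow> z \<noteq> Cup"
     "\<not> crossing Cup" "\<not> crossing Cap" for z by (auto simp: crossing_def)
  have e: "(\<exists>w. (k + 2, w, Suc (k + 2)) \<in> cap_arcs i M) \<longleftrightarrow> (\<exists>w. (k, w, Suc k) \<in> M)"
    "(\<exists>w. (i, w, Suc i) \<in> cap_arcs (k + 2) M) \<longleftrightarrow> (\<exists>w. (i, w, Suc i) \<in> M)"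
    using in_cap_arcs_simps(1)[of i k _ "Suc k" M] in_cap_arcs_simps(1)[of "k + 2" i _ "Suc i" M] unfolding g by simp_all
  have "act [(x, i, c), (y, k + outs x, d)] M = act [(y, k + ins x, d), (x, i, c)] M \<and>
    loops [(x, i, c), (y, k + outs x, d)] M = loops [(y, k + ins x, d), (x, i, c)] M"
  proof (cases x rule: event_cases; cases y rule: event_cases)
    assume "x = Cup" "y = Cup"
    then show ?thesis using cup_cup_exchange[OF M i] cup_cup_loops[OF M i, of c d] by simp
  next
    assume "x = Cup" "y = Cap"
    then show ?thesis using cup_cap_exchange[OF i, of M] e(2) by simp
  next
    assume "x = Cup" "crossing y"
    then show ?thesis using cup_cross_exchange[of i k y d M] g ex_cross[of i "Suc i" y "k + 2" d M] s i
      by (simp add: layer_arcs_crossing)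
  next
    assume "x = Cap" "y = Cup"
    then show ?thesis using cap_cup_exchange[OF i, of M] e(1) by simp
  next
    assume "x = Cap" "y = Cap"
    then show ?thesis using cap_cap_exchange[OF i, of M] by simp
  next
    assume "x = Cap" "crossing y"
    then show ?thesis using cap_cross_exchange[of i k y d M] g i by (simp add: layer_arcs_crossing)
  next
    assume "crossing x" "y = Cup"
    then show ?thesis using cup_cross_exchange[of "k + 2" i x c M] g ex_cross[of "k + 2" "Suc (k + 2)" x i c M] s i
      by (simp add: layer_arcs_crossing)
  next
    assume "crossing x" "y = Cap"
    then show ?thesis using cap_cross_exchange[of "k + 2" i x c M] g i by (simp add: layer_arcs_crossing)
  next
    assume "crossing x" "crossing y"
    then show ?thesis using cross_cross_exchange[of i "k + 2" x c y d M] i by (simp add: layer_arcs_crossing)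
  qed
  then show "act [(x, i, c), (y, k + outs x, d)] M = act [(y, k + ins x, d), (x, i, c)] M"
    and "loops [(x, i, c), (y, k + outs x, d)] M = loops [(y, k + ins x, d), (x, i, c)] M" by blast+
qed

lemma replaceable_exchange:
  assumes "i \<le> k"
  shows "replaceable (=) [(x, i), (y, k + outs x)] [(y, k + ins x), (x, i)]"
    and "replaceable (=) [(y, k + ins x), (x, i)] [(x, i), (y, k + outs x)]"
proof -
  show "replaceable (=) [(x, i), (y, k + outs x)] [(y, k + ins x), (x, i)]"
  proof (rule replaceable_eqI)
    fix A :: "(nat \<times> nat) layer list" and n m and M :: "(nat \<times> nat) arcs"
    assume A: "erase A = [(x, i), (y, k + outs x)]" "arc_system m M"
    then obtain c d where "A = [(x, i, c), (y, k + outs x, d)]" unfolding erase_2 by blast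
    then show "\<exists>B. erase B = [(y, k + ins x), (x, i)] \<and> set (ids B) = set (ids A) \<and> (distinct (ids A) \<longrightarrow> distinct (ids B)) \<and>
      act B M = act A M \<and> loops B M = loops A M"
      using exchange_arcs[OF A(2) assms, of x c y d] by (intro exI[of _ "[(y, k + ins x, d), (x, i, c)]"]) auto
  qed
  show "replaceable (=) [(y, k + ins x), (x, i)] [(x, i), (y, k + outs x)]"
  proof (rule replaceable_eqI)
    fix A :: "(nat \<times> nat) layer list" and n m and M :: "(nat \<times> nat) arcs"
    assume A: "erase A = [(y, k + ins x), (x, i)]" "arc_system m M"
    then obtain c d where "A = [(y, k + ins x, d), (x, i, c)]" unfolding erase_2 by blast
    then show "\<exists>B. erase B = [(x, i), (y, k + outs x)] \<and> set (ids B) = set (ids A) \<and> (distinct (ids A) \<longrightarrow> distinct (ids B)) \<and>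
      act B M = act A M \<and> loops B M = loops A M"
      using exchange_arcs[OF A(2) assms, of x c y d] by (intro exI[of _ "[(x, i, c), (y, k + outs x, d)]"]) auto
  qed
qed

lemma replaceable_zigzag:
  shows "replaceable (=) [(Cup, i), (Cap, i + 1)] []" "replaceable (=) [] [(Cup, i), (Cap, i + 1)]"
    "replaceable (=) [(Cup, i + 1), (Cap, i)] []" "replaceable (=) [] [(Cup, i + 1), (Cap, i)]"
proof -
  have l1: "act [(Cup, i, c), (Cap, i + 1, d)] M = M \<and> loops [(Cup, i, c), (Cap, i + 1, d)] M = 0"
    if "arc_system m M" for c d :: "nat \<times> nat" and M and m
  proof -
    have "i = gap (Suc i) i" by (simp add: gap_def)
    then have "(i, w, Suc i) \<notin> cap_arcs (Suc i) M" for w using in_cap_arcs_simps(4)[of i w "Suc i" M] by auto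
    then show ?thesis using zigzag_left_arcs[OF that, of i] by simp
  qed
  have l2: "act [(Cup, i + 1, c), (Cap, i, d)] M = M \<and> loops [(Cup, i + 1, c), (Cap, i, d)] M = 0"
    if "arc_system m M" for c d :: "nat \<times> nat" and M and m
    using zigzag_right_arcs[OF that, of i] by simp
  have c: "\<not> crossing Cup" "\<not> crossing Cap" by (auto simp: crossing_def)
  show "replaceable (=) [(Cup, i), (Cap, i + 1)] []"
    by (rule replaceable_eqI, rule exI[of _ "[]"]) (use l1 in \<open>auto simp: erase_2 c\<close>)
  show "replaceable (=) [(Cup, i + 1), (Cap, i)] []"
    by (rule replaceable_eqI, rule exI[of _ "[]"]) (use l2 in \<open>auto simp: erase_2 c\<close>)
  show "replaceable (=) [] [(Cup, i), (Cap, i + 1)]"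
    by (rule replaceable_eqI, rule exI[of _ "[(Cup, i, (0, 0)), (Cap, i + 1, (0, 0))]"]) (use l1 in \<open>auto simp: erase_0 c\<close>)
  show "replaceable (=) [] [(Cup, i + 1), (Cap, i)]"
    by (rule replaceable_eqI, rule exI[of _ "[(Cup, i + 1, (0, 0)), (Cap, i, (0, 0))]"]) (use l2 in \<open>auto simp: erase_0 c\<close>)
qed

text \<open>The set \<open>Y\<close> collects the labels in use outside the move, above as well as
  below, so a label outside \<open>Y\<close> can be given to a new crossing.\<close>

lemma replaceableI:
  assumes *: "\<And>(A :: (nat \<times> nat) layer list) n k M X Y. erase A = S \<Longrightarrow> tangle n S k \<Longrightarrow> tangle n T k \<Longrightarrow> arc_system k M \<Longrightarrow>
    distinct (ids A) \<Longrightarrow> finite Y \<Longrightarrow> set (ids A) \<inter> Y = {} \<Longrightarrow> X \<subseteq> Y \<Longrightarrow> fst ` passes M \<subseteq> Y \<Longrightarrow> fst ` passes M \<inter> X = {} \<Longrightarrow>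
    \<exists>B. erase B = T \<and> distinct (ids B) \<and> set (ids B) \<inter> Y = {} \<and> loops B M = loops A M \<and> exchangeable X n R (act A M) (act B M)"
  shows "replaceable R S T"
  unfolding replaceable_def
proof (intro allI impI)
  fix A V :: "(nat \<times> nat) layer list" and X n k
  assume a: "erase A = S" "tangle n S k" "tangle n T k" "tangle k (erase V) 0" "distinct (ids (A @ V))"
    "finite X" "set (ids (A @ V)) \<inter> X = {}"
  have d: "distinct (ids A)" "distinct (ids V)" "set (ids A) \<inter> (X \<union> set (ids V)) = {}" using a(5,7) by auto
  have sys: "arc_system k (act V {})" "passes (act V {}) \<subseteq> set (ids V) \<times> UNIV" using arc_system_act[OF a(4) d(2)] by auto
  have p: "fst ` passes (act V {}) \<subseteq> X \<union> set (ids V)" "fst ` passes (act V {}) \<inter> X = {}" using sys(2) a(7) by auto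
  from *[OF a(1-3) sys(1) d(1) _ d(3) _ p] a(6) obtain B where B: "erase B = T" "distinct (ids B)" "set (ids B) \<inter> (X \<union> set (ids V)) = {}"
    "loops B (act V {}) = loops A (act V {})" "exchangeable X n R (act A (act V {})) (act B (act V {}))" by auto
  have "set (ids B) \<inter> X = {}" "set (ids B) \<inter> set (ids V) = {}" using B(3) by auto
  then show "\<exists>B. erase B = T \<and> distinct (ids (B @ V)) \<and> set (ids (B @ V)) \<inter> X = {} \<and>
      loops B (act V {}) = loops A (act V {}) \<and> exchangeable X n R (act (A @ V) {}) (act (B @ V) {})"
    using B a(7) d by (intro exI[of _ B]) (auto simp: act_append)
qed

section \<open>Moves that change the Gauss word\<close>

lemma crossing_flip [simp]: "crossing (flip x) = crossing x" "flip (flip x) = x"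
  by (cases x; simp add: crossing_def)+

lemma crossing_ins [simp]: "crossing x \<Longrightarrow> ins x = 2" "crossing x \<Longrightarrow> outs x = 2" "\<not> crossing Cup" "\<not> crossing Cap"
  "crossing Over" "crossing Under"
  by (auto simp: crossing_def)

lemma crossing_not_Cup: "crossing x \<Longrightarrow> x \<noteq> Cup" "crossing x \<Longrightarrow> flip x \<noteq> Cup"
  by (cases x; simp add: crossing_def)+

lemma exchangeable_rescale:
  assumes s: "s * s = 1" and N: "arc_system n N" "fst ` passes N \<inter> X = {}" and c: "c \<notin> X"
  shows "exchangeable X n (=) (subst (\<lambda>l. [rescale c s l]) N) N"
proof -
  have "exchange_data X n (=) (subst (\<lambda>l. [rescale c s l]) N) N N (\<lambda>l. [rescale c s l]) (\<lambda>l. [l]) {c} UNIV"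
    unfolding exchange_data_def
  proof (intro conjI allI impI)
    show "({c} \<union> fst ` passes N) \<inter> X = {}" using N(2) c by auto
    show "N = subst (\<lambda>l. [l]) N" by (rule sym, rule subst_id) simp
    have "concat (map (\<lambda>l. [rescale c s l]) w) = map (rescale c s) w" for w by (induction w) auto
    then show "casson (concat (map (\<lambda>l. [rescale c s l]) w)) = casson (concat (map (\<lambda>l. [l]) w))" for w
      by (simp only: casson_rescale[OF s]) simp
  qed (use N in \<open>auto simp: rescale_def\<close>)
  then show ?thesis unfolding exchangeable_def by blast
qed

text \<open>A slide reverses one letter and flips the event. Together this is merely another choice
  of the free sign of the crossing \<open>c\<close>: a factor \<open>s\<close> at a cup and
  \<open>- s\<close> at a cap.\<close>

lemma slide_letters:
  assumes "crossing x" and "s = (if x = Over then 1 else - 1)"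
  shows "rescale c s (left_letter (flip x) c) = right_letter x c"
    "rescale c s (right_letter (flip x) c) = rev_letter (left_letter x c)"
    "rescale c (- s) (left_letter (flip x) c) = rev_letter (right_letter x c)"
    "rescale c (- s) (right_letter (flip x) c) = left_letter x c"
  using assms by (cases x; simp add: rescale_def left_letter_def right_letter_def crossing_def)+

lemma subst_rescale_cross:
  assumes "c \<notin> fst ` passes M"
  shows "subst (\<lambda>l. [rescale c s l]) (decorate (at2 i [u] [v]) (permute f M)) = decorate (at2 i [rescale c s u] [rescale c s v]) (permute f M)"
proof -
  have r: "rescale c s (rev_letter l) = rev_letter (rescale c s l)" for l by (simp add: rescale_def rev_letter_def)
  have "subst (\<lambda>l. [rescale c s l]) (permute f M) = permute f M"
  proof (rule subst_id)
    fix l assume "l \<in> letters (permute f M)"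
    then have "fst l \<in> fst ` passes M" using in_letters passes_permute by metis
    then show "[rescale c s l] = [l]" using assms by (auto simp: rescale_def)
  qed
  moreover have "subst (\<lambda>l. [rescale c s l]) (decorate (at2 i [u] [v]) (permute f M)) =
    decorate (at2 i [rescale c s u] [rescale c s v]) (subst (\<lambda>l. [rescale c s l]) (permute f M))"
    by (rule subst_decorate) (auto simp: at2_def r)
  ultimately show ?thesis by simp
qed

lemma slide_cup_exchangeable:
  assumes x: "crossing x" and t: "tangle n [(Cup, i + 1), (flip x, i)] k" and M: "arc_system k M"
    and c: "c \<notin> fst ` passes M" and X: "fst ` passes M \<inter> X = {}" "c \<notin> X"
  shows "exchangeable X n (=) (act [(Cup, i, e), (x, i + 1, c)] M) (act [(Cup, i + 1, e), (flip x, i, c)] M)"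
    and "loops [(Cup, i, e), (x, i + 1, c)] M = loops [(Cup, i + 1, e), (flip x, i, c)] M"
proof -
  define s :: int where "s = (if x = Over then 1 else - 1)"
  let ?B = "[(Cup, i + 1, e), (flip x, i, c)]"
  have sys: "arc_system n (act ?B M) \<and> passes (act ?B M) \<subseteq> passes M \<union> set (ids ?B) \<times> UNIV"
    using act_arc_system[OF M, of n ?B] t c x by auto
  have "act [(Cup, i, e), (x, i + 1, c)] M = subst (\<lambda>l. [rescale c s l]) (act ?B M)"
    using x by (simp add: layer_arcs_crossing cross_arcs_def slide_cup_arcs subst_cup
        subst_rescale_cross[OF c] slide_letters[OF x s_def])
  moreover have "exchangeable X n (=) (subst (\<lambda>l. [rescale c s l]) (act ?B M)) (act ?B M)"
  proof (rule exchangeable_rescale)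
    have "passes (act ?B M) \<subseteq> passes M \<union> {c} \<times> UNIV" using sys x by simp
    then have "fst ` passes (act ?B M) \<subseteq> fst ` passes M \<union> {c}" by force
    then show "fst ` passes (act ?B M) \<inter> X = {}" using X by blast
  qed (use sys X in \<open>auto simp: s_def\<close>)
  ultimately show "exchangeable X n (=) (act [(Cup, i, e), (x, i + 1, c)] M) (act ?B M)" by simp
  have "swap (Suc i) i = i" "swap (Suc i) (Suc i) = Suc (Suc i)" "swap i (Suc (Suc i)) = Suc (Suc i)" by (auto simp: swap_def)
  then show "loops [(Cup, i, e), (x, i + 1, c)] M = loops ?B M"
    using x by (auto simp: layer_arcs_crossing ex_cross crossing_not_Cup)
qed

lemma slide_cap_exchangeable:
  assumes x: "crossing x" and t: "tangle n [(flip x, i), (Cap, i + 1)] k" and M: "arc_system k M"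
    and c: "c \<notin> fst ` passes M" and X: "fst ` passes M \<inter> X = {}" "c \<notin> X"
  shows "exchangeable X n (=) (act [(x, i + 1, c), (Cap, i, e)] M) (act [(flip x, i, c), (Cap, i + 1, e)] M)"
    and "loops [(x, i + 1, c), (Cap, i, e)] M = loops [(flip x, i, c), (Cap, i + 1, e)] M"
proof -
  define s :: int where "s = (if x = Over then 1 else - 1)"
  let ?B = "[(flip x, i, c), (Cap, i + 1, e)]"
  have sys: "arc_system n (act ?B M) \<and> passes (act ?B M) \<subseteq> passes M \<union> set (ids ?B) \<times> UNIV"
    using act_arc_system[OF M, of n ?B] t c x by auto
  have c': "c \<notin> fst ` passes (cap_arcs (Suc i) M)" using c unfolding passes_cap .
  have "act [(x, i + 1, c), (Cap, i, e)] M = subst (\<lambda>l. [rescale c (- s) l]) (act ?B M)"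
    using x by (simp add: layer_arcs_crossing cross_arcs_def slide_cap_arcs
        subst_rescale_cross[OF c'] slide_letters[OF x s_def])
  moreover have "exchangeable X n (=) (subst (\<lambda>l. [rescale c (- s) l]) (act ?B M)) (act ?B M)"
  proof (rule exchangeable_rescale)
    have "passes (act ?B M) \<subseteq> passes M \<union> {c} \<times> UNIV" using sys x by simp
    then have "fst ` passes (act ?B M) \<subseteq> fst ` passes M \<union> {c}" by force
    then show "fst ` passes (act ?B M) \<inter> X = {}" using X by blast
  qed (use sys X in \<open>auto simp: s_def\<close>)
  ultimately show "exchangeable X n (=) (act [(x, i + 1, c), (Cap, i, e)] M) (act ?B M)" by simp
  show "loops [(x, i + 1, c), (Cap, i, e)] M = loops ?B M"
    using x by (auto simp: crossing_def)
qed

text \<open>Places fresh markers on distinct ends. Each marker is a single over passage, read with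
  sign 1 or - 1 according to the direction, as \<open>marked\<close> requires.\<close>

lemma marks:
  assumes M: "arc_system n M" and K: "K \<inter> fst ` passes M = {}"
    and d': "\<forall>a. d a = [] \<or> (\<exists>k \<in> K. d a = [(k, True, 1)])" "\<forall>a b. a \<noteq> b \<longrightarrow> d a = d b \<longrightarrow> d a = []"
  shows "arc_system n (decorate d M)" "fst ` passes (decorate d M) \<subseteq> K \<union> fst ` passes M"
    "l \<in> letters (decorate d M) \<Longrightarrow> fst l \<in> K \<Longrightarrow> fst (snd l) \<and> snd (snd l) \<in> {1, - 1}"
proof -
  have d: "d a = [] \<or> (\<exists>k \<in> K. d a = [(k, True, 1)])" "a \<noteq> b \<Longrightarrow> d a = d b \<Longrightarrow> d a = []" for a b using d' by auto
  have pd: "pass ` set (d a) = (\<lambda>l. (fst l, True)) ` set (d a)" "fst ` set (d a) \<subseteq> K" "set (d a) \<subseteq> {l. fst (snd l) \<and> snd (snd l) \<in> {1, - 1}}"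
    "set (rev_word (d a)) \<subseteq> {l. fst (snd l) \<and> snd (snd l) \<in> {1, - 1}}" for a
    using d(1)[of a] by auto
  show "arc_system n (decorate d M)"
  proof (rule arc_system_decorate[OF M])
    show "distinct (map pass (d a))" for a using d(1)[of a] by auto
    show "pass ` set (d a) \<inter> pass ` set (d b) = {}" if "a \<noteq> b" for a b
      using d(1)[of a] d(1)[of b] d(2)[OF that] by auto
    show "pass ` set (d a) \<inter> passes M = {}" for a
    proof (rule ccontr)
      assume "pass ` set (d a) \<inter> passes M \<noteq> {}"
      then obtain k where "k \<in> K" "(k, True) \<in> passes M" using d(1)[of a] by auto
      then show False using K by force
    qed
  qed
  show "fst ` passes (decorate d M) \<subseteq> K \<union> fst ` passes M"
  proof -
    have "fst ` pass ` set (d a) \<subseteq> K" for a using pd(2)[of a] by (auto simp: pass_def)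
    then show ?thesis unfolding passes_decorate[OF M] by (auto simp: image_Un image_UN)
  qed
  assume l: "l \<in> letters (decorate d M)" "fst l \<in> K"
  then have "l \<notin> letters M" using in_letters K by blast
  then obtain a where "l \<in> set (d a) \<union> set (rev_word (d a))" using l(1) letters_decorate[of d M] by blast
  then show "fst (snd l) \<and> snd (snd l) \<in> {1, - 1}" using pd(3,4)[of a] by blast
qed

lemma letters_cup: "letters (cup_arcs i M) \<subseteq> letters M"
  unfolding letters_def in_cup_arcs by fastforce

lemma expand_fixed: "dom W \<subseteq> K \<Longrightarrow> fst l \<notin> K \<Longrightarrow> expand W l = [l]"
  by (rule expand_id) blast

lemma exchangeable_expand:
  assumes N: "arc_system n N" "(K \<union> fst ` passes N) \<inter> X = {}"
    and l: "\<And>l. l \<in> letters N \<Longrightarrow> fst l \<in> K \<Longrightarrow> fst (snd l) \<and> snd (snd l) \<in> {1, - 1}"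
    and M: "M = subst (expand W) N" "M' = subst (expand W') N" "dom W \<subseteq> K" "dom W' \<subseteq> K"
    and R: "\<And>w. marked K w \<Longrightarrow> passes N \<subseteq> pass ` set w \<Longrightarrow> distinct (map pass (concat (map (expand W) w))) \<Longrightarrow>
      distinct (map pass (concat (map (expand W') w))) \<Longrightarrow> R (casson (concat (map (expand W) w))) (casson (concat (map (expand W') w)))"
  shows "exchangeable X n R M M'"
proof -
  have "exchange_data X n R M M' N (expand W) (expand W') K {l. fst (snd l) \<and> snd (snd l) \<in> {1, - 1}}"
    unfolding exchange_data_def
  proof (intro conjI)
    show "\<forall>l. fst l \<notin> K \<longrightarrow> expand W l = [l]" using expand_fixed[OF M(3)] by blast
    show "\<forall>l. fst l \<notin> K \<longrightarrow> expand W' l = [l]" using expand_fixed[OF M(4)] by blast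
  qed (use N M l R in \<open>auto simp: marked_def\<close>)
  then show ?thesis unfolding exchangeable_def by blast
qed

lemma disjoint_union_mono: "P \<subseteq> K \<union> Q \<Longrightarrow> Q \<inter> X = {} \<Longrightarrow> K \<inter> X = {} \<Longrightarrow> (K \<union> P) \<inter> X = {}"
  by blast

lemma R1_cup_exchangeable:
  assumes x: "crossing x" and i: "i \<le> n" and M: "arc_system (n + 2) M"
    and c: "c \<notin> fst ` passes M" and X: "fst ` passes M \<inter> X = {}" "c \<notin> X"
  shows "exchangeable X n (=) (act [(Cup, i, e), (x, i, c)] M) (act [(Cup, i, e)] M)"
    and "loops [(Cup, i, e), (x, i, c)] M = loops [(Cup, i, e)] M"
proof -
  let ?W = "[c \<mapsto> [rev_letter (left_letter x c), right_letter x c]]"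
  let ?d = "at2 i [(c, True, 1)] []"
    have d: "\<forall>a. ?d a = [] \<or> (\<exists>k \<in> {c}. ?d a = [(k, True, 1)])" "\<forall>a b. a \<noteq> b \<longrightarrow> ?d a = ?d b \<longrightarrow> ?d a = []"
    by (auto simp: at2_def split: if_splits)
  have K: "{c} \<inter> fst ` passes M = {}" using c by simp
  note m = marks[where d = ?d, OF M K d(1) d(2)]
  have W: "dom ?W \<inter> fst ` passes M = {}" "dom [c \<mapsto> []] \<inter> fst ` passes M = {}" using c by auto
  have A: "act [(Cup, i, e), (x, i, c)] M = subst (expand ?W) (cup_arcs i (decorate ?d M))"
    using x unfolding subst_cup
    by (subst subst_expand_decorate[OF W(1), where e = "at2 i [rev_letter (left_letter x c), right_letter x c] []"])
      (auto simp: layer_arcs_crossing cross_arcs_def R1_cup_arcs at2_def)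
  have B: "act [(Cup, i, e)] M = subst (expand [c \<mapsto> []]) (cup_arcs i (decorate ?d M))"
    unfolding subst_cup
    by (subst subst_expand_decorate[OF W(2), where e = "\<lambda>_. []"]) (auto simp: at2_def decorate_Nil)
  show "exchangeable X n (=) (act [(Cup, i, e), (x, i, c)] M) (act [(Cup, i, e)] M)"
  proof (rule exchangeable_expand[OF _ _ _ A B])
    show "arc_system n (cup_arcs i (decorate ?d M))" using arc_system_cup[OF m(1) i] .
    show "({c} \<union> fst ` passes (cup_arcs i (decorate ?d M))) \<inter> X = {}"
      by (rule disjoint_union_mono[OF subset_trans[OF image_mono[OF passes_cup_subset] m(2)] X(1)]) (use X in auto)
    show "fst (snd l) \<and> snd (snd l) \<in> {1, - 1}" if "l \<in> letters (cup_arcs i (decorate ?d M))" "fst l \<in> {c}" for l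
      using m(3)[OF subsetD[OF letters_cup that(1)] that(2)] .
    show "casson (concat (map (expand ?W) w)) = casson (concat (map (expand [c \<mapsto> []]) w))"
      if "marked {c} w" "distinct (map pass (concat (map (expand ?W) w)))" for w
      by (rule casson_expand_R1) (use that in auto)
  qed auto
  show "loops [(Cup, i, e), (x, i, c)] M = loops [(Cup, i, e)] M"
    using x arc_systemD(4)[OF M] by (auto simp: layer_arcs_crossing ex_cross)
qed

lemma R1_cap_exchangeable:
  assumes x: "crossing x" and i: "i \<le> n" and M: "arc_system n M"
    and c: "c \<notin> fst ` passes M" and X: "fst ` passes M \<inter> X = {}" "c \<notin> X"
  shows "exchangeable X (n + 2) (=) (act [(x, i, c), (Cap, i, e)] M) (act [(Cap, i, e)] M)"
    and "loops [(x, i, c), (Cap, i, e)] M = loops [(Cap, i, e)] M"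
proof -
  let ?W = "[c \<mapsto> [left_letter x c, rev_letter (right_letter x c)]]"
  let ?d = "at2 i [(c, True, 1)] []"
  let ?M = "cap_arcs i M"
  have M': "arc_system (n + 2) ?M" using arc_system_cap[OF M i] .
  have d: "\<forall>a. ?d a = [] \<or> (\<exists>k \<in> {c}. ?d a = [(k, True, 1)])" "\<forall>a b. a \<noteq> b \<longrightarrow> ?d a = ?d b \<longrightarrow> ?d a = []"
    by (auto simp: at2_def split: if_splits)
  have K: "{c} \<inter> fst ` passes ?M = {}" using c by (simp add: passes_cap)
  note m = marks[where d = ?d, OF M' K d(1) d(2)]
  have W: "dom ?W \<inter> fst ` passes ?M = {}" "dom [c \<mapsto> []] \<inter> fst ` passes ?M = {}" using c by (auto simp: passes_cap)
  have A: "act [(x, i, c), (Cap, i, e)] M = subst (expand ?W) (decorate ?d ?M)"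
    using x
    by (subst subst_expand_decorate[OF W(1), where e = "at2 i [left_letter x c, rev_letter (right_letter x c)] []"])
      (auto simp: layer_arcs_crossing cross_arcs_def R1_cap_arcs at2_def)
  have B: "act [(Cap, i, e)] M = subst (expand [c \<mapsto> []]) (decorate ?d ?M)"
    by (subst subst_expand_decorate[OF W(2), where e = "\<lambda>_. []"]) (auto simp: at2_def decorate_Nil)
  show "exchangeable X (n + 2) (=) (act [(x, i, c), (Cap, i, e)] M) (act [(Cap, i, e)] M)"
  proof (rule exchangeable_expand[OF _ _ _ A B])
    show "arc_system (n + 2) (decorate ?d ?M)" using m(1) .
    show "({c} \<union> fst ` passes (decorate ?d ?M)) \<inter> X = {}" by (rule disjoint_union_mono[OF m(2)]) (use X in \<open>auto simp: passes_cap\<close>)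
    show "fst (snd l) \<and> snd (snd l) \<in> {1, - 1}" if "l \<in> letters (decorate ?d ?M)" "fst l \<in> {c}" for l
      using m(3)[OF that] .
    show "casson (concat (map (expand ?W) w)) = casson (concat (map (expand [c \<mapsto> []]) w))"
      if "marked {c} w" "distinct (map pass (concat (map (expand ?W) w)))" for w
      by (rule casson_expand_R1) (use that in auto)
  qed auto
  show "loops [(x, i, c), (Cap, i, e)] M = loops [(Cap, i, e)] M" using x by (auto simp: crossing_def)
qed

lemma R2_exchangeable:
  assumes x: "crossing x" and M: "arc_system n M" and cd: "c \<noteq> d"
    and c: "c \<notin> fst ` passes M" "d \<notin> fst ` passes M" and X: "fst ` passes M \<inter> X = {}" "c \<notin> X" "d \<notin> X"
  shows "exchangeable X n (=) (act [(x, i, c), (flip x, i, d)] M) M"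
    and "loops [(x, i, c), (flip x, i, d)] M = 0"
proof -
  let ?W = "[c \<mapsto> [left_letter x c, right_letter (flip x) d], d \<mapsto> [right_letter x c, left_letter (flip x) d]]"
  let ?d = "at2 i [(c, True, 1)] [(d, True, 1)]"
  have d: "\<forall>a. ?d a = [] \<or> (\<exists>k \<in> {c, d}. ?d a = [(k, True, 1)])" "\<forall>a b. a \<noteq> b \<longrightarrow> ?d a = ?d b \<longrightarrow> ?d a = []"
    using cd by (auto simp: at2_def split: if_splits)
  have K: "{c, d} \<inter> fst ` passes M = {}" using c by simp
  note m = marks[where d = ?d, OF M K d(1) d(2)]
  have W: "dom ?W \<inter> fst ` passes M = {}" "dom [c \<mapsto> [], d \<mapsto> []] \<inter> fst ` passes M = {}" using c by auto
  have A: "act [(x, i, c), (flip x, i, d)] M = subst (expand ?W) (decorate ?d M)"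
    using x cd
    by (subst subst_expand_decorate[OF W(1), where e = "at2 i [left_letter x c, right_letter (flip x) d] [right_letter x c, left_letter (flip x) d]"])
      (auto simp: layer_arcs_crossing cross_arcs_def R2_arcs at2_def)
  have B: "M = subst (expand [c \<mapsto> [], d \<mapsto> []]) (decorate ?d M)"
    using cd by (subst subst_expand_decorate[OF W(2), where e = "\<lambda>_. []"]) (auto simp: at2_def decorate_Nil)
  show "exchangeable X n (=) (act [(x, i, c), (flip x, i, d)] M) M"
  proof (rule exchangeable_expand[OF _ _ _ A B])
    show "arc_system n (decorate ?d M)" using m(1) .
    show "({c, d} \<union> fst ` passes (decorate ?d M)) \<inter> X = {}" by (rule disjoint_union_mono[OF m(2)]) (use X in auto)
    show "fst (snd l) \<and> snd (snd l) \<in> {1, - 1}" if "l \<in> letters (decorate ?d M)" "fst l \<in> {c, d}" for l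
      using m(3)[OF that] .
    show "casson (concat (map (expand ?W) w)) = casson (concat (map (expand [c \<mapsto> [], d \<mapsto> []]) w))"
      if "marked {c, d} w" for w
    proof (rule casson_expand_R2[OF that cd])
      \<comment> \<open>One strand is over at both crossings and the other under at both; the four
        letter signs multiply to - 1.\<close>
      show "?W = [c \<mapsto> [(c, x = Over, 1), (d, x = Over, if x = Over then - 1 else 1)],
        d \<mapsto> [(c, \<not> x = Over, if x = Over then 1 else - 1), (d, \<not> x = Over, 1)]]"
        using x by (cases x) (auto simp: left_letter_def right_letter_def crossing_def)
    qed auto
  qed auto
  show "loops [(x, i, c), (flip x, i, d)] M = 0" using x by (cases x) (auto simp: crossing_def)
qed

lemma triangle_exchangeable:
  assumes x: "crossing x" "crossing y" "crossing z" and M: "arc_system n M" and i: "i + 3 \<le> n"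
    and abc: "a \<noteq> b" "a \<noteq> c" "b \<noteq> c"
    and abc': "a \<notin> fst ` passes M" "b \<notin> fst ` passes M" "c \<notin> fst ` passes M" and X: "fst ` passes M \<inter> X = {}" "a \<notin> X" "b \<notin> X" "c \<notin> X"
    and R: "R = (if x = z \<and> y = flip x then (\<lambda>v w. \<bar>v - w\<bar> = 1) else (=))"
  shows "exchangeable X n R (act [(x, i, a), (y, i + 1, b), (z, i, c)] M) (act [(z, i + 1, c), (y, i, b), (x, i + 1, a)] M)"
    and "loops [(x, i, a), (y, i + 1, b), (z, i, c)] M = loops [(z, i + 1, c), (y, i, b), (x, i + 1, a)] M"
proof -
  let ?p = "x = Over" and ?q = "y = Over" and ?r = "z = Over"
  let ?d = "at3 i [(a, True, 1)] [(b, True, 1)] [(c, True, 1)]"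
  let ?M = "permute (turn3 i) M"
  have M': "arc_system n ?M"
    using arc_system_permute_swap[OF arc_system_permute_swap[OF arc_system_permute_swap[OF M]], of i "Suc i" i] i
    by (simp add: permute_permute turn3_def comp_assoc)
  have pM: "passes ?M = passes M" by (rule passes_permute)
  have d: "\<forall>k. ?d k = [] \<or> (\<exists>l \<in> {a, b, c}. ?d k = [(l, True, 1)])" "\<forall>k l. k \<noteq> l \<longrightarrow> ?d k = ?d l \<longrightarrow> ?d k = []"
    using abc by (auto simp: at3_def split: if_splits)
  have K: "{a, b, c} \<inter> fst ` passes ?M = {}" using abc' pM by simp
  note m = marks[where d = ?d, OF M' K d(1) d(2)]
  let ?W = "triangle a b c ?p ?q ?r" and ?W' = "triangle' a b c ?p ?q ?r"
  have dom: "dom ?W \<subseteq> {a, b, c}" "dom ?W' \<subseteq> {a, b, c}" by (auto simp: triangle_def triangle'_def split: if_splits)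
  then have W: "dom ?W \<inter> fst ` passes ?M = {}" "dom ?W' \<inter> fst ` passes ?M = {}" using K by blast+
  have L: "left_letter u k = (k, u = Over, 1)" for u k by (simp add: left_letter_def)
  have Rr: "right_letter u k = (k, u \<noteq> Over, sgn_of (u = Over))" if "crossing u" for u k
    using that by (cases u) (auto simp: right_letter_def sgn_of_def crossing_def)
  have A: "act [(x, i, a), (y, i + 1, b), (z, i, c)] M = subst (expand ?W) (decorate ?d ?M)"
    using x abc
    by (subst subst_expand_decorate[OF W(1), where e = "at3 i [left_letter x a, left_letter y b] [right_letter x a, left_letter z c] [right_letter y b, right_letter z c]"])
      (auto simp: layer_arcs_crossing cross_arcs_def R3_arcs at3_def triangle_def L Rr)
  have B: "act [(z, i + 1, c), (y, i, b), (x, i + 1, a)] M = subst (expand ?W') (decorate ?d ?M)"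
    using x abc
    by (subst subst_expand_decorate[OF W(2), where e = "at3 i [left_letter y b, left_letter x a] [left_letter z c, right_letter x a] [right_letter z c, right_letter y b]"])
      (auto simp: layer_arcs_crossing cross_arcs_def R3_arcs at3_def triangle'_def L Rr)
  have cyc: "(x = z \<and> y = flip x) \<longleftrightarrow> ?p = ?r \<and> ?q \<noteq> ?p"
    using x by (cases x; cases y; cases z) (auto simp: crossing_def)
  show "exchangeable X n R (act [(x, i, a), (y, i + 1, b), (z, i, c)] M) (act [(z, i + 1, c), (y, i, b), (x, i + 1, a)] M)"
  proof (rule exchangeable_expand[OF _ _ _ A B dom])
    show "arc_system n (decorate ?d ?M)" using m(1) .
    show "({a, b, c} \<union> fst ` passes (decorate ?d ?M)) \<inter> X = {}" by (rule disjoint_union_mono[OF m(2)]) (use X pM in auto)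
    show "fst (snd l) \<and> snd (snd l) \<in> {1, - 1}" if "l \<in> letters (decorate ?d ?M)" "fst l \<in> {a, b, c}" for l
      using m(3)[OF that] .
    fix w assume w: "marked {a, b, c} w" "passes (decorate ?d ?M) \<subseteq> pass ` set w"
      "distinct (map pass (concat (map (expand ?W) w)))" "distinct (map pass (concat (map (expand ?W') w)))"
    have "pass ` set (?d i) \<union> pass ` set (?d (Suc i)) \<union> pass ` set (?d (Suc (Suc i))) \<subseteq> passes (decorate ?d ?M)"
      unfolding passes_decorate[OF M'] using i by (intro Un_least) (auto intro!: UN_I)
    \<comment> \<open>The word of a one-component diagram runs through all three strands and hence
      contains every marker; this makes the change exactly 1 or - 1 in the cyclic case.\<close>
    then have full: "{(a, True), (b, True), (c, True)} \<subseteq> pass ` set w" using w(2) by (auto simp: at3_def)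
    note T = casson_triangle[OF w(1) abc w(3,4) refl]
    show "R (casson (concat (map (expand ?W) w))) (casson (concat (map (expand ?W') w)))"
      unfolding R cyc using T(1) T(2)[OF full] by auto
  qed
  show "loops [(x, i, a), (y, i + 1, b), (z, i, c)] M = loops [(z, i + 1, c), (y, i, b), (x, i + 1, a)] M"
    using x by (cases x; cases y; cases z) (auto simp: crossing_def)
qed

lemma exchangeable_commute:
  assumes "exchangeable X n R M M'" "\<And>x y. R x y = R y x"
  shows "exchangeable X n R M' M"
proof -
  have "(\<lambda>x y. R y x) = R" using assms(2) by (intro ext) simp
  then show ?thesis using exchangeable_sym[OF assms(1)] by simp
qed

text \<open>Labels are pairs of naturals: an infinite supply of fresh ones, and natural coordinates
  for crossings in columns or blocks.\<close>

lemma fresh_id: "finite (Y :: (nat \<times> nat) set) \<Longrightarrow> \<exists>c. c \<notin> Y"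
  by (rule ex_new_if_finite) (simp_all add: finite_prod)

lemma replaceable_slide_cup:
  assumes x: "crossing x"
  shows "replaceable (=) [(Cup, i), (x, i + 1)] [(Cup, i + 1), (flip x, i)]"
    and "replaceable (=) [(Cup, i + 1), (flip x, i)] [(Cup, i), (x, i + 1)]"
proof -
  show "replaceable (=) [(Cup, i), (x, i + 1)] [(Cup, i + 1), (flip x, i)]"
  proof (rule replaceableI)
    fix A :: "(nat \<times> nat) layer list" and n k M X Y
    assume A: "erase A = [(Cup, i), (x, i + 1)]" and t: "tangle n [(Cup, i + 1), (flip x, i)] k" and M: "arc_system k M"
      and Y: "set (ids A) \<inter> Y = {}" "X \<subseteq> Y" "fst ` passes M \<subseteq> Y" "fst ` passes M \<inter> X = {}"
    obtain e c where A': "A = [(Cup, i, e), (x, i + 1, c)]" using A unfolding erase_2 by blast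
    have c: "c \<notin> Y" using Y(1) x by (simp add: A')
    then have "c \<notin> fst ` passes M" "c \<notin> X" using Y by blast+
    note S = slide_cup_exchangeable[OF x t M this(1) Y(4) this(2), of e]
    show "\<exists>B. erase B = [(Cup, i + 1), (flip x, i)] \<and> distinct (ids B) \<and> set (ids B) \<inter> Y = {} \<and> loops B M = loops A M \<and>
      exchangeable X n (=) (act A M) (act B M)"
      unfolding A' by (rule exI[of _ "[(Cup, i + 1, e), (flip x, i, c)]"], intro conjI S(1) S(2)[symmetric]) (use x c in auto)
  qed
  show "replaceable (=) [(Cup, i + 1), (flip x, i)] [(Cup, i), (x, i + 1)]"
  proof (rule replaceableI)
    fix A :: "(nat \<times> nat) layer list" and n k M X Y
    assume A: "erase A = [(Cup, i + 1), (flip x, i)]" and t: "tangle n [(Cup, i + 1), (flip x, i)] k" and M: "arc_system k M"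
      and Y: "set (ids A) \<inter> Y = {}" "X \<subseteq> Y" "fst ` passes M \<subseteq> Y" "fst ` passes M \<inter> X = {}"
    obtain e c where A': "A = [(Cup, i + 1, e), (flip x, i, c)]" using A unfolding erase_2 by blast
    have c: "c \<notin> Y" using Y(1) x by (simp add: A')
    then have "c \<notin> fst ` passes M" "c \<notin> X" using Y by blast+
    note S = slide_cup_exchangeable[OF x t M this(1) Y(4) this(2), of e]
    show "\<exists>B. erase B = [(Cup, i), (x, i + 1)] \<and> distinct (ids B) \<and> set (ids B) \<inter> Y = {} \<and> loops B M = loops A M \<and>
      exchangeable X n (=) (act A M) (act B M)"
      unfolding A' by (rule exI[of _ "[(Cup, i, e), (x, i + 1, c)]"], intro conjI S(2) exchangeable_commute[OF S(1)]) (use x c in auto)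
  qed
qed

lemma replaceable_slide_cap:
  assumes x: "crossing x"
  shows "replaceable (=) [(x, i + 1), (Cap, i)] [(flip x, i), (Cap, i + 1)]"
    and "replaceable (=) [(flip x, i), (Cap, i + 1)] [(x, i + 1), (Cap, i)]"
proof -
  show "replaceable (=) [(x, i + 1), (Cap, i)] [(flip x, i), (Cap, i + 1)]"
  proof (rule replaceableI)
    fix A :: "(nat \<times> nat) layer list" and n k M X Y
    assume A: "erase A = [(x, i + 1), (Cap, i)]" and t: "tangle n [(flip x, i), (Cap, i + 1)] k" and M: "arc_system k M"
      and Y: "set (ids A) \<inter> Y = {}" "X \<subseteq> Y" "fst ` passes M \<subseteq> Y" "fst ` passes M \<inter> X = {}"
    obtain e c where A': "A = [(x, i + 1, c), (Cap, i, e)]" using A unfolding erase_2 by blast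
    have c: "c \<notin> Y" using Y(1) x by (simp add: A')
    then have "c \<notin> fst ` passes M" "c \<notin> X" using Y by blast+
    note S = slide_cap_exchangeable[OF x t M this(1) Y(4) this(2), of e]
    show "\<exists>B. erase B = [(flip x, i), (Cap, i + 1)] \<and> distinct (ids B) \<and> set (ids B) \<inter> Y = {} \<and> loops B M = loops A M \<and>
      exchangeable X n (=) (act A M) (act B M)"
      unfolding A' by (rule exI[of _ "[(flip x, i, c), (Cap, i + 1, e)]"], intro conjI S(1) S(2)[symmetric]) (use x c in auto)
  qed
  show "replaceable (=) [(flip x, i), (Cap, i + 1)] [(x, i + 1), (Cap, i)]"
  proof (rule replaceableI)
    fix A :: "(nat \<times> nat) layer list" and n k M X Y
    assume A: "erase A = [(flip x, i), (Cap, i + 1)]" and t: "tangle n [(flip x, i), (Cap, i + 1)] k" and M: "arc_system k M"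
      and Y: "set (ids A) \<inter> Y = {}" "X \<subseteq> Y" "fst ` passes M \<subseteq> Y" "fst ` passes M \<inter> X = {}"
    obtain e c where A': "A = [(flip x, i, c), (Cap, i + 1, e)]" using A unfolding erase_2 by blast
    have c: "c \<notin> Y" using Y(1) x by (simp add: A')
    then have "c \<notin> fst ` passes M" "c \<notin> X" using Y by blast+
    note S = slide_cap_exchangeable[OF x t M this(1) Y(4) this(2), of e]
    show "\<exists>B. erase B = [(x, i + 1), (Cap, i)] \<and> distinct (ids B) \<and> set (ids B) \<inter> Y = {} \<and> loops B M = loops A M \<and>
      exchangeable X n (=) (act A M) (act B M)"
      unfolding A' by (rule exI[of _ "[(x, i + 1, c), (Cap, i, e)]"], intro conjI S(2) exchangeable_commute[OF S(1)]) (use x c in auto)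
  qed
qed

lemma replaceable_R1_cup:
  assumes x: "crossing x"
  shows "replaceable (=) [(Cup, i), (x, i)] [(Cup, i)]" and "replaceable (=) [(Cup, i)] [(Cup, i), (x, i)]"
proof -
  show "replaceable (=) [(Cup, i), (x, i)] [(Cup, i)]"
  proof (rule replaceableI)
    fix A :: "(nat \<times> nat) layer list" and n k M X Y
    assume A: "erase A = [(Cup, i), (x, i)]" and t: "tangle n [(Cup, i)] k" and M: "arc_system k M"
      and Y: "set (ids A) \<inter> Y = {}" "X \<subseteq> Y" "fst ` passes M \<subseteq> Y" "fst ` passes M \<inter> X = {}"
    obtain e c where A': "A = [(Cup, i, e), (x, i, c)]" using A unfolding erase_2 by blast
    have c: "c \<notin> Y" using Y(1) x by (simp add: A')
    then have "c \<notin> fst ` passes M" "c \<notin> X" using Y by blast+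
    moreover have "i \<le> n" "k = n + 2" using t by auto
    ultimately have S: "exchangeable X n (=) (act [(Cup, i, e), (x, i, c)] M) (act [(Cup, i, e)] M)"
      "loops [(Cup, i, e), (x, i, c)] M = loops [(Cup, i, e)] M"
      using R1_cup_exchangeable[OF x _ _ _ Y(4), of i n c e] M by auto
    show "\<exists>B. erase B = [(Cup, i)] \<and> distinct (ids B) \<and> set (ids B) \<inter> Y = {} \<and> loops B M = loops A M \<and>
      exchangeable X n (=) (act A M) (act B M)"
      unfolding A' by (rule exI[of _ "[(Cup, i, e)]"], intro conjI S(1) S(2)[symmetric]) auto
  qed
  show "replaceable (=) [(Cup, i)] [(Cup, i), (x, i)]"
  proof (rule replaceableI)
    fix A :: "(nat \<times> nat) layer list" and n k M X Y
    assume A: "erase A = [(Cup, i)]" and t: "tangle n [(Cup, i)] k" and M: "arc_system k M" and Yf: "finite Y"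
      and Y: "set (ids A) \<inter> Y = {}" "X \<subseteq> Y" "fst ` passes M \<subseteq> Y" "fst ` passes M \<inter> X = {}"
    obtain e where A': "A = [(Cup, i, e)]" using A unfolding erase_1 by blast
    obtain c where c: "c \<notin> Y" using fresh_id[OF Yf] by blast
    then have "c \<notin> fst ` passes M" "c \<notin> X" using Y by blast+
    moreover have "i \<le> n" "k = n + 2" using t by auto
    ultimately have S: "exchangeable X n (=) (act [(Cup, i, e), (x, i, c)] M) (act [(Cup, i, e)] M)"
      "loops [(Cup, i, e), (x, i, c)] M = loops [(Cup, i, e)] M"
      using R1_cup_exchangeable[OF x _ _ _ Y(4), of i n c e] M by auto
    show "\<exists>B. erase B = [(Cup, i), (x, i)] \<and> distinct (ids B) \<and> set (ids B) \<inter> Y = {} \<and> loops B M = loops A M \<and>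
      exchangeable X n (=) (act A M) (act B M)"
      unfolding A' by (rule exI[of _ "[(Cup, i, e), (x, i, c)]"], intro conjI S(2) exchangeable_commute[OF S(1)]) (use x c in auto)
  qed
qed

lemma replaceable_R1_cap:
  assumes x: "crossing x"
  shows "replaceable (=) [(x, i), (Cap, i)] [(Cap, i)]" and "replaceable (=) [(Cap, i)] [(x, i), (Cap, i)]"
proof -
  show "replaceable (=) [(x, i), (Cap, i)] [(Cap, i)]"
  proof (rule replaceableI)
    fix A :: "(nat \<times> nat) layer list" and n k M X Y
    assume A: "erase A = [(x, i), (Cap, i)]" and t: "tangle n [(Cap, i)] k" and M: "arc_system k M"
      and Y: "set (ids A) \<inter> Y = {}" "X \<subseteq> Y" "fst ` passes M \<subseteq> Y" "fst ` passes M \<inter> X = {}"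
    obtain e c where A': "A = [(x, i, c), (Cap, i, e)]" using A unfolding erase_2 by blast
    have c: "c \<notin> Y" using Y(1) x by (simp add: A')
    then have "c \<notin> fst ` passes M" "c \<notin> X" using Y by blast+
    moreover have "i \<le> k" "n = k + 2" using t by auto
    ultimately have S: "exchangeable X n (=) (act [(x, i, c), (Cap, i, e)] M) (act [(Cap, i, e)] M)"
      "loops [(x, i, c), (Cap, i, e)] M = loops [(Cap, i, e)] M"
      using R1_cap_exchangeable[OF x _ M _ Y(4), of i c e] by auto
    show "\<exists>B. erase B = [(Cap, i)] \<and> distinct (ids B) \<and> set (ids B) \<inter> Y = {} \<and> loops B M = loops A M \<and>
      exchangeable X n (=) (act A M) (act B M)"
      unfolding A' by (rule exI[of _ "[(Cap, i, e)]"], intro conjI S(1) S(2)[symmetric]) auto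
  qed
  show "replaceable (=) [(Cap, i)] [(x, i), (Cap, i)]"
  proof (rule replaceableI)
    fix A :: "(nat \<times> nat) layer list" and n k M X Y
    assume A: "erase A = [(Cap, i)]" and t: "tangle n [(Cap, i)] k" and M: "arc_system k M" and Yf: "finite Y"
      and Y: "set (ids A) \<inter> Y = {}" "X \<subseteq> Y" "fst ` passes M \<subseteq> Y" "fst ` passes M \<inter> X = {}"
    obtain e where A': "A = [(Cap, i, e)]" using A unfolding erase_1 by blast
    obtain c where c: "c \<notin> Y" using fresh_id[OF Yf] by blast
    then have "c \<notin> fst ` passes M" "c \<notin> X" using Y by blast+
    moreover have "i \<le> k" "n = k + 2" using t by auto
    ultimately have S: "exchangeable X n (=) (act [(x, i, c), (Cap, i, e)] M) (act [(Cap, i, e)] M)"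
      "loops [(x, i, c), (Cap, i, e)] M = loops [(Cap, i, e)] M"
      using R1_cap_exchangeable[OF x _ M _ Y(4), of i c e] by auto
    show "\<exists>B. erase B = [(x, i), (Cap, i)] \<and> distinct (ids B) \<and> set (ids B) \<inter> Y = {} \<and> loops B M = loops A M \<and>
      exchangeable X n (=) (act A M) (act B M)"
      unfolding A' by (rule exI[of _ "[(x, i, c), (Cap, i, e)]"], intro conjI S(2) exchangeable_commute[OF S(1)]) (use x c in auto)
  qed
qed

lemma replaceable_R2:
  assumes x: "crossing x"
  shows "replaceable (=) [(x, i), (flip x, i)] []" and "replaceable (=) [] [(x, i), (flip x, i)]"
proof -
  show "replaceable (=) [(x, i), (flip x, i)] []"
  proof (rule replaceableI)
    fix A :: "(nat \<times> nat) layer list" and n k M X Y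
    assume A: "erase A = [(x, i), (flip x, i)]" and t: "tangle n [] k" and M: "arc_system k M" and dA: "distinct (ids A)"
      and Y: "set (ids A) \<inter> Y = {}" "X \<subseteq> Y" "fst ` passes M \<subseteq> Y" "fst ` passes M \<inter> X = {}"
    obtain c d where A': "A = [(x, i, c), (flip x, i, d)]" using A unfolding erase_2 by blast
    have cd: "c \<noteq> d" "c \<notin> Y" "d \<notin> Y" using Y(1) dA x by (simp_all add: A')
    then have "c \<notin> fst ` passes M" "d \<notin> fst ` passes M" "c \<notin> X" "d \<notin> X" using Y by blast+
    moreover have "k = n" using t by auto
    ultimately have S: "exchangeable X n (=) (act A M) M" "loops A M = 0"
      unfolding A' using R2_exchangeable[OF x M cd(1) _ _ Y(4), of i] by auto
    show "\<exists>B. erase B = [] \<and> distinct (ids B) \<and> set (ids B) \<inter> Y = {} \<and> loops B M = loops A M \<and>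
      exchangeable X n (=) (act A M) (act B M)"
      by (rule exI[of _ "[]"]) (use S in auto)
  qed
  show "replaceable (=) [] [(x, i), (flip x, i)]"
  proof (rule replaceableI)
    fix A :: "(nat \<times> nat) layer list" and n k M X Y
    assume A: "erase A = []" and t: "tangle n [] k" and M: "arc_system k M" and Yf: "finite Y"
      and Y: "set (ids A) \<inter> Y = {}" "X \<subseteq> Y" "fst ` passes M \<subseteq> Y" "fst ` passes M \<inter> X = {}"
    have A': "A = []" using A unfolding erase_0 .
    obtain c where c: "c \<notin> Y" using fresh_id[OF Yf] by blast
    obtain d where d: "d \<notin> insert c Y" using fresh_id[of "insert c Y"] Yf by blast
    have cd: "c \<noteq> d" "d \<notin> Y" using d by auto
    then have "c \<notin> fst ` passes M" "d \<notin> fst ` passes M" "c \<notin> X" "d \<notin> X" using Y c by blast+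
    moreover have "k = n" using t by auto
    ultimately have S: "exchangeable X n (=) (act [(x, i, c), (flip x, i, d)] M) M" "loops [(x, i, c), (flip x, i, d)] M = 0"
      using R2_exchangeable[OF x M cd(1) _ _ Y(4), of i] by auto
    have E: "exchangeable X n (=) (act A M) (act [(x, i, c), (flip x, i, d)] M)"
      using exchangeable_commute[OF S(1)] by (auto simp: A')
    show "\<exists>B. erase B = [(x, i), (flip x, i)] \<and> distinct (ids B) \<and> set (ids B) \<inter> Y = {} \<and> loops B M = loops A M \<and>
      exchangeable X n (=) (act A M) (act B M)"
      by (rule exI[of _ "[(x, i, c), (flip x, i, d)]"], intro conjI E) (use S cd c x A' in auto)
  qed
qed

lemma replaceable_triangle:
  assumes x: "crossing x" "crossing y" "crossing z"
    and R: "R = (if x = z \<and> y = flip x then (\<lambda>v w. \<bar>v - w\<bar> = 1) else (=))"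
  shows "replaceable R [(x, i), (y, i + 1), (z, i)] [(z, i + 1), (y, i), (x, i + 1)]"
    and "replaceable R [(z, i + 1), (y, i), (x, i + 1)] [(x, i), (y, i + 1), (z, i)]"
proof -
  have Rs: "R v w = R w v" for v w unfolding R by auto
  show "replaceable R [(x, i), (y, i + 1), (z, i)] [(z, i + 1), (y, i), (x, i + 1)]"
  proof (rule replaceableI)
    fix A :: "(nat \<times> nat) layer list" and n k M X Y
    assume A: "erase A = [(x, i), (y, i + 1), (z, i)]" and t: "tangle n [(x, i), (y, i + 1), (z, i)] k" and M: "arc_system k M" and dA: "distinct (ids A)"
      and Y: "set (ids A) \<inter> Y = {}" "X \<subseteq> Y" "fst ` passes M \<subseteq> Y" "fst ` passes M \<inter> X = {}"
    obtain a b c where A': "A = [(x, i, a), (y, i + 1, b), (z, i, c)]" using A unfolding erase_3 by blast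
    have abc: "a \<noteq> b" "a \<noteq> c" "b \<noteq> c" "a \<notin> Y" "b \<notin> Y" "c \<notin> Y" using Y(1) dA x by (auto simp: A')
    then have f: "a \<notin> fst ` passes M" "b \<notin> fst ` passes M" "c \<notin> fst ` passes M" "a \<notin> X" "b \<notin> X" "c \<notin> X" using Y by blast+
    have k: "k = n" "i + 3 \<le> n" using t x by auto
    note S = triangle_exchangeable[OF x M[unfolded k(1)] k(2) abc(1-3) f(1-3) Y(4) f(4-6) R]
    show "\<exists>B. erase B = [(z, i + 1), (y, i), (x, i + 1)] \<and> distinct (ids B) \<and> set (ids B) \<inter> Y = {} \<and> loops B M = loops A M \<and>
      exchangeable X n R (act A M) (act B M)"
      unfolding A' by (rule exI[of _ "[(z, i + 1, c), (y, i, b), (x, i + 1, a)]"], intro conjI S(1) S(2)[symmetric]) (use abc x in auto)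
  qed
  show "replaceable R [(z, i + 1), (y, i), (x, i + 1)] [(x, i), (y, i + 1), (z, i)]"
  proof (rule replaceableI)
    fix A :: "(nat \<times> nat) layer list" and n k M X Y
    assume A: "erase A = [(z, i + 1), (y, i), (x, i + 1)]" and t: "tangle n [(x, i), (y, i + 1), (z, i)] k" and M: "arc_system k M" and dA: "distinct (ids A)"
      and Y: "set (ids A) \<inter> Y = {}" "X \<subseteq> Y" "fst ` passes M \<subseteq> Y" "fst ` passes M \<inter> X = {}"
    obtain a b c where A': "A = [(z, i + 1, c), (y, i, b), (x, i + 1, a)]" using A unfolding erase_3 by blast
    have abc: "a \<noteq> b" "a \<noteq> c" "b \<noteq> c" "a \<notin> Y" "b \<notin> Y" "c \<notin> Y" using Y(1) dA x by (auto simp: A')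
    then have f: "a \<notin> fst ` passes M" "b \<notin> fst ` passes M" "c \<notin> fst ` passes M" "a \<notin> X" "b \<notin> X" "c \<notin> X" using Y by blast+
    have k: "k = n" "i + 3 \<le> n" using t x by auto
    note S = triangle_exchangeable[OF x M[unfolded k(1)] k(2) abc(1-3) f(1-3) Y(4) f(4-6) R]
    show "\<exists>B. erase B = [(x, i), (y, i + 1), (z, i)] \<and> distinct (ids B) \<and> set (ids B) \<inter> Y = {} \<and> loops B M = loops A M \<and>
      exchangeable X n R (act A M) (act B M)"
      unfolding A' by (rule exI[of _ "[(x, i, a), (y, i + 1, b), (z, i, c)]"], intro conjI S(2) exchangeable_commute[OF S(1) Rs]) (use abc x in auto)
  qed
qed

lemma isotopy_move_replaceable:
  assumes "isotopy_move S T"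
  shows "replaceable (=) S T \<and> replaceable (=) T S"
  using assms
proof cases
  case (R3 a b c i)
  have "(=) = (if a = c \<and> b = flip a then (\<lambda>v w. \<bar>v - w\<bar> = 1) else ((=) :: int \<Rightarrow> int \<Rightarrow> bool))" using R3 by auto
  then show ?thesis using replaceable_triangle[OF R3(3-5), of "(=)" i] R3 by simp
qed (use replaceable_exchange replaceable_zigzag replaceable_slide_cup replaceable_slide_cap replaceable_R1_cup
    replaceable_R1_cap replaceable_R2 in simp_all)

lemma delta_local_replaceable:
  assumes "delta_local S T"
  shows "replaceable (\<lambda>v w. \<bar>v - w\<bar> = 1) S T \<and> replaceable (\<lambda>v w. \<bar>v - w\<bar> = 1) T S"
  using assms
proof cases
  case (1 a i)
  have "(\<lambda>v w. \<bar>v - w\<bar> = 1) = (if a = a \<and> flip a = flip a then (\<lambda>v w. \<bar>v - w\<bar> = 1) else ((=) :: int \<Rightarrow> int \<Rightarrow> bool))" by simp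
  then show ?thesis using replaceable_triangle[of a "flip a" a "\<lambda>v w. \<bar>v - w\<bar> = 1" i] 1 by simp
qed

lemma nth_gap: "length L = i \<Longrightarrow> (L @ p # q # R) ! gap i a = (L @ R) ! a"
  by (auto simp: gap_def nth_append numeral_2_eq_2 Suc_diff_le)

lemma nth_swap: "length L = i \<Longrightarrow> a \<noteq> i \<Longrightarrow> a \<noteq> Suc i \<Longrightarrow> (L @ q' # p' # R) ! a = (L @ p # q # R) ! a"
  by (auto simp: nth_append nth_Cons split: nat.splits)

lemma nth_mid: "length L = i \<Longrightarrow> (L @ p # q # R) ! i = p" "length L = i \<Longrightarrow> (L @ p # q # R) ! Suc i = q"
  by (auto simp: nth_append)

section \<open>Change of the base point\<close>

text \<open>In a list of strand data the pair (d, z) stands for a strand running up (d = 1) or down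
  (d = - 1) with the label z at that height.\<close>

definition matched :: "int \<times> 'l \<Rightarrow> int \<times> 'l \<Rightarrow> bool" where
  "matched p q \<longleftrightarrow> fst p \<in> {1, - 1} \<and> fst q = - fst p \<and> snd p = snd q"

text \<open>The curve is labelled between passages: \<open>lin\<close> is the label just before a
  passage and \<open>lout\<close> the one just after it in the direction of travel, and
  \<open>sg\<close> is the letter sign in this direction.\<close>

locale labelling =
  fixes lin lout :: "'c \<times> bool \<Rightarrow> 'l" and sg :: "'c \<times> bool \<Rightarrow> int"
begin

text \<open>The data \<open>p\<close> belong to the strand below the crossing, \<open>p'\<close> to
  the strand above. A strand running down enters from above, so \<open>lin\<close> and
  \<open>lout\<close> change places and the letter sign is reversed.\<close>

definition edge :: "'c letter \<Rightarrow> int \<times> 'l \<Rightarrow> int \<times> 'l \<Rightarrow> bool" where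
  "edge l p p' \<longleftrightarrow> fst p' = fst p \<and> fst p \<in> {1, - 1} \<and> sg (pass l) = fst p * snd (snd l) \<and>
     (if fst p = 1 then snd p = lin (pass l) \<and> snd p' = lout (pass l)
      else snd p = lout (pass l) \<and> snd p' = lin (pass l))"

fun chain :: "'l \<Rightarrow> 'c word \<Rightarrow> 'l \<Rightarrow> bool" where
  "chain t [] t' \<longleftrightarrow> t = t'"
| "chain t (l # w) t' \<longleftrightarrow> lin (pass l) = t \<and> sg (pass l) = snd (snd l) \<and> chain (lout (pass l)) w t'"

lemma chain_append: "chain t (u @ v) t' \<longleftrightarrow> (\<exists>m. chain t u m \<and> chain m v t')"
  by (induction u arbitrary: t) auto

fun layer_ok :: "'c layer \<Rightarrow> (int \<times> 'l) list \<Rightarrow> (int \<times> 'l) list \<Rightarrow> bool" where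
  "layer_ok (Cup, i, c) s s' \<longleftrightarrow> (\<exists>L R p q. s = L @ R \<and> s' = L @ p # q # R \<and> length L = i \<and> matched p q)"
| "layer_ok (Cap, i, c) s s' \<longleftrightarrow> (\<exists>L R p q. s' = L @ R \<and> s = L @ p # q # R \<and> length L = i \<and> matched p q)"
| "layer_ok (x, i, c) s s' \<longleftrightarrow> (\<exists>L R p q p' q'. s = L @ p # q # R \<and> s' = L @ q' # p' # R \<and> length L = i \<and>
     edge (left_letter x c) p p' \<and> edge (right_letter x c) q q')"

text \<open>The horizontal view of a labelling, which can be verified, or summed over, one layer at
  a time.\<close>

fun trace :: "'c layer list \<Rightarrow> (int \<times> 'l) list \<Rightarrow> bool" where
  "trace [] s \<longleftrightarrow> s = []"
| "trace (y # A) s \<longleftrightarrow> (\<exists>s'. layer_ok y s s' \<and> trace A s')"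

text \<open>The same labelling seen along the arcs, hence along the Gauss word. The passage between
  the two views is \<open>trace_consistent\<close> and \<open>consistent_trace\<close>.\<close>

definition consistent :: "'c arcs \<Rightarrow> (int \<times> 'l) list \<Rightarrow> bool" where
  "consistent M s \<longleftrightarrow> (\<forall>a w b. (a, w, b) \<in> M \<longrightarrow> fst (s ! a) \<in> {1, - 1} \<and> fst (s ! b) = - fst (s ! a) \<and>
     (fst (s ! a) = 1 \<longrightarrow> chain (snd (s ! a)) w (snd (s ! b))))"

lemma consistentD:
  assumes "consistent M s" "(a, w, b) \<in> M"
  shows "fst (s ! a) = 1 \<or> fst (s ! a) = - 1" "fst (s ! b) = - fst (s ! a)"
    "fst (s ! a) = 1 \<Longrightarrow> chain (snd (s ! a)) w (snd (s ! b))"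
  using assms unfolding consistent_def by blast+

lemma layer_ok_crossing: "crossing x \<Longrightarrow> layer_ok (x, i, c) s s' \<longleftrightarrow> (\<exists>L R p q p' q'. s = L @ p # q # R \<and> s' = L @ q' # p' # R \<and> length L = i \<and>
     edge (left_letter x c) p p' \<and> edge (right_letter x c) q q')"
  by (cases x) (auto simp: crossing_def)

lemma edge_chain:
  assumes "edge l p p'"
  shows "fst p = 1 \<Longrightarrow> chain (snd p) ([l] @ v) t \<longleftrightarrow> chain (snd p') v t"
    "fst p = - 1 \<Longrightarrow> chain t (v @ [rev_letter l]) (snd p) \<longleftrightarrow> chain t v (snd p')"
  using assms by (auto simp: edge_def chain_append rev_letter_def pass_def)

lemma consistent_cross:
  assumes L: "length L = i" and e: "edge l p p'" "edge r q q'"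
  shows "consistent (decorate (at2 i [l] [r]) (permute (swap i) M)) (L @ p # q # R) \<longleftrightarrow> consistent M (L @ q' # p' # R)"
proof -
  let ?s = "L @ p # q # R" and ?s' = "L @ q' # p' # R" and ?d = "at2 i [l] [r]"
  have f: "fst (?s ! y) = fst (?s' ! swap i y)" for y
    using e nth_mid[OF L, of p q R] nth_mid[OF L, of q' p' R] nth_swap[OF L, of y q' p' R p q] by (cases "y = i"; cases "y = Suc i") (auto simp: edge_def swap_def)
  have k1: "chain (snd (?s ! y)) (?d y @ v) t \<longleftrightarrow> chain (snd (?s' ! swap i y)) v t" if "fst (?s ! y) = 1" for y v t
    using that edge_chain(1)[OF e(1)] edge_chain(1)[OF e(2)] nth_mid[OF L, of p q R] nth_mid[OF L, of q' p' R] nth_swap[OF L, of y q' p' R p q]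
    by (cases "y = i"; cases "y = Suc i") (auto simp: swap_def at2_other)
  have k2: "chain t (v @ rev_word (?d y)) (snd (?s ! y)) \<longleftrightarrow> chain t v (snd (?s' ! swap i y))" if "fst (?s ! y) = - 1" for y v t
    using that edge_chain(2)[OF e(1)] edge_chain(2)[OF e(2)] nth_mid[OF L, of p q R] nth_mid[OF L, of q' p' R] nth_swap[OF L, of y q' p' R p q]
    by (cases "y = i"; cases "y = Suc i") (auto simp: swap_def at2_other)
  have k: "chain (snd (?s ! y)) (?d y @ u @ rev_word (?d z)) (snd (?s ! z)) \<longleftrightarrow> chain (snd (?s' ! swap i y)) u (snd (?s' ! swap i z))"
    if "fst (?s ! y) = 1" "fst (?s ! z) = - 1" for y z u
    using k1[OF that(1), of "u @ rev_word (?d z)"] k2[OF that(2)] by simp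
  show ?thesis
  proof
    assume *: "consistent (decorate ?d (permute (swap i) M)) ?s"
    show "consistent M ?s'" unfolding consistent_def
    proof (intro allI impI)
      fix a w b assume "(a, w, b) \<in> M"
      then have "(swap i a, ?d (swap i a) @ w @ rev_word (?d (swap i b)), swap i b) \<in> decorate ?d (permute (swap i) M)"
        unfolding in_decorate in_permute_swap by auto
      note D = consistentD[OF * this]
      show "fst (?s' ! a) \<in> {1, - 1} \<and> fst (?s' ! b) = - fst (?s' ! a) \<and> (fst (?s' ! a) = 1 \<longrightarrow> chain (snd (?s' ! a)) w (snd (?s' ! b)))"
        using D k[of "swap i a" "swap i b" w] unfolding f swap_swap by auto
    qed
  next
    assume *: "consistent M ?s'"
    show "consistent (decorate ?d (permute (swap i) M)) ?s" unfolding consistent_def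
    proof (intro allI impI)
      fix a u b assume "(a, u, b) \<in> decorate ?d (permute (swap i) M)"
      then obtain w where w: "u = ?d a @ w @ rev_word (?d b)" "(swap i a, w, swap i b) \<in> M"
        unfolding in_decorate in_permute_swap by auto
      note D = consistentD[OF * w(2)]
      show "fst (?s ! a) \<in> {1, - 1} \<and> fst (?s ! b) = - fst (?s ! a) \<and> (fst (?s ! a) = 1 \<longrightarrow> chain (snd (?s ! a)) u (snd (?s ! b)))"
        using D k[of a b w] unfolding w(1) f by auto
    qed
  qed
qed

lemma consistent_cap:
  assumes L: "length L = i"
  shows "consistent (cap_arcs i M) (L @ p # q # R) \<longleftrightarrow> consistent M (L @ R) \<and> matched p q"
proof
  assume *: "consistent (cap_arcs i M) (L @ p # q # R)"
  have "consistent M (L @ R)" unfolding consistent_def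
  proof (intro allI impI)
    fix a w b assume "(a, w, b) \<in> M"
    then have "(gap i a, w, gap i b) \<in> cap_arcs i M" by simp
    from consistentD[OF * this] show "fst ((L @ R) ! a) \<in> {1, - 1} \<and> fst ((L @ R) ! b) = - fst ((L @ R) ! a) \<and>
      (fst ((L @ R) ! a) = 1 \<longrightarrow> chain (snd ((L @ R) ! a)) w (snd ((L @ R) ! b)))" unfolding nth_gap[OF L] by auto
  qed
  moreover have "matched p q"
  proof -
    have "(i, [], Suc i) \<in> cap_arcs i M" "(Suc i, [], i) \<in> cap_arcs i M" by simp_all
    note D = consistentD[OF * this(1), unfolded nth_mid[OF L]] consistentD(3)[OF * this(2), unfolded nth_mid[OF L]]
    from D(1) show ?thesis
    proof
      assume "fst p = 1" then show ?thesis using D(2,3) by (simp add: matched_def)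
    next
      assume "fst p = - 1" then show ?thesis using D(2,4) by (simp add: matched_def)
    qed
  qed
  ultimately show "consistent M (L @ R) \<and> matched p q" ..
next
  assume *: "consistent M (L @ R) \<and> matched p q"
  show "consistent (cap_arcs i M) (L @ p # q # R)" unfolding consistent_def
  proof (intro allI impI)
    fix a w b assume "(a, w, b) \<in> cap_arcs i M"
    then show "fst ((L @ p # q # R) ! a) \<in> {1, - 1} \<and> fst ((L @ p # q # R) ! b) = - fst ((L @ p # q # R) ! a) \<and>
      (fst ((L @ p # q # R) ! a) = 1 \<longrightarrow> chain (snd ((L @ p # q # R) ! a)) w (snd ((L @ p # q # R) ! b)))"
      unfolding in_cap_arcs
    proof (elim disjE exE conjE)
      fix a' b' assume "a = gap i a'" "b = gap i b'" "(a', w, b') \<in> M"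
      then show ?thesis using consistentD[OF conjunct1[OF *], of a' w b'] by (auto simp: nth_gap[OF L])
    qed (use * in \<open>auto simp: nth_mid[OF L] matched_def\<close>)
  qed
qed

lemma consistent_cup:
  assumes L: "length L = i" and pq: "matched p q" and *: "consistent M (L @ p # q # R)"
  shows "consistent (cup_arcs i M) (L @ R)"
  unfolding consistent_def
proof (intro allI impI)
  fix a w b assume "(a, w, b) \<in> cup_arcs i M"
  then show "fst ((L @ R) ! a) \<in> {1, - 1} \<and> fst ((L @ R) ! b) = - fst ((L @ R) ! a) \<and>
      (fst ((L @ R) ! a) = 1 \<longrightarrow> chain (snd ((L @ R) ! a)) w (snd ((L @ R) ! b)))"
    unfolding in_cup_arcs
  proof (elim disjE exE conjE)
    assume "(gap i a, w, gap i b) \<in> M"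
    from consistentD[OF * this] show ?thesis unfolding nth_gap[OF L] by auto
  next
    fix w1 w2 assume w: "w = w1 @ w2" "(gap i a, w1, i) \<in> M" "(Suc i, w2, gap i b) \<in> M"
    note D = consistentD[OF * w(2), unfolded nth_gap[OF L] nth_mid[OF L]] consistentD[OF * w(3), unfolded nth_gap[OF L] nth_mid[OF L]]
    show ?thesis using D pq unfolding w(1) chain_append matched_def by auto
  next
    fix w1 w2 assume w: "w = w1 @ w2" "(gap i a, w1, Suc i) \<in> M" "(i, w2, gap i b) \<in> M"
    note D = consistentD[OF * w(2), unfolded nth_gap[OF L] nth_mid[OF L]] consistentD[OF * w(3), unfolded nth_gap[OF L] nth_mid[OF L]]
    show ?thesis using D pq unfolding w(1) chain_append matched_def by auto
  qed
qed

text \<open>The arc through the cup is cut there: \<open>chain_append\<close> supplies the label at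
  the cut, and the direction of the arc tells which of the two ends runs up. A loop would leave no
  arc to cut.\<close>

lemma consistent_cup_converse:
  assumes M: "arc_system (n + 2) M" and i: "i \<le> n" and nl: "\<not> (\<exists>w. (i, w, Suc i) \<in> M)"
    and L: "length L = i" and *: "consistent (cup_arcs i M) (L @ R)"
  shows "\<exists>p q. matched p q \<and> consistent M (L @ p # q # R)"
proof -
  note U = arc_system_unique[OF M] and E = arc_system_unique_end[OF M]
  obtain w1 a1 where w1: "(i, w1, a1) \<in> M" using arc_system_total[OF M, of i] i by auto
  obtain w2 b1 where w2: "(Suc i, w2, b1) \<in> M" using arc_system_total[OF M, of "Suc i"] i by auto
  have "a1 \<noteq> i" "a1 \<noteq> Suc i" using w1 nl arc_systemD(3)[OF M w1] by auto
  then obtain a where a: "a1 = gap i a" by (metis gap_cases)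
  have "b1 \<noteq> i" "b1 \<noteq> Suc i" using w2 nl arc_systemD(3,4)[OF M w2] by auto
  then obtain b where b: "b1 = gap i b" by (metis gap_cases)
  note w1 = w1[unfolded a] and w2 = w2[unfolded b]
  note r1 = arc_systemD(4)[OF M w1] and r2 = arc_systemD(4)[OF M w2]
  have "(a, rev_word w1 @ w2, b) \<in> cup_arcs i M" "(b, rev_word w2 @ w1, a) \<in> cup_arcs i M"
    unfolding in_cup_arcs using r1 w2 r2 w1 by blast+
  note C1 = consistentD[OF * this(1)] and C2 = consistentD[OF * this(2)]
  have gen: "consistent M (L @ p # q # R)"
    if pq: "fst p = - fst ((L @ R) ! a)" "fst q = - fst ((L @ R) ! b)"
      "fst p = 1 \<Longrightarrow> chain (snd p) w1 (snd ((L @ R) ! a))" "fst p = - 1 \<Longrightarrow> chain (snd ((L @ R) ! a)) (rev_word w1) (snd p)"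
      "fst q = 1 \<Longrightarrow> chain (snd q) w2 (snd ((L @ R) ! b))" "fst q = - 1 \<Longrightarrow> chain (snd ((L @ R) ! b)) (rev_word w2) (snd q)" for p q
    unfolding consistent_def
  proof (intro allI impI)
    fix x w y assume x: "(x, w, y) \<in> M"
    let ?s = "L @ p # q # R"
    consider "x = i" | "x = Suc i" | "y = i" | "y = Suc i" | x' y' where "x = gap i x'" "y = gap i y'"
      by (metis gap_cases)
    then show "fst (?s ! x) \<in> {1, - 1} \<and> fst (?s ! y) = - fst (?s ! x) \<and> (fst (?s ! x) = 1 \<longrightarrow> chain (snd (?s ! x)) w (snd (?s ! y)))"
    proof cases
      case 1
      then have "w = w1" "y = gap i a" using U[OF w1] x by auto
      then show ?thesis using 1 pq C1 by (auto simp: nth_gap[OF L] nth_mid[OF L])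
    next
      case 2
      then have "w = w2" "y = gap i b" using U[OF w2] x by auto
      then show ?thesis using 2 pq C2 by (auto simp: nth_gap[OF L] nth_mid[OF L])
    next
      case 3
      then have "w = rev_word w1" "x = gap i a" using E[OF r1] x by auto
      then show ?thesis using 3 pq C1 by (auto simp: nth_gap[OF L] nth_mid[OF L])
    next
      case 4
      then have "w = rev_word w2" "x = gap i b" using E[OF r2] x by auto
      then show ?thesis using 4 pq C2 by (auto simp: nth_gap[OF L] nth_mid[OF L])
    next
      case 5
      then have "(x', w, y') \<in> cup_arcs i M" unfolding in_cup_arcs using x by blast
      from consistentD[OF * this] show ?thesis unfolding 5 nth_gap[OF L] by auto
    qed
  qed
  show ?thesis
  proof (cases "fst ((L @ R) ! a) = 1")
    case True
    then obtain m where m: "chain (snd ((L @ R) ! a)) (rev_word w1) m" "chain m w2 (snd ((L @ R) ! b))"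
      using C1(3) unfolding chain_append by blast
    have "consistent M (L @ (- 1, m) # (1, m) # R)" by (rule gen) (use True m C1 in auto)
    then show ?thesis by (intro exI[of _ "(- 1, m)"] exI[of _ "(1, m)"]) (simp add: matched_def)
  next
    case False
    then have F: "fst ((L @ R) ! a) = - 1" "fst ((L @ R) ! b) = 1" using C1 by auto
    then obtain m where m: "chain (snd ((L @ R) ! b)) (rev_word w2) m" "chain m w1 (snd ((L @ R) ! a))"
      using C2(3) unfolding chain_append by blast
    have "consistent M (L @ (1, m) # (- 1, m) # R)" by (rule gen) (use F m in auto)
    then show ?thesis by (intro exI[of _ "(1, m)"] exI[of _ "(- 1, m)"]) (simp add: matched_def)
  qed
qed

lemma trace_consistent:
  "trace A s \<Longrightarrow> tangle (length s) (erase A) 0 \<and> consistent (act A {}) s"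
proof (induction A arbitrary: s)
  case Nil
  then show ?case by (simp add: consistent_def)
next
  case (Cons y A)
  obtain x i c where y: "y = (x, i, c)" by (cases y) auto
  obtain s' where s': "layer_ok y s s'" "trace A s'" using Cons.prems by auto
  note IH = Cons.IH[OF s'(2)]
  show ?case
  proof (cases x rule: event_cases)
    case 1
    then obtain L R p q where "s = L @ R" "s' = L @ p # q # R" "length L = i" "matched p q" using s'(1) by (auto simp: y)
    then show ?thesis using IH consistent_cup[of L i p q "act A {}" R] 1 by (simp add: y)
  next
    case 2
    then obtain L R p q where "s' = L @ R" "s = L @ p # q # R" "length L = i" "matched p q" using s'(1) by (auto simp: y)
    then show ?thesis using IH consistent_cap[of L i "act A {}" p q R] 2 by (simp add: y)
  next
    case 3
    then obtain L R p q p' q' where "s = L @ p # q # R" "s' = L @ q' # p' # R" "length L = i"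
      "edge (left_letter x c) p p'" "edge (right_letter x c) q q'" using s'(1) by (auto simp: y layer_ok_crossing)
    then show ?thesis using IH consistent_cross[of L i "left_letter x c" p p' "right_letter x c" q q' "act A {}" R] 3
      by (simp add: y layer_arcs_crossing cross_arcs_def)
  qed
qed

lemma edge_exists:
  assumes M: "arc_system n M" and s: "consistent M s" and a: "(a, l # w, b) \<in> M"
  shows "\<exists>p'. edge l (s ! a) p'"
proof -
  note C = consistentD[OF s a]
  show ?thesis
  proof (cases "fst (s ! a) = 1")
    case True
    then have "edge l (s ! a) (1, lout (pass l))" using C by (simp add: edge_def)
    then show ?thesis ..
  next
    case False
    then have F: "fst (s ! a) = - 1" "fst (s ! b) = 1" using C by auto
    have "chain (snd (s ! b)) (rev_word w @ [rev_letter l]) (snd (s ! a))"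
      using consistentD(3)[OF s arc_systemD(4)[OF M a]] F by simp
    then have "edge l (s ! a) (- 1, lin (pass l))" using F by (auto simp: edge_def chain_append rev_letter_def pass_def)
    then show ?thesis ..
  qed
qed

text \<open>Labels are propagated upwards from the lowest section. Since no cup closes a loop, each
  cup lies on an arc that already carries labels.\<close>

lemma consistent_trace:
  "tangle (length s) (erase A) 0 \<Longrightarrow> distinct (ids A) \<Longrightarrow> loops A {} = 0 \<Longrightarrow> consistent (act A {}) s \<Longrightarrow> trace A s"
proof (induction A arbitrary: s)
  case Nil
  then show ?case by simp
next
  case (Cons y A)
  obtain x i c where y: "y = (x, i, c)" by (cases y) auto
  have d: "distinct (ids A)" using Cons.prems(2) by (auto simp: y split: if_splits)
  have l: "loops A {} = 0" using Cons.prems(3) by simp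
  show ?case
  proof (cases x rule: event_cases)
    case 1
    have t: "i \<le> length s" "tangle (length s + 2) (erase A) 0" using Cons.prems(1) 1 by (auto simp: y)
    have M: "arc_system (length s + 2) (act A {})" using arc_system_act(1)[OF t(2) d] .
    have s: "take i s @ drop i s = s" "length (take i s) = i" using t(1) by auto
    have nl: "\<not> (\<exists>w. (i, w, Suc i) \<in> act A {})" using Cons.prems(3) 1 by (auto simp: y split: if_splits)
    obtain p q where pq: "matched p q" "consistent (act A {}) (take i s @ p # q # drop i s)"
      using consistent_cup_converse[OF M t(1) nl s(2), of "drop i s"] Cons.prems(4) 1 by (auto simp: y s)
    have "trace A (take i s @ p # q # drop i s)"
      by (rule Cons.IH) (use t d l pq(2) in auto)
    moreover have "layer_ok y s (take i s @ p # q # drop i s)"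
      unfolding y 1 layer_ok.simps using pq(1) s by metis
    ultimately show ?thesis by auto
  next
    case 2
    have t: "i + 2 \<le> length s" "tangle (length s - 2) (erase A) 0" using Cons.prems(1) 2 by (auto simp: y)
    obtain L p q R where s: "s = L @ p # q # R" "length L = i"
      using that t(1) by (metis Cons_nth_drop_Suc add_2_eq_Suc' add_leE append_take_drop_id length_take min.absorb2 Suc_le_lessD Suc_leD)
    have c: "consistent (act A {}) (L @ R)" "matched p q"
      using consistent_cap[OF s(2), of "act A {}" p q R] Cons.prems(4) 2 by (auto simp: y s(1))
    have "trace A (L @ R)" by (rule Cons.IH) (use t d l c s in auto)
    moreover have "layer_ok y s (L @ R)" unfolding y 2 layer_ok.simps using c(2) s by metis
    ultimately show ?thesis by auto
  next
    case 3
    have t1: "i + 2 \<le> length s" using Cons.prems(1) 3 by (auto simp: y)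
    then have "length s - ins x + outs x = length s" using 3 by simp
    then have t: "i + 2 \<le> length s" "tangle (length s) (erase A) 0" using Cons.prems(1) t1 by (auto simp: y)
    obtain L p q R where s: "s = L @ p # q # R" "length L = i"
      using that t(1) by (metis Cons_nth_drop_Suc add_2_eq_Suc' add_leE append_take_drop_id length_take min.absorb2 Suc_le_lessD Suc_leD)
    have M: "arc_system (length s) (act (y # A) {})" using arc_system_act(1)[OF Cons.prems(1,2)] .
    have M': "arc_system (length s) (act A {})" using arc_system_act(1)[OF t(2) d] .
    have act: "act (y # A) {} = decorate (at2 i [left_letter x c] [right_letter x c]) (permute (swap i) (act A {}))"
      using 3 by (simp add: y layer_arcs_crossing cross_arcs_def)
    obtain w1 b1 where w1: "(Suc i, w1, b1) \<in> act A {}" using arc_system_total[OF M', of "Suc i"] t(1) by auto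
    obtain w2 b2 where w2: "(i, w2, b2) \<in> act A {}" using arc_system_total[OF M', of i] t(1) by auto
    have "(i, left_letter x c # w1 @ rev_word (at2 i [left_letter x c] [right_letter x c] (swap i b1)), swap i b1) \<in> act (y # A) {}"
      "(Suc i, right_letter x c # w2 @ rev_word (at2 i [left_letter x c] [right_letter x c] (swap i b2)), swap i b2) \<in> act (y # A) {}"
      unfolding act in_decorate in_permute_swap using w1 w2 by auto
    then obtain p' q' where e: "edge (left_letter x c) p p'" "edge (right_letter x c) q q'"
      using edge_exists[OF M Cons.prems(4)] by (metis s(1) nth_mid[OF s(2)])
    have "consistent (act A {}) (L @ q' # p' # R)"
      using consistent_cross[OF s(2) e, of "act A {}" R] Cons.prems(4) unfolding act s(1) by simp
    then have "trace A (L @ q' # p' # R)" by (intro Cons.IH) (use t d l s in auto)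
    moreover have "layer_ok y s (L @ q' # p' # R)" unfolding y layer_ok_crossing[OF 3] using e s by metis
    ultimately show ?thesis by auto
  qed
qed

end

section \<open>Winding sums and the intersection number of two curves\<close>

text \<open>For labels 0 and 1 this compares, in a horizontal section, the order of the strands of both
  colours; passing a layer changes it only at the crossings between the colours, by their signs.\<close>

fun wind :: "(int \<times> int) list \<Rightarrow> int" where
  "wind [] = 0"
| "wind ((d, z) # s) = d * (z * (\<Sum>(d', z') \<leftarrow> s. d') - (\<Sum>(d', z') \<leftarrow> s. d' * z')) + wind s"

lemma wind_append: "wind (u @ v) = wind u + wind v + (\<Sum>(d, z) \<leftarrow> u. d * z) * (\<Sum>(d, z) \<leftarrow> v. d) -
    (\<Sum>(d, z) \<leftarrow> u. d) * (\<Sum>(d, z) \<leftarrow> v. d * z)"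
  by (induction u rule: wind.induct) (auto simp: algebra_simps)

locale colouring = labelling lin lout sg
  for lin lout :: "'c \<times> bool \<Rightarrow> int" and sg
begin

text \<open>In closed form \<open>wind\<close> is the sum of d_i d_j (z_i - z_j) over i < j. A
  matched pair has opposite directions and equal labels, so cups and caps change nothing. At a
  crossing the first condition makes the contribution against all other strands invariant, so only
  the pair itself counts.\<close>

lemma wind_trace:
  assumes "trace A s"
    and "\<And>x i c p q p' q'. (x, i, c) \<in> set A \<Longrightarrow> crossing x \<Longrightarrow> edge (left_letter x c) p p' \<Longrightarrow> edge (right_letter x c) q q' \<Longrightarrow>
      fst p * snd p + fst q * snd q = fst q' * snd q' + fst p' * snd p' \<and>
      wind [p, q] - wind [q', p'] = k c"
  shows "wind s = (\<Sum>c \<leftarrow> ids A. k c)"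
  using assms
proof (induction A arbitrary: s)
  case Nil
  then show ?case by simp
next
  case (Cons y A)
  obtain x i c where y: "y = (x, i, c)" by (cases y) auto
  obtain s' where s': "layer_ok y s s'" "trace A s'" using Cons.prems by auto
  have IH: "wind s' = (\<Sum>c \<leftarrow> ids A. k c)" by (rule Cons.IH[OF s'(2)], rule Cons.prems(2)) auto
  have split: "wind (L @ p # q # R) = wind [p, q] + wind (L @ R) +
    (fst p * snd p + fst q * snd q) * (\<Sum>(d, z) \<leftarrow> R. d) - (fst p + fst q) * (\<Sum>(d, z) \<leftarrow> R. d * z) +
    (\<Sum>(d, z) \<leftarrow> L. d * z) * (fst p + fst q) - (\<Sum>(d, z) \<leftarrow> L. d) * (fst p * snd p + fst q * snd q)" for L R p q
    by (cases p; cases q) (simp add: wind_append algebra_simps)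
  show ?case
  proof (cases x rule: event_cases)
    case 1
    then obtain L R p q where "s = L @ R" "s' = L @ p # q # R" "length L = i" "matched p q" using s'(1) by (auto simp: y)
    then show ?thesis using IH 1 by (cases p; cases q) (simp add: y split matched_def algebra_simps)
  next
    case 2
    then obtain L R p q where "s' = L @ R" "s = L @ p # q # R" "length L = i" "matched p q" using s'(1) by (auto simp: y)
    then show ?thesis using IH 2 by (cases p; cases q) (simp add: y split matched_def algebra_simps)
  next
    case 3
    then obtain L R p q p' q' where s: "s = L @ p # q # R" "s' = L @ q' # p' # R" "length L = i"
      "edge (left_letter x c) p p'" "edge (right_letter x c) q q'" using s'(1) by (auto simp: y layer_ok_crossing)
    have k: "fst p * snd p + fst q * snd q = fst q' * snd q' + fst p' * snd p'" "wind [p, q] - wind [q', p'] = k c"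
      using Cons.prems(2)[of x i c, OF _ 3 s(4,5)] by (simp_all add: y)
    have "fst p' = fst p" "fst q' = fst q" using s(4,5) by (simp_all add: edge_def)
    then have "wind s - wind s' = k c" using k unfolding s(1,2) split by (simp add: algebra_simps)
    then show ?thesis using IH 3 by (simp add: y)
  qed
qed

end

text \<open>The value 0 is a default for passages outside the word.\<close>

definition letter_sign :: "'c word \<Rightarrow> 'c \<times> bool \<Rightarrow> int" where
  "letter_sign w p = (case filter (\<lambda>l. pass l = p) w of [] \<Rightarrow> 0 | l # _ \<Rightarrow> snd (snd l))"

lemma letter_sign:
  assumes "distinct (map pass w)" "l \<in> set w"
  shows "letter_sign w (pass l) = snd (snd l)"
proof -
  obtain u v where w: "w = u @ l # v" using assms(2) by (meson split_list)
  have "pass l \<notin> pass ` set u" using assms(1) unfolding w by simp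
  then have "\<forall>k \<in> set u. pass k \<noteq> pass l" by (metis imageI)
  then have "filter (\<lambda>k. pass k = pass l) u = []" by (rule filter_False)
  then show ?thesis unfolding letter_sign_def w by simp
qed

lemma letter_sign_cong: "distinct (map pass w) \<Longrightarrow> mset w = mset w' \<Longrightarrow> p \<in> pass ` set w \<Longrightarrow> letter_sign w p = letter_sign w' p"
proof -
  assume d: "distinct (map pass w)" and m: "mset w = mset w'" and p: "p \<in> pass ` set w"
  obtain l where l: "l \<in> set w" "p = pass l" using p by blast
  have "distinct (map pass w')" using d m by (metis mset_eq_imp_distinct_iff mset_map)
  moreover have "l \<in> set w'" using l m by (metis set_mset_mset)
  ultimately show ?thesis using letter_sign[OF d l(1)] letter_sign[of w' l] l(2) by simp
qed

definition inside :: "'c word \<Rightarrow> 'c \<times> bool \<Rightarrow> int" where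
  "inside Q p = (if p \<in> pass ` set Q then 1 else 0)"

text \<open>Smoothing the crossing of l and l' splits the curve into two closed curves in the plane, whose
  algebraic intersection number is zero; the sum below is this number.\<close>

lemma planar_sum:
  assumes A: "tangle 2 (erase A) 0" "distinct (ids A)" "loops A {} = 0" and w: "(0, w, 1) \<in> act A {}"
    and split: "w = P @ l # Q @ l' # R" and c: "fst l = c" "fst l' = c"
  shows "(\<Sum>d \<in> set (ids A) - {c}. letter_sign w (d, True) * letter_sign w (d, False) * (inside Q (d, True) - inside Q (d, False))) = 0"
proof -
  have sys: "arc_system 2 (act A {})" "passes (act A {}) = set (ids A) \<times> UNIV" using arc_system_act[OF A(1,2)] A(3) by auto
  have d: "distinct (map pass w)" using arc_systemD(5)[OF sys(1) w] .
  \<comment> \<open>Colour 1 on the loop between \<open>l\<close> and \<open>l'\<close>, colour 0 on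
    the rest; the colour changes exactly at the smoothed crossing.\<close>
  define lin :: "'a \<times> bool \<Rightarrow> int" where "lin p = (if p \<in> pass ` set Q \<or> p = pass l' then 1 else 0)" for p
  define lout :: "'a \<times> bool \<Rightarrow> int" where "lout p = (if p \<in> pass ` set Q \<or> p = pass l then 1 else 0)" for p
  interpret colouring lin lout "letter_sign w" .
  have ch: "chain z v z" if "\<And>k. k \<in> set v \<Longrightarrow> k \<in> set w \<and> lin (pass k) = z \<and> lout (pass k) = z" for z v
    using that by (induction v) (auto simp: letter_sign[OF d])
  have lw: "l \<in> set w" "l' \<in> set w" unfolding split by auto
  have ne: "pass l \<noteq> pass l'" "pass l \<notin> pass ` set Q" "pass l' \<notin> pass ` set Q" using d unfolding split by auto
  have out: "pass k \<notin> pass ` set Q \<and> pass k \<noteq> pass l \<and> pass k \<noteq> pass l'" if "k \<in> set P \<or> k \<in> set R" for k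
  proof -
    have "pass ` set P \<inter> (pass ` set Q \<union> {pass l, pass l'}) = {}"
      using d unfolding split by simp blast
    moreover have "pass ` set R \<inter> (pass ` set Q \<union> {pass l, pass l'}) = {}"
      using d unfolding split by simp blast
    moreover have "pass k \<in> pass ` set P \<or> pass k \<in> pass ` set R" using that by (metis imageI)
    ultimately show ?thesis by blast
  qed
  have 1: "chain 0 P 0" by (rule ch) (simp add: split lin_def lout_def out)
  have 3: "chain 0 R 0" by (rule ch) (simp add: split lin_def lout_def out)
  have 2: "chain 1 Q 1" by (rule ch) (simp add: split lin_def lout_def)
  have L: "lin (pass l) = 0" "lout (pass l) = 1" "lin (pass l') = 1" "lout (pass l') = 0" using ne by (simp_all add: lin_def lout_def)
  then have "chain 0 (l # Q @ l' # R) 0" using 2 3 by (auto simp: chain_append letter_sign[OF d lw(1)] letter_sign[OF d lw(2)])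
  then have "chain 0 (P @ l # Q @ l' # R) 0" unfolding chain_append using 1 by blast
  then have chain: "chain 0 w 0" by (simp only: split)
  have con: "consistent (act A {}) [(1, 0), (- 1, 0)]"
    unfolding consistent_def
  proof (intro allI impI)
    fix a v b assume v: "(a, v, b) \<in> act A {}"
    have "a = 0 \<or> a = 1" using arc_systemD(1)[OF sys(1) v] by auto
    then show "fst ([(1 :: int, 0 :: int), (- 1, 0)] ! a) \<in> {1, - 1} \<and>
      fst ([(1 :: int, 0 :: int), (- 1, 0)] ! b) = - fst ([(1 :: int, 0 :: int), (- 1, 0)] ! a) \<and>
      (fst ([(1 :: int, 0 :: int), (- 1, 0)] ! a) = 1 \<longrightarrow>
        chain (snd ([(1 :: int, 0), (- 1, 0)] ! a)) v (snd ([(1 :: int, 0), (- 1, 0)] ! b)))"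
    proof
      assume a: "a = 0"
      then have "v = w" "b = 1" using arc_system_unique[OF sys(1) w] v by auto
      then show ?thesis using a chain by simp
    next
      assume a: "a = 1"
      then have "b = 0" using arc_system_unique[OF sys(1) arc_systemD(4)[OF sys(1) w]] v by auto
      then show ?thesis using a by simp
    qed
  qed
  have tr: "trace A [(1, 0), (- 1, 0)]" by (rule consistent_trace) (use A con in \<open>auto simp: numeral_2_eq_2\<close>)
  \<comment> \<open>At an unsmoothed crossing two strands with fixed colours change places, which
    negates their term in \<open>wind\<close>; hence the factor 2. At the smoothed crossing the
    changes of colour and of position cancel.\<close>
  define k where "k d = (if d = c then 0 else 2 * (letter_sign w (d, True) * letter_sign w (d, False) * (inside Q (d, True) - inside Q (d, False))))" for d
  have pc: "{pass l, pass l'} = {(c, True), (c, False)}" using c ne(1) by (cases l; cases l') auto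
  have "wind [(1, 0), (- 1, 0)] = (\<Sum>d \<leftarrow> ids A. k d)"
  proof (rule wind_trace[OF tr])
    fix x i e p q p' q'
    assume x: "crossing x" and ed: "edge (left_letter x e) p p'" "edge (right_letter x e) q q'"
    show "fst p * snd p + fst q * snd q = fst q' * snd q' + fst p' * snd p' \<and> wind [p, q] - wind [q', p'] = k e"
    proof (cases "e = c")
      case False
      then have "lin (e, v) = inside Q (e, v)" "lout (e, v) = inside Q (e, v)" for v
        using pc by (auto simp: lin_def lout_def inside_def)
      then show ?thesis using ed x False
        by (cases x; cases p; cases q; cases p'; cases q')
          (auto simp: edge_def left_letter_def right_letter_def k_def crossing_def algebra_simps)
    next
      case True
      have "pass l = (c, True) \<and> pass l' = (c, False) \<or> pass l = (c, False) \<and> pass l' = (c, True)"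
        using pc by (auto simp: doubleton_eq_iff)
      then have "lin (c, True) = 0 \<and> lout (c, True) = 1 \<and> lin (c, False) = 1 \<and> lout (c, False) = 0 \<or>
        lin (c, True) = 1 \<and> lout (c, True) = 0 \<and> lin (c, False) = 0 \<and> lout (c, False) = 1"
        using L by auto
      then show ?thesis using ed x unfolding True
        by (cases x; cases p; cases q; cases p'; cases q')
          (auto simp: edge_def left_letter_def right_letter_def k_def crossing_def)
    qed
  qed
  then have "(\<Sum>d \<leftarrow> ids A. k d) = 0" by simp
  then have "(\<Sum>d \<in> set (ids A). k d) = 0" using sum_list_distinct_conv_sum_set[OF A(2), of k] by simp
  then have "(\<Sum>d \<in> set (ids A) - {c}. k d) = 0"
    by (subst (asm) sum.mono_neutral_right[where S = "set (ids A) - {c}"]) (auto simp: k_def)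
  then have "2 * (\<Sum>d \<in> set (ids A) - {c}. letter_sign w (d, True) * letter_sign w (d, False) * (inside Q (d, True) - inside Q (d, False))) = 0"
  proof -
    have "2 * (\<Sum>d \<in> set (ids A) - {c}. letter_sign w (d, True) * letter_sign w (d, False) * (inside Q (d, True) - inside Q (d, False))) =
      (\<Sum>d \<in> set (ids A) - {c}. k d)"
      unfolding sum_distrib_left by (rule sum.cong[OF refl]) (simp add: k_def)
    then show ?thesis using \<open>(\<Sum>d \<in> set (ids A) - {c}. k d) = 0\<close> by simp
  qed
  then show ?thesis by simp
qed

text \<open>Something changes only if \<open>d\<close> has one letter in \<open>Q\<close> and one in
  \<open>R\<close>. In the pattern the first and the last letter are under, so \<open>l\<close> must
  be under; then the letter of \<open>d\<close> in \<open>Q\<close> has to be over for a term before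
  the rotation and under for a term after it.\<close>

lemma rotate_pair:
  assumes d: "distinct (map pass (l # Q @ l' # R))" and c: "fst l = c" "fst l' = c" and dc: "d \<noteq> c"
    and full: "(d, True) \<in> pass ` set (Q @ R)" "(d, False) \<in> pass ` set (Q @ R)"
    and w: "w = l # Q @ l' # R"
  shows "interleaving c d (restrict c d (l # Q @ l' # R)) + interleaving d c (restrict c d (l # Q @ l' # R)) -
      interleaving c d (restrict c d (Q @ l' # R @ [l])) - interleaving d c (restrict c d (Q @ l' # R @ [l])) =
    (if snd (pass l) then 0 else snd (snd l) * snd (snd l') *
       (letter_sign w (d, True) * letter_sign w (d, False) * (inside Q (d, True) - inside Q (d, False))))"
proof -
  let ?f = "filter (\<lambda>k. fst k = d)"
  have nc: "fst k \<noteq> c" if "k \<in> set (Q @ R)" for k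
  proof
    assume k: "fst k = c"
    have "pass k \<in> pass ` set Q \<union> pass ` set R" using that by (auto intro: imageI)
    moreover have "pass l \<notin> pass ` set Q \<union> pass ` set R" "pass l' \<notin> pass ` set Q \<union> pass ` set R" using d by auto
    ultimately have "pass k \<noteq> pass l" "pass k \<noteq> pass l'" by metis+
    moreover have "pass l \<noteq> pass l'" using d by auto
    ultimately show False using k c by (cases k; cases l; cases l') auto
  qed
  have res: "restrict c d (l # Q @ l' # R) = l # ?f Q @ l' # ?f R" "restrict c d (Q @ l' # R @ [l]) = ?f Q @ l' # ?f R @ [l]"
  proof -
    have "restrict c d Q = ?f Q" "restrict c d R = ?f R"
      unfolding restrict_def by (rule filter_cong[OF refl], use nc in \<open>simp del: split_paired_All\<close>)+
    moreover have "restrict c d (k # v) = k # restrict c d v" if "fst k = c" for k v using that by (simp add: restrict_def)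
    moreover have "restrict c d [] = []" by (simp add: restrict_def)
    ultimately show "restrict c d (l # Q @ l' # R) = l # ?f Q @ l' # ?f R" "restrict c d (Q @ l' # R @ [l]) = ?f Q @ l' # ?f R @ [l]"
      using c by (simp_all only: restrict_append)
  qed
  have dd: "distinct (map pass (?f Q @ ?f R))"
    using d by (auto simp: distinct_map_filter)
  have ps: "pass ` set (?f Q @ ?f R) = {(d, True), (d, False)}"
  proof
    show "pass ` set (?f Q @ ?f R) \<subseteq> {(d, True), (d, False)}" by (auto simp: pass_def)
    show "{(d, True), (d, False)} \<subseteq> pass ` set (?f Q @ ?f R)" using full by (force simp: pass_def)
  qed
  have "length (?f Q @ ?f R) = card {(d, True), (d, False)}"
    using distinct_card[OF dd] ps by (metis length_map list.set_map)
  then have "length (?f Q @ ?f R) = 2" by simp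
  moreover have "\<exists>x y. v = [x, y]" if "length v = 2" for v :: "'a word"
    using that by (cases v; cases "tl v") auto
  ultimately obtain x y where xy: "?f Q @ ?f R = [x, y]" by blast
  have px: "pass x = (d, True) \<and> pass y = (d, False) \<or> pass x = (d, False) \<and> pass y = (d, True)"
    using ps dd unfolding xy by (auto simp: doubleton_eq_iff)
  have xyw: "x \<in> set w" "y \<in> set w"
  proof -
    have "x \<in> set (?f Q @ ?f R)" "y \<in> set (?f Q @ ?f R)" unfolding xy by auto
    then show "x \<in> set w" "y \<in> set w" unfolding w by auto
  qed
  have sgn: "letter_sign w (pass x) = snd (snd x)" "letter_sign w (pass y) = snd (snd y)"
    using letter_sign[of w] xyw d unfolding w by auto
  have ins: "inside Q (d, v) = (if (d, v) \<in> pass ` set (?f Q) then 1 else 0)" for v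
    by (force simp: inside_def pass_def)
  have pl: "pass l = (c, True) \<and> pass l' = (c, False) \<or> pass l = (c, False) \<and> pass l' = (c, True)"
    using d c by (cases l; cases l') auto
  obtain vl el where l: "l = (c, vl, el)" using c by (cases l) auto
  obtain el' where l': "l' = (c, \<not> vl, el')" using pl l by (cases l') auto
  obtain vx ex where x: "x = (d, vx, ex)" using px by (cases x) auto
  obtain ey where y: "y = (d, \<not> vx, ey)" using px x by (cases y) auto
  have sgn': "letter_sign w (d, vx) = ex" "letter_sign w (d, \<not> vx) = ey" using sgn unfolding x y by simp_all
  consider "?f Q = []" "?f R = [x, y]" | "?f Q = [x]" "?f R = [y]" | "?f Q = [x, y]" "?f R = []"
    using xy by (auto simp: append_eq_Cons_conv)
  then show ?thesis
  proof cases
    case 1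
    show ?thesis unfolding res ins 1 unfolding l l' x y using dc by (cases vl; cases vx; simp add: interleaving_def)
  next
    case 2
    show ?thesis using dc sgn' unfolding res ins 2 unfolding l l' x y by (cases vl; cases vx; simp add: interleaving_def)
  next
    case 3
    show ?thesis unfolding res ins 3 unfolding l l' x y using dc by (cases vl; cases vx; simp add: interleaving_def)
  qed
qed

text \<open>Summed over all \<open>d\<close>, the changes from \<open>rotate_pair\<close> are a
  multiple of the intersection number assumed to vanish.\<close>

lemma casson_rotate1:
  assumes d: "distinct (map pass (l # Q @ l' # R))" and c: "fst l = c" "fst l' = c"
    and ps: "pass ` set (l # Q @ l' # R) = I \<times> UNIV"
    and w: "w = l # Q @ l' # R"
    and z: "(\<Sum>d \<in> I - {c}. letter_sign w (d, True) * letter_sign w (d, False) * (inside Q (d, True) - inside Q (d, False))) = 0"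
  shows "casson (l # Q @ l' # R) = casson (Q @ l' # R @ [l])"
proof -
  let ?u = "l # Q @ l' # R" and ?v = "Q @ l' # R @ [l]"
  have "fst ` pass ` set ?u = I" unfolding ps by auto
  moreover have "fst ` pass ` K = fst ` K" for K :: "'a letter set" by (force simp: pass_def)
  ultimately have I: "fst ` set ?u = I" by metis
  then have I': "fst ` set ?v = I" by auto
  have fin: "finite I" unfolding I[symmetric] by simp
  have cI: "c \<in> I" unfolding I[symmetric] using c by auto
  have cas: "casson v = (\<Sum>x \<in> I - {c}. \<Sum>y \<in> I - {c}. interleaving x y (restrict x y v)) +
      (\<Sum>x \<in> I - {c}. interleaving c x (restrict c x v) + interleaving x c (restrict c x v))"
    if v: "fst ` set v = I" "distinct (map pass v)" for v
  proof -
    have "casson v = (\<Sum>x \<in> (I - {c}) \<union> {c}. \<Sum>y \<in> (I - {c}) \<union> {c}. interleaving x y (restrict x y v))"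
      using cI unfolding casson_def v by (simp add: insert_absorb)
    also have "\<dots> = (\<Sum>x \<in> I - {c}. \<Sum>y \<in> I - {c}. interleaving x y (restrict x y v)) +
      (\<Sum>x \<in> I - {c}. interleaving c x (restrict c x v) + interleaving x c (restrict c x v))"
    proof -
      have "interleaving x c (restrict x c v) + interleaving c x (restrict c x v) =
        interleaving c x (restrict c x v) + interleaving x c (restrict c x v)" for x
        by (simp only: restrict_commute[of x c] add.commute)
      moreover have *: "finite (I - {c})" "finite {c}" "(I - {c}) \<inter> {c} = {}" using fin by auto
      ultimately show ?thesis unfolding sum_sum_Un[OF *] by (simp add: interleaving_same[OF v(2)] add.commute)
    qed
    finally show ?thesis .
  qed
  have d': "distinct (map pass ?v)" using d by auto
  have same: "restrict x y ?u = restrict x y ?v" if "x \<noteq> c" "y \<noteq> c" for x y using that c by (simp add: restrict_def)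
  have full: "(e, v) \<in> pass ` set (Q @ R)" if "e \<in> I - {c}" for e v
  proof -
    have "(e, v) \<in> pass ` set ?u" using that unfolding ps by auto
    then show ?thesis using that c by (auto simp: pass_def)
  qed
  have "casson ?u - casson ?v = (\<Sum>x \<in> I - {c}. interleaving c x (restrict c x ?u) + interleaving x c (restrict c x ?u) -
      interleaving c x (restrict c x ?v) - interleaving x c (restrict c x ?v))"
  proof -
    have "(\<Sum>x \<in> I - {c}. \<Sum>y \<in> I - {c}. interleaving x y (restrict x y ?u)) = (\<Sum>x \<in> I - {c}. \<Sum>y \<in> I - {c}. interleaving x y (restrict x y ?v))"
      by (intro sum.cong refl) (use same in auto)
    then show ?thesis unfolding cas[OF I d] cas[OF I' d'] by (simp add: sum_subtractf sum.distrib)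
  qed
  also have "\<dots> = (\<Sum>x \<in> I - {c}. if snd (pass l) then 0 else snd (snd l) * snd (snd l') *
       (letter_sign w (x, True) * letter_sign w (x, False) * (inside Q (x, True) - inside Q (x, False))))"
    by (rule sum.cong[OF refl], rule rotate_pair[OF d c _ full full w]) auto
  also have "\<dots> = 0"
    using z by (cases "snd (pass l)") (simp_all flip: sum_distrib_left)
  finally show ?thesis by simp
qed

text \<open>The base point is moved past one letter at a time. \<open>planar_sum\<close> refers to
  the fixed word of the arc, while the loop from \<open>l\<close> to \<open>l'\<close> in the
  rotated word may run through the old base point.\<close>

lemma casson_rotate:
  assumes A: "tangle 2 (erase A) 0" "distinct (ids A)" "loops A {} = 0" and w: "(0, X @ Y, 1) \<in> act A {}"
  shows "casson (Y @ X) = casson (X @ Y)"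
  using w
proof (induction X arbitrary: Y rule: rev_induct)
  case Nil
  then show ?case by simp
next
  case (snoc l X)
  have w: "(0, X @ l # Y, 1) \<in> act A {}" using snoc.prems by simp
  have IH: "casson (l # Y @ X) = casson (X @ l # Y)" using snoc.IH[of "l # Y"] w by simp
  have sys: "arc_system 2 (act A {})" "passes (act A {}) = set (ids A) \<times> UNIV" using arc_system_act[OF A(1,2)] A(3) by auto
  define c where "c = fst l"
  let ?w = "X @ l # Y"
  have d: "distinct (map pass ?w)" using arc_systemD(5)[OF sys(1) w] .
  have ps: "pass ` set ?w = set (ids A) \<times> UNIV"
  proof -
    have "p \<in> pass ` set ?w" if p: "p \<in> passes (act A {})" for p
    proof -
      obtain a v b where v: "(a, v, b) \<in> act A {}" "p \<in> pass ` set v" using p unfolding in_passes by blast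
      then have "a = 0 \<or> a = 1" using arc_systemD(1)[OF sys(1) v(1)] by auto
      then show ?thesis
      proof
        assume "a = 0" then show ?thesis using v arc_system_unique[OF sys(1) w] by auto
      next
        assume "a = 1"
        then have "v = rev_word ?w" using v(1) arc_system_unique[OF sys(1) arc_systemD(4)[OF sys(1) w]] by auto
        then show ?thesis using v(2) pass_rev_word by metis
      qed
    qed
    moreover have "pass ` set ?w \<subseteq> passes (act A {})" by (rule image_subsetI) (rule passesI[OF w])
    ultimately show ?thesis unfolding sys(2) by blast
  qed
  have "(c, \<not> snd (pass l)) \<in> pass ` set ?w"
  proof -
    have "pass l \<in> pass ` set ?w" by auto
    then show ?thesis unfolding ps c_def by (cases l) auto
  qed
  then obtain l' where l': "l' \<in> set ?w" "pass l' = (c, \<not> snd (pass l))" by (metis imageE)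
  have "pass l' \<noteq> pass l" using l'(2) by (metis snd_conv)
  then have "l' \<in> set X \<or> l' \<in> set Y" using l'(1) by auto
  have fc: "fst l = c" "fst l' = c" using l'(2) by (auto simp: c_def pass_def)
  have rot: "casson (l # Y @ X) = casson (Y @ X @ [l])"
    using \<open>l' \<in> set X \<or> l' \<in> set Y\<close>
  proof
    assume "l' \<in> set Y"
    then obtain Q R where Y: "Y = Q @ l' # R" by (meson split_list)
    let ?v = "l # Q @ l' # R @ X"
    have m: "mset ?w = mset ?v" by (simp add: Y)
    have dv: "distinct (map pass ?v)"
      using d mset_eq_imp_distinct_iff[of "map pass ?w" "map pass ?v"] m by (simp only: mset_map)
    have pv: "pass ` set ?v = set (ids A) \<times> UNIV" unfolding ps[symmetric] Y by auto
    note S = planar_sum[OF A w, of X l Q l' R c, unfolded Y, OF refl fc]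
    have "(\<Sum>d \<in> set (ids A) - {c}. letter_sign ?v (d, True) * letter_sign ?v (d, False) * (inside Q (d, True) - inside Q (d, False))) = 0"
    proof -
      have "letter_sign ?v (e, v) = letter_sign ?w (e, v)" if "e \<in> set (ids A) - {c}" for e v
        by (rule letter_sign_cong[OF d m, symmetric]) (use that ps in auto)
      then have "(\<Sum>d \<in> set (ids A) - {c}. letter_sign ?v (d, True) * letter_sign ?v (d, False) * (inside Q (d, True) - inside Q (d, False))) =
        (\<Sum>d \<in> set (ids A) - {c}. letter_sign ?w (d, True) * letter_sign ?w (d, False) * (inside Q (d, True) - inside Q (d, False)))"
        by (intro sum.cong refl) (simp only:)
      then show ?thesis using S unfolding Y by simp
    qed
    from casson_rotate1[OF dv fc pv refl this] show ?thesis unfolding Y by simp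
  next
    assume "l' \<in> set X"
    then obtain P R where X: "X = P @ l' # R" by (meson split_list)
    let ?Q = "Y @ P"
    let ?v = "l # ?Q @ l' # R"
    have m: "mset ?w = mset ?v" by (simp add: X)
    have dv: "distinct (map pass ?v)"
      using d mset_eq_imp_distinct_iff[of "map pass ?w" "map pass ?v"] m by (simp only: mset_map)
    have pv: "pass ` set ?v = set (ids A) \<times> UNIV" unfolding ps[symmetric] X by auto
    have w': "(0, P @ l' # R @ l # Y, 1) \<in> act A {}" using w unfolding X by simp
    note S = planar_sum[OF A w' refl fc(2,1)]
    \<comment> \<open>In this case the loop from \<open>l\<close> to \<open>l'\<close> contains the
      old base point; \<open>R\<close> is the complementary loop, so \<open>inside\<close> is
      complemented and the sum is negated.\<close>
    have ins: "inside ?Q (e, v) = 1 - inside R (e, v)" if "e \<in> set (ids A) - {c}" for e v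
    proof -
      have "(e, v) \<in> pass ` set ?v" using that unfolding pv by auto
      moreover have "(e, v) \<noteq> pass l" "(e, v) \<noteq> pass l'" using that fc by (auto simp: pass_def)
      moreover have "pass ` set ?Q \<inter> pass ` set R = {}" using dv by simp blast
      ultimately show ?thesis unfolding inside_def by auto
    qed
    have "(\<Sum>d \<in> set (ids A) - {c}. letter_sign ?v (d, True) * letter_sign ?v (d, False) * (inside ?Q (d, True) - inside ?Q (d, False))) =
      (\<Sum>d \<in> set (ids A) - {c}. - (letter_sign ?w (d, True) * letter_sign ?w (d, False) * (inside R (d, True) - inside R (d, False))))"
    proof (rule sum.cong[OF refl])
      fix e assume e: "e \<in> set (ids A) - {c}"
      have "letter_sign ?v (e, v) = letter_sign ?w (e, v)" for v
        by (rule letter_sign_cong[OF d m, symmetric]) (use e ps in auto)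
      then show "letter_sign ?v (e, True) * letter_sign ?v (e, False) * (inside ?Q (e, True) - inside ?Q (e, False)) =
        - (letter_sign ?w (e, True) * letter_sign ?w (e, False) * (inside R (e, True) - inside R (e, False)))"
        unfolding ins[OF e] by (simp add: algebra_simps)
    qed
    also have "\<dots> = 0" using S unfolding X sum_negf by simp
    finally have "(\<Sum>d \<in> set (ids A) - {c}. letter_sign ?v (d, True) * letter_sign ?v (d, False) * (inside ?Q (d, True) - inside ?Q (d, False))) = 0" .
    from casson_rotate1[OF dv fc pv refl this] show ?thesis unfolding X by simp
  qed
  then show ?case using IH by simp
qed

section \<open>Invariance\<close>

text \<open>The exchange makes the other cup the first one and thereby moves the base point to it.
  The two words are rotations of each other, up to reversal, and \<open>casson\<close> is invariant
  under both.\<close>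

lemma value_first_cups:
  assumes t: "tangle 4 V 0"
  shows "value_of ((Cup, 0) # (Cup, 2) # V) v \<longleftrightarrow> value_of ((Cup, 0) # (Cup, 0) # V) v"
proof
  assume "value_of ((Cup, 0) # (Cup, 2) # V) v"
  then obtain C :: "(nat \<times> nat) layer list" and w where C: "(Cup, 2) # V = erase C" "tangle 2 (erase C) 0" "distinct (ids C)"
    "loops C {} = 0" "(0, w, 1) \<in> act C {}" "casson w = v" unfolding value_of_def by auto
  then obtain c A where A: "C = (Cup, 2, c) # A" "V = erase A" by (cases C) (auto simp: erase_def)
  let ?M = "act A {}"
  have dA: "distinct (ids A)" using C(3) by (simp add: A)
  have M: "arc_system 4 ?M" using arc_system_act(1)[of 4 A] t A dA by auto
  note U = arc_system_unique[OF M] and R = arc_systemD(4)[OF M]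
  have nl: "\<not> (\<exists>w. (2, w, 3) \<in> ?M)" "loops A {} = 0" using C(4) by (auto simp: A eval_nat_numeral split: if_splits)
  have g: "gap 2 0 = 0" "gap 2 (Suc 0) = 1" "gap 0 0 = 2" "gap 0 (Suc 0) = 3" by (auto simp: gap_def)
  have "(0, w, 1) \<in> ?M \<or> (\<exists>w1 w2. w = w1 @ w2 \<and> (0, w1, 2) \<in> ?M \<and> (3, w2, 1) \<in> ?M) \<or>
     (\<exists>w1 w2. w = w1 @ w2 \<and> (0, w1, 3) \<in> ?M \<and> (2, w2, 1) \<in> ?M)"
    using C(5) by (simp add: A in_cup_arcs g)
  then obtain w' where w': "(0, w', 1) \<in> cup_arcs 0 ?M" "casson w' = v" "\<not> (\<exists>w. (0, w, 1) \<in> ?M)"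
  proof (elim disjE exE conjE)
    \<comment> \<open>Then the second cup would lie on another component. Ends 0 and 1 being taken,
      end 2 could only be joined to end 3, a loop excluded by \<open>nl\<close>.\<close>
    assume w: "(0, w, 1) \<in> ?M"
    obtain u b where u: "(2, u, b) \<in> ?M" using arc_system_total[OF M, of 2] by auto
    have "b < 4" "b \<noteq> 2" using arc_systemD(2,3)[OF M u] by auto
    moreover have "b \<noteq> 3" using nl u by blast
    moreover have "b \<noteq> 0" by (rule notI) (use U[OF R[OF u], of w 1] w in simp)
    moreover have "b \<noteq> 1" by (rule notI) (use U[OF R[OF u], of "rev_word w" 0] R[OF w] in simp)
    ultimately show thesis by linarith
  next
    fix w1 w2 assume w: "w = w1 @ w2" "(0, w1, 2) \<in> ?M" "(3, w2, 1) \<in> ?M"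
    have "(0, rev_word (w2 @ w1), 1) \<in> cup_arcs 0 ?M"
      unfolding in_cup_arcs One_nat_def g rev_word_simps using R[OF w(2)] R[OF w(3)] by auto
    moreover have "casson (w2 @ w1) = v" using casson_rotate[OF C(2,3,4)] C(5,6) unfolding w(1) by auto
    ultimately show thesis using that U[OF w(2)] by (metis casson_rev one_neq_zero numeral_One numeral_eq_iff semiring_norm(85))
  next
    fix w1 w2 assume w: "w = w1 @ w2" "(0, w1, 3) \<in> ?M" "(2, w2, 1) \<in> ?M"
    have "(0, w2 @ w1, 1) \<in> cup_arcs 0 ?M"
      unfolding in_cup_arcs One_nat_def g using w by auto
    moreover have "casson (w2 @ w1) = v" using casson_rotate[OF C(2,3,4)] C(5,6) unfolding w(1) by auto
    moreover have "\<not> (\<exists>w. (0, w, 1) \<in> ?M)" using U[OF w(2), of _ 1] by auto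
    ultimately show thesis by (rule that)
  qed
  let ?B = "(Cup, 0, c) # A"
  have "loops ?B {} = 0" using nl w'(3) by simp
  then show "value_of ((Cup, 0) # (Cup, 0) # V) v"
    unfolding value_of_def using w' C(3) t
    by (intro exI[of _ ?B] exI[of _ w']) (auto simp: A)
next
  assume "value_of ((Cup, 0) # (Cup, 0) # V) v"
  then obtain C :: "(nat \<times> nat) layer list" and w where C: "(Cup, 0) # V = erase C" "tangle 2 (erase C) 0" "distinct (ids C)"
    "loops C {} = 0" "(0, w, 1) \<in> act C {}" "casson w = v" unfolding value_of_def by auto
  then obtain c A where A: "C = (Cup, 0, c) # A" "V = erase A" by (cases C) (auto simp: erase_def)
  let ?M = "act A {}"
  have dA: "distinct (ids A)" using C(3) by (simp add: A)
  have M: "arc_system 4 ?M" using arc_system_act(1)[of 4 A] t A dA by auto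
  note U = arc_system_unique[OF M] and R = arc_systemD(4)[OF M]
  have nl: "\<not> (\<exists>w. (0, w, 1) \<in> ?M)" "loops A {} = 0" using C(4) by (auto simp: A split: if_splits)
  have g: "gap 2 0 = 0" "gap 2 (Suc 0) = 1" "gap 0 0 = 2" "gap 0 (Suc 0) = 3" "Suc 2 = 3" by (auto simp: gap_def)
  have "(2, w, 3) \<in> ?M \<or> (\<exists>w1 w2. w = w1 @ w2 \<and> (2, w1, 0) \<in> ?M \<and> (1, w2, 3) \<in> ?M) \<or>
     (\<exists>w1 w2. w = w1 @ w2 \<and> (2, w1, 1) \<in> ?M \<and> (0, w2, 3) \<in> ?M)"
    using C(5) by (simp add: A in_cup_arcs g)
  then obtain w' where w': "(0, w', 1) \<in> cup_arcs 2 ?M" "casson w' = v" "\<not> (\<exists>w. (2, w, 3) \<in> ?M)"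
  proof (elim disjE exE conjE)
    assume w: "(2, w, 3) \<in> ?M"
    obtain u b where u: "(0, u, b) \<in> ?M" using arc_system_total[OF M, of 0] by auto
    have "b < 4" "b \<noteq> 0" using arc_systemD(2,3)[OF M u] by auto
    moreover have "b \<noteq> 1" using nl u by blast
    moreover have "b \<noteq> 2" by (rule notI) (use U[OF R[OF u], of w 3] w in simp)
    moreover have "b \<noteq> 3" by (rule notI) (use U[OF R[OF u], of "rev_word w" 2] R[OF w] in simp)
    ultimately show thesis by linarith
  next
    fix w1 w2 assume w: "w = w1 @ w2" "(2, w1, 0) \<in> ?M" "(1, w2, 3) \<in> ?M"
    have "(0, rev_word (w2 @ w1), 1) \<in> cup_arcs 2 ?M"
      unfolding in_cup_arcs One_nat_def g rev_word_simps using R[OF w(2)] R[OF w(3)] by auto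
    moreover have "casson (rev_word (w2 @ w1)) = v"
      unfolding casson_rev using casson_rotate[OF C(2,3,4)] C(5,6) unfolding w(1) by auto
    moreover have "\<not> (\<exists>w. (2, w, 3) \<in> ?M)" using U[OF w(2), of _ 3] by auto
    ultimately show thesis by (rule that)
  next
    fix w1 w2 assume w: "w = w1 @ w2" "(2, w1, 1) \<in> ?M" "(0, w2, 3) \<in> ?M"
    have "(0, w2 @ w1, 1) \<in> cup_arcs 2 ?M"
      unfolding in_cup_arcs One_nat_def g using w by auto
    moreover have "casson (w2 @ w1) = v" using casson_rotate[OF C(2,3,4)] C(5,6) unfolding w(1) by auto
    moreover have "\<not> (\<exists>w. (2, w, 3) \<in> ?M)" using U[OF w(2), of _ 3] by auto
    ultimately show thesis by (rule that)
  qed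
  let ?B = "(Cup, 2, c) # A"
  have "loops ?B {} = 0" using nl w'(3) by (simp add: g)
  then show "value_of ((Cup, 0) # (Cup, 2) # V) v"
    unfolding value_of_def using w' C(3) t
    by (intro exI[of _ ?B] exI[of _ w']) (auto simp: A)
qed

text \<open>The base point lies inside the kink: the letters of its crossing are the first and the
  last of the word, and the rest is traversed backwards.\<close>

lemma value_first_R1:
  assumes t: "tangle 2 V 0" and x: "crossing x"
  shows "value_of ((Cup, 0) # (x, 0) # V) v \<longleftrightarrow> value_of ((Cup, 0) # V) v"
proof
  assume "value_of ((Cup, 0) # (x, 0) # V) v"
  then obtain C :: "(nat \<times> nat) layer list" and w where C: "(x, 0) # V = erase C" "tangle 2 (erase C) 0" "distinct (ids C)"
    "loops C {} = 0" "(0, w, 1) \<in> act C {}" "casson w = v" unfolding value_of_def by auto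
  then obtain c A where A: "C = (x, 0, c) # A" "V = erase A" by (cases C) (auto simp: erase_def)
  have dA: "distinct (ids A)" "c \<notin> set (ids A)" using C(3) x by (simp_all add: A)
  have M: "arc_system 2 (act A {})" "passes (act A {}) \<subseteq> set (ids A) \<times> UNIV" using arc_system_act[of 2 A] t A dA by auto
  obtain u where u: "w = left_letter x c # u @ [rev_letter (right_letter x c)]" "(1, u, 0) \<in> act A {}"
    using C(5) x by (auto simp: A layer_arcs_crossing cross_arcs_def in_decorate in_permute_swap at2_def swap_def)
  have "c \<notin> fst ` set u"
  proof
    assume "c \<in> fst ` set u"
    then obtain l where "l \<in> set u" "fst l = c" by auto
    then have "pass l \<in> set (ids A) \<times> UNIV" using passesI[OF u(2)] M(2) by blast
    then show False using \<open>fst l = c\<close> dA(2) by (simp add: pass_def)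
  qed
  then have "casson (rev_word u) = v" using C(6) unfolding u(1) by (subst (asm) casson_ends[of _ c]) auto
  moreover have "(0, rev_word u, 1) \<in> act A {}" using arc_systemD(4)[OF M(1) u(2)] .
  ultimately show "value_of ((Cup, 0) # V) v"
    unfolding value_of_def using C(4) dA t by (intro exI[of _ A] exI[of _ "rev_word u"]) (auto simp: A)
next
  assume "value_of ((Cup, 0) # V) v"
  then obtain A :: "(nat \<times> nat) layer list" and w where A: "V = erase A" "distinct (ids A)"
    "loops A {} = 0" "(0, w, 1) \<in> act A {}" "casson w = v" unfolding value_of_def by auto
  obtain c where c: "c \<notin> set (ids A)" using fresh_id[of "set (ids A)"] by auto
  have M: "arc_system 2 (act A {})" "passes (act A {}) \<subseteq> set (ids A) \<times> UNIV" using arc_system_act[of 2 A] t A by auto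
  have r: "(1, rev_word w, 0) \<in> act A {}" using arc_systemD(4)[OF M(1) A(4)] .
  have "c \<notin> fst ` set (rev_word w)"
  proof
    assume "c \<in> fst ` set (rev_word w)"
    then obtain l where "l \<in> set (rev_word w)" "fst l = c" by auto
    then have "pass l \<in> set (ids A) \<times> UNIV" using passesI[OF r] M(2) by blast
    then show False using \<open>fst l = c\<close> c by (simp add: pass_def)
  qed
  then have "casson (left_letter x c # rev_word w @ [rev_letter (right_letter x c)]) = v"
    using A(5) by (subst casson_ends[of _ c]) auto
  moreover have "(0, left_letter x c # rev_word w @ [rev_letter (right_letter x c)], 1) \<in> act ((x, 0, c) # A) {}"
    using r x by (auto simp: layer_arcs_crossing cross_arcs_def in_decorate in_permute_swap at2_def swap_def)
  ultimately show "value_of ((Cup, 0) # (x, 0) # V) v"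
    unfolding value_of_def using A(1,2,3) c t x
    by (intro exI[of _ "(x, 0, c) # A"] exI[of _ "left_letter x c # rev_word w @ [rev_letter (right_letter x c)]"])
      (auto simp: numeral_2_eq_2 crossing_not_Cup)
qed

lemma value_apply_move:
  assumes "apply_move isotopy_move D E"
  shows "value_of D v \<longleftrightarrow> value_of E v"
  using assms
proof cases
  case (1 S T U V)
  show ?thesis
  proof (cases "U = []")
    case False
    then show ?thesis
      using isotopy_move_replaceable[OF 1(3)] value_replace[of "(=)" S T U V v] value_replace[of "(=)" T S U V v] 1 by auto
  next
    \<comment> \<open>Starting from zero strands, only an exchange of two cups or a kink on the
      first cup fits the widths.\<close>
    case True
    then have D: "D = S @ V" "E = T @ V" "tangle 0 (S @ V) 0" using 1 by (auto simp: link_diagram_def)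
    from \<open>isotopy_move S T\<close> show ?thesis
    proof cases
      case (exchange i k x y)
      have "i = 0" "ins x = 0" using D(3) exchange by auto
      then have "x = Cup" by (cases x) auto
      then have "ins y = 0" "k = 0" using D(3) exchange \<open>i = 0\<close> by auto
      then have "y = Cup" by (cases y) auto
      then show ?thesis using value_first_cups[of V v] D exchange \<open>i = 0\<close> \<open>x = Cup\<close> \<open>k = 0\<close>
        by (simp add: eval_nat_numeral)
    next
      case (R1_cup x i)
      then show ?thesis using value_first_R1[of V x v] D by (auto simp: numeral_2_eq_2)
    qed (use D in auto)
  qed
qed

lemma value_isotopic: "isotopic D E \<Longrightarrow> value_of D v \<longleftrightarrow> value_of E v"
  unfolding isotopic_def
proof (induction rule: equivclp_induct)
  case (step y z)
  then show ?case using value_apply_move by blast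
qed simp

lemma value_delta_move:
  assumes "delta_move D E" "value_of D v"
  shows "\<exists>v'. value_of E v' \<and> \<bar>v - v'\<bar> = 1"
proof -
  have *: "\<exists>v'. value_of E v' \<and> \<bar>v - v'\<bar> = 1" if "apply_move delta_local D E \<or> apply_move delta_local E D" "value_of D v" for D E v
    using that(1)
  proof
    assume "apply_move delta_local D E"
    then show ?thesis
    proof cases
      case (1 S T U V)
      then have "U \<noteq> []" by (auto simp: link_diagram_def elim!: delta_local.cases)
      then show ?thesis using value_replace[of "\<lambda>v w. \<bar>v - w\<bar> = 1" S T U V v] delta_local_replaceable 1 that(2) by auto
    qed
  next
    assume "apply_move delta_local E D"
    then show ?thesis
    proof cases
      case (1 S T U V)
      then have "U \<noteq> []" by (auto simp: link_diagram_def elim!: delta_local.cases)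
      then show ?thesis using value_replace[of "\<lambda>v w. \<bar>v - w\<bar> = 1" T S U V v] delta_local_replaceable 1 that(2) by auto
    qed
  qed
  then show ?thesis using assms unfolding delta_move_def symclp_def by blast
qed

lemma isotopic_sym: "isotopic D E \<Longrightarrow> isotopic E D"
  unfolding isotopic_def by (rule equivclp_sym)

lemma isotopic_trans [trans]: "isotopic D E \<Longrightarrow> isotopic E F \<Longrightarrow> isotopic D F"
  unfolding isotopic_def by (rule equivclp_trans)

lemma value_unknot: "value_of unknot v \<longleftrightarrow> v = 0"
proof -
  have c: "\<not> crossing Cap" by (simp add: crossing_def)
  have e: "(0, w, 1) \<in> act [(Cap, 0, c)] {} \<longleftrightarrow> w = []" for w c by (auto simp: in_cap_arcs)
  have "casson [] = 0" by (simp add: casson_def)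
  then have z: "casson w = 0" if "(0, w, 1) \<in> act [(Cap, 0, c)] {}" for w c using that e by simp
  show ?thesis
  proof
    assume "value_of unknot v"
    then obtain A :: "(nat \<times> nat) layer list" and w where A: "erase A = [(Cap, 0)]" "(0, w, 1) \<in> act A {}" "casson w = v"
      unfolding value_of_def unknot_def by auto
    then show "v = 0" using z unfolding erase_1 by auto
  next
    assume "v = 0"
    then show "value_of unknot v"
      unfolding value_of_def unknot_def using e[of "[]" "(0, 0)"] z[of "[]" "(0, 0)"] c
      by (intro exI[of _ "[(Cap, 0, (0, 0))]"] exI[of _ "[]"]) simp
  qed
qed

section \<open>Paths of Delta-moves and mirror images\<close>

lemma delta_path_0: "delta_path 0 D E \<longleftrightarrow> isotopic D E"
  by (auto elim: delta_path.cases intro: delta_path.isotopy)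

lemma delta_path_1: "delta_path (Suc 0) D F \<longleftrightarrow> (\<exists>E E'. isotopic D E \<and> delta_move E E' \<and> isotopic E' F)"
proof
  assume "delta_path (Suc 0) D F"
  then show "\<exists>E E'. isotopic D E \<and> delta_move E E' \<and> isotopic E' F"
    by cases (auto simp: delta_path_0)
next
  assume "\<exists>E E'. isotopic D E \<and> delta_move E E' \<and> isotopic E' F"
  then show "delta_path (Suc 0) D F" using delta_path.intros by blast
qed

text \<open>In \<open>enat\<close> the infimum over a nonempty set of naturals is attained at its
  least element.\<close>

lemma delta_unknotting_number_1:
  "delta_unknotting_number D = 1 \<longleftrightarrow> delta_path (Suc 0) D unknot \<and> \<not> isotopic D unknot"
proof -
  define N where "N = {n. delta_path n D unknot}"
  have inf: "(INF n \<in> N. enat n) = enat (LEAST n. n \<in> N)" if "N \<noteq> {}"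
  proof (rule antisym)
    have "(LEAST n. n \<in> N) \<in> N" using that by (metis LeastI all_not_in_conv)
    then show "(INF n \<in> N. enat n) \<le> enat (LEAST n. n \<in> N)" by (rule INF_lower)
    show "enat (LEAST n. n \<in> N) \<le> (INF n \<in> N. enat n)" by (rule INF_greatest) (simp add: Least_le)
  qed
  have n: "delta_unknotting_number D = (INF n \<in> N. enat n)"
    by (simp add: delta_unknotting_number_def delta_gordian_distance_def N_def)
  show ?thesis
  proof
    assume *: "delta_unknotting_number D = 1"
    then have "N \<noteq> {}" unfolding n by (auto simp: top_enat_def one_enat_def)
    then have "enat (LEAST n. n \<in> N) = enat 1" using * inf unfolding n one_enat_def by simp
    then have L: "(LEAST n. n \<in> N) = 1" by simp
    then have "1 \<in> N" using \<open>N \<noteq> {}\<close> by (metis LeastI all_not_in_conv)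
    moreover have "0 \<notin> N" using L by (metis Least_eq_0 zero_neq_one)
    ultimately show "delta_path (Suc 0) D unknot \<and> \<not> isotopic D unknot" by (simp add: N_def delta_path_0)
  next
    assume *: "delta_path (Suc 0) D unknot \<and> \<not> isotopic D unknot"
    then have m: "1 \<in> N" "0 \<notin> N" by (auto simp: N_def delta_path_0)
    have "(LEAST n. n \<in> N) = 1"
      by (rule Least_equality) (use m in \<open>auto simp: Suc_le_eq intro: gr0I\<close>)
    then show "delta_unknotting_number D = 1" unfolding n using inf m(1) by (auto simp: one_enat_def)
  qed
qed

text \<open>Read backwards, the path carries the value 0 of the unknot to some value of
  \<open>D\<close>. Read forwards, it takes every value of \<open>D\<close> to a value of the
  unknot, hence to 0, at distance 1.\<close>

lemma value_delta_path_unknot: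
  assumes "delta_path (Suc 0) D unknot"
  shows "\<exists>v. value_of D v" "value_of D v \<Longrightarrow> \<bar>v\<bar> = 1"
proof -
  obtain E E' where E: "isotopic D E" "delta_move E E'" "isotopic E' unknot" using assms unfolding delta_path_1 by blast
  have "delta_move E' E" using E(2) unfolding delta_move_def by (simp add: symclp_def disj_commute)
  moreover have "value_of E' 0" using value_isotopic[OF E(3)] value_unknot by simp
  ultimately show "\<exists>v. value_of D v" using value_delta_move value_isotopic[OF E(1)] by blast
  assume "value_of D v"
  then have "value_of E v" using value_isotopic[OF E(1)] by blast
  then obtain v' where "value_of E' v'" "\<bar>v - v'\<bar> = 1" using value_delta_move[OF E(2)] by blast
  then show "\<bar>v\<bar> = 1" using value_isotopic[OF E(3)] value_unknot by auto
qed

lemma mirror_simps [simp]: "mirror [] = []" "mirror ((x, i) # D) = (flip x, i) # mirror D" "mirror (D @ E) = mirror D @ mirror E"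
  "mirror (mirror D) = D"
  by (auto simp: mirror_def comp_def case_prod_beta)

lemma flip_ins [simp]: "ins (flip x) = ins x" "outs (flip x) = outs x"
  by (cases x; simp)+

lemma tangle_mirror [simp]: "tangle m (mirror D) n = tangle m D n"
  by (induction m D n rule: tangle.induct) auto

lemma isotopy_move_mirror: "isotopy_move S T \<Longrightarrow> isotopy_move (mirror S) (mirror T)"
proof (induction rule: isotopy_move.induct)
  case (exchange i k x y)
  then show ?case using isotopy_move.exchange[of i k "flip x" "flip y"] by simp
next
  case (slide_cup x i)
  then show ?case using isotopy_move.slide_cup[of "flip x" i] by simp
next
  case (slide_cap x i)
  then show ?case using isotopy_move.slide_cap[of "flip x" i] by simp
next
  case (R2 x i)
  then show ?case using isotopy_move.R2[of "flip x" i] by simp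
next
  case (R3 a b c i)
  moreover have "flip a = flip b \<longleftrightarrow> a = b" "flip b = c \<longleftrightarrow> b = flip c" for a b c by (cases a; cases b; cases c; simp)+
  ultimately show ?case using isotopy_move.R3[of "flip a" "flip b" "flip c" i] by simp
next
  case (zigzag_left i)
  then show ?case using isotopy_move.zigzag_left[of i] by simp
next
  case (zigzag_right i)
  then show ?case using isotopy_move.zigzag_right[of i] by simp
qed (auto intro: isotopy_move.intros)

lemma delta_local_mirror: "delta_local S T \<Longrightarrow> delta_local (mirror S) (mirror T)"
proof (induction rule: delta_local.induct)
  case (1 a i)
  then show ?case using delta_local.intros[of "flip a" i] by simp
qed

lemma apply_move_mirror:
  assumes "\<And>S T. M S T \<Longrightarrow> M (mirror S) (mirror T)" "apply_move M D E"
  shows "apply_move M (mirror D) (mirror E)"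
  using assms(2)
proof cases
  case (1 S T U V)
  then show ?thesis using apply_move.intros[of M "mirror S" "mirror T" "mirror U" "mirror V"] assms(1)[of S T]
    by (simp add: link_diagram_def flip: mirror_simps(3))
qed

lemma isotopic_mirror: "isotopic D E \<Longrightarrow> isotopic (mirror D) (mirror E)"
  unfolding isotopic_def
proof (induction rule: equivclp_induct)
  case (step y z)
  then have "equivclp (apply_move isotopy_move) (mirror y) (mirror z)"
    using apply_move_mirror[of isotopy_move, OF isotopy_move_mirror]
    by (meson equivclp_sym r_into_equivclp)
  then show ?case using step by (meson equivclp_trans)
qed simp

lemma delta_path_mirror: "delta_path (Suc 0) D unknot \<Longrightarrow> delta_path (Suc 0) (mirror D) unknot"
proof -
  assume "delta_path (Suc 0) D unknot"
  then obtain E E' where E: "isotopic D E" "delta_move E E'" "isotopic E' unknot" unfolding delta_path_1 by blast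
  have "delta_move (mirror E) (mirror E')"
    using E(2) apply_move_mirror[of delta_local, OF delta_local_mirror] unfolding delta_move_def symclp_def by blast
  moreover have "mirror unknot = unknot" by (simp add: unknot_def)
  ultimately show ?thesis using isotopic_mirror[OF E(1)] isotopic_mirror[OF E(3)] unfolding delta_path_1 by metis
qed

section \<open>Diagrams with crossings of equal sign\<close>

context labelling
begin

lemma chain_sign: "chain t w t' \<Longrightarrow> l \<in> set w \<Longrightarrow> snd (snd l) = sg (pass l)"
  by (induction w arbitrary: t) auto

end

text \<open>Labels now serve as times along the curve; that they increase at each passage is assumed
  in the lemmas.\<close>

locale increasing_labelling = labelling lin lout sg
  for lin lout :: "'c \<times> bool \<Rightarrow> int" and sg
begin

lemma chain_sorted:
  "chain t w t' \<Longrightarrow> (\<And>l. l \<in> set w \<Longrightarrow> lin (pass l) < lout (pass l)) \<Longrightarrow>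
    sorted_wrt (<) (map lin (map pass w)) \<and> (\<forall>l \<in> set w. t \<le> lin (pass l))"
proof (induction w arbitrary: t)
  case (Cons l w)
  have IH: "sorted_wrt (<) (map lin (map pass w)) \<and> (\<forall>k \<in> set w. lout (pass l) \<le> lin (pass k))"
    using Cons.IH[of "lout (pass l)"] Cons.prems by simp
  have lt: "lin (pass l) < lout (pass l)" using Cons.prems(2)[of l] by simp
  have t: "t = lin (pass l)" using Cons.prems(1) by simp
  have "\<forall>k \<in> set w. t < lin (pass k)" using IH lt unfolding t by (metis less_le_trans)
  then show ?case using IH t by simp (metis less_imp_le)
qed simp

text \<open>The pattern of the Polyak-Viro formula expressed by times of passage.\<close>

definition crossing_pairs :: "'c set \<Rightarrow> ('c \<times> 'c) set" where
  "crossing_pairs I = {(c, d). c \<in> I \<and> d \<in> I \<and> lin (c, False) < lin (d, True) \<and> lin (d, True) < lin (c, True) \<and> lin (c, True) < lin (d, False)}"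

text \<open>Since times increase along the word, four passages occur in the order of their times.
  All crossings have sign \<open>\<eta>\<close>, so each term equals
  \<open>\<eta> * \<eta> = 1\<close>.\<close>

lemma casson_count:
  assumes ch: "chain t w t'" and inc: "\<And>c v. c \<in> I \<Longrightarrow> lin (c, v) < lout (c, v)" and I: "finite I"
    and ps: "pass ` set w = I \<times> UNIV" and e: "\<And>c. c \<in> I \<Longrightarrow> sg (c, True) * sg (c, False) = \<eta>" "\<eta> * \<eta> = 1"
  shows "casson w = int (card (crossing_pairs I))"
proof -
  have inc': "lin (pass l) < lout (pass l)" if "l \<in> set w" for l
  proof -
    have "pass l \<in> I \<times> UNIV" using that ps by (metis imageI)
    then show ?thesis using inc[of "fst (pass l)" "snd (pass l)"] by auto
  qed
  have srt: "sorted_wrt (<) (map lin (map pass w))" using chain_sorted[OF ch inc'] by blast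
  have "fst ` pass ` set w = I" unfolding ps by auto
  moreover have "fst ` pass ` K = fst ` K" for K :: "'c letter set" by (force simp: pass_def)
  ultimately have fw: "fst ` set w = I" by metis
  let ?C = "\<lambda>c d. lin (c, False) < lin (d, True) \<and> lin (d, True) < lin (c, True) \<and> lin (c, True) < lin (d, False)"
  have i: "interleaving c d (restrict c d w) = (if ?C c d then 1 else 0)" if cd: "c \<in> I" "d \<in> I" for c d
  proof -
    let ?v = "restrict c d w" and ?L = "[(c, False), (d, True), (c, True), (d, False)]"
    have sv: "sorted_wrt (<) (map lin (map pass ?v))"
      unfolding restrict_def map_map using srt by (auto simp: sorted_wrt_map sorted_wrt_filter)
    have "pass ` set ?v = {(c, False), (d, True), (c, True), (d, False)}"
    proof
      show "pass ` set ?v \<subseteq> {(c, False), (d, True), (c, True), (d, False)}" by (auto simp: restrict_def pass_def)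
      have "(x, v) \<in> pass ` set ?v" if "x = c \<or> x = d" for x v
      proof -
        have "(x, v) \<in> pass ` set w" unfolding ps using that cd by auto
        then obtain l where "l \<in> set w" "pass l = (x, v)" by (metis imageE)
        then have "l \<in> set ?v" using that by (auto simp: restrict_def pass_def)
        then show ?thesis using \<open>pass l = (x, v)\<close> by (metis imageI)
      qed
      then show "{(c, False), (d, True), (c, True), (d, False)} \<subseteq> pass ` set ?v" by blast
    qed
    then have sets: "set (map pass ?v) = set ?L" by auto
    have pr: "prod_list (map (\<lambda>l. snd (snd l)) ?v) = prod_list (map sg (map pass ?v))"
      unfolding map_map by (rule arg_cong[where f = prod_list], rule map_cong)
        (auto simp: restrict_def chain_sign[OF ch])
    show ?thesis
    proof (cases "?C c d")
      case True
      have sL: "sorted_wrt (<) (map lin ?L)" using True by auto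
      have "map lin (map pass ?v) = map lin ?L"
        by (rule strict_sorted_equal[OF sv sL, symmetric]) (metis list.set_map sets)
      moreover have "inj_on lin (set (map pass ?v) \<union> set ?L)"
        using True unfolding sets by (auto simp: inj_on_def)
      ultimately have m: "map pass ?v = ?L" using inj_on_map_eq_map by blast
      have "prod_list (map sg ?L) = 1" using e(1)[OF cd(1)] e(1)[OF cd(2)] e(2) by (simp add: algebra_simps)
      then show ?thesis using True m pr by (simp add: interleaving_def)
    next
      case False
      have "map pass ?v \<noteq> ?L" using sv False by auto
      then show ?thesis using False by (simp add: interleaving_def)
    qed
  qed
  have "casson w = (\<Sum>c \<in> I. \<Sum>d \<in> I. if ?C c d then 1 else 0)"
    unfolding casson_def fw using i by simp
  also have "\<dots> = (\<Sum>p \<in> I \<times> I. if ?C (fst p) (snd p) then 1 else 0)"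
    unfolding sum.cartesian_product by (rule sum.cong) auto
  also have "\<dots> = int (card {p \<in> I \<times> I. ?C (fst p) (snd p)})"
    using I by (simp add: sum.If_cases Int_def)
  also have "{p \<in> I \<times> I. ?C (fst p) (snd p)} = crossing_pairs I" by (auto simp: crossing_pairs_def)
  finally show ?thesis .
qed

end

locale diagram_labelling = increasing_labelling lin lout sg
  for lin lout :: "(nat \<times> nat) \<times> bool \<Rightarrow> int" and sg
begin

text \<open>By \<open>act_ends\<close> the number of loops depends only on the erased diagram, so
  the existence of any value certifies a single component for the chosen labels too.\<close>

lemma value_crossing_pairs:
  assumes tr: "trace A [(1, t), (- 1, t')]" and d: "distinct (ids A)"
    and inc: "\<And>c v. c \<in> set (ids A) \<Longrightarrow> lin (c, v) < lout (c, v)"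
    and e: "\<And>c. c \<in> set (ids A) \<Longrightarrow> sg (c, True) * sg (c, False) = \<eta>" "\<eta> * \<eta> = 1"
    and v: "value_of ((Cup, 0) # erase A) v"
  shows "value_of ((Cup, 0) # erase A) (int (card (crossing_pairs (set (ids A)))))"
proof -
  have T: "tangle 2 (erase A) 0" "consistent (act A {}) [(1, t), (- 1, t')]"
    using trace_consistent[OF tr] by (auto simp: numeral_2_eq_2)
  obtain B :: "(nat \<times> nat) layer list" where "erase A = erase B" "loops B {} = 0" using v unfolding value_of_def by auto
  then have l: "loops A {} = 0" using act_ends[of A B "{}" "{}"] by simp
  have M: "arc_system 2 (act A {})" "passes (act A {}) = set (ids A) \<times> UNIV" using arc_system_act[OF T(1) d] l by auto
  obtain w b where w: "(0, w, b) \<in> act A {}" using arc_system_total[OF M(1), of 0] by auto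
  have "b = 1" using arc_systemD(2,3)[OF M(1) w] by auto
  note w = w[unfolded this]
  have ch: "chain t w t'" using consistentD(3)[OF T(2) w] by simp
  have "p \<in> pass ` set w" if p: "p \<in> passes (act A {})" for p
  proof -
    obtain a v b where v: "(a, v, b) \<in> act A {}" "p \<in> pass ` set v" using p unfolding in_passes by blast
    then have "a = 0 \<or> a = 1" using arc_systemD(1)[OF M(1) v(1)] by auto
    then show ?thesis
    proof
      assume "a = 0" then show ?thesis using v arc_system_unique[OF M(1) w] by auto
    next
      assume "a = 1"
      then have "v = rev_word w" using v(1) arc_system_unique[OF M(1) arc_systemD(4)[OF M(1) w]] by auto
      then show ?thesis using v(2) pass_rev_word by metis
    qed
  qed
  moreover have "pass ` set w \<subseteq> passes (act A {})" by (rule image_subsetI) (rule passesI[OF w])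
  ultimately have ps: "pass ` set w = set (ids A) \<times> UNIV" unfolding M(2) by blast
  have "casson w = int (card (crossing_pairs (set (ids A))))"
    by (rule casson_count[OF ch inc _ ps e]) simp_all
  moreover have "value_of ((Cup, 0) # erase A) (casson w)"
    unfolding value_of_def using T(1) d l w by blast
  ultimately show ?thesis by simp
qed

text \<open>A cardinality is nonnegative, so absolute value 1 leaves exactly one pair.\<close>

lemma delta_one_count:
  assumes tr: "trace A [(1, t), (- 1, t')]" and d: "distinct (ids A)"
    and inc: "\<And>c v. c \<in> set (ids A) \<Longrightarrow> lin (c, v) < lout (c, v)"
    and e: "\<And>c. c \<in> set (ids A) \<Longrightarrow> sg (c, True) * sg (c, False) = \<eta>" "\<eta> * \<eta> = 1"
    and K: "isotopic K ((Cup, 0) # erase A)" "delta_path (Suc 0) K unknot"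
  shows "card (crossing_pairs (set (ids A))) = 1"
proof -
  obtain v where "value_of ((Cup, 0) # erase A) v" using value_delta_path_unknot(1)[OF K(2)] value_isotopic[OF K(1)] by blast
  from value_crossing_pairs[OF tr d inc e this] show ?thesis
    using value_delta_path_unknot(2)[OF K(2)] value_isotopic[OF K(1)] by fastforce
qed

end

lemma two_pairs:
  assumes "finite S" "p \<in> S" "q \<in> S" "p \<noteq> q"
  shows "card S \<noteq> 1"
  using assms by (metis card_1_singletonE singletonD)

lemma finite_crossing_pairs: "finite I \<Longrightarrow> finite (increasing_labelling.crossing_pairs lin I)"
  unfolding increasing_labelling.crossing_pairs_def by (rule finite_subset[of _ "I \<times> I"]) auto

section \<open>Pretzel knots\<close>

lemma erase_map: "erase (map (\<lambda>j. (x j, i j, c j)) l) = map (\<lambda>j. (x j, i j)) l"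
  by (simp add: erase_def comp_def)

lemma erase_concat: "erase (concat l) = concat (map erase l)"
  by (induction l) auto

lemma ids_concat: "ids (concat l) = concat (map ids l)"
  by (induction l) auto

lemma ids_map: "ids (map (\<lambda>j. (x j, i j, c j)) l) = map c (filter (\<lambda>j. crossing (x j)) l)"
  by (induction l) auto

lemma crossing_twist [simp]: "crossing (twist p)"
  by (simp add: twist_def crossing_def)

text \<open>For column \<open>j\<close>, \<open>dL j\<close> and \<open>dR j\<close> are the
  directions of its two runs, and \<open>uL j\<close> and \<open>uR j\<close> their times at the
  bottom of the column.\<close>

locale columns =
  fixes ps :: "int list" and uL uR dL dR :: "nat \<Rightarrow> int"
begin

definition strands :: "nat \<Rightarrow> nat" where "strands j = nat \<bar>ps ! j\<bar>"

text \<open>The run L (R) enters the j-th column at its bottom left (right) end; it is on the left at the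
  heights t with t even (odd).  The function on_L singles out the passes that belong to the run L.\<close>

definition on_L :: "nat \<Rightarrow> nat \<Rightarrow> bool \<Rightarrow> bool" where
  "on_L j t v \<longleftrightarrow> (even t \<longleftrightarrow> (v \<longleftrightarrow> 0 \<le> ps ! j))"

text \<open>A run going down reaches the crossing between heights \<open>t\<close> and
  \<open>t + 1\<close> from above, at its time for height \<open>t + 1\<close>; hence the
  subtraction of 1.\<close>

definition lin :: "(nat \<times> nat) \<times> bool \<Rightarrow> int" where
  "lin = (\<lambda>((j, t), v). if on_L j t v then uL j + dL j * int t - (if dL j = 1 then 0 else 1)
     else uR j + dR j * int t - (if dR j = 1 then 0 else 1))"

definition lout :: "(nat \<times> nat) \<times> bool \<Rightarrow> int" where
  "lout p = lin p + 1"

text \<open>The second factor is the sign from \<open>left_letter\<close> or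
  \<open>right_letter\<close>: a passage enters at the bottom left exactly if it is over in a column
  of \<open>Over\<close> or under in a column of \<open>Under\<close>.\<close>

definition sg :: "(nat \<times> nat) \<times> bool \<Rightarrow> int" where
  "sg = (\<lambda>((j, t), v). (if on_L j t v then dL j else dR j) * (if v \<longleftrightarrow> 0 \<le> ps ! j then 1 else if 0 \<le> ps ! j then 1 else - 1))"

sublocale diagram_labelling lin lout sg .

lemma lin_apply: "lin ((j, t), v) = (if on_L j t v then uL j + dL j * int t - (if dL j = 1 then 0 else 1)
     else uR j + dR j * int t - (if dR j = 1 then 0 else 1))"
  by (simp add: lin_def)

lemma sg_apply: "sg ((j, t), v) = (if on_L j t v then dL j else dR j) * (if v \<longleftrightarrow> 0 \<le> ps ! j then 1 else if 0 \<le> ps ! j then 1 else - 1)"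
  by (simp add: sg_def)

definition runL :: "nat \<Rightarrow> nat \<Rightarrow> int \<times> int" where "runL j t = (dL j, uL j + dL j * int t)"
definition runR :: "nat \<Rightarrow> nat \<Rightarrow> int \<times> int" where "runR j t = (dR j, uR j + dR j * int t)"

definition level :: "nat \<Rightarrow> nat \<Rightarrow> (int \<times> int) list" where
  "level j t = (if even t then [runL j t, runR j t] else [runR j t, runL j t])"

definition column :: "nat \<Rightarrow> nat \<Rightarrow> (nat \<times> nat) layer list" where
  "column j t = map (\<lambda>t. (twist (ps ! j), 2 * j, (j, t))) [t..<strands j]"

text \<open>The first cup is left out, as in \<open>value_of\<close>. The label
  \<open>(0, 0)\<close> at cups and caps is a dummy.\<close>

definition annotated :: "(nat \<times> nat) layer list" where
  "annotated = map (\<lambda>j. (Cup, 2 * j + 1, (0, 0))) [0..<length ps - 1] @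
     concat (map (\<lambda>j. column j 0) [0..<length ps]) @
     map (\<lambda>j. (Cap, 2 * j + 1, (0, 0))) (rev [0..<length ps - 1]) @ [(Cap, 0, (0, 0))]"

lemma erase_annotated: "(Cup, 0) # erase annotated = pretzel_diagram ps"
  unfolding annotated_def pretzel_diagram_def Let_def erase_simps erase_map erase_concat map_map comp_def column_def
  by (simp add: map_replicate_const strands_def erase_def)

lemma ids_annotated: "ids annotated = concat (map (\<lambda>j. map (\<lambda>t. (j, t)) [0..<strands j]) [0..<length ps])"
proof -
  have "ids ([(Cap, 0, (0, 0))] :: (nat \<times> nat) layer list) = []" by simp
  then show ?thesis unfolding annotated_def ids_append ids_map ids_concat map_map comp_def column_def by simp
qed

lemma set_ids: "set (ids annotated) = {(j, t). j < length ps \<and> t < strands j}"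
  unfolding ids_annotated by auto

lemma distinct_ids: "distinct (ids annotated)"
proof -
  have "distinct (concat (map (\<lambda>j. map (\<lambda>t. (j, t)) [0..<f j]) [0..<n]))" for n and f :: "nat \<Rightarrow> nat"
    by (induction n) (auto simp: distinct_map inj_on_def)
  then show ?thesis unfolding ids_annotated .
qed

text \<open>Times have to fit at every cup and cap that joins columns, except at the outermost cup:
  the base point lies there and time starts anew.\<close>

definition compatible :: bool where
  "compatible \<longleftrightarrow> ps \<noteq> [] \<and>
     (\<forall>j < length ps. dL j \<in> {1, - 1} \<and> dR j \<in> {1, - 1}) \<and>
     (\<forall>j. Suc j < length ps \<longrightarrow> matched (runR j 0) (runL (Suc j) 0) \<and>
        matched (level j (strands j) ! 1) (level (Suc j) (strands (Suc j)) ! 0)) \<and>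
     matched (level 0 (strands 0) ! 0) (level (length ps - 1) (strands (length ps - 1)) ! 1)"

lemma column_trace:
  assumes d: "dL j \<in> {1, - 1}" "dR j \<in> {1, - 1}" and l: "length s = 2 * j"
    and A: "trace A (s @ level j (strands j) @ s')" and t: "t \<le> strands j"
  shows "trace (column j t @ A) (s @ level j t @ s')"
  using t
proof (induction t rule: inc_induct)
  case base
  then show ?case using A by (simp add: column_def)
next
  case (step t)
  have c: "column j t = (twist (ps ! j), 2 * j, (j, t)) # column j (Suc t)"
    using step.hyps by (simp add: column_def upt_conv_Cons)
  have "layer_ok (twist (ps ! j), 2 * j, (j, t)) (s @ level j t @ s') (s @ level j (Suc t) @ s')"
  proof (cases "even t")
    case True
    have "edge (left_letter (twist (ps ! j)) (j, t)) (runL j t) (runL j (Suc t))"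
      "edge (right_letter (twist (ps ! j)) (j, t)) (runR j t) (runR j (Suc t))"
      using True d unfolding edge_def by (auto simp: runL_def runR_def left_letter_def right_letter_def twist_def lin_apply lout_def sg_apply on_L_def algebra_simps)
    then show ?thesis unfolding layer_ok_crossing[OF crossing_twist] using True l
      by (intro exI[of _ s] exI[of _ s'] exI[of _ "runL j t"] exI[of _ "runR j t"] exI[of _ "runL j (Suc t)"] exI[of _ "runR j (Suc t)"])
        (simp add: level_def)
  next
    case False
    have "edge (left_letter (twist (ps ! j)) (j, t)) (runR j t) (runR j (Suc t))"
      "edge (right_letter (twist (ps ! j)) (j, t)) (runL j t) (runL j (Suc t))"
      using False d unfolding edge_def by (auto simp: runL_def runR_def left_letter_def right_letter_def twist_def lin_apply lout_def sg_apply on_L_def algebra_simps)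
    then show ?thesis unfolding layer_ok_crossing[OF crossing_twist] using False l
      by (intro exI[of _ s] exI[of _ s'] exI[of _ "runR j t"] exI[of _ "runL j t"] exI[of _ "runR j (Suc t)"] exI[of _ "runL j (Suc t)"])
        (simp add: level_def)
  qed
  then show ?case unfolding c append_Cons trace.simps using step.IH by blast
qed

lemma length_level [simp]: "length (level j t) = 2"
  by (simp add: level_def)

lemma columns_trace:
  assumes d: "\<And>j. j < n \<Longrightarrow> dL j \<in> {1, - 1} \<and> dR j \<in> {1, - 1}"
    and A: "trace A (concat (map (\<lambda>j. level j (strands j)) [0..<n]))" and m: "m \<le> n"
  shows "trace (concat (map (\<lambda>j. column j 0) [m..<n]) @ A)
    (concat (map (\<lambda>j. level j (strands j)) [0..<m]) @ concat (map (\<lambda>j. level j 0) [m..<n]))"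
  using m
proof (induction m rule: inc_induct)
  case base
  then show ?case using A by simp
next
  case (step m)
  have l: "length (concat (map (\<lambda>j. level j (strands j)) [0..<m])) = 2 * m"
    by (induction m) auto
  have u: "[m..<n] = m # [Suc m..<n]" using step.hyps by (simp add: upt_conv_Cons)
  have "trace (column m 0 @ concat (map (\<lambda>j. column j 0) [Suc m..<n]) @ A)
    (concat (map (\<lambda>j. level j (strands j)) [0..<m]) @ level m 0 @ concat (map (\<lambda>j. level j 0) [Suc m..<n]))"
    by (rule column_trace) (use d[of m] step l in auto)
  then show ?case unfolding u by simp
qed

lemma cups_trace:
  assumes A: "trace A s" and l: "length s = 2 * Suc n" and m: "\<And>j. j < n \<Longrightarrow> matched (s ! Suc (2 * j)) (s ! Suc (Suc (2 * j)))" and k: "k \<le> n"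
  shows "trace (map (\<lambda>j. (Cup, 2 * j + 1, c)) [k..<n] @ A) (take (2 * k + 1) s @ [s ! (2 * n + 1)])"
  using k
proof (induction k rule: inc_induct)
  case base
  have "take (2 * n + 1) s @ [s ! (2 * n + 1)] = s" using l by (simp add: take_Suc_conv_app_nth[symmetric])
  then show ?case using A by simp
next
  case (step k)
  have u: "[k..<n] = k # [Suc k..<n]" using step.hyps by (simp add: upt_conv_Cons)
  have t: "take (2 * Suc k + 1) s = take (2 * k + 1) s @ [s ! Suc (2 * k), s ! Suc (Suc (2 * k))]"
    using l step.hyps by (simp add: take_Suc_conv_app_nth)
  have "layer_ok (Cup, 2 * k + 1, c) (take (2 * k + 1) s @ [s ! (2 * n + 1)]) (take (2 * Suc k + 1) s @ [s ! (2 * n + 1)])"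
    unfolding t layer_ok.simps using m[of k] step.hyps l
    by (intro exI[of _ "take (2 * k + 1) s"] exI[of _ "[s ! (2 * n + 1)]"] exI[of _ "s ! Suc (2 * k)"] exI[of _ "s ! Suc (Suc (2 * k))"]) simp
  then show ?case unfolding u list.map append_Cons trace.simps using step.IH by blast
qed

lemma caps_trace:
  assumes l: "length s = 2 * Suc n" and m: "\<And>j. j < n \<Longrightarrow> matched (s ! Suc (2 * j)) (s ! Suc (Suc (2 * j)))"
    and e: "matched (s ! 0) (s ! (2 * n + 1))" and k: "k \<le> n"
  shows "trace (map (\<lambda>j. (Cap, 2 * j + 1, c)) (rev [0..<k]) @ [(Cap, 0, c)]) (take (2 * k + 1) s @ [s ! (2 * n + 1)])"
  using k
proof (induction k)
  case 0
  have "take 1 s = [s ! 0]" using l by (simp add: take_Suc_conv_app_nth)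
  then show ?case using e by (cases "s ! 0"; cases "s ! Suc (2 * n)") (auto intro!: exI[of _ "[]"])
next
  case (Suc k)
  have t: "take (2 * Suc k + 1) s = take (2 * k + 1) s @ [s ! Suc (2 * k), s ! Suc (Suc (2 * k))]"
    using l Suc.prems by (simp add: take_Suc_conv_app_nth)
  have "layer_ok (Cap, 2 * k + 1, c) (take (2 * Suc k + 1) s @ [s ! (2 * n + 1)]) (take (2 * k + 1) s @ [s ! (2 * n + 1)])"
    unfolding t layer_ok.simps using m[of k] Suc.prems l
    by (intro exI[of _ "take (2 * k + 1) s"] exI[of _ "[s ! (2 * n + 1)]"] exI[of _ "s ! Suc (2 * k)"] exI[of _ "s ! Suc (Suc (2 * k))"]) simp
  then show ?case using Suc by (auto simp del: layer_ok.simps)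
qed

lemma nth_concat_level:
  "j < n \<Longrightarrow> concat (map (\<lambda>j. level j (f j)) [0..<n]) ! (2 * j) = level j (f j) ! 0"
  "j < n \<Longrightarrow> concat (map (\<lambda>j. level j (f j)) [0..<n]) ! Suc (2 * j) = level j (f j) ! 1"
proof -
  have l: "length (concat (map (\<lambda>j. level j (f j)) [0..<n])) = 2 * n" for n by (induction n) auto
  show "j < n \<Longrightarrow> concat (map (\<lambda>j. level j (f j)) [0..<n]) ! (2 * j) = level j (f j) ! 0"
  proof (induction n)
    case (Suc n)
    then show ?case using l[of n] by (cases "j < n") (auto simp: nth_append not_less less_Suc_eq)
  qed simp
  show "j < n \<Longrightarrow> concat (map (\<lambda>j. level j (f j)) [0..<n]) ! Suc (2 * j) = level j (f j) ! 1"
  proof (induction n)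
    case (Suc n)
    then show ?case using l[of n] by (cases "j < n") (auto simp: nth_append not_less less_Suc_eq)
  qed simp
qed

lemma annotated_trace:
  assumes c: compatible
  shows "trace annotated [runL 0 0, runR (length ps - 1) 0]"
proof -
  have "ps \<noteq> []" using c by (simp add: compatible_def)
  then obtain n where n: "length ps = Suc n" by (metis length_0_conv not0_implies_Suc)
  let ?b = "concat (map (\<lambda>j. level j 0) [0..<Suc n])" and ?t = "concat (map (\<lambda>j. level j (strands j)) [0..<Suc n])"
  have l: "length (concat (map (\<lambda>j. level j (f j)) [0..<n])) = 2 * n" for n f by (induction n) auto
  note nb = nth_concat_level[of _ "Suc n" "\<lambda>_. 0"] and nt = nth_concat_level[of _ "Suc n" strands]
  have d: "dL j \<in> {1, - 1} \<and> dR j \<in> {1, - 1}" if "j < Suc n" for j using c that by (simp add: compatible_def n)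
  have m: "matched (?b ! Suc (2 * j)) (?b ! Suc (Suc (2 * j)))" "matched (?t ! Suc (2 * j)) (?t ! Suc (Suc (2 * j)))" if "j < n" for j
    using c that nb(1)[of "Suc j"] nb(2)[of j] nt(1)[of "Suc j"] nt(2)[of j] unfolding compatible_def n by (simp_all add: level_def)
  have e: "matched (?t ! 0) (?t ! (2 * n + 1))" using c nt(1)[of 0] nt(2)[of n] unfolding compatible_def n by simp
  have "trace (map (\<lambda>j. (Cap, 2 * j + 1, (0, 0))) (rev [0..<n]) @ [(Cap, 0, (0, 0))]) (take (2 * n + 1) ?t @ [?t ! (2 * n + 1)])"
    by (rule caps_trace[OF l m(2) e]) auto
  moreover have "take (2 * n + 1) ?t @ [?t ! (2 * n + 1)] = ?t" using l[of strands "Suc n"] by (simp add: take_Suc_conv_app_nth[symmetric] del: upt_Suc)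
  ultimately have 1: "trace (map (\<lambda>j. (Cap, 2 * j + 1, (0, 0))) (rev [0..<n]) @ [(Cap, 0, (0, 0))]) ?t" by simp
  have 2: "trace (concat (map (\<lambda>j. column j 0) [0..<Suc n]) @ map (\<lambda>j. (Cap, 2 * j + 1, (0, 0))) (rev [0..<n]) @ [(Cap, 0, (0, 0))]) ?b"
    using columns_trace[OF d 1, of 0] by simp
  have "trace annotated (take (2 * 0 + 1) ?b @ [?b ! (2 * n + 1)])"
    using cups_trace[OF 2 l m(1), of 0 "(0, 0)"] unfolding annotated_def n by simp
  moreover have "take (2 * 0 + 1) ?b = [?b ! 0]" using l[of "\<lambda>_. 0" "Suc n"] by (simp add: take_Suc_conv_app_nth del: upt_Suc)
  ultimately show ?thesis using nb(1)[of 0] nb(2)[of n] by (simp add: n level_def del: upt_Suc)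
qed

lemma pretzel_trace:
  assumes c: compatible and s: "dL 0 = 1" "dR (length ps - 1) = - 1"
  shows "trace annotated [(1, uL 0), (- 1, uR (length ps - 1))]"
  using annotated_trace[OF c] s by (simp add: runL_def runR_def)

lemma pretzel_signs:
  assumes e: "\<And>j. j < length ps \<Longrightarrow> dL j * dR j * (if 0 \<le> ps ! j then 1 else - 1) = \<eta>"
    and c: "c \<in> set (ids annotated)"
  shows "sg (c, True) * sg (c, False) = \<eta>"
  using e[of "fst c"] c unfolding set_ids
  by (cases c) (auto simp: sg_apply on_L_def algebra_simps split: if_splits)

lemma card_pairs:
  assumes c: compatible and s: "dL 0 = 1" "dR (length ps - 1) = - 1"
    and e: "\<And>j. j < length ps \<Longrightarrow> dL j * dR j * (if 0 \<le> ps ! j then 1 else - 1) = \<eta>" "\<eta> * \<eta> = 1"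
    and K: "isotopic K (pretzel_diagram ps)" "delta_path (Suc 0) K unknot"
  shows "card (crossing_pairs {(j, t). j < length ps \<and> t < strands j}) = 1"
proof -
  from delta_one_count[OF pretzel_trace[OF c s] distinct_ids _ pretzel_signs[OF e(1)] e(2)] K show ?thesis
    unfolding erase_annotated set_ids by (simp add: lout_def)
qed

end

section \<open>Times on the three types of positive pretzel diagrams\<close>

definition partial_sum :: "int list \<Rightarrow> nat \<Rightarrow> int" where
  "partial_sum ps j = (\<Sum>i<j. \<bar>ps ! i\<bar>)"

lemma partial_sum_simps [simp]:
  "partial_sum ps 0 = 0" "partial_sum ps (Suc j) = partial_sum ps j + \<bar>ps ! j\<bar>"
  by (simp_all add: partial_sum_def)

lemma partial_sum_mono: "i \<le> j \<Longrightarrow> partial_sum ps i \<le> partial_sum ps j"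
  unfolding partial_sum_def by (rule sum_mono2) auto

lemma odd_pos_ge_3: "odd (p :: int) \<Longrightarrow> 0 < p \<Longrightarrow> p \<noteq> 1 \<Longrightarrow> 3 \<le> p"
  by presburger

lemma pretzel_odd_delta_one:
  assumes T: "pretzel_odd_type ps" and K: "isotopic K (pretzel_diagram ps)" "delta_path (Suc 0) K unknot"
  shows "ps = [1, 1, 1]"
proof -
  define P N n where "P = partial_sum ps" and "N = P (length ps)" and "n = length ps"
  \<comment> \<open>Here \<open>N\<close> is the number of crossings. The knot runs through all
    columns from left to right twice: first up the run L of even columns and down the run R of odd
    ones, and from time \<open>N\<close> on along the other runs.\<close>
  define uL uR where "uL = (\<lambda>j. if even j then P j else N + P j)"
    and "uR = (\<lambda>j. if even j then N + P (Suc j) else P (Suc j))"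
  interpret columns ps uL uR "\<lambda>_. 1" "\<lambda>_. - 1" .
  have n: "odd n" using T by (simp add: n_def pretzel_odd_type_def)
  have a: "odd (ps ! j)" "0 < ps ! j" if "j < n" for j
    using T that unfolding pretzel_odd_type_def n_def by (meson nth_mem)+
  have P: "P 0 = 0" "P (Suc j) = P j + \<bar>ps ! j\<bar>" for j by (simp_all add: P_def)
  have Pn: "P j \<le> N" if "j \<le> n" for j using that unfolding N_def P_def n_def by (rule partial_sum_mono)
  have st: "int (strands j) = ps ! j" "odd (strands j)" if "j < n" for j
    using a[OF that] by (auto simp: strands_def even_nat_iff)
  have u: "uL j = (if even j then P j else N + P j)" "uR j = (if even j then N + P (Suc j) else P (Suc j))" for j
    by (simp_all add: uL_def uR_def)
  have compatible unfolding compatible_def n_def[symmetric]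
  proof (intro conjI allI impI)
    show "ps \<noteq> []" using n by (auto simp: n_def)
    fix j assume j: "Suc j < n"
    then have j': "j < n" by simp
    show "matched (runR j 0) (runL (Suc j) 0)" by (simp add: matched_def runR_def runL_def) (simp add: u)
    show "matched (level j (strands j) ! 1) (level (Suc j) (strands (Suc j)) ! 0)"
      using st[OF j] st[OF j'] a[OF j] a[OF j'] by (simp add: level_def matched_def runR_def runL_def) (simp add: u P)
  next
    have n1: "n - 1 < n" "0 < n" "P n = P (n - 1) + \<bar>ps ! (n - 1)\<bar>" using n P(2)[of "n - 1"] by (cases n; simp)+
    then show "matched (level 0 (strands 0) ! 0) (level (n - 1) (strands (n - 1)) ! 1)"
      using st[OF n1(1)] st[OF n1(2)] a[OF n1(1)] a[OF n1(2)] n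
      by (simp add: level_def matched_def runR_def runL_def) (simp add: u P N_def n_def)
  qed simp_all
  from card_pairs[OF this _ _ _ _ K, of "- 1"]
  have card1: "card (crossing_pairs {(j, t). j < n \<and> t < strands j}) = 1"
    using a unfolding n_def[symmetric] by (simp add: less_imp_le)
  let ?S = "crossing_pairs {(j, t). j < n \<and> t < strands j}"
  have onL: "on_L j t v \<longleftrightarrow> (even t \<longleftrightarrow> v)" if "j < n" for j t v
    using a(2)[OF that] by (simp add: on_L_def)
  have "?S \<noteq> {}" using card1 by auto
  \<comment> \<open>A single column closes to an unknot diagram, whose times admit no pair.\<close>
  have "n \<noteq> 1"
  proof
    assume n1: "n = 1"
    then have N: "N = ps ! 0" using a[of 0] P unfolding N_def n_def[symmetric] by simp
    have "?S = {}" unfolding crossing_pairs_def n1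
      using a[of 0] by (auto simp: n1 lin_apply onL u P N strands_def split: if_splits)
    with \<open>?S \<noteq> {}\<close> show False ..
  qed
  then have n3: "3 \<le> n" using n by presburger
  \<comment> \<open>For even \<open>s\<close> the crossing \<open>(j, s)\<close> is passed over on
    L, at time \<open>uL j + s\<close>, and under on R, which comes down to it at time
    \<open>uR j - s - 1\<close>.\<close>
  have mem: "((i, t), (j, s)) \<in> ?S"
    if "i < n" "j < n" "int t < ps ! i" "int s < ps ! j" "even s"
      "if even t then uR i - t - 1 < uL j + s \<and> uL j + s < uL i + t \<and> uL i + t < uR j - s - 1
       else uL i + t < uL j + s \<and> uL j + s < uR i - t - 1 \<and> uR i - t - 1 < uR j - s - 1" for i j t s
    using that st[of i] st[of j] by (auto simp: crossing_pairs_def lin_apply onL split: if_splits)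
  have a3: "0 < ps ! 0" "0 < ps ! 1" "0 < ps ! 2" using a(2)[of 0] a(2)[of 1] a(2)[of 2] n3 by auto
  have S3: "P 1 = ps ! 0" "P 2 = ps ! 0 + ps ! 1" "P 3 = ps ! 0 + ps ! 1 + ps ! 2"
    using a3 P(2)[of 0] P(2)[of 1] P(2)[of 2] by (simp_all add: P(1) numeral_2_eq_2 numeral_3_eq_3)
  have u3: "uL 0 = 0" "uR 0 = N + P 1" "uL 1 = N + P 1" "uR 1 = P 2" "uL 2 = P 2" "uR 2 = N + P 3"
    using P(1) by (simp_all add: u numeral_2_eq_2 numeral_3_eq_3)
  \<comment> \<open>This pair is always present; each deviation from \<open>[1, 1, 1]\<close> will
    produce a second one.\<close>
  have p0: "((1, 0), (2, 0)) \<in> ?S" by (rule mem) (use n3 a3 Pn[of 3] in \<open>simp_all del: One_nat_def add: u3 S3\<close>)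
  have no: "p \<notin> ?S" if "p \<noteq> ((1, 0), (2, 0))" for p
    using two_pairs[OF card_ge_0_finite p0 _ that[symmetric]] card1 by auto
  have "n = 3"
  proof (rule ccontr)
    assume "n \<noteq> 3"
    then have "5 \<le> n" using n n3 by presburger
    then have "((1, 0), (4, 0)) \<in> ?S"
      by (intro mem) (use a3 Pn[of 5] a(2)[of 3] a(2)[of 4] P(2)[of 3] P(2)[of 4] in \<open>simp_all del: One_nat_def add: u3 u[of 4] S3\<close>)
    then show False using no by simp
  qed
  moreover have N: "N = P 3" using \<open>n = 3\<close> by (simp add: N_def n_def)
  have "ps ! 0 = 1"
  proof (rule ccontr)
    assume "ps ! 0 \<noteq> 1"
    then have "3 \<le> ps ! 0" using a[of 0] n3 odd_pos_ge_3 by simp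
    then have "((0, 1), (2, 0)) \<in> ?S"
      by (intro mem) (use a3 n3 N in \<open>simp_all del: One_nat_def add: u3 S3\<close>)
    then show False using no by simp
  qed
  moreover have "ps ! 1 = 1"
  proof (rule ccontr)
    assume "ps ! 1 \<noteq> 1"
    then have "3 \<le> ps ! 1" using a[of 1] n3 odd_pos_ge_3 by simp
    then have "((1, 2), (2, 0)) \<in> ?S"
      by (intro mem) (use a3 n3 N in \<open>simp_all del: One_nat_def add: u3 S3\<close>)
    then show False using no by simp
  qed
  moreover have "ps ! 2 = 1"
  proof (rule ccontr)
    assume "ps ! 2 \<noteq> 1"
    then have "3 \<le> ps ! 2" using a[of 2] n3 odd_pos_ge_3 by simp
    then have "((1, 0), (2, 2)) \<in> ?S"
      by (intro mem) (use a3 n3 N in \<open>simp_all del: One_nat_def add: u3 S3\<close>)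
    then show False using no by simp
  qed
  ultimately show ?thesis
    unfolding n_def by (auto simp: list_eq_iff_nth_eq less_Suc_eq eval_nat_numeral)
qed

lemma pretzel_A_delta_one:
  assumes T: "pretzel_even_type_A ps" and K: "isotopic K (pretzel_diagram ps)" "delta_path (Suc 0) K unknot"
  shows "ps = [2, 1]"
proof -
  define P N n where "P = partial_sum ps" and "N = P (length ps)" and "n = length ps"
  \<comment> \<open>The two runs of each column are parallel. The knot goes up column 0, then
    through the other columns from right to left, up column 0 again from time \<open>N\<close>, and
    finally from left to right. \<open>E j\<close> is the time at which column \<open>j\<close> is
    entered on the way from right to left; for column 0 it is \<open>N\<close>.\<close>
  define E where "E = (\<lambda>j. N - P (Suc j) + P (Suc 0))"
  define d where "d = (\<lambda>j :: nat. if even j then 1 else - 1 :: int)"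
  define uL uR where "uL = (\<lambda>j. if j = 0 then 0 else if even j then N + P j else E j + ps ! j)"
    and "uR = (\<lambda>j. if even j then E j else N + P (Suc j))"
  interpret columns ps uL uR d d .
  have n: "even n" "0 < n" using T by (simp_all add: n_def pretzel_even_type_A_def)
  have ne: "ps \<noteq> []" using n by (auto simp: n_def)
  have a0: "even (ps ! 0)" "0 < ps ! 0" using T ne by (simp_all add: pretzel_even_type_A_def hd_conv_nth)
  have a: "odd (ps ! j)" "0 < ps ! j" if "j < n" "0 < j" for j
  proof -
    have "ps ! j = tl ps ! (j - 1)" "j - 1 < length (tl ps)" using that by (simp_all add: nth_tl n_def)
    then show "odd (ps ! j)" "0 < ps ! j" using T unfolding pretzel_even_type_A_def by (metis nth_mem)+
  qed
  have pos: "0 < ps ! j" if "j < n" for j using a0 a that by (cases "j = 0") auto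
  have P: "P 0 = 0" "P (Suc j) = P j + \<bar>ps ! j\<bar>" for j by (simp_all add: P_def)
  have P1: "P (Suc 0) = ps ! 0" using P(2)[of 0] a0 P(1) by simp
  have Pn: "P j \<le> N" if "j \<le> n" for j using that unfolding N_def P_def n_def by (rule partial_sum_mono)
  have st: "int (strands j) = ps ! j" "even (strands j) \<longleftrightarrow> j = 0" if "j < n" for j
    using a[OF that] a0 by (cases "j = 0"; auto simp: strands_def even_nat_iff)+
  have u: "uL j = (if j = 0 then 0 else if even j then N + P j else E j + ps ! j)"
    "uR j = (if even j then E j else N + P (Suc j))" "E j = N - P (Suc j) + ps ! 0"
    "d j = (if even j then 1 else - 1)" for j
    by (simp_all add: uL_def uR_def E_def P1 d_def)
  have compatible unfolding compatible_def n_def[symmetric]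
  proof (intro conjI allI impI)
    show "ps \<noteq> []" using n by (auto simp: n_def)
    fix j assume j: "Suc j < n"
    then have j': "j < n" by simp
    show "matched (runR j 0) (runL (Suc j) 0)"
      using pos[OF j] pos[OF j'] by (simp add: matched_def runR_def runL_def) (simp add: u P)
    show "matched (level j (strands j) ! 1) (level (Suc j) (strands (Suc j)) ! 0)"
      using st[OF j] st[OF j'] pos[OF j] pos[OF j']
      by (simp add: level_def matched_def runR_def runL_def) (auto simp: u P)
  next
    have n1: "n - 1 < n" "n - 1 \<noteq> 0" "odd (n - 1)" "Suc (n - 1) = n" using n by presburger+
    have "P n = N" by (simp add: N_def n_def)
    then show "matched (level 0 (strands 0) ! 0) (level (n - 1) (strands (n - 1)) ! 1)"
      using st[OF n1(1)] st[OF n(2)] pos[OF n1(1)] pos[OF n(2)] n1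
      by (simp add: level_def matched_def runR_def runL_def) (simp add: u)
  qed (simp_all add: u)
  from card_pairs[OF this _ _ _ _ K, of 1]
  have card1: "card (crossing_pairs {(j, t). j < n \<and> t < strands j}) = 1"
    using pos n unfolding n_def[symmetric] by (simp add: u less_imp_le)
  let ?S = "crossing_pairs {(j, t). j < n \<and> t < strands j}"
  have onL: "on_L j t v \<longleftrightarrow> (even t \<longleftrightarrow> v)" if "j < n" for j t v
    using pos[OF that] by (simp add: on_L_def)
  \<comment> \<open>In column 0 the crossings at odd heights are first passed under, at time
    \<open>t\<close>, and then over, at time \<open>N + t\<close>.\<close>
  have mem: "((0, t), (j, s)) \<in> ?S"
    if "j < n" "odd j" "int t < ps ! 0" "int s < ps ! j" "even s" "odd t"
      "t < uL j - s - 1" "uL j - s - 1 < N + t" "N + t < uR j - s - 1" for j t s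
  proof -
    have "d j = - 1" "d 0 = 1" "uL 0 = 0" "uR 0 = N" using that by (simp_all add: u P1)
    then show ?thesis using that st(1)[of 0] st(1)[of j] n
      by (auto simp: crossing_pairs_def lin_apply onL)
  qed
  have n1: "1 < n" using n by presburger
  have odd_nat: "even (nat (q - 1))" "int (nat (q - 1)) = q - 1" "q < 3 \<Longrightarrow> q = 1"
    "3 \<le> q \<Longrightarrow> even (nat (q - 3))" "3 \<le> q \<Longrightarrow> int (nat (q - 3)) = q - 3" if "odd q" "0 < q" for q :: int
    using that by (auto simp: even_nat_iff, presburger)
  have u1: "uL 1 = N" "uR 1 = N + ps ! 0 + ps ! 1" "2 \<le> ps ! 0" "N \<ge> ps ! 0 + ps ! 1"
    proof -
    show "2 \<le> ps ! 0" using a0 by presburger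
  qed (use P(2)[of 1] P1 pos[of 1] pos[of 0] Pn[of 2] n1 in \<open>simp_all add: u numeral_2_eq_2\<close>)
  \<comment> \<open>The topmost crossing of column 1; as \<open>ps ! 1\<close> is odd, its height is
    even.\<close>
  let ?p = "((0, 1), (1, nat (ps ! 1 - 1)))"
  note o1 = odd_nat[OF a(1)[OF n1] a(2)[OF n1]]
  have p0: "?p \<in> ?S" by (rule mem) (use n1 u1 pos[OF n1] o1 in auto)
  have no: "p \<notin> ?S" if "p \<noteq> ?p" for p
    using two_pairs[OF card_ge_0_finite p0 _ that[symmetric]] card1 by auto
  have n2: "n = 2"
  proof (rule ccontr)
    assume "n \<noteq> 2"
    then have n3: "3 < n" using n n1 by presburger
    note o3 = odd_nat[OF a(1)[OF n3] a(2)[OF n3]]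
    have u3: "uL 3 = N - ps ! 1 - ps ! 2" "uR 3 = N + ps ! 0 + ps ! 1 + ps ! 2 + ps ! 3" "N \<ge> ps ! 0 + ps ! 1 + ps ! 2 + ps ! 3"
      using P(2)[of 1] P(2)[of 2] P(2)[of 3] P1 pos[of 1] pos[of 2] pos[of 3] n3 Pn[of 4] by (simp_all add: u numeral_2_eq_2[symmetric])
    have "((0, 1), (3, nat (ps ! 3 - 1))) \<in> ?S" by (rule mem) (use n3 u3 u1 pos[of 1] pos[of 2] pos[of 3] o3 in auto)
    then show False using no by simp
  qed
  have N: "N = ps ! 0 + ps ! 1" using n2 P(2)[of 1] P1 pos[of 1] unfolding N_def n_def by (simp add: numeral_2_eq_2)
  have "ps ! 0 = 2"
  proof (rule ccontr)
    assume "ps ! 0 \<noteq> 2"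
    then have "4 \<le> ps ! 0" using a0 by presburger
    then have "((0, 3), (1, nat (ps ! 1 - 1))) \<in> ?S" by (intro mem) (use n1 u1 N pos[OF n1] o1 in auto)
    then show False using no by simp
  qed
  moreover have "ps ! 1 = 1"
  proof (rule ccontr)
    assume "ps ! 1 \<noteq> 1"
    then have "3 \<le> ps ! 1" using o1 by linarith
    then have "((0, 1), (1, nat (ps ! 1 - 3))) \<in> ?S" by (intro mem) (use n1 u1 N o1 in auto)
    then show False using no \<open>3 \<le> ps ! 1\<close> by simp
  qed
  ultimately show ?thesis
    using n2 unfolding n_def by (auto simp: list_eq_iff_nth_eq less_Suc_eq eval_nat_numeral)
qed

lemma pretzel_B_delta_one:
  assumes T: "pretzel_even_type_B ps" and K: "isotopic K (pretzel_diagram ps)" "delta_path (Suc 0) K unknot"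
  shows "ps = [- 2, 1, 1]"
proof -
  define P N n where "P = partial_sum ps" and "N = P (length ps)" and "n = length ps"
  \<comment> \<open>The order is as for type A, except that column 0 is run down from time
    \<open>N\<close>. Its two runs are thus antiparallel while those of other columns are parallel;
    since column 0 is also the negative one, all crossings have sign 1.\<close>
  define E where "E = (\<lambda>j. N - P (Suc j) + P (Suc 0))"
  define dL where "dL = (\<lambda>j :: nat. if j = 0 \<or> odd j then 1 else - 1 :: int)"
  define dR where "dR = (\<lambda>j :: nat. if odd j then 1 else - 1 :: int)"
  define uL uR where "uL = (\<lambda>j. if j = 0 then 0 else if odd j then N + P j else E j + ps ! j)"
    and "uR = (\<lambda>j. if odd j then E j else N + P (Suc j))"
  interpret columns ps uL uR dL dR .
  have n: "odd n" "0 < n" using T odd_pos unfolding n_def pretzel_even_type_B_def by blast+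
  have ne: "ps \<noteq> []" using n by (auto simp: n_def)
  have a0: "even (ps ! 0)" "ps ! 0 < 0" using T ne by (simp_all add: pretzel_even_type_B_def hd_conv_nth)
  have a: "odd (ps ! j)" "0 < ps ! j" if "j < n" "0 < j" for j
  proof -
    have "ps ! j = tl ps ! (j - 1)" "j - 1 < length (tl ps)" using that by (simp_all add: nth_tl n_def)
    then show "odd (ps ! j)" "0 < ps ! j" using T unfolding pretzel_even_type_B_def by (metis nth_mem)+
  qed
  have P: "P 0 = 0" "P (Suc j) = P j + \<bar>ps ! j\<bar>" for j by (simp_all add: P_def)
  have P1: "P (Suc 0) = - ps ! 0" using P(2)[of 0] a0 P(1) by simp
  have Pn: "P j \<le> N" if "j \<le> n" for j using that unfolding N_def P_def n_def by (rule partial_sum_mono)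
  have st: "int (strands j) = \<bar>ps ! j\<bar>" "even (strands j) \<longleftrightarrow> j = 0" if "j < n" for j
    using a[OF that] a0 by (cases "j = 0"; auto simp: strands_def even_nat_iff)+
  have sgn: "\<bar>ps ! j\<bar> = (if j = 0 then - ps ! 0 else ps ! j)" "0 \<le> ps ! j \<longleftrightarrow> j \<noteq> 0" if "j < n" for j
    using a[OF that] a0 by (cases "j = 0"; auto)+
  have u: "uL j = (if j = 0 then 0 else if odd j then N + P j else E j + ps ! j)"
    "uR j = (if odd j then E j else N + P (Suc j))" "E j = N - P (Suc j) - ps ! 0"
    "dL j = (if j = 0 \<or> odd j then 1 else - 1)" "dR j = (if odd j then 1 else - 1)" for j
    by (simp_all add: uL_def uR_def E_def P1 dL_def dR_def)
  have compatible unfolding compatible_def n_def[symmetric]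
  proof (intro conjI allI impI)
    show "ps \<noteq> []" by (rule ne)
    fix j assume j: "Suc j < n"
    then have j': "j < n" by simp
    show "matched (runR j 0) (runL (Suc j) 0)"
      using sgn[OF j] sgn[OF j'] by (simp add: matched_def runR_def runL_def) (simp add: u P)
    show "matched (level j (strands j) ! 1) (level (Suc j) (strands (Suc j)) ! 0)"
      using st[OF j] st[OF j'] sgn[OF j] sgn[OF j']
      by (simp add: level_def matched_def runR_def runL_def) (auto simp add: u P)
  next
    have n1: "n - 1 < n" "even (n - 1)" "Suc (n - 1) = n" using n by presburger+
    have "P n = N" by (simp add: N_def n_def)
    then show "matched (level 0 (strands 0) ! 0) (level (n - 1) (strands (n - 1)) ! 1)"
      using st[OF n1(1)] st[OF n(2)] sgn[OF n1(1)] sgn[OF n(2)] n1 P1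
      by (cases "n = 1") (auto simp: level_def matched_def runR_def runL_def u)
  qed (simp_all add: u)
  from card_pairs[OF this _ _ _ _ K, of 1]
  have card1: "card (crossing_pairs {(j, t). j < n \<and> t < strands j}) = 1"
    using sgn(2) n unfolding n_def[symmetric] by (simp add: u)
  let ?S = "crossing_pairs {(j, t). j < n \<and> t < strands j}"
  \<comment> \<open>The negative twist interchanges over and under in column 0, so there it is the
    even heights that are first passed under.\<close>
  have onL: "on_L j t v \<longleftrightarrow> (even t \<longleftrightarrow> v \<longleftrightarrow> j \<noteq> 0)" if "j < n" for j t v
    using sgn(2)[OF that] by (auto simp add: on_L_def)
  have u0: "dL 0 = 1" "dR 0 = - 1" "uL 0 = 0" "uR 0 = N - ps ! 0" using P1 by (simp_all add: u)
  have "n \<noteq> 1"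
  proof
    assume n1: "n = 1"
    then have N: "N = - ps ! 0" using a0 P unfolding N_def n_def[symmetric] by simp
    have "?S = {}" unfolding crossing_pairs_def n1
      using a0 by (auto simp: n1 lin_apply onL u0 N strands_def split: if_splits)
    with card1 show False by simp
  qed
  then have n3: "2 < n" using n by presburger
  have mem: "((0, t), (j, s)) \<in> ?S"
    if "j < n" "even j" "j \<noteq> 0" "int t < - ps ! 0" "int s < ps ! j" "even s" "even t"
      "t < uL j - s - 1" "uL j - s - 1 < N - ps ! 0 - t - 1" "N - ps ! 0 - t - 1 < uR j - s - 1" for j t s
  proof -
    have "dL j = - 1" "dR j = - 1" using that by (simp_all add: u)
    then show ?thesis using that st(1)[of 0] st(1)[of j] n u0
      by (auto simp: crossing_pairs_def lin_apply onL)
  qed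
  have odd_nat: "even (nat (q - 1))" "int (nat (q - 1)) = q - 1" "q < 3 \<Longrightarrow> q = 1"
    "3 \<le> q \<Longrightarrow> even (nat (q - 3))" "3 \<le> q \<Longrightarrow> int (nat (q - 3)) = q - 3" if "odd q" "0 < q" for q :: int
    using that by (auto simp: even_nat_iff, presburger)
  have a2: "0 < ps ! 2" "0 < ps ! 1" using n3 a by auto
  have u1: "uL 2 = N - ps ! 1" "uR 2 = N - ps ! 0 + ps ! 1 + ps ! 2" "ps ! 0 \<le> - 2" "N \<ge> ps ! 1 + ps ! 2 - ps ! 0"
    "uL 1 = N - ps ! 0" "uR 1 = N - ps ! 1"
    proof -
    show "ps ! 0 \<le> - 2" using a0 by presburger
  qed (use P(2)[of 1] P(2)[of 2] P1 a2 a0 Pn[of 3] n3 in \<open>simp_all add: u numeral_eq_Suc\<close>)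
  let ?p = "((0, 0), (2, nat (ps ! 2 - 1)))"
  note o2 = odd_nat[OF a(1)[OF n3] a2(1)]
  have p0: "?p \<in> ?S" by (rule mem) (use n3 u1 a2 o2 in auto)
  have no: "p \<notin> ?S" if "p \<noteq> ?p" for p
    using two_pairs[OF card_ge_0_finite p0 _ that[symmetric]] card1 by auto
  have n2: "n = 3"
  proof (rule ccontr)
    assume "n \<noteq> 3"
    then have n4: "4 < n" using n n3 by presburger
    have a4: "0 < ps ! 3" "0 < ps ! 4" using n4 a by auto
    note o4 = odd_nat[OF a(1)[OF n4] a4(2)]
    have u4: "uL 4 = N - ps ! 1 - ps ! 2 - ps ! 3" "uR 4 = N - ps ! 0 + ps ! 1 + ps ! 2 + ps ! 3 + ps ! 4" "N \<ge> ps ! 1 + ps ! 2 + ps ! 3 + ps ! 4 - ps ! 0"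
      using P(2)[of 1] P(2)[of 2] P(2)[of 3] P(2)[of 4] P1 a2 a4 n4 Pn[of 5] by (simp_all add: u numeral_2_eq_2[symmetric])
    have "((0, 0), (4, nat (ps ! 4 - 1))) \<in> ?S" by (rule mem) (use n4 u4 u1 a2 a4 o4 in auto)
    then show False using no by simp
  qed
  have N: "N = ps ! 1 + ps ! 2 - ps ! 0" using n2 P(2)[of 1] P(2)[of 2] P1 a2 unfolding N_def n_def by (simp add: numeral_eq_Suc)
  have "ps ! 0 = - 2"
  proof (rule ccontr)
    assume "ps ! 0 \<noteq> - 2"
    then have "ps ! 0 \<le> - 4" using a0 by presburger
    then have "((0, 2), (2, nat (ps ! 2 - 1))) \<in> ?S" by (intro mem) (use n3 u1 N a2 o2 in auto)
    then show False using no by simp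
  qed
  moreover have "ps ! 2 = 1"
  proof (rule ccontr)
    assume "ps ! 2 \<noteq> 1"
    then have 3: "3 \<le> ps ! 2" using o2 by linarith
    then have "((0, 0), (2, nat (ps ! 2 - 3))) \<in> ?S" by (intro mem) (use n3 u1 N a2 o2 in auto)
    then show False using no 3 by simp
  qed
  moreover have "ps ! 1 = 1"
  proof (rule ccontr)
    assume "ps ! 1 \<noteq> 1"
    then have 3: "3 \<le> ps ! 1" using a[of 1] n3 odd_pos_ge_3 by simp
    \<comment> \<open>Both runs of column 1 go up, so \<open>mem\<close>, which is about downward
      columns, does not apply; the pair is checked from the definition.\<close>
    have "dL 1 = 1" "dR 1 = 1" by (simp_all add: u)
    then have "((0, 0), (1, 1)) \<in> ?S" using 3 n3 u1 u0 N a2 a0 st(1)[of 0] st(1)[of 1] n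
      by (auto simp: crossing_pairs_def lin_apply onL)
    then show False using no by simp
  qed
  ultimately show ?thesis
    using n2 unfolding n_def by (auto simp: list_eq_iff_nth_eq less_Suc_eq eval_nat_numeral)
qed

section \<open>Explicit isotopies\<close>

text \<open>Locating a move by its index \<open>k\<close> reduces each step of an explicit isotopy
  to evaluating \<open>take\<close> and \<open>drop\<close> on concrete lists.\<close>

lemma isotopic_at:
  assumes "isotopy_move S T" "take (length S) (drop k D) = S" "E = take k D @ T @ drop (k + length S) D"
    "link_diagram D" "link_diagram E"
  shows "isotopic D E"
proof -
  have "D = take k D @ S @ drop (k + length S) D"
    using assms(2) by (metis append_take_drop_id drop_drop add.commute)
  then show ?thesis unfolding isotopic_def
    using assms(1,3,4,5) by (metis apply_move.intros r_into_equivclp)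
qed

lemma isotopic_at_rev:
  assumes "isotopy_move S T" "take (length S) (drop k E) = S" "D = take k E @ T @ drop (k + length S) E"
    "link_diagram D" "link_diagram E"
  shows "isotopic D E"
  using isotopic_at[OF assms(1,2,3,5,4)] by (rule isotopic_sym)

lemmas isotopic_at_simps = link_diagram_def crossing_def

text \<open>After the last crossing is slid to the middle, a kink is created at the left cap,
  carried down by two third Reidemeister moves, and removed at the cup. On its way it shifts the two
  left crossings, leaving three crossings that can all be placed in the middle.\<close>

lemma isotopic_pretzel_A: "isotopic (pretzel_diagram [2, 1]) trefoil"
proof -
  have "isotopic [(Cup, 0), (Cup, 1), (Over, 0), (Over, 0), (Over, 2), (Cap, 1), (Cap, 0)]
    [(Cup, 0), (Cup, 1), (Over, 0), (Over, 0), (Under, 1), (Cap, 2), (Cap, 0)]"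
    by (rule isotopic_at[OF isotopy_move.slide_cap[of Over 1], of 4]) (simp_all add: isotopic_at_simps)
  also have "isotopic \<dots>
    [(Cup, 0), (Cup, 1), (Over, 0), (Over, 0), (Under, 1), (Cap, 0), (Cap, 0)]"
    by (rule isotopic_at_rev[OF isotopy_move.exchange[of 0 0 Cap Cap], of 5]) (simp_all add: isotopic_at_simps)
  also have "isotopic \<dots>
    [(Cup, 0), (Cup, 1), (Over, 0), (Over, 0), (Under, 1), (Under, 0), (Cap, 0), (Cap, 0)]"
    by (rule isotopic_at_rev[OF isotopy_move.R1_cap[of Under 0], of 5]) (simp_all add: isotopic_at_simps)
  also have "isotopic \<dots>
    [(Cup, 0), (Cup, 1), (Over, 0), (Under, 1), (Under, 0), (Over, 1), (Cap, 0), (Cap, 0)]"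
    by (rule isotopic_at[OF isotopy_move.R3[of Over Under Under 0], of 3]) (simp_all add: isotopic_at_simps)
  also have "isotopic \<dots>
    [(Cup, 0), (Cup, 1), (Under, 1), (Under, 0), (Over, 1), (Over, 1), (Cap, 0), (Cap, 0)]"
    by (rule isotopic_at[OF isotopy_move.R3[of Over Under Under 0], of 2]) (simp_all add: isotopic_at_simps)
  also have "isotopic \<dots>
    [(Cup, 0), (Cup, 1), (Under, 0), (Over, 1), (Over, 1), (Cap, 0), (Cap, 0)]"
    by (rule isotopic_at[OF isotopy_move.R1_cup[of Under 1], of 1]) (simp_all add: isotopic_at_simps)
  also have "isotopic \<dots>
    [(Cup, 0), (Cup, 0), (Over, 1), (Over, 1), (Over, 1), (Cap, 0), (Cap, 0)]"
    by (rule isotopic_at_rev[OF isotopy_move.slide_cup[of Over 0], of 1]) (simp_all add: isotopic_at_simps)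
  also have "isotopic \<dots>
    [(Cup, 0), (Cup, 2), (Over, 1), (Over, 1), (Over, 1), (Cap, 0), (Cap, 0)]"
    by (rule isotopic_at_rev[OF isotopy_move.exchange[of 0 0 Cup Cup], of 0]) (simp_all add: isotopic_at_simps)
  finally show ?thesis by (simp add: trefoil_def unknot_def torus_diagram_def pretzel_diagram_def twist_def eval_nat_numeral)
qed

text \<open>The same device upside down: the kink is created at a cup and removed at a cap.\<close>

lemma isotopic_torus_23: "isotopic (torus_diagram 2 3) trefoil"
proof -
  have "isotopic [(Cup, 0), (Cup, 1), (Over, 0), (Over, 0), (Over, 0), (Cap, 1), (Cap, 0)]
    [(Cup, 0), (Cup, 0), (Under, 1), (Over, 0), (Over, 0), (Cap, 1), (Cap, 0)]"
    by (rule isotopic_at_rev[OF isotopy_move.slide_cup[of Under 0], of 1]) (simp_all add: isotopic_at_simps)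
  also have "isotopic \<dots>
    [(Cup, 0), (Cup, 0), (Under, 0), (Under, 1), (Over, 0), (Over, 0), (Cap, 1), (Cap, 0)]"
    by (rule isotopic_at_rev[OF isotopy_move.R1_cup[of Under 0], of 1]) (simp_all add: isotopic_at_simps)
  also have "isotopic \<dots>
    [(Cup, 0), (Cup, 2), (Under, 0), (Under, 1), (Over, 0), (Over, 0), (Cap, 1), (Cap, 0)]"
    by (rule isotopic_at_rev[OF isotopy_move.exchange[of 0 0 Cup Cup], of 0]) (simp_all add: isotopic_at_simps)
  also have "isotopic \<dots>
    [(Cup, 0), (Cup, 2), (Over, 1), (Under, 0), (Under, 1), (Over, 0), (Cap, 1), (Cap, 0)]"
    by (rule isotopic_at[OF isotopy_move.R3[of Under Under Over 0], of 2]) (simp_all add: isotopic_at_simps)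
  also have "isotopic \<dots>
    [(Cup, 0), (Cup, 2), (Over, 1), (Over, 1), (Under, 0), (Under, 1), (Cap, 1), (Cap, 0)]"
    by (rule isotopic_at[OF isotopy_move.R3[of Under Under Over 0], of 3]) (simp_all add: isotopic_at_simps)
  also have "isotopic \<dots>
    [(Cup, 0), (Cup, 2), (Over, 1), (Over, 1), (Under, 0), (Cap, 1), (Cap, 0)]"
    by (rule isotopic_at[OF isotopy_move.R1_cap[of Under 1], of 5]) (simp_all add: isotopic_at_simps)
  also have "isotopic \<dots>
    [(Cup, 0), (Cup, 2), (Over, 1), (Over, 1), (Over, 1), (Cap, 0), (Cap, 0)]"
    by (rule isotopic_at_rev[OF isotopy_move.slide_cap[of Over 0], of 4]) (simp_all add: isotopic_at_simps)
  finally show ?thesis by (simp add: trefoil_def unknot_def torus_diagram_def pretzel_diagram_def twist_def eval_nat_numeral)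
qed

text \<open>Three single crossings side by side form a two-strand twist seen from the side. A zigzag
  at the middle column is straightened, and each crossing is slid once around a cup or cap, which
  turns \<open>Over\<close> into \<open>Under\<close>; hence the mirror image.\<close>

lemma isotopic_pretzel_odd: "isotopic (pretzel_diagram [1, 1, 1]) (mirror trefoil)"
proof -
  have "isotopic [(Cup, 0), (Cup, 1), (Cup, 3), (Over, 0), (Over, 2), (Over, 4), (Cap, 3), (Cap, 1), (Cap, 0)]
    [(Cup, 0), (Cup, 1), (Over, 0), (Cup, 3), (Over, 2), (Over, 4), (Cap, 3), (Cap, 1), (Cap, 0)]"
    by (rule isotopic_at_rev[OF isotopy_move.exchange[of 0 1 Over Cup], of 2]) (simp_all add: isotopic_at_simps)
  also have "isotopic \<dots>
    [(Cup, 0), (Cup, 1), (Over, 0), (Cup, 2), (Under, 3), (Over, 4), (Cap, 3), (Cap, 1), (Cap, 0)]"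
    by (rule isotopic_at_rev[OF isotopy_move.slide_cup[of Under 2], of 3]) (simp_all add: isotopic_at_simps)
  also have "isotopic \<dots>
    [(Cup, 0), (Cup, 1), (Over, 0), (Cup, 2), (Under, 3), (Over, 4), (Cap, 1), (Cap, 1), (Cap, 0)]"
    by (rule isotopic_at_rev[OF isotopy_move.exchange[of 1 1 Cap Cap], of 6]) (simp_all add: isotopic_at_simps)
  also have "isotopic \<dots>
    [(Cup, 0), (Cup, 1), (Over, 0), (Cup, 2), (Under, 3), (Cap, 1), (Over, 2), (Cap, 1), (Cap, 0)]"
    by (rule isotopic_at_rev[OF isotopy_move.exchange[of 1 2 Cap Over], of 5]) (simp_all add: isotopic_at_simps)
  also have "isotopic \<dots>
    [(Cup, 0), (Cup, 1), (Over, 0), (Cup, 2), (Cap, 1), (Under, 1), (Over, 2), (Cap, 1), (Cap, 0)]"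
    by (rule isotopic_at_rev[OF isotopy_move.exchange[of 1 1 Cap Under], of 4]) (simp_all add: isotopic_at_simps)
  also have "isotopic \<dots>
    [(Cup, 0), (Cup, 1), (Over, 0), (Under, 1), (Over, 2), (Cap, 1), (Cap, 0)]"
    by (rule isotopic_at[OF isotopy_move.zigzag_right[of 1], of 3]) (simp_all add: isotopic_at_simps)
  also have "isotopic \<dots>
    [(Cup, 0), (Cup, 0), (Under, 1), (Under, 1), (Over, 2), (Cap, 1), (Cap, 0)]"
    by (rule isotopic_at_rev[OF isotopy_move.slide_cup[of Under 0], of 1]) (simp_all add: isotopic_at_simps)
  also have "isotopic \<dots>
    [(Cup, 0), (Cup, 0), (Under, 1), (Under, 1), (Under, 1), (Cap, 2), (Cap, 0)]"
    by (rule isotopic_at[OF isotopy_move.slide_cap[of Over 1], of 4]) (simp_all add: isotopic_at_simps)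
  also have "isotopic \<dots>
    [(Cup, 0), (Cup, 0), (Under, 1), (Under, 1), (Under, 1), (Cap, 0), (Cap, 0)]"
    by (rule isotopic_at_rev[OF isotopy_move.exchange[of 0 0 Cap Cap], of 5]) (simp_all add: isotopic_at_simps)
  also have "isotopic \<dots>
    [(Cup, 0), (Cup, 2), (Under, 1), (Under, 1), (Under, 1), (Cap, 0), (Cap, 0)]"
    by (rule isotopic_at_rev[OF isotopy_move.exchange[of 0 0 Cup Cup], of 0]) (simp_all add: isotopic_at_simps)
  finally show ?thesis by (simp add: trefoil_def unknot_def torus_diagram_def pretzel_diagram_def twist_def eval_nat_numeral)
qed

text \<open>The zigzag is removed as for \<open>[1, 1, 1]\<close>. One third Reidemeister move then
  frees a kink, whose removal reduces four crossings to three.\<close>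

lemma isotopic_pretzel_B: "isotopic (pretzel_diagram [- 2, 1, 1]) trefoil"
proof -
  have "isotopic [(Cup, 0), (Cup, 1), (Cup, 3), (Under, 0), (Under, 0), (Over, 2), (Over, 4), (Cap, 3), (Cap, 1), (Cap, 0)]
    [(Cup, 0), (Cup, 1), (Under, 0), (Cup, 3), (Under, 0), (Over, 2), (Over, 4), (Cap, 3), (Cap, 1), (Cap, 0)]"
    by (rule isotopic_at_rev[OF isotopy_move.exchange[of 0 1 Under Cup], of 2]) (simp_all add: isotopic_at_simps)
  also have "isotopic \<dots>
    [(Cup, 0), (Cup, 1), (Under, 0), (Under, 0), (Cup, 3), (Over, 2), (Over, 4), (Cap, 3), (Cap, 1), (Cap, 0)]"
    by (rule isotopic_at_rev[OF isotopy_move.exchange[of 0 1 Under Cup], of 3]) (simp_all add: isotopic_at_simps)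
  also have "isotopic \<dots>
    [(Cup, 0), (Cup, 1), (Under, 0), (Under, 0), (Cup, 2), (Under, 3), (Over, 4), (Cap, 3), (Cap, 1), (Cap, 0)]"
    by (rule isotopic_at_rev[OF isotopy_move.slide_cup[of Under 2], of 4]) (simp_all add: isotopic_at_simps)
  also have "isotopic \<dots>
    [(Cup, 0), (Cup, 1), (Under, 0), (Under, 0), (Cup, 2), (Under, 3), (Over, 4), (Cap, 1), (Cap, 1), (Cap, 0)]"
    by (rule isotopic_at_rev[OF isotopy_move.exchange[of 1 1 Cap Cap], of 7]) (simp_all add: isotopic_at_simps)
  also have "isotopic \<dots>
    [(Cup, 0), (Cup, 1), (Under, 0), (Under, 0), (Cup, 2), (Under, 3), (Cap, 1), (Over, 2), (Cap, 1), (Cap, 0)]"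
    by (rule isotopic_at_rev[OF isotopy_move.exchange[of 1 2 Cap Over], of 6]) (simp_all add: isotopic_at_simps)
  also have "isotopic \<dots>
    [(Cup, 0), (Cup, 1), (Under, 0), (Under, 0), (Cup, 2), (Cap, 1), (Under, 1), (Over, 2), (Cap, 1), (Cap, 0)]"
    by (rule isotopic_at_rev[OF isotopy_move.exchange[of 1 1 Cap Under], of 5]) (simp_all add: isotopic_at_simps)
  also have "isotopic \<dots>
    [(Cup, 0), (Cup, 1), (Under, 0), (Under, 0), (Under, 1), (Over, 2), (Cap, 1), (Cap, 0)]"
    by (rule isotopic_at[OF isotopy_move.zigzag_right[of 1], of 4]) (simp_all add: isotopic_at_simps)
  also have "isotopic \<dots>
    [(Cup, 0), (Cup, 0), (Over, 1), (Under, 0), (Under, 1), (Over, 2), (Cap, 1), (Cap, 0)]"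
    by (rule isotopic_at_rev[OF isotopy_move.slide_cup[of Over 0], of 1]) (simp_all add: isotopic_at_simps)
  also have "isotopic \<dots>
    [(Cup, 0), (Cup, 2), (Over, 1), (Under, 0), (Under, 1), (Over, 2), (Cap, 1), (Cap, 0)]"
    by (rule isotopic_at_rev[OF isotopy_move.exchange[of 0 0 Cup Cup], of 0]) (simp_all add: isotopic_at_simps)
  also have "isotopic \<dots>
    [(Cup, 0), (Cup, 2), (Over, 1), (Under, 0), (Under, 1), (Under, 1), (Cap, 2), (Cap, 0)]"
    by (rule isotopic_at[OF isotopy_move.slide_cap[of Over 1], of 5]) (simp_all add: isotopic_at_simps)
  also have "isotopic \<dots>
    [(Cup, 0), (Cup, 2), (Over, 1), (Under, 0), (Under, 1), (Under, 1), (Cap, 0), (Cap, 0)]"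
    by (rule isotopic_at_rev[OF isotopy_move.exchange[of 0 0 Cap Cap], of 6]) (simp_all add: isotopic_at_simps)
  also have "isotopic \<dots>
    [(Cup, 0), (Cup, 2), (Over, 1), (Under, 0), (Under, 1), (Over, 0), (Cap, 1), (Cap, 0)]"
    by (rule isotopic_at[OF isotopy_move.slide_cap[of Under 0], of 5]) (simp_all add: isotopic_at_simps)
  also have "isotopic \<dots>
    [(Cup, 0), (Cup, 2), (Over, 1), (Over, 1), (Under, 0), (Under, 1), (Cap, 1), (Cap, 0)]"
    by (rule isotopic_at[OF isotopy_move.R3[of Under Under Over 0], of 3]) (simp_all add: isotopic_at_simps)
  also have "isotopic \<dots>
    [(Cup, 0), (Cup, 2), (Over, 1), (Over, 1), (Under, 0), (Cap, 1), (Cap, 0)]"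
    by (rule isotopic_at[OF isotopy_move.R1_cap[of Under 1], of 5]) (simp_all add: isotopic_at_simps)
  also have "isotopic \<dots>
    [(Cup, 0), (Cup, 2), (Over, 1), (Over, 1), (Over, 1), (Cap, 0), (Cap, 0)]"
    by (rule isotopic_at_rev[OF isotopy_move.slide_cap[of Over 0], of 4]) (simp_all add: isotopic_at_simps)
  finally show ?thesis by (simp add: trefoil_def unknot_def torus_diagram_def pretzel_diagram_def twist_def eval_nat_numeral)
qed

text \<open>The braid relation lets the third strand be straightened: its crossing becomes a kink
  and its cup and cap a zigzag.\<close>

lemma isotopic_torus_32: "isotopic (torus_diagram 3 2) trefoil"
proof -
  have "isotopic [(Cup, 0), (Cup, 1), (Cup, 2), (Over, 0), (Over, 1), (Over, 0), (Over, 1), (Cap, 2), (Cap, 1), (Cap, 0)]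
    [(Cup, 0), (Cup, 1), (Over, 0), (Cup, 2), (Over, 1), (Over, 0), (Over, 1), (Cap, 2), (Cap, 1), (Cap, 0)]"
    by (rule isotopic_at_rev[OF isotopy_move.exchange[of 0 0 Over Cup], of 2]) (simp_all add: isotopic_at_simps)
  also have "isotopic \<dots>
    [(Cup, 0), (Cup, 1), (Over, 0), (Cup, 2), (Over, 0), (Over, 1), (Over, 0), (Cap, 2), (Cap, 1), (Cap, 0)]"
    by (rule isotopic_at_rev[OF isotopy_move.R3[of Over Over Over 0], of 4]) (simp_all add: isotopic_at_simps)
  also have "isotopic \<dots>
    [(Cup, 0), (Cup, 1), (Over, 0), (Over, 0), (Cup, 2), (Over, 1), (Over, 0), (Cap, 2), (Cap, 1), (Cap, 0)]"
    by (rule isotopic_at_rev[OF isotopy_move.exchange[of 0 0 Over Cup], of 3]) (simp_all add: isotopic_at_simps)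
  also have "isotopic \<dots>
    [(Cup, 0), (Cup, 1), (Over, 0), (Over, 0), (Cup, 1), (Under, 2), (Over, 0), (Cap, 2), (Cap, 1), (Cap, 0)]"
    by (rule isotopic_at_rev[OF isotopy_move.slide_cup[of Under 1], of 4]) (simp_all add: isotopic_at_simps)
  also have "isotopic \<dots>
    [(Cup, 0), (Cup, 1), (Over, 0), (Over, 0), (Cup, 1), (Under, 2), (Cap, 2), (Over, 0), (Cap, 1), (Cap, 0)]"
    by (rule isotopic_at[OF isotopy_move.exchange[of 0 0 Over Cap], of 6]) (simp_all add: isotopic_at_simps)
  also have "isotopic \<dots>
    [(Cup, 0), (Cup, 1), (Over, 0), (Over, 0), (Cup, 1), (Cap, 2), (Over, 0), (Cap, 1), (Cap, 0)]"
    by (rule isotopic_at[OF isotopy_move.R1_cap[of Under 2], of 5]) (simp_all add: isotopic_at_simps)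
  also have "isotopic \<dots>
    [(Cup, 0), (Cup, 1), (Over, 0), (Over, 0), (Over, 0), (Cap, 1), (Cap, 0)]"
    by (rule isotopic_at[OF isotopy_move.zigzag_left[of 1], of 4]) (simp_all add: isotopic_at_simps)
  \<comment> \<open>The diagram reached here is \<open>torus_diagram 2 3\<close>. From now on a kink
    is carried from the cap down to the cup, as for \<open>[2, 1]\<close>.\<close>
  also have "isotopic \<dots>
    [(Cup, 0), (Cup, 1), (Over, 0), (Over, 0), (Under, 1), (Cap, 0), (Cap, 0)]"
    by (rule isotopic_at_rev[OF isotopy_move.slide_cap[of Under 0], of 4]) (simp_all add: isotopic_at_simps)
  also have "isotopic \<dots>
    [(Cup, 0), (Cup, 1), (Over, 0), (Over, 0), (Under, 1), (Under, 0), (Cap, 0), (Cap, 0)]"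
    by (rule isotopic_at_rev[OF isotopy_move.R1_cap[of Under 0], of 5]) (simp_all add: isotopic_at_simps)
  also have "isotopic \<dots>
    [(Cup, 0), (Cup, 1), (Over, 0), (Under, 1), (Under, 0), (Over, 1), (Cap, 0), (Cap, 0)]"
    by (rule isotopic_at[OF isotopy_move.R3[of Over Under Under 0], of 3]) (simp_all add: isotopic_at_simps)
  also have "isotopic \<dots>
    [(Cup, 0), (Cup, 1), (Under, 1), (Under, 0), (Over, 1), (Over, 1), (Cap, 0), (Cap, 0)]"
    by (rule isotopic_at[OF isotopy_move.R3[of Over Under Under 0], of 2]) (simp_all add: isotopic_at_simps)
  also have "isotopic \<dots>
    [(Cup, 0), (Cup, 1), (Under, 0), (Over, 1), (Over, 1), (Cap, 0), (Cap, 0)]"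
    by (rule isotopic_at[OF isotopy_move.R1_cup[of Under 1], of 1]) (simp_all add: isotopic_at_simps)
  also have "isotopic \<dots>
    [(Cup, 0), (Cup, 0), (Over, 1), (Over, 1), (Over, 1), (Cap, 0), (Cap, 0)]"
    by (rule isotopic_at_rev[OF isotopy_move.slide_cup[of Over 0], of 1]) (simp_all add: isotopic_at_simps)
  also have "isotopic \<dots>
    [(Cup, 0), (Cup, 2), (Over, 1), (Over, 1), (Over, 1), (Cap, 0), (Cap, 0)]"
    by (rule isotopic_at_rev[OF isotopy_move.exchange[of 0 0 Cup Cup], of 0]) (simp_all add: isotopic_at_simps)
  finally show ?thesis by (simp add: trefoil_def unknot_def torus_diagram_def pretzel_diagram_def twist_def eval_nat_numeral)
qed

text \<open>Sliding the outer two of the three equal crossings sideways puts all three into a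
  triangle with cyclic heights, ready for a Delta-move.\<close>

lemma isotopic_trefoil_delta_source: "isotopic trefoil
  [(Cup, 0), (Cup, 1), (Under, 0), (Over, 1), (Under, 0), (Cap, 1), (Cap, 0)]"
proof -
  have "isotopic [(Cup, 0), (Cup, 2), (Over, 1), (Over, 1), (Over, 1), (Cap, 0), (Cap, 0)]
    [(Cup, 0), (Cup, 0), (Over, 1), (Over, 1), (Over, 1), (Cap, 0), (Cap, 0)]"
    by (rule isotopic_at[OF isotopy_move.exchange[of 0 0 Cup Cup], of 0]) (simp_all add: isotopic_at_simps)
  also have "isotopic \<dots>
    [(Cup, 0), (Cup, 1), (Under, 0), (Over, 1), (Over, 1), (Cap, 0), (Cap, 0)]"
    by (rule isotopic_at[OF isotopy_move.slide_cup[of Over 0], of 1]) (simp_all add: isotopic_at_simps)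
  also have "isotopic \<dots>
    [(Cup, 0), (Cup, 1), (Under, 0), (Over, 1), (Under, 0), (Cap, 1), (Cap, 0)]"
    by (rule isotopic_at[OF isotopy_move.slide_cap[of Over 0], of 4]) (simp_all add: isotopic_at_simps)
  finally show ?thesis by (simp add: trefoil_def unknot_def torus_diagram_def pretzel_diagram_def twist_def eval_nat_numeral)
qed

lemma isotopic_delta_target_unknot: "isotopic [(Cup, 0), (Cup, 1), (Under, 1), (Over, 0), (Under, 1), (Cap, 1), (Cap, 0)]
  unknot"
proof -
  have "isotopic [(Cup, 0), (Cup, 1), (Under, 1), (Over, 0), (Under, 1), (Cap, 1), (Cap, 0)]
    [(Cup, 0), (Cup, 1), (Over, 0), (Under, 1), (Cap, 1), (Cap, 0)]"
    by (rule isotopic_at[OF isotopy_move.R1_cup[of Under 1], of 1]) (simp_all add: isotopic_at_simps)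
  also have "isotopic \<dots>
    [(Cup, 0), (Cup, 1), (Over, 0), (Cap, 1), (Cap, 0)]"
    by (rule isotopic_at[OF isotopy_move.R1_cap[of Under 1], of 3]) (simp_all add: isotopic_at_simps)
  also have "isotopic \<dots>
    [(Cup, 0), (Cup, 0), (Under, 1), (Cap, 1), (Cap, 0)]"
    by (rule isotopic_at_rev[OF isotopy_move.slide_cup[of Under 0], of 1]) (simp_all add: isotopic_at_simps)
  also have "isotopic \<dots>
    [(Cup, 0), (Cup, 0), (Cap, 1), (Cap, 0)]"
    by (rule isotopic_at[OF isotopy_move.R1_cap[of Under 1], of 2]) (simp_all add: isotopic_at_simps)
  also have "isotopic \<dots>
    [(Cup, 0), (Cap, 0)]"
    by (rule isotopic_at[OF isotopy_move.zigzag_left[of 0], of 1]) (simp_all add: isotopic_at_simps)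
  finally show ?thesis by (simp add: trefoil_def unknot_def torus_diagram_def pretzel_diagram_def twist_def eval_nat_numeral)
qed

section \<open>The Delta-unknotting number of the trefoil\<close>

lemma delta_path_trefoil: "delta_path (Suc 0) trefoil unknot"
  unfolding delta_path_1 delta_move_def
proof (intro exI conjI)
  let ?U = "[(Cup, 0), (Cup, 1)]" and ?V = "[(Cap, 1), (Cap, 0)]"
  have "apply_move delta_local (?U @ [(Under, 0), (flip Under, 0 + 1), (Under, 0)] @ ?V)
    (?U @ [(Under, 0 + 1), (flip Under, 0), (Under, 0 + 1)] @ ?V)"
    by (intro apply_move.intros delta_local.intros) (simp_all add: isotopic_at_simps)
  then show "symclp (apply_move delta_local) [(Cup, 0), (Cup, 1), (Under, 0), (Over, 1), (Under, 0), (Cap, 1), (Cap, 0)]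
    [(Cup, 0), (Cup, 1), (Under, 1), (Over, 0), (Under, 1), (Cap, 1), (Cap, 0)]"
    by (simp add: symclp_def)
qed (rule isotopic_trefoil_delta_source isotopic_delta_target_unknot)+

text \<open>The count is made on \<open>pretzel_diagram [2, 1]\<close> with the times of type A for
  \<open>N = 3\<close>. A single pair gives a positive value, whereas the unknot has only the value
  0.\<close>

lemma trefoil_not_isotopic_unknot: "\<not> isotopic trefoil unknot"
proof
  define u d where "u = (\<lambda>j :: nat. if j = 0 then 0 else 3 :: int)" and "d = (\<lambda>j :: nat. if j = 0 then 1 else - 1 :: int)"
  have [simp]: "u 0 = 0" "u (Suc j) = 3" "d 0 = 1" "d (Suc j) = - 1" for j by (simp_all add: u_def d_def)
  interpret columns "[2, 1]" u "\<lambda>j. u j + 3" d d .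
  assume "isotopic trefoil unknot"
  then have K: "isotopic (pretzel_diagram [2, 1]) unknot" using isotopic_pretzel_A isotopic_trans by blast
  have c: compatible
    by (auto simp: compatible_def matched_def level_def runL_def runR_def strands_def less_Suc_eq)
  have s: "sg (c, True) * sg (c, False) = 1" if "c \<in> set (ids annotated)" for c
    by (rule pretzel_signs[OF _ that]) (auto simp: less_Suc_eq)
  have "value_of (pretzel_diagram [2, 1]) (int (card (crossing_pairs (set (ids annotated)))))"
    unfolding erase_annotated[symmetric]
    by (rule value_crossing_pairs[OF pretzel_trace[OF c] distinct_ids _ s, of 0])
      (use value_isotopic[OF K] value_unknot in \<open>simp_all add: lout_def erase_annotated\<close>)
  then have "card (crossing_pairs (set (ids annotated))) = 0"
    using value_isotopic[OF K] value_unknot by simp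
  moreover have "((0, 1), (1, 0)) \<in> crossing_pairs (set (ids annotated))"
    unfolding crossing_pairs_def set_ids by (auto simp: lin_apply on_L_def strands_def)
  ultimately show False using finite_crossing_pairs[of "set (ids annotated)"] by (auto simp: card_eq_0_iff)
qed

lemma delta_unknotting_number_trefoil:
  assumes "isotopic K trefoil"
  shows "delta_unknotting_number K = 1"
  unfolding delta_unknotting_number_1
proof
  show "delta_path (Suc 0) K unknot"
    using delta_path_trefoil assms isotopic_trans unfolding delta_path_1 by blast
  show "\<not> isotopic K unknot"
    using trefoil_not_isotopic_unknot assms isotopic_sym isotopic_trans by blast
qed

lemma mirror_mirror [simp]: "mirror (mirror D) = D"
proof -
  have "flip (flip x) = x" for x by (cases x) auto
  then show ?thesis by (simp add: mirror_def case_prod_beta comp_def)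
qed

lemma mirror_unknot: "mirror unknot = unknot"
  by (simp add: unknot_def)

lemma delta_unknotting_number_mirror:
  assumes "delta_unknotting_number K = 1"
  shows "delta_unknotting_number (mirror K) = 1"
  using assms delta_path_mirror isotopic_mirror[of "mirror K" unknot] unfolding delta_unknotting_number_1 by (auto simp: mirror_unknot)

lemma positive_pretzel_delta_one:
  assumes T: "pretzel_odd_type ps \<or> pretzel_even_type_A ps \<or> pretzel_even_type_B ps"
    and K: "isotopic K (pretzel_diagram ps)" "delta_unknotting_number K = 1"
  shows "isotopic K trefoil \<or> isotopic K (mirror trefoil)"
proof -
  have "delta_path (Suc 0) K unknot" using K(2) unfolding delta_unknotting_number_1 ..
  then have "ps \<in> {[1, 1, 1], [2, 1], [- 2, 1, 1]}"
    using T K(1) pretzel_odd_delta_one pretzel_A_delta_one pretzel_B_delta_one by blast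
  then show ?thesis
    using K(1) isotopic_pretzel_odd isotopic_pretzel_A isotopic_pretzel_B isotopic_trans by blast
qed

lemma mirror_trefoil_cases:
  assumes "isotopic (mirror K) trefoil \<or> isotopic (mirror K) (mirror trefoil)"
  shows "isotopic K trefoil \<or> isotopic K (mirror trefoil)"
  using assms isotopic_mirror by fastforce

section \<open>Torus knots\<close>

locale torus =
  fixes p q :: nat
  assumes p: "2 \<le> p" and q: "1 \<le> q" and coprime: "coprime p q"
begin

text \<open>The knot runs through the pq strands (r, j) at the bottom of the q blocks, where j is the
  position and r the block; each block moves the position by - 1 modulo p.  Strand (r, j) is the one
  passed at time T r j, and r = q stands for the top of the braid, where the bound r \<open>\<le>\<close> s makes
  the start (0, 0) reappear at time pq.\<close>

definition T :: "nat \<Rightarrow> nat \<Rightarrow> nat" where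
  "T r j = (LEAST s. r \<le> s \<and> q dvd s - r \<and> p dvd s + j)"

lemma T_exists: "\<exists>s. r \<le> s \<and> q dvd s - r \<and> p dvd s + j"
proof -
  have "gcd p q = 1" using coprime by (simp add: coprime_iff_gcd_eq_1)
  obtain x y where xy: "q * x = p * y + 1"
    using coprime p q by (metis bezout_nat coprime_commute coprime_iff_gcd_eq_1 not_one_le_zero)
  \<comment> \<open>Modulo \<open>p\<close>, \<open>x\<close> is inverse to \<open>q\<close> and
    \<open>p - 1\<close> is - 1, so the added multiple of \<open>q\<close> is congruent to the
    negative of \<open>r + j\<close>.\<close>
  have "p dvd r + q * (x * (p - 1) * (r + j)) + j"
  proof -
    have "r + q * (x * (p - 1) * (r + j)) + j = (r + j) * (1 + (q * x) * (p - 1))" by (simp add: algebra_simps)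
    also have "1 + (q * x) * (p - 1) = p * (1 + y * (p - 1))"
      using p unfolding xy by (cases p) (simp_all add: algebra_simps)
    finally show ?thesis by simp
  qed
  then show ?thesis by (intro exI[of _ "r + q * (x * (p - 1) * (r + j))"]) simp
qed

lemma T: "r \<le> T r j" "q dvd T r j - r" "p dvd T r j + j"
  using LeastI_ex[OF T_exists[of r j]] unfolding T_def by blast+

text \<open>By coprimality the two congruences have only one solution below
  \<open>p * q\<close>.\<close>

lemma T_eqI:
  assumes "r < q" "s < p * q" "s mod q = r" "p dvd s + j"
  shows "T r j = s"
proof -
  have s: "r \<le> s" "q dvd s - r" using assms(3) by (auto simp: dvd_minus_mod)
  have le: "T r j \<le> s" unfolding T_def by (rule Least_le) (use s assms in simp)
  have "s - T r j = (s - r) - (T r j - r)" "s - T r j = (s + j) - (T r j + j)" using T(1)[of r j] by simp_all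
  then have "q dvd s - T r j" "p dvd s - T r j" using s T[of r j] assms(4) by (metis dvd_diff_nat)+
  then have "p * q dvd s - T r j" using coprime by (simp add: divides_mult)
  then have "s - T r j = 0" using assms(2) by (metis dvd_imp_le le_neq_implies_less less_imp_diff_less linorder_not_less neq0_conv)
  then show ?thesis using le by simp
qed

lemma T_shift:
  assumes "\<And>s. p dvd Suc s + j' \<longleftrightarrow> p dvd s + j"
  shows "T (Suc r) j' = Suc (T r j)"
proof -
  have "T (Suc r) j' = (LEAST s. \<exists>s'. s = Suc s' \<and> r \<le> s' \<and> q dvd s' - r \<and> p dvd s' + j)"
    unfolding T_def using assms by (intro arg_cong[where f = Least] ext) (metis Suc_le_D Suc_le_mono diff_Suc_Suc)
  also have "\<dots> = Suc (T r j)"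
    by (rule Least_equality) (use T[of r j] in \<open>auto simp: T_def intro: Least_le\<close>)
  finally show ?thesis .
qed

lemma T_Suc: "T (Suc r) j = Suc (T r (Suc j))" "T (Suc r) (p - 1) = Suc (T r 0)"
proof -
  show "T (Suc r) j = Suc (T r (Suc j))" by (rule T_shift) simp
  have "p dvd Suc s + (p - 1) \<longleftrightarrow> p dvd s + 0" for s
  proof -
    have "Suc s + (p - 1) = s + p" using p by simp
    then show ?thesis by simp
  qed
  then show "T (Suc r) (p - 1) = Suc (T r 0)" by (rule T_shift)
qed

text \<open>For these \<open>j\<close> time 0 is no solution, and any other multiple of
  \<open>q\<close> is at least \<open>q\<close>, so the lower bound does not alter the set of
  solutions.\<close>

lemma T_top: "0 < j \<Longrightarrow> j < p \<Longrightarrow> T q j = T 0 j"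
proof -
  assume j: "0 < j" "j < p"
  have "\<not> p dvd j" using j by (auto dest: dvd_imp_le)
  then have "(q \<le> s \<and> q dvd s - q \<and> p dvd s + j) \<longleftrightarrow> (0 \<le> s \<and> q dvd s - 0 \<and> p dvd s + j)" for s
    by (cases "s = 0") (auto dest: dvd_imp_le simp: le_imp_diff_is_add dvd_diff_nat elim: dvd_diffD1 dvd_diffD)
  then show ?thesis unfolding T_def by simp
qed

lemma T_0_0: "T 0 0 = 0"
  unfolding T_def by (rule Least_equality) simp_all

text \<open>Times are stretched by the factor \<open>p\<close>: the strand at position 0 crosses
  over all others of its block, and its \<open>p - 1\<close> passages have to fit into one
  step.\<close>

definition over :: "nat \<Rightarrow> nat \<Rightarrow> nat" where
  "over r j = (if j = p - 1 then p * Suc (T r 0) else p * T r 0 + j)"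

definition lin :: "(nat \<times> nat) \<times> bool \<Rightarrow> int" where
  "lin = (\<lambda>((r, j), v). int (if v then over r j else p * T r (Suc j)))"

definition lout :: "(nat \<times> nat) \<times> bool \<Rightarrow> int" where
  "lout = (\<lambda>((r, j), v). int (if v then over r (Suc j) else p * T (Suc r) j))"

sublocale diagram_labelling lin lout "\<lambda>_. 1" .

lemma lin_apply: "lin ((r, j), v) = int (if v then over r j else p * T r (Suc j))"
  by (simp add: lin_def)

lemma lout_apply: "lout ((r, j), v) = int (if v then over r (Suc j) else p * T (Suc r) j)"
  by (simp add: lout_def)

definition up :: "nat \<Rightarrow> int \<times> int" where "up t = (1, int t)"
definition down :: "nat \<Rightarrow> int \<times> int" where "down t = (- 1, int t)"

definition block :: "nat \<Rightarrow> nat \<Rightarrow> (nat \<times> nat) layer list" where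
  "block r j = map (\<lambda>j. (Over, j, (r, j))) [j..<p - 1]"

definition annotated :: "(nat \<times> nat) layer list" where
  "annotated = map (\<lambda>j. (Cup, j, (0, 0))) [1..<p] @ concat (map (\<lambda>r. block r 0) [0..<q]) @
     map (\<lambda>j. (Cap, j, (0, 0))) (rev [0..<p])"

lemma erase_annotated: "(Cup, 0) # erase annotated = torus_diagram p (int q)"
proof -
  have "[0..<p] = 0 # [1..<p]" using p by (simp add: upt_conv_Cons)
  then have "map (\<lambda>j. (Cup, j)) [0..<p] = (Cup, 0) # map (\<lambda>j. (Cup, j)) [1..<p]" by simp
  then show ?thesis
    unfolding annotated_def torus_diagram_def erase_simps erase_map erase_concat map_map comp_def block_def
    by (simp add: map_replicate_const twist_def)
qed

lemma ids_annotated: "ids annotated = concat (map (\<lambda>r. map (\<lambda>j. (r, j)) [0..<p - 1]) [0..<q])"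
  unfolding annotated_def ids_append ids_map ids_concat map_map comp_def block_def by (simp add: crossing_def)

lemma set_ids: "set (ids annotated) = {(r, j). r < q \<and> j < p - 1}"
  unfolding ids_annotated by auto

lemma distinct_ids: "distinct (ids annotated)"
proof -
  have "distinct (concat (map (\<lambda>r. map (\<lambda>j. (r, j)) [0..<m]) [0..<n]))" for m n
    by (induction n) (auto simp: distinct_map inj_on_def)
  then show ?thesis unfolding ids_annotated .
qed

text \<open>The section of block \<open>r\<close> just below its crossing \<open>j\<close>: strands
  to the left have already gone under and carry times of the next block.\<close>

definition level :: "nat \<Rightarrow> nat \<Rightarrow> (int \<times> int) list" where
  "level r j = map (\<lambda>i. up (p * T (Suc r) i)) [0..<j] @ up (over r j) # map (\<lambda>i. up (p * T r i)) [Suc j..<p]"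

lemma level_0: "level r 0 = map (\<lambda>i. up (p * T r i)) [0..<p]"
proof -
  have "[0..<p] = 0 # [Suc 0..<p]" using p by (simp add: upt_conv_Cons)
  then show ?thesis using p by (simp add: level_def over_def)
qed

lemma level_last: "level r (p - 1) = level (Suc r) 0"
proof -
  have "[0..<p] = [0..<p - 1] @ [p - 1]" using p upt_Suc_append[of 0 "p - 1"] by simp
  then show ?thesis unfolding level_0 using p by (simp add: level_def over_def T_Suc(2)[unfolded One_nat_def])
qed

lemma block_trace:
  assumes A: "trace A (level (Suc r) 0 @ s)" and j: "j \<le> p - 1"
  shows "trace (block r j @ A) (level r j @ s)"
  using j
proof (induction j rule: inc_induct)
  case base
  then show ?case using A by (simp add: block_def level_last[unfolded One_nat_def])
next
  case (step j)
  have b: "block r j = (Over, j, (r, j)) # block r (Suc j)" using step.hyps by (simp add: block_def upt_conv_Cons)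
  have u: "[Suc j..<p] = Suc j # [Suc (Suc j)..<p]" using step.hyps by (simp add: upt_conv_Cons)
  have x: "crossing Over" by (simp add: crossing_def)
  have e: "edge (left_letter Over (r, j)) (up (over r j)) (up (over r (Suc j)))"
    "edge (right_letter Over (r, j)) (up (p * T r (Suc j))) (up (p * T (Suc r) j))"
    unfolding edge_def by (simp_all add: lin_apply lout_apply up_def left_letter_def right_letter_def)
  have "layer_ok (Over, j, (r, j)) (level r j @ s) (level r (Suc j) @ s)"
    unfolding layer_ok_crossing[OF x]
    by (intro exI[of _ "map (\<lambda>i. up (p * T (Suc r) i)) [0..<j]"] exI[of _ "map (\<lambda>i. up (p * T r i)) [Suc (Suc j)..<p] @ s"]
        exI[of _ "up (over r j)"] exI[of _ "up (p * T r (Suc j))"] exI[of _ "up (over r (Suc j))"] exI[of _ "up (p * T (Suc r) j)"])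
      (simp add: level_def u e)
  then show ?case unfolding b append_Cons trace.simps using step.IH by blast
qed

lemma blocks_trace:
  assumes A: "trace A (level q 0 @ s)" and r: "r \<le> q"
  shows "trace (concat (map (\<lambda>r. block r 0) [r..<q]) @ A) (level r 0 @ s)"
  using r
proof (induction r rule: inc_induct)
  case base
  then show ?case using A by simp
next
  case (step r)
  have u: "[r..<q] = r # [Suc r..<q]" using step.hyps by (simp add: upt_conv_Cons)
  show ?case using block_trace[OF step.IH, of 0] unfolding u by simp
qed

end

context labelling
begin

lemma nested_cups_trace:
  assumes A: "trace A (map f [0..<p] @ map g (rev [0..<p]))" and m: "\<And>j. n \<le> j \<Longrightarrow> j < p \<Longrightarrow> matched (f j) (g j)" and n: "n \<le> p"
  shows "trace (map (\<lambda>j. (Cup, j, c)) [n..<p] @ A) (map f [0..<n] @ map g (rev [0..<n]))"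
  using n m
proof (induction n rule: inc_induct)
  case base
  then show ?case using A by simp
next
  case (step n)
  have u: "[n..<p] = n # [Suc n..<p]" using step.hyps by (simp add: upt_conv_Cons)
  have "layer_ok (Cup, n, c) (map f [0..<n] @ map g (rev [0..<n])) (map f [0..<Suc n] @ map g (rev [0..<Suc n]))"
    unfolding layer_ok.simps using step.prems[of n] step.hyps
    by (intro exI[of _ "map f [0..<n]"] exI[of _ "map g (rev [0..<n])"] exI[of _ "f n"] exI[of _ "g n"]) simp
  moreover have "trace (map (\<lambda>j. (Cup, j, c)) [Suc n..<p] @ A) (map f [0..<Suc n] @ map g (rev [0..<Suc n]))"
    by (rule step.IH) (use step.prems in simp)
  ultimately show ?case unfolding u list.map append_Cons trace.simps by blast
qed

lemma nested_caps_trace: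
  assumes m: "\<And>j. j < p \<Longrightarrow> matched (f j) (g j)"
  shows "trace (map (\<lambda>j. (Cap, j, c)) (rev [0..<p])) (map f [0..<p] @ map g (rev [0..<p]))"
  using m
proof (induction p)
  case (Suc p)
  have "layer_ok (Cap, p, c) (map f [0..<Suc p] @ map g (rev [0..<Suc p])) (map f [0..<p] @ map g (rev [0..<p]))"
    unfolding layer_ok.simps using Suc.prems[of p]
    by (intro exI[of _ "map f [0..<p]"] exI[of _ "map g (rev [0..<p])"] exI[of _ "f p"] exI[of _ "g p"]) simp
  moreover have "trace (map (\<lambda>j. (Cap, j, c)) (rev [0..<p])) (map f [0..<p] @ map g (rev [0..<p]))"
    by (rule Suc.IH) (use Suc.prems in simp)
  ultimately show ?case unfolding upt_Suc_append[OF le0] rev_append by (auto simp del: layer_ok.simps)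
qed simp

end

context torus
begin

lemma annotated_trace: "trace annotated [(1, 0), (- 1, int (p * T q 0))]"
proof -
  let ?f = "\<lambda>r i. up (p * T r i)" and ?g = "\<lambda>i. down (p * T q i)"
  have "trace (map (\<lambda>j. (Cap, j, (0, 0))) (rev [0..<p])) (level q 0 @ map ?g (rev [0..<p]))"
    unfolding level_0 by (rule nested_caps_trace) (simp add: matched_def up_def down_def)
  from blocks_trace[OF this, of 0]
  have "trace annotated (map (?f 0) [0..<1] @ map ?g (rev [0..<1]))"
    unfolding annotated_def level_0
    by (intro nested_cups_trace) (use p in \<open>simp_all add: matched_def up_def down_def T_top\<close>)
  then show ?thesis by (simp add: up_def down_def T_0_0)
qed

section \<open>Crossing pairs in torus diagrams\<close>

lemma over_less: "j < p - 1 \<Longrightarrow> over r j < over r (Suc j)"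
  using p by (auto simp: over_def)

lemma card_pairs:
  assumes K: "isotopic K (torus_diagram p (int q))" "delta_path (Suc 0) K unknot"
  shows "card (crossing_pairs {(r, j). r < q \<and> j < p - 1}) = 1"
proof -
  have "lin (c, v) < lout (c, v)" if "c \<in> set (ids annotated)" for c v
    using that over_less p unfolding set_ids by (auto simp: lin_def lout_def T_Suc(1))
  from delta_one_count[OF annotated_trace distinct_ids this, of 1] K
  show ?thesis unfolding erase_annotated set_ids by simp
qed

text \<open>With a single block all over passages precede all under passages, but in the pattern an
  under passage precedes an over passage.\<close>

lemma q_not_1:
  assumes K: "isotopic K (torus_diagram p (int q))" "delta_path (Suc 0) K unknot"
  shows "q \<noteq> 1"
proof
  assume q1: "q = 1"
  have "crossing_pairs {(r, j). r < q \<and> j < p - 1} = {}"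
  proof -
    have "\<not> int (p * T r (Suc j)) < int (over r' j')" if "j < p - 1" "j' < p - 1" "r < q" "r' < q" for r r' j j'
    proof -
      have r: "r = 0" "r' = 0" using that q1 by auto
      have "\<not> p dvd Suc j" using that by (auto dest: dvd_imp_le)
      then have "T r (Suc j) \<noteq> 0" using T(3)[of r "Suc j"] by (metis add_0)
      then have "p \<le> p * T r (Suc j)" by simp
      moreover have "over r' j' = j'" using that by (simp add: over_def r T_0_0)
      ultimately show ?thesis using that unfolding of_nat_less_iff by linarith
    qed
    then show ?thesis unfolding crossing_pairs_def by (auto simp: lin_apply)
  qed
  then show False using card_pairs[OF K] by simp
qed

text \<open>Time \<open>t\<close> determines the block, in which the over strand starts at position
  0. At time \<open>u\<close> the under strand is at the position congruent to \<open>- u\<close>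
  modulo \<open>p\<close>, one to the right of the index of the crossing.\<close>

definition crossing_at :: "nat \<Rightarrow> nat \<Rightarrow> nat \<times> nat" where
  "crossing_at t u = (t mod q, p - 1 - u mod p)"

lemma crossing_at:
  assumes t: "p dvd t" "t < p * q" and u: "\<not> p dvd u" "u < p * q" "u mod q = t mod q"
  shows "fst (crossing_at t u) < q" "snd (crossing_at t u) < p - 1"
    "lin (crossing_at t u, True) = int (p * t + (p - 1 - u mod p))" "lin (crossing_at t u, False) = int (p * u)"
proof -
  have m: "0 < u mod p" "u mod p < p" using u(1) p by (auto simp: mod_greater_zero_iff_not_dvd)
  show "fst (crossing_at t u) < q" "snd (crossing_at t u) < p - 1" using m q p by (auto simp: crossing_at_def)
  have nm: "p - Suc (u mod p) \<noteq> p - Suc 0" using m by linarith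
  have "T (t mod q) 0 = t" by (rule T_eqI) (use t q in simp_all)
  then show "lin (crossing_at t u, True) = int (p * t + (p - 1 - u mod p))"
    using m p nm by (simp add: lin_def crossing_at_def over_def)
  have "u + Suc (p - 1 - u mod p) = u div p * p + p"
    using m div_mult_mod_eq[of u p] by linarith
  then have "p dvd u + Suc (p - 1 - u mod p)" by simp
  then have "T (t mod q) (Suc (p - 1 - u mod p)) = u" by (intro T_eqI) (use u q in simp_all)
  then show "lin (crossing_at t u, False) = int (p * u)" by (simp add: lin_def crossing_at_def)
qed

text \<open>The data of a crossing pair: the crossing c (d) is passed over at time t (t'), and under at
  time u (u').\<close>

definition pair_data :: "nat \<Rightarrow> nat \<Rightarrow> nat \<Rightarrow> nat \<Rightarrow> bool" where
  "pair_data u t' t u' \<longleftrightarrow> p dvd t \<and> p dvd t' \<and> (\<exists>l. 0 < l \<and> l < p \<and> t = u + q * l) \<and> (\<exists>l. 0 < l \<and> l < p \<and> u' = t' + q * l) \<and>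
     u < t' \<and> (t' < t \<or> t' = t \<and> u mod p < u' mod p) \<and> t < u' \<and> u' < p * q"

lemma pair_data:
  assumes "pair_data u t' t u'"
  shows "(crossing_at t u, crossing_at t' u') \<in> crossing_pairs {(r, j). r < q \<and> j < p - 1}"
    "lin (crossing_at t u, False) = int (p * u)" "lin (crossing_at t' u', False) = int (p * u')"
proof -
  obtain l l' where l: "0 < l" "l < p" "t = u + q * l" "0 < l'" "l' < p" "u' = t' + q * l'"
    using assms unfolding pair_data_def by blast
  have d: "p dvd t" "p dvd t'" "u < t'" "t' < t \<or> t' = t \<and> u mod p < u' mod p" "t < u'" "u' < p * q"
    using assms unfolding pair_data_def by blast+
  have n: "\<not> p dvd q * k" if "0 < k" "k < p" for k
    using that coprime by (auto simp: coprime_dvd_mult_right_iff dest: dvd_imp_le)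
  have nd: "\<not> p dvd u" "\<not> p dvd u'"
    using n[OF l(1,2)] n[OF l(4,5)] d(1,2) unfolding l(3,6) by (metis dvd_add_right_iff)+
  have lt: "t < p * q" "t' < p * q" "u < p * q" using d by linarith+
  have mq: "u mod q = t mod q" "u' mod q = t' mod q" unfolding l(3,6) by simp_all
  note c = crossing_at[OF d(1) lt(1) nd(1) lt(3) mq(1)] crossing_at[OF d(2) lt(2) nd(2) d(6) mq(2)]
  have p0: "0 < p" using p by simp
  have "p * Suc u \<le> p * t'" "p * Suc t \<le> p * u'" using d(3,5) by (simp_all del: mult_Suc_right)
  then have 1: "p * u < p * t' + (p - 1 - u' mod p)" "p * t + (p - 1 - u mod p) < p * u'" using p0 by auto
  \<comment> \<open>For \<open>t' = t\<close> both over passages belong to the same run across a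
    block. The larger residue of the under time lies further left and is crossed first.\<close>
  have 2: "p * t' + (p - 1 - u' mod p) < p * t + (p - 1 - u mod p)"
    using d(4)
  proof
    assume "t' < t"
    then have "p * Suc t' \<le> p * t" by (simp del: mult_Suc_right)
    then show ?thesis using p0 by auto
  next
    assume "t' = t \<and> u mod p < u' mod p"
    moreover have "u' mod p < p" using p0 by simp
    ultimately show ?thesis by auto
  qed
  show "(crossing_at t u, crossing_at t' u') \<in> crossing_pairs {(r, j). r < q \<and> j < p - 1}"
    unfolding crossing_pairs_def using 1 2 c by (auto simp: mem_Times_iff split_beta simp del: of_nat_add of_nat_mult)
  show "lin (crossing_at t u, False) = int (p * u)" "lin (crossing_at t' u', False) = int (p * u')" using c by simp_all
qed

lemma no_two_pair_data:
  assumes K: "isotopic K (torus_diagram p (int q))" "delta_path (Suc 0) K unknot"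
    and d: "pair_data u t' t u'" "pair_data v s' s v'" "u \<noteq> v \<or> u' \<noteq> v'"
  shows False
proof -
  have "(crossing_at t u, crossing_at t' u') \<noteq> (crossing_at s v, crossing_at s' v')"
    using d(3) pair_data(2,3)[OF d(1)] pair_data(2,3)[OF d(2)] p by (auto simp del: of_nat_mult)
  from two_pairs[OF card_ge_0_finite pair_data(1)[OF d(1)] pair_data(1)[OF d(2)] this] card_pairs[OF K]
  show False by simp
qed

lemma torus_cases:
  assumes K: "isotopic K (torus_diagram p (int q))" "delta_path (Suc 0) K unknot"
  shows "p = 2 \<and> q = 3 \<or> p = 3 \<and> q = 2"
proof (rule ccontr)
  assume ne: "\<not> ?thesis"
  have q2: "2 \<le> q" using q_not_1[OF K] q by simp
  have pq: "p \<noteq> q" using coprime p by auto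
  consider "p = 2" | "3 \<le> p" "p < q" | "q < p" using p pq by linarith
  then show False
  proof cases
    case 1
    then have "odd q" using coprime by (metis coprime_left_2_iff_odd)
    then obtain k where k: "q = 2 * k + 1" by (auto elim: oddE)
    then have k2: "2 \<le> k" using q2 ne 1 by presburger
    \<comment> \<open>With two strands the even times are the over times and the two times of a
      crossing differ by \<open>q\<close>. From \<open>k \<ge> 2\<close> there is room for two
      values of \<open>t'\<close> between \<open>u = 1\<close> and \<open>t = q + 1\<close>.\<close>
    have "pair_data 1 (2 * k) (2 * k + 2) (4 * k + 1)" "pair_data 1 (2 * (k - 1)) (2 * k + 2) (4 * k - 1)"
      unfolding pair_data_def unfolding 1 k using k2 by (auto intro!: exI[of _ 1])
    then show False by (rule no_two_pair_data[OF K]) (use k2 in simp)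
  next
    case 2
    \<comment> \<open>Thus \<open>p * (a - 1)\<close> and \<open>p * a\<close> are the multiples of
      \<open>p\<close> next to \<open>q\<close>, below and above. All crossings used have times
      differing by \<open>q\<close>, and the second pair is the first one delayed by
      \<open>p\<close>.\<close>
    define m a where "m = q mod p" and "a = q div p + 1"
    have "\<not> p dvd q" using coprime p coprime_common_divisor_nat[of p q p] by auto
    then have m: "0 < m" "m < p" using p by (auto simp: m_def mod_greater_zero_iff_not_dvd)
    have a: "p * a + m = q + p" using mult_div_mod_eq[of p q] by (simp add: a_def m_def algebra_simps)
    have "3 * q \<le> p * q" using 2 by simp
    then have q3: "2 * q - m < p * q" "2 * q + p - m < p * q" using 2 m by linarith+
    have "pair_data (p - m) (p * (a - 1)) (p * a) (2 * q - m)" "pair_data (2 * p - m) (p * a) (p * (a + 1)) (2 * q + p - m)"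
      unfolding pair_data_def using m a 2 q3 by (auto intro!: exI[of _ 1] simp: algebra_simps a_def)
    then show False by (rule no_two_pair_data[OF K]) (use m 2 in simp)
  next
    case 3
    \<comment> \<open>Since \<open>p = m + q * l\<close>, the crossing with under time
      \<open>m\<close> has over time \<open>p\<close>. The first pair uses two over passages within
      the same block, at \<open>t = t' = p\<close>.\<close>
    define m l where "m = p mod q" and "l = p div q"
    have "\<not> q dvd p" using coprime q2 coprime_common_divisor_nat[of p q q] by auto
    then have m: "0 < m" "m < q" using q2 by (auto simp: m_def mod_greater_zero_iff_not_dvd)
    have l: "p = q * l + m" by (simp add: l_def m_def)
    have l0: "0 < l" using 3 q by (simp add: l_def div_greater_zero_iff)
    have 2: "2 * l \<le> q * l" "q \<le> q * l" "2 * p \<le> p * q" using q2 l0 by simp_all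
    have md: "m mod p = m" "(p + q * k) mod p = q * k" if "k \<le> l" for k
    proof -
      have "m < p" "q * k < p" using 3 m l mult_le_mono2[OF that, of q] by linarith+
      then show "m mod p = m" "(p + q * k) mod p = q * k" by simp_all
    qed
    have b: "l < p" "m < q * l" "m < p" "p + q * l < p * q" using 2 3 l m l0 by linarith+
    have "pair_data m p p (p + q * l)"
      unfolding pair_data_def using m l l0 3 b md[of l] by (auto intro!: exI[of _ l])
    \<comment> \<open>For \<open>q = 2\<close> the second pair lowers \<open>u'\<close> by
      \<open>q\<close>, which needs \<open>l \<ge> 2\<close> and so leaves out exactly
      \<open>p = 3\<close>. For larger \<open>q\<close> the over passage of the first crossing is
      postponed to \<open>2 * p\<close>.\<close>
    moreover have "\<exists>v s' s v'. pair_data v s' s v' \<and> (m \<noteq> v \<or> p + q * l \<noteq> v')"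
    proof (cases "q = 2")
      case True
      then have "m = 1" using m by simp
      then have l2: "2 \<le> l" using l l0 ne True by (cases "l = 1") auto
      then have "pair_data m p p (p + q * (l - 1))"
        unfolding pair_data_def using l2 m l 3 b md[of "l - 1"] \<open>m = 1\<close> True by (auto intro!: exI[of _ l] exI[of _ "l - 1"])
      then show ?thesis using l2 True by (intro exI conjI) (assumption, simp)
    next
      case False
      then have "3 * l \<le> q * l" "3 * p \<le> p * q" using q2 by simp_all
      then have c: "Suc l < p" "2 * p + q - m < p * q" using 3 l m l0 by linarith+
      have e: "2 * p = p + m - q + q * Suc l" "2 * p + q - m = p + q * Suc l" using 3 l m by simp_all
      have "pair_data (p + m - q) p (2 * p) (2 * p + q - m)"
        unfolding pair_data_def using m c 3
        by (intro conjI exI[of _ "Suc l"] e) simp_all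
      then show ?thesis using 3 m by (intro exI conjI) (assumption, simp)
    qed
    ultimately show False using no_two_pair_data[OF K] by blast
  qed
qed

end

lemma torus_diagram_mirror: "torus_diagram p (- q) = mirror (torus_diagram p q)" if "q \<noteq> 0"
proof -
  have "mirror (concat (replicate n D)) = concat (replicate n (mirror D))" for n D
    by (induction n) simp_all
  then show ?thesis using that by (simp add: torus_diagram_def) (simp add: mirror_def twist_def comp_def)
qed

lemma torus_delta_one:
  assumes p: "1 \<le> p" "1 \<le> q" "coprime (int p) q" and K: "isotopic K (torus_diagram p q)" "delta_unknotting_number K = 1"
  shows "isotopic K trefoil \<or> isotopic K (mirror trefoil)"
proof -
  have D: "delta_path (Suc 0) K unknot" "\<not> isotopic K unknot" using K(2) unfolding delta_unknotting_number_1 by blast+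
  obtain n where n: "q = int n" using p(2) by (metis zero_le_imp_eq_int order_trans zero_le_one)
  have "p \<noteq> 1"
  proof
    assume "p = 1"
    then have "torus_diagram p q = unknot" by (simp add: torus_diagram_def unknot_def)
    then show False using K(1) D(2) by simp
  qed
  then interpret torus p n using p n by unfold_locales (auto simp: coprime_int_iff)
  have "torus_diagram p q = torus_diagram 2 3 \<or> torus_diagram p q = torus_diagram 3 2"
    using torus_cases[OF K(1)[unfolded n] D(1)] n by auto
  then show ?thesis using K(1) isotopic_torus_23 isotopic_torus_32 isotopic_trans by metis
qed

theorem theorem1p8:
  shows "(\<forall>K. positive_pretzel_knot K \<longrightarrow>
            (delta_unknotting_number K = 1 \<longleftrightarrow> isotopic K trefoil \<or> isotopic K (mirror trefoil)))
       \<and> (\<forall>K. torus_knot K \<longrightarrow>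
            (delta_unknotting_number K = 1 \<longleftrightarrow> isotopic K trefoil \<or> isotopic K (mirror trefoil)))"
proof -
  have one: "delta_unknotting_number K = 1" if "isotopic K trefoil \<or> isotopic K (mirror trefoil)" for K
    using that
  proof
    assume "isotopic K (mirror trefoil)"
    then have "isotopic (mirror K) trefoil" using isotopic_mirror[of K "mirror trefoil"] by simp
    then show ?thesis using delta_unknotting_number_trefoil delta_unknotting_number_mirror[of "mirror K"] by simp
  qed (rule delta_unknotting_number_trefoil)
  have "isotopic K trefoil \<or> isotopic K (mirror trefoil)"
    if T: "positive_pretzel_knot K" "delta_unknotting_number K = 1" for K
  proof -
    obtain ps where ps: "pretzel_odd_type ps \<or> pretzel_even_type_A ps \<or> pretzel_even_type_B ps"
      "isotopic K (pretzel_diagram ps) \<or> isotopic K (mirror (pretzel_diagram ps))"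
      using T(1) unfolding positive_pretzel_knot_def by blast
    from ps(2) show ?thesis
    proof
      assume "isotopic K (mirror (pretzel_diagram ps))"
      then have "isotopic (mirror K) (pretzel_diagram ps)" using isotopic_mirror[of K "mirror (pretzel_diagram ps)"] by simp
      then show ?thesis
        using positive_pretzel_delta_one[OF ps(1)] delta_unknotting_number_mirror[OF T(2)] mirror_trefoil_cases by blast
    qed (use positive_pretzel_delta_one[OF ps(1)] T(2) in blast)
  qed
  moreover have "isotopic K trefoil \<or> isotopic K (mirror trefoil)"
    if T: "torus_knot K" "delta_unknotting_number K = 1" for K
  proof -
    obtain p q where pq: "1 \<le> p" "coprime (int p) q" "isotopic K (torus_diagram p q)"
      using T(1) unfolding torus_knot_def by blast
    consider "q = 0" | "1 \<le> q" | "1 \<le> - q" by linarith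
    then show ?thesis
    proof cases
      case 1
      \<comment> \<open>Being coprime to 0 forces \<open>p = 1\<close>, so the closure is a single
        circle.\<close>
      then have "torus_diagram p q = unknot" using pq(1,2) by (simp add: torus_diagram_def unknot_def)
      then show ?thesis using pq(3) T(2) unfolding delta_unknotting_number_1 by simp
    next
      case 2
      then show ?thesis using torus_delta_one pq T(2) by blast
    next
      case 3
      then have "isotopic (mirror K) (torus_diagram p (- q))"
        using isotopic_mirror[OF pq(3)] by (simp add: torus_diagram_mirror)
      then show ?thesis
        using torus_delta_one[OF pq(1) 3] pq(2) delta_unknotting_number_mirror[OF T(2)] mirror_trefoil_cases by simp
    qed
  qed
  ultimately show ?thesis using one by blast
qed

end
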